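(* Let $\mathbb{D}$ be a division ring with finite dimension $d$ over a central subfield $\mathbb{F}$, and assume that $\mathbb{D}$ is of quadratic type over $\mathbb{F}$, with associated pair $(\sigma,e)$. Let $n\geq 1$ be such that $|\mathbb{F}|\geq nd$. For every optimal trivial spectrum subspace $\mathcal{M}$ of $\mathrm{M}_n(\mathbb{D})$, there exist an ordered partition $n=n_1+\cdots+n_p$ into positive integers and a list $(P_1,\dots,P_p)\in\mathrm{GL}_{n_1}(\mathbb{D})\times\cdots\times\mathrm{GL}_{n_p}(\mathbb{D})$ of $e$-nonisotropic matrices such that $\mathcal{M}$ is similar to $$P_1^{-1}\mathcal{SH}_{n_1}(\mathbb{D})\vee\cdots\vee P_p^{-1}\mathcal{SH}_{n_p}(\mathbb{D}).$$ The integers $n_1,\dots,n_p$ are uniquely determined by $\mathcal{M}$, and for each $i\in\{1,\dots,p\}$ the matrix $P_i$ is uniquely determined by $\mathcal{M}$ up to homo-star-congruence. Conversely, for any ordered partition $n=n_1+\cdots+n_p$ into positive integers and any list $(P_1,\dots,P_p)\in\mathrm{GL}_{n_1}(\mathbb{D})\times\cdots\times\mathrm{GL}_{n_p}(\mathbb{D})$ of $e$-nonisotropic matrices, the space $P_1^{-1}\mathcal{SH}_{n_1}(\mathbb{D})\vee\cdots\vee P_p^{-1}\mathcal{SH}_{n_p}(\mathbb{D})$, as well as all its conjugates in $\mathrm{M}_n(\mathbb{D})$, is an optimal trivial spectrum subspace of $\mathrm{M}_n(\mathbb{D})$.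
   Context: A central subfield of $\mathbb{D}$ is a subfield contained in the center of $\mathbb{D}$. An $\mathbb{F}$-linear subspace $S$ of $\mathrm{M}_n(\mathbb{D})$ has trivial spectrum if $I_n-M$ is invertible for all $M\in S$; it is optimal if it has the greatest possible dimension over $\mathbb{F}$ among all trivial spectrum $\mathbb{F}$-linear subspaces of $\mathrm{M}_n(\mathbb{D})$. Two subsets $\mathcal{S},\mathcal{T}$ of $\mathrm{M}_n(\mathbb{D})$ are similar (conjugate) if $\mathcal{T}=Q\mathcal{S}Q^{-1}$ for some $Q\in\mathrm{GL}_n(\mathbb{D})$. For nonempty $\mathcal{M}_i\subseteq\mathrm{M}_{n_i}(\mathbb{D})$, the joint $\mathcal{M}_1\vee\cdots\vee\mathcal{M}_p$ is the set of all block upper-triangular matrices with diagonal blocks $M_1\in\mathcal{M}_1,\dots,M_p\in\mathcal{M}_p$ and arbitrary blocks above the diagonal. $\mathbb{D}$ is of quadratic type over $\mathbb{F}$ if one of the following holds: (i) $d=1$; (ii) $d=2$ and $\mathbb{D}$ is a separable field extension of $\mathbb{F}$; (iii) $d=4$ and $\mathbb{D}$ is a quaternion algebra over $\mathbb{F}$; (iv) $d=2^m$ for some $m\geq 1$, $\operatorname{char}(\mathbb{F})=2$, $\mathbb{D}$ is a field and $x^2\in\mathbb{F}$ for all $x\in\mathbb{D}$. The standard involution $\sigma$ of $\mathbb{D}$ is the identity of $\mathbb{D}$ in cases (i) and (iv), the non-identity $\mathbb{F}$-automorphism in case (ii), and the quaternionic conjugation in case (iii). An associated pair $(\sigma,e)$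 for $\mathbb{D}$ over $\mathbb{F}$ consists of the standard involution $\sigma$ and of an $\mathbb{F}$-linear form $e:\mathbb{D}\to\mathbb{F}$ which is the Galois trace of $\mathbb{D}$ over $\mathbb{F}$ in cases (i) and (ii) (so $e=\operatorname{id}$ if $d=1$), the reduced trace $x\mapsto x+\sigma(x)$ in case (iii), and an arbitrary nonzero $\mathbb{F}$-linear form on $\mathbb{D}$ in case (iv). For a matrix $A$ over $\mathbb{D}$, $A^\star$ is the transpose of the matrix obtained by applying $\sigma$ to all entries of $A$. $\mathcal{SH}_k(\mathbb{D})$ is the set of all $M=(m_{i,j})\in\mathrm{M}_k(\mathbb{D})$ such that $M^\star=-M$ and $e(m_{i,i})=0$ for all $i$. A matrix $P\in\mathrm{M}_k(\mathbb{D})$ is $e$-nonisotropic if $e(X^\star PX)\neq 0$ for all $X\in\mathbb{D}^k\setminus\{0\}$. Matrices $A,B\in\mathrm{M}_k(\mathbb{D})$ are homo-star-congruent if $B=\alpha\,PAP^\star$ for some $\alpha\in\mathbb{F}^\times$ and some $P\in\mathrm{GL}_k(\mathbb{D})$. *)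

theory Defs
  imports
    "Jordan_Normal_Form.Matrix"
    "HOL-Algebra.Algebraic_Closure_Type"
begin

text \<open>
  The division ring is the type \<open>'d :: division_ring\<close>, seen as a HOL-Algebra ring \<open>\<D>\<close>; the
  central subfield is a subset \<open>F\<close> of that type. The matrix ring \<open>M\<^sub>n(\<D>)\<close> is the
  HOL-Algebra ring on \<open>carrier_mat n n\<close>, so that \<open>GL\<^sub>n(\<D>)\<close> is its group of units.
\<close>

abbreviation dring :: "'d :: division_ring ring" (\<open>\<D>\<close>) where
  "\<D> \<equiv> ring_of_type_algebra"

abbreviation mat_ring :: "nat \<Rightarrow> 'd :: division_ring mat ring" where
  "mat_ring n \<equiv> ring_mat TYPE('d) n ()"

abbreviation GL :: "nat \<Rightarrow> 'd :: division_ring mat set" where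
  "GL n \<equiv> Units (mat_ring n)"

definition central_subfield :: "'d :: division_ring set \<Rightarrow> bool" where
  "central_subfield F \<longleftrightarrow> subfield F \<D> \<and> (\<forall>a\<in>F. \<forall>x. a * x = x * a)"


subsection \<open>Trivial spectrum subspaces\<close>

text \<open>
  \<open>F\<close> is embedded in the matrix ring as the scalar matrices with entry in \<open>F\<close>; for this copy
  \<open>K\<close> of \<open>F\<close>, the locale \<open>subalgebra K S\<close> of HOL-Algebra says that \<open>S\<close> is a linear subspace
  over \<open>K\<close> (no closure under multiplication is required).
\<close>

definition scalar_mats :: "'d :: division_ring set \<Rightarrow> nat \<Rightarrow> 'd mat set" where
  "scalar_mats F n = (\<lambda>a. a \<cdot>\<^sub>m 1\<^sub>m n) ` F"

definition mat_dim :: "'d :: division_ring set \<Rightarrow> nat \<Rightarrow> 'd mat set \<Rightarrow> nat" where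
  "mat_dim F n S = ring.dim (mat_ring n) (scalar_mats F n) S"

definition trivial_spectrum_subspace ::
    "'d :: division_ring set \<Rightarrow> nat \<Rightarrow> 'd mat set \<Rightarrow> bool" where
  "trivial_spectrum_subspace F n S \<longleftrightarrow>
     subalgebra (scalar_mats F n) S (mat_ring n) \<and> (\<forall>M\<in>S. 1\<^sub>m n - M \<in> GL n)"

definition optimal_trivial_spectrum ::
    "'d :: division_ring set \<Rightarrow> nat \<Rightarrow> 'd mat set \<Rightarrow> bool" where
  "optimal_trivial_spectrum F n S \<longleftrightarrow>
     trivial_spectrum_subspace F n S \<and>
     (\<forall>T. trivial_spectrum_subspace F n T \<longrightarrow> mat_dim F n T \<le> mat_dim F n S)"

definition similar_sets :: "nat \<Rightarrow> 'd :: division_ring mat set \<Rightarrow> 'd mat set \<Rightarrow> bool" where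
  "similar_sets n S T \<longleftrightarrow> (\<exists>Q\<in>GL n. T = (\<lambda>M. Q * M * inv\<^bsub>mat_ring n\<^esub> Q) ` S)"


subsection \<open>Joints\<close>

text \<open>
  For a list \<open>ns\<close> of block sizes, \<open>block ns M i j\<close> is the block of \<open>M\<close> of size
  \<open>ns ! i\<close> times \<open>ns ! j\<close> in position \<open>(i, j)\<close>, with indices starting at 0.
\<close>

definition block :: "nat list \<Rightarrow> 'd mat \<Rightarrow> nat \<Rightarrow> nat \<Rightarrow> 'd mat" where
  "block ns M i j =
     mat (ns ! i) (ns ! j) (\<lambda>(r, c). M $$ (sum_list (take i ns) + r, sum_list (take j ns) + c))"

definition joint :: "nat list \<Rightarrow> 'd :: division_ring mat set list \<Rightarrow> 'd mat set" where
  "joint ns Ms =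
     {M \<in> carrier_mat (sum_list ns) (sum_list ns).
        (\<forall>i<length ns. block ns M i i \<in> Ms ! i) \<and>
        (\<forall>i<length ns. \<forall>j<i. block ns M i j = 0\<^sub>m (ns ! i) (ns ! j))}"


subsection \<open>Separable extensions, automorphisms and the Galois trace\<close>

text \<open>
  Polynomials are those of HOL-Algebra: lists of coefficients, leading coefficient first.
  An irreducible polynomial is separable if it is relatively prime to its derivative, an element
  is separable over \<open>F\<close> if its minimal polynomial \<open>Irr F x\<close> is separable.
\<close>

definition derivative :: "'d :: division_ring list \<Rightarrow> 'd list" where
  "derivative p =
     ring.normalize \<D> (map (\<lambda>i. of_nat i * ring.coeff \<D> p i) (rev [1..<length p]))"

definition separable_element :: "'d :: division_ring set \<Rightarrow> 'd \<Rightarrow> bool" where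
  "separable_element F x \<longleftrightarrow>
     \<not> ring.transcendental \<D> F x \<and>
     (\<forall>q\<in>carrier (univ_poly \<D> F).
        q divides\<^bsub>univ_poly \<D> F\<^esub> ring.Irr \<D> F x \<and>
        q divides\<^bsub>univ_poly \<D> F\<^esub> derivative (ring.Irr \<D> F x) \<longrightarrow>
        q \<in> Units (univ_poly \<D> F))"

definition separable_field_extension :: "'d :: division_ring set \<Rightarrow> bool" where
  "separable_field_extension F \<longleftrightarrow> field (\<D> :: 'd ring) \<and> (\<forall>x. separable_element F x)"

definition automorphisms_over :: "'d :: division_ring set \<Rightarrow> ('d \<Rightarrow> 'd) set" where
  "automorphisms_over F = {g \<in> ring_iso \<D> \<D>. \<forall>a\<in>F. g a = a}"

definition galois_trace :: "'d :: division_ring set \<Rightarrow> 'd \<Rightarrow> 'd" where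
  "galois_trace F x = (\<Sum>g\<in>automorphisms_over F. g x)"


subsection \<open>Quaternion algebras\<close>

text \<open>
  A quaternion basis is \<open>(1, i, j, i * j)\<close> with \<open>i\<^sup>2 = a\<close>, \<open>j\<^sup>2 = b\<close>, \<open>j i = - i j\<close> for nonzero \<open>a\<close> and
  \<open>b\<close> in \<open>F\<close> if the characteristic is not 2, and with \<open>i\<^sup>2 + i = a\<close>, \<open>j\<^sup>2 = b\<close>,
  \<open>j i = (i + 1) j\<close> for \<open>a\<close> in \<open>F\<close> and nonzero \<open>b\<close> in \<open>F\<close> in characteristic 2.
\<close>

definition quaternion_basis :: "'d :: division_ring set \<Rightarrow> 'd \<Rightarrow> 'd \<Rightarrow> bool" where
  "quaternion_basis F i j \<longleftrightarrow>
     ring.independent \<D> F [1, i, j, i * j] \<and> ring.Span \<D> F [1, i, j, i * j] = UNIV \<and>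
     j * j \<in> F - {0} \<and>
     (if CHAR('d) = 2 then i * i + i \<in> F \<and> j * i = (i + 1) * j
      else i * i \<in> F - {0} \<and> j * i = - (i * j))"

definition quaternion_algebra :: "'d :: division_ring set \<Rightarrow> bool" where
  "quaternion_algebra F \<longleftrightarrow> (\<exists>i j. quaternion_basis F i j)"

text \<open>
  The conjugation negates \<open>i\<close>, \<open>j\<close> and \<open>i * j\<close>, except that in characteristic 2 it
  maps \<open>i\<close> to \<open>i + 1 = 1 - i\<close>. It does not depend on the choice of the quaternion basis.
\<close>

definition quaternion_conjugation :: "'d :: division_ring set \<Rightarrow> ('d \<Rightarrow> 'd) \<Rightarrow> bool" where
  "quaternion_conjugation F \<sigma> \<longleftrightarrow>
     (\<exists>i j. quaternion_basis F i j \<and>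
        (\<forall>s\<in>F. \<forall>t\<in>F. \<forall>u\<in>F. \<forall>v\<in>F.
           \<sigma> (s + t * i + u * j + v * (i * j)) =
             (if CHAR('d) = 2 then s + t else s) - t * i - u * j - v * (i * j)))"


subsection \<open>Division rings of quadratic type and associated pairs\<close>

definition quad_trivial :: "'d :: division_ring set \<Rightarrow> nat \<Rightarrow> bool" where
  "quad_trivial F d \<longleftrightarrow> d = 1"

definition quad_separable :: "'d :: division_ring set \<Rightarrow> nat \<Rightarrow> bool" where
  "quad_separable F d \<longleftrightarrow> d = 2 \<and> separable_field_extension F"

definition quad_quaternion :: "'d :: division_ring set \<Rightarrow> nat \<Rightarrow> bool" where
  "quad_quaternion F d \<longleftrightarrow> d = 4 \<and> quaternion_algebra F"

definition quad_radicial :: "'d :: division_ring set \<Rightarrow> nat \<Rightarrow> bool" where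
  "quad_radicial F d \<longleftrightarrow>
     (\<exists>m\<ge>1. d = 2 ^ m) \<and> CHAR('d) = 2 \<and> field (\<D> :: 'd ring) \<and> (\<forall>x. x\<^sup>2 \<in> F)"

definition quadratic_type :: "'d :: division_ring set \<Rightarrow> nat \<Rightarrow> bool" where
  "quadratic_type F d \<longleftrightarrow>
     quad_trivial F d \<or> quad_separable F d \<or> quad_quaternion F d \<or> quad_radicial F d"

definition standard_involution ::
    "'d :: division_ring set \<Rightarrow> nat \<Rightarrow> ('d \<Rightarrow> 'd) \<Rightarrow> bool" where
  "standard_involution F d \<sigma> \<longleftrightarrow>
     (quad_trivial F d \<or> quad_radicial F d) \<and> \<sigma> = id \<or>
     quad_separable F d \<and> \<sigma> \<in> automorphisms_over F \<and> \<sigma> \<noteq> id \<or>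
     quad_quaternion F d \<and> quaternion_conjugation F \<sigma>"

definition linear_form :: "'d :: division_ring set \<Rightarrow> ('d \<Rightarrow> 'd) \<Rightarrow> bool" where
  "linear_form F e \<longleftrightarrow>
     (\<forall>x. e x \<in> F) \<and> (\<forall>x y. e (x + y) = e x + e y) \<and> (\<forall>a\<in>F. \<forall>x. e (a * x) = a * e x)"

definition associated_pair ::
    "'d :: division_ring set \<Rightarrow> nat \<Rightarrow> ('d \<Rightarrow> 'd) \<Rightarrow> ('d \<Rightarrow> 'd) \<Rightarrow> bool" where
  "associated_pair F d \<sigma> e \<longleftrightarrow>
     standard_involution F d \<sigma> \<and> linear_form F e \<and>
     ((quad_trivial F d \<or> quad_separable F d) \<and> e = galois_trace F \<or>
      quad_quaternion F d \<and> (\<forall>x. e x = x + \<sigma> x) \<or>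
      quad_radicial F d \<and> (\<exists>x. e x \<noteq> 0))"


subsection \<open>The building blocks\<close>

definition star :: "('d \<Rightarrow> 'd) \<Rightarrow> 'd mat \<Rightarrow> 'd mat" where
  "star \<sigma> A = transpose_mat (map_mat \<sigma> A)"

definition SH :: "('d :: division_ring \<Rightarrow> 'd) \<Rightarrow> ('d \<Rightarrow> 'd) \<Rightarrow> nat \<Rightarrow> 'd mat set" where
  "SH \<sigma> e k = {M \<in> carrier_mat k k. star \<sigma> M = - M \<and> (\<forall>i<k. e (M $$ (i, i)) = 0)}"

text \<open>
  A vector \<open>V\<close> is a matrix with one column, and \<open>V\<^sup>\<star> P V\<close> is a matrix with one entry,
  identified with that entry.
\<close>

definition nonisotropic ::
    "('d :: division_ring \<Rightarrow> 'd) \<Rightarrow> ('d \<Rightarrow> 'd) \<Rightarrow> nat \<Rightarrow> 'd mat \<Rightarrow> bool" where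
  "nonisotropic \<sigma> e k P \<longleftrightarrow>
     P \<in> carrier_mat k k \<and>
     (\<forall>V\<in>carrier_mat k 1. V \<noteq> 0\<^sub>m k 1 \<longrightarrow> e ((star \<sigma> V * P * V) $$ (0, 0)) \<noteq> 0)"

definition homo_star_congruent ::
    "'d :: division_ring set \<Rightarrow> ('d \<Rightarrow> 'd) \<Rightarrow> nat \<Rightarrow> 'd mat \<Rightarrow> 'd mat \<Rightarrow> bool" where
  "homo_star_congruent F \<sigma> k A B \<longleftrightarrow> (\<exists>\<alpha>\<in>F - {0}. \<exists>P\<in>GL k. B = \<alpha> \<cdot>\<^sub>m (P * A * star \<sigma> P))"

definition ordered_partition :: "nat \<Rightarrow> nat list \<Rightarrow> bool" where
  "ordered_partition n ns \<longleftrightarrow> (\<forall>k\<in>set ns. 0 < k) \<and> sum_list ns = n"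

definition nonisotropic_list ::
    "('d :: division_ring \<Rightarrow> 'd) \<Rightarrow> ('d \<Rightarrow> 'd) \<Rightarrow> nat list \<Rightarrow> 'd mat list \<Rightarrow> bool" where
  "nonisotropic_list \<sigma> e ns Ps \<longleftrightarrow>
     length Ps = length ns \<and>
     (\<forall>i<length ns. Ps ! i \<in> GL (ns ! i) \<and> nonisotropic \<sigma> e (ns ! i) (Ps ! i))"

definition SH_joint ::
    "('d :: division_ring \<Rightarrow> 'd) \<Rightarrow> ('d \<Rightarrow> 'd) \<Rightarrow> nat list \<Rightarrow> 'd mat list \<Rightarrow> 'd mat set" where
  "SH_joint \<sigma> e ns Ps =
     joint ns (map2 (\<lambda>k P. (\<lambda>M. inv\<^bsub>mat_ring k\<^esub> P * M) ` SH \<sigma> e k) ns Ps)"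

end

theory Submission
  imports Defs "HOL-Library.Function_Algebras"
begin

text \<open>Matrices act as operators on right \<open>\<D>\<close>-spaces. If \<open>V\<close> is a trivial spectrum space of operators of
  \<open>E\<close>, some nonzero \<open>x\<close> is regular: every \<open>M \<in> V\<close> with \<open>M x = 0\<close> maps \<open>E\<close> into \<open>V x\<close>. As \<open>x \<notin> V x\<close>, there
  is a \<open>\<D>\<close>-linear \<open>\<phi>\<close> with \<open>e (\<phi> x) \<noteq> 0\<close> and \<open>e (\<phi> z) = 0\<close> on \<open>V x\<close>; the operators killing \<open>x\<close> act on
  the kernel of \<open>\<phi>\<close>, and by induction the dimension of \<open>V\<close> is at most the sum of the \<open>k * d - 1\<close> for \<open>k \<le> n\<close>.

  If the bound is attained, the induction produces a proper subspace \<open>H\<close> and a sesquilinear form \<open>b\<close>, zero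
  on \<open>H\<close> and with \<open>e (b v v) \<noteq> 0\<close> outside \<open>H\<close>, such that \<open>V\<close> consists of all \<open>N\<close> that preserve \<open>H\<close>,
  restrict on \<open>H\<close> to an element of an optimal space, and satisfy \<open>e (b v (N v)) = 0\<close> for all \<open>v\<close>. In a basis
  adapted to \<open>H\<close>, the Gram matrix of \<open>b\<close> is the last of the matrices \<open>P\<close>, and the others come from \<open>H\<close>.

  For uniqueness, \<open>x \<in> E\<close> lies in \<open>H\<close> if and only if \<open>V x\<close> together with \<open>x F\<close> does not span \<open>E\<close>; and
  \<open>V x\<close> is the kernel of \<open>z \<mapsto> e (b x z)\<close> for \<open>x \<notin> H\<close>, which determines \<open>b\<close> up to a factor in \<open>F\<close>.\<close>

section \<open>Linear algebra over a central subfield\<close>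

text \<open>The size of F enters through eigenvalue counts. A regular pencil on an F-space of
  dimension r has at most r eigenvalues, so r + 1 scalars in F decide between a contradiction and a
  singular pencil (\<open>regular_exists\<close>, \<open>Zy_full\<close>); a few quadratic
  identities in t also need a third scalar besides 0 and 1.

  The obstacle is the passage from ker \<phi> back to E. The optimal space on ker \<phi> has its own
  subspace H0 and form b, whereas x only contributes the hyperplane V x. For y outside H0, trivial
  spectrum at x u + y gives a form killing V (x u + y), made of a part along x and a multiple of
  \<open>e (b y _)\<close>, in an unknown proportion. Either V preserves ker \<phi>, which becomes
  the new H (\<open>caseB\<close>), or the parts combine to one sesquilinear form that extends a
  multiple of b, and H is again H0 (\<open>caseA\<close>). Three things remain: no y falls between
  the alternatives, all y fall on the same side with the same proportion, and the cross term of the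
  new form is linear over the division ring. The case d = 1 is singled out because there V x has no
  component along x, which removes the equations that settle the other cases.\<close>

locale central_field =
  fixes F :: "'d :: division_ring set"
  assumes F_0: "0 \<in> F" and F_1: "1 \<in> F"
    and F_add: "a \<in> F \<Longrightarrow> b \<in> F \<Longrightarrow> a + b \<in> F"
    and F_neg: "a \<in> F \<Longrightarrow> - a \<in> F"
    and F_mul: "a \<in> F \<Longrightarrow> b \<in> F \<Longrightarrow> a * b \<in> F"
    and F_inv: "a \<in> F \<Longrightarrow> inverse a \<in> F"
    and F_comm: "a \<in> F \<Longrightarrow> a * x = x * a"
begin

lemma F_diff: "a \<in> F \<Longrightarrow> b \<in> F \<Longrightarrow> a - b \<in> F"
  using F_add[OF _ F_neg] by simp

lemma F_div: "a \<in> F \<Longrightarrow> b \<in> F \<Longrightarrow> a / b \<in> F"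
  by (simp add: divide_inverse F_mul F_inv)

lemmas F_cl = F_0 F_1 F_add F_neg F_mul F_inv F_diff F_div

end

locale fspace = central_field F for F :: "'d :: division_ring set" +
  fixes sc :: "'d \<Rightarrow> 'w :: ab_group_add \<Rightarrow> 'w"
  assumes sc_add: "a \<in> F \<Longrightarrow> sc a (x + y) = sc a x + sc a y"
    and sc_plus: "a \<in> F \<Longrightarrow> b \<in> F \<Longrightarrow> sc (a + b) x = sc a x + sc b x"
    and sc_sc: "a \<in> F \<Longrightarrow> b \<in> F \<Longrightarrow> sc a (sc b x) = sc (a * b) x"
    and sc_1: "sc 1 x = x"
begin

lemma sc_0: "sc 0 x = 0"
  using sc_plus[of 0 0 x] F_0 by simp

lemma sc_zero: "a \<in> F \<Longrightarrow> sc a 0 = 0"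
  using sc_add[of a 0 0] by simp

lemma sc_neg: "a \<in> F \<Longrightarrow> sc (- a) x = - sc a x"
  using sc_plus[of a "- a" x] by (simp add: F_neg sc_0 eq_neg_iff_add_eq_0 add.commute)

lemma sc_minus: "a \<in> F \<Longrightarrow> sc a (- x) = - sc a x"
  using sc_add[of a x "- x"] by (simp add: sc_zero eq_neg_iff_add_eq_0 add.commute)

lemma sc_diff: "a \<in> F \<Longrightarrow> sc a (x - y) = sc a x - sc a y"
  using sc_add[of a x "- y"] by (simp add: sc_minus)

lemma sc_diff_l: "a \<in> F \<Longrightarrow> b \<in> F \<Longrightarrow> sc (a - b) x = sc a x - sc b x"
  using sc_plus[of a "- b" x] by (simp add: sc_neg F_neg)

lemma sc_inverse: "a \<in> F \<Longrightarrow> a \<noteq> 0 \<Longrightarrow> sc (inverse a) (sc a x) = x"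
  by (simp add: sc_sc F_inv sc_1)

lemma sc_eq_0: "a \<in> F \<Longrightarrow> sc a x = 0 \<longleftrightarrow> a = 0 \<or> x = 0"
  using sc_inverse[of a x] sc_zero[of "inverse a"] sc_zero[of a] sc_0 F_inv by metis

lemma sc_sum: "a \<in> F \<Longrightarrow> sc a (sum g K) = (\<Sum>i\<in>K. sc a (g i))"
  by (induction K rule: infinite_finite_induct) (auto simp: sc_zero sc_add)

section \<open>Subspaces and dimension over F\<close>

definition subsp :: "'w set \<Rightarrow> bool" where
  "subsp S \<longleftrightarrow> 0 \<in> S \<and> (\<forall>x\<in>S. \<forall>y\<in>S. x + y \<in> S) \<and> (\<forall>a\<in>F. \<forall>x\<in>S. sc a x \<in> S)"

lemma subsp_0: "subsp S \<Longrightarrow> 0 \<in> S"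
  and subsp_add: "subsp S \<Longrightarrow> x \<in> S \<Longrightarrow> y \<in> S \<Longrightarrow> x + y \<in> S"
  and subsp_sc: "subsp S \<Longrightarrow> a \<in> F \<Longrightarrow> x \<in> S \<Longrightarrow> sc a x \<in> S"
  unfolding subsp_def by auto

lemma subsp_neg: "subsp S \<Longrightarrow> x \<in> S \<Longrightarrow> - x \<in> S"
  using subsp_sc[of S "- 1" x] by (simp add: sc_neg F_1 F_neg sc_1)

lemma subsp_diff: "subsp S \<Longrightarrow> x \<in> S \<Longrightarrow> y \<in> S \<Longrightarrow> x - y \<in> S"
  using subsp_add[OF _ _ subsp_neg] by simp

lemmas subsp_cl = subsp_0 subsp_add subsp_sc subsp_neg subsp_diff

lemma subsp_Int: "subsp S \<Longrightarrow> subsp T \<Longrightarrow> subsp (S \<inter> T)"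
  unfolding subsp_def by auto

definition ext :: "'w \<Rightarrow> 'w set \<Rightarrow> 'w set" where
  "ext v E = {sc a v + x | a x. a \<in> F \<and> x \<in> E}"

lemma extI: "a \<in> F \<Longrightarrow> x \<in> E \<Longrightarrow> sc a v + x \<in> ext v E"
  unfolding ext_def by blast

lemma extE: "y \<in> ext v E \<Longrightarrow> (\<And>a x. a \<in> F \<Longrightarrow> x \<in> E \<Longrightarrow> y = sc a v + x \<Longrightarrow> thesis) \<Longrightarrow> thesis"
  unfolding ext_def by blast

lemma ext_base: "subsp E \<Longrightarrow> v \<in> ext v E"
  using extI[OF F_1 subsp_0, of E v] by (simp add: sc_1)

lemma ext_mono: "E \<subseteq> ext v E"
  using extI[OF F_0, of _ E v] by (auto simp: sc_0)

lemma subsp_ext: "subsp E \<Longrightarrow> subsp (ext v E)"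
  unfolding subsp_def[of "ext v E"]
proof (intro conjI ballI)
  assume E: "subsp E"
  show "0 \<in> ext v E" using ext_mono subsp_0[OF E] by blast
  fix x assume x: "x \<in> ext v E"
  then obtain a x' where x': "a \<in> F" "x' \<in> E" "x = sc a v + x'" by (rule extE)
  { fix y assume "y \<in> ext v E"
    then obtain b y' where y': "b \<in> F" "y' \<in> E" "y = sc b v + y'" by (rule extE)
    have "x + y = sc (a + b) v + (x' + y')" using x' y' by (simp add: sc_plus algebra_simps)
    then show "x + y \<in> ext v E" using extI[OF F_add[OF x'(1) y'(1)] subsp_add[OF E x'(2) y'(2)]] by simp }
  fix b assume b: "b \<in> F"
  have "sc b x = sc (b * a) v + sc b x'" using x' b by (simp add: sc_add sc_sc)
  then show "sc b x \<in> ext v E" using extI[OF F_mul[OF b x'(1)] subsp_sc[OF E b x'(2)]] by simp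
qed

lemma ext_sub: "subsp S \<Longrightarrow> E \<subseteq> S \<Longrightarrow> v \<in> S \<Longrightarrow> ext v E \<subseteq> S"
  by (auto elim!: extE intro!: subsp_add subsp_sc)

text \<open>Built like \<open>ring.dimension\<close> of HOL-Algebra, so that
  \<open>dring_dimension_fdim\<close> and \<open>dimension_fdim\<close> carry dimensions over by
  rule induction.\<close>

inductive fdim :: "nat \<Rightarrow> 'w set \<Rightarrow> bool" where
  fdim_0: "fdim 0 {0}"
| fdim_Suc: "v \<notin> E \<Longrightarrow> fdim n E \<Longrightarrow> fdim (Suc n) (ext v E)"

lemma fdim_subsp: "fdim n S \<Longrightarrow> subsp S"
proof (induction rule: fdim.induct)
  case fdim_0
  show ?case by (simp add: subsp_def sc_zero)
qed (rule subsp_ext)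

lemma fdim_0D: "fdim 0 S \<Longrightarrow> S = {0}"
  by (auto elim: fdim.cases)

lemma fdim_SucE:
  assumes "fdim (Suc n) S"
  obtains v E where "v \<notin> E" "fdim n E" "S = ext v E"
  using assms by (cases rule: fdim.cases) auto

text \<open>The exchange step behind uniqueness of dimension: once some vector of T lies outside the
  hyperplane E, every other one is pushed into E by subtracting a multiple of it, so exactly one
  dimension is lost.\<close>

lemma fdim_Int:
  assumes "fdim m T" "subsp E" "T \<subseteq> ext v E"
  shows "T \<subseteq> E \<or> (\<exists>k. m = Suc k \<and> fdim k (T \<inter> E))"
  using assms(1,3)
proof (induction rule: fdim.induct)
  case fdim_0
  then show ?case using subsp_0[OF assms(2)] by simp
next
  case (fdim_Suc t T1 n)
  note T1 = fdim_subsp[OF fdim_Suc.hyps(2)]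
  have sub: "T1 \<subseteq> ext v E" using fdim_Suc.prems ext_mono by blast
  have "t \<in> ext v E" using fdim_Suc.prems ext_base[OF T1] by blast
  then obtain a t' where t: "a \<in> F" "t' \<in> E" "t = sc a v + t'" by (rule extE)
  show ?case
  proof (cases "T1 \<subseteq> E")
    assume T1E: "T1 \<subseteq> E"
    show ?thesis
    proof (cases "t \<in> E")
      case True
      then show ?thesis using T1E ext_sub[OF assms(2)] by blast
    next
      case False
      have "ext t T1 \<inter> E \<subseteq> T1"
      proof
        fix z assume z: "z \<in> ext t T1 \<inter> E"
        then obtain b z' where z': "b \<in> F" "z' \<in> T1" "z = sc b t + z'" by (auto elim: extE)
        then have "sc b t \<in> E" using z T1E subsp_diff[OF assms(2), of z z'] by auto
        then have "b = 0"
          using False sc_inverse[of b t] subsp_sc[OF assms(2), of "inverse b" "sc b t"] z'(1) F_inv by metis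
        then show "z \<in> T1" using z' by (simp add: sc_0)
      qed
      then have "ext t T1 \<inter> E = T1" using T1E ext_mono by blast
      then show ?thesis using fdim_Suc.hyps(2) by auto
    qed
  next
    assume nT: "\<not> T1 \<subseteq> E"
    then obtain k where k: "n = Suc k" "fdim k (T1 \<inter> E)" using fdim_Suc.IH[OF sub] by blast
    obtain t1 where t1: "t1 \<in> T1" "t1 \<notin> E" using nT by blast
    then obtain b t1' where b: "b \<in> F" "t1' \<in> E" "t1 = sc b v + t1'" using sub by (blast elim: extE)
    have b0: "b \<noteq> 0" using b t1 by (auto simp: sc_0)
    \<comment> \<open>With this \<open>c\<close>, the vectors t and \<open>sc c t1\<close> have the
      same component along v, so their difference s falls into E while it still extends T1.\<close>
    define c where "c = a * inverse b"
    have c: "c \<in> F" using t b by (simp add: c_def F_cl)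
    have cb: "c * b = a" using b0 by (simp add: c_def mult.assoc)
    define s where "s = t - sc c t1"
    have "s = t' - sc c t1'" unfolding s_def t b using c b(1) cb by (simp add: sc_add sc_sc)
    then have sE: "s \<in> E" using t b c assms(2) by (auto intro: subsp_cl)
    have sT: "s \<notin> T1"
    proof
      assume "s \<in> T1"
      then have "s + sc c t1 \<in> T1" using T1 t1 c by (auto intro: subsp_cl)
      then show False using fdim_Suc.hyps(1) by (simp add: s_def)
    qed
    have "ext t T1 \<inter> E = ext s (T1 \<inter> E)"
    proof
      show "ext s (T1 \<inter> E) \<subseteq> ext t T1 \<inter> E"
      proof (rule ext_sub)
        show "subsp (ext t T1 \<inter> E)" by (intro subsp_Int subsp_ext T1 assms)
        show "T1 \<inter> E \<subseteq> ext t T1 \<inter> E" using ext_mono by blast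
        have "s \<in> ext t T1" unfolding s_def
          using ext_base[OF T1] t1 c ext_mono[of T1 t] subsp_ext[OF T1] by (meson subsp_cl subsetD)
        then show "s \<in> ext t T1 \<inter> E" using sE by blast
      qed
      show "ext t T1 \<inter> E \<subseteq> ext s (T1 \<inter> E)"
      proof
        fix z assume z: "z \<in> ext t T1 \<inter> E"
        then obtain g z' where z': "g \<in> F" "z' \<in> T1" "z = sc g t + z'" by (auto elim: extE)
        have eq: "z = sc g s + (sc (g * c) t1 + z')" unfolding z' s_def using z' c by (simp add: sc_diff sc_sc)
        have "sc (g * c) t1 + z' \<in> T1" using z' c t1 T1 by (auto intro!: subsp_cl F_cl)
        moreover have "sc (g * c) t1 + z' = z - sc g s" using eq by simp
        then have "sc (g * c) t1 + z' \<in> E"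
          using z subsp_diff[OF assms(2) _ subsp_sc[OF assms(2) z'(1) sE]] by simp
        ultimately show "z \<in> ext s (T1 \<inter> E)" using eq z'(1) extI by blast
      qed
    qed
    then show ?thesis by (metis IntD1 fdim.fdim_Suc k(1,2) sT)
  qed
qed

lemma fdim_le: "fdim n S \<Longrightarrow> fdim m T \<Longrightarrow> T \<subseteq> S \<Longrightarrow> m \<le> n"
proof (induction n arbitrary: S T m)
  case 0
  then have "T \<subseteq> {0}" using fdim_0D by blast
  have "m \<noteq> Suc k" for k
  proof
    assume "m = Suc k"
    then obtain v E where "v \<notin> E" "fdim k E" "T = ext v E" using 0(2) by (blast elim: fdim_SucE)
    then show False using \<open>T \<subseteq> {0}\<close> ext_base[of E v] fdim_subsp[of k E] subsp_0[of E] by blast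
  qed
  then show ?case by (cases m) auto
next
  case (Suc n)
  obtain v E where v: "v \<notin> E" "fdim n E" "S = ext v E" using Suc.prems(1) by (rule fdim_SucE)
  from fdim_Int[OF Suc.prems(2) fdim_subsp[OF v(2)]] Suc.prems(3) v(3)
  show ?case using Suc.IH[OF v(2)] Suc.prems(2) by fastforce
qed

lemma fdim_unique: "fdim n S \<Longrightarrow> fdim m S \<Longrightarrow> m = n"
  using fdim_le by (meson order_antisym order_refl)

lemma fdim_subspace: "fdim n S \<Longrightarrow> subsp T \<Longrightarrow> T \<subseteq> S \<Longrightarrow> \<exists>m\<le>n. fdim m T \<and> (m = n \<longrightarrow> T = S)"
proof (induction arbitrary: T rule: fdim.induct)
  case fdim_0
  then have "T = {0}" using subsp_0 by blast
  then show ?case using fdim.fdim_0 by blast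
next
  case (fdim_Suc v E n)
  note E = fdim_subsp[OF fdim_Suc.hyps(2)]
  obtain m where m: "m \<le> n" "fdim m (T \<inter> E)" "m = n \<longrightarrow> T \<inter> E = E"
    using fdim_Suc.IH[OF subsp_Int[OF fdim_Suc.prems(1) E]] by blast
  show ?case
  proof (cases "T \<subseteq> E")
    case True
    then show ?thesis using m by (metis Int_absorb2 le_SucI not_less_eq_eq)
  next
    case False
    then obtain t where t: "t \<in> T" "t \<notin> E" by blast
    then obtain b t' where b: "b \<in> F" "t' \<in> E" "t = sc b v + t'" using fdim_Suc.prems by (blast elim: extE)
    have b0: "b \<noteq> 0" using b t by (auto simp: sc_0)
    have eq: "T = ext t (T \<inter> E)"
    proof
      show "ext t (T \<inter> E) \<subseteq> T" using ext_sub[OF fdim_Suc.prems(1)] t by blast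
      show "T \<subseteq> ext t (T \<inter> E)"
      proof
        fix z assume z: "z \<in> T"
        then obtain c z' where c: "c \<in> F" "z' \<in> E" "z = sc c v + z'" using fdim_Suc.prems by (blast elim: extE)
        define g where "g = c * inverse b"
        have g: "g \<in> F" using c b by (simp add: g_def F_cl)
        have gb: "g * b = c" using b0 by (simp add: g_def mult.assoc)
        have "z - sc g t = z' - sc g t'" unfolding b c using g b(1) gb by (simp add: sc_add sc_sc)
        then have "z - sc g t \<in> E" using subsp_diff[OF E c(2) subsp_sc[OF E g b(2)]] by simp
        moreover have "z - sc g t \<in> T" using z t g fdim_Suc.prems(1) by (auto intro: subsp_cl)
        ultimately show "z \<in> ext t (T \<inter> E)" using extI[OF g, of "z - sc g t" "T \<inter> E" t] by simp
      qed
    qed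
    have "fdim (Suc m) T" using fdim.fdim_Suc[of t "T \<inter> E" m] m(2) t eq by simp
    moreover have "Suc m = Suc n \<longrightarrow> T = ext v E"
    proof
      assume "Suc m = Suc n"
      then have ET: "E \<subseteq> T" using m(3) by blast
      have "sc b v = t - t'" using b by simp
      then have "sc b v \<in> T" using subsp_diff[OF fdim_Suc.prems(1) t(1)] b(2) ET by auto
      then have "v \<in> T" using sc_inverse[OF b(1) b0, of v] subsp_sc[OF fdim_Suc.prems(1) F_inv[OF b(1)]] by metis
      then show "T = ext v E" using ext_sub[OF fdim_Suc.prems(1) ET] fdim_Suc.prems(2) by blast
    qed
    ultimately show ?thesis using m(1) by blast
  qed
qed

lemma fdim_eq: "fdim n S \<Longrightarrow> fdim n T \<Longrightarrow> T \<subseteq> S \<Longrightarrow> T = S"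
  using fdim_subspace[of n S T] fdim_subsp fdim_unique by metis

text \<open>The family is indexed, so that in \<open>pencil\<close> distinct eigenvalues count
  without a separate proof that their eigenvectors differ.\<close>

lemma indep_card:
  assumes "finite I" "fdim n S" "\<And>i. i \<in> I \<Longrightarrow> w i \<in> S"
    and "\<And>a. (\<And>i. i \<in> I \<Longrightarrow> a i \<in> F) \<Longrightarrow> (\<Sum>i\<in>I. sc (a i) (w i)) = 0 \<Longrightarrow> \<forall>i\<in>I. a i = 0"
  shows "card I \<le> n"
proof -
  have S: "subsp S" using assms(2) by (rule fdim_subsp)
  have "\<exists>T. fdim (card J) T \<and> T \<subseteq> S \<and> (\<forall>z\<in>T. \<exists>a. (\<forall>i\<in>J. a i \<in> F) \<and> z = (\<Sum>i\<in>J. sc (a i) (w i)))"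
    if "J \<subseteq> I" for J
    using finite_subset[OF that assms(1)] that
  proof (induction J rule: finite_induct)
    case empty
    then show ?case using fdim_0 subsp_0[OF S] by (intro exI[of _ "{0}"]) auto
  next
    case (insert j J)
    then obtain T where T: "fdim (card J) T" "T \<subseteq> S"
      "\<forall>z\<in>T. \<exists>a. (\<forall>i\<in>J. a i \<in> F) \<and> z = (\<Sum>i\<in>J. sc (a i) (w i))" by blast
    have jI: "j \<in> I" and JI: "J \<subseteq> I" using insert.prems by auto
    have "w j \<notin> T"
    proof
      assume "w j \<in> T"
      then obtain a where a: "\<forall>i\<in>J. a i \<in> F" "w j = (\<Sum>i\<in>J. sc (a i) (w i))" using T by blast
      define a' where "a' = (\<lambda>i. if i = j then - 1 else if i \<in> J then a i else 0)"
      have "(\<Sum>i\<in>I. sc (a' i) (w i)) = (\<Sum>i\<in>insert j J. sc (a' i) (w i))"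
        using assms(1) jI JI by (intro sum.mono_neutral_right) (auto simp: a'_def sc_0)
      also have "\<dots> = sc (- 1) (w j) + (\<Sum>i\<in>J. sc (a' i) (w i))"
        using insert.hyps by (simp add: a'_def)
      also have "(\<Sum>i\<in>J. sc (a' i) (w i)) = w j"
        unfolding a(2) using insert.hyps(2) by (intro sum.cong) (auto simp: a'_def)
      finally have "(\<Sum>i\<in>I. sc (a' i) (w i)) = 0" by (simp add: sc_neg F_1 sc_1)
      moreover have "a' i \<in> F" for i using a by (auto simp: a'_def F_cl)
      ultimately have "a' j = 0" using assms(4)[of a'] jI by blast
      then show False by (simp add: a'_def)
    qed
    then have "fdim (card (insert j J)) (ext (w j) T)" using insert.hyps T fdim_Suc by simp
    moreover have "ext (w j) T \<subseteq> S" using ext_sub[OF S T(2)] assms(3)[OF jI] by blast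
    moreover have "\<exists>a. (\<forall>i\<in>insert j J. a i \<in> F) \<and> z = (\<Sum>i\<in>insert j J. sc (a i) (w i))"
      if z: "z \<in> ext (w j) T" for z
    proof -
      obtain c z' where c: "c \<in> F" "z' \<in> T" "z = sc c (w j) + z'" using z by (rule extE)
      then obtain a where a: "\<forall>i\<in>J. a i \<in> F" "z' = (\<Sum>i\<in>J. sc (a i) (w i))" using T by blast
      have "(\<Sum>i\<in>J. sc ((a(j := c)) i) (w i)) = z'" unfolding a(2)
        using insert.hyps by (intro sum.cong) auto
      then show ?thesis using insert.hyps a c by (intro exI[of _ "a(j := c)"]) auto
    qed
    ultimately show ?case by blast
  qed
  then obtain T where "fdim (card I) T" "T \<subseteq> S" by blast
  then show ?thesis using fdim_le assms(2) by blast
qed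

text \<open>For \<open>Rel w w' \<longleftrightarrow> \<Theta> w' = \<Gamma> w\<close> with \<open>\<Theta>\<close> injective, this bounds the number of
  eigenvalues of the pencil \<open>t \<Theta> - \<Gamma>\<close>.\<close>

lemma pencil:
  assumes "finite I" "I \<subseteq> F" "fdim n Z"
    and R0: "Rel 0 0"
    and Radd: "\<And>x x' y y'. x \<in> Z \<Longrightarrow> x' \<in> Z \<Longrightarrow> y \<in> Z \<Longrightarrow> y' \<in> Z \<Longrightarrow> Rel x x' \<Longrightarrow> Rel y y' \<Longrightarrow> Rel (x + y) (x' + y')"
    and Rsc: "\<And>x x' a. x \<in> Z \<Longrightarrow> x' \<in> Z \<Longrightarrow> a \<in> F \<Longrightarrow> Rel x x' \<Longrightarrow> Rel (sc a x) (sc a x')"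
    and Rinj: "\<And>x. x \<in> Z \<Longrightarrow> Rel 0 x \<Longrightarrow> x = 0"
    and ev: "\<And>t. t \<in> I \<Longrightarrow> w t \<in> Z \<and> w t \<noteq> 0 \<and> Rel (w t) (sc t (w t))"
  shows "card I \<le> n"
proof -
  have Z: "subsp Z" using assms(3) by (rule fdim_subsp)
  have ind: "\<forall>t\<in>J. a t = 0"
    if "J \<subseteq> I" "\<And>t. t \<in> J \<Longrightarrow> a t \<in> F" "(\<Sum>t\<in>J. sc (a t) (w t)) = 0" for J a
    using finite_subset[OF that(1) assms(1)] that
  proof (induction J arbitrary: a rule: finite_induct)
    case empty
    then show ?case by simp
  next
    case (insert j J)
    have jI: "j \<in> I" "j \<in> F" and JI: "J \<subseteq> I" "J \<subseteq> F" using insert.prems assms(2) by auto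
    have mem: "(\<Sum>t\<in>K. sc (b t) (w t)) \<in> Z" if "finite K" "K \<subseteq> I" "\<And>t. t \<in> K \<Longrightarrow> b t \<in> F" for K b
      using that
    proof (induction K rule: finite_induct)
      case empty
      then show ?case using subsp_0[OF Z] by simp
    next
      case (insert k K)
      then have "(\<Sum>t\<in>K. sc (b t) (w t)) \<in> Z" "sc (b k) (w k) \<in> Z"
        using ev[of k] subsp_sc[OF Z] by auto
      then show ?case using insert.hyps by (simp add: subsp_add[OF Z])
    qed
    \<comment> \<open>By additivity, the relation takes the combination with coefficients
      \<open>a t\<close> to the one with coefficients \<open>a t * t\<close>.\<close>
    have "Rel (\<Sum>t\<in>K. sc (a t) (w t)) (\<Sum>t\<in>K. sc (a t * t) (w t))"
      if "finite K" "K \<subseteq> insert j J" for K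
      using that
    proof (induction K rule: finite_induct)
      case empty
      then show ?case using R0 by simp
    next
      case (insert k K)
      have k: "k \<in> I" "k \<in> F" "a k \<in> F" using insert.prems JI jI insert(4) \<open>\<And>t. t \<in> insert j J \<Longrightarrow> a t \<in> F\<close> by auto
      have KI: "K \<subseteq> I" "K \<subseteq> F" "\<And>t. t \<in> K \<Longrightarrow> a t \<in> F"
        using insert.prems JI jI \<open>\<And>t. t \<in> insert j J \<Longrightarrow> a t \<in> F\<close> by auto
      have "Rel (sc (a k) (w k)) (sc (a k) (sc k (w k)))"
        using Rsc[of "w k" "sc k (w k)" "a k"] ev[OF k(1)] k Z by (auto intro: subsp_sc)
      then have "Rel (sc (a k) (w k)) (sc (a k * k) (w k))" using k by (simp add: sc_sc)
      moreover have "sc (a k) (w k) \<in> Z" "sc (a k * k) (w k) \<in> Z" 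
        using ev[OF k(1)] k Z by (auto intro!: subsp_sc F_mul)
      moreover have "(\<Sum>t\<in>K. sc (a t) (w t)) \<in> Z" "(\<Sum>t\<in>K. sc (a t * t) (w t)) \<in> Z"
        using mem[OF insert.hyps(1) KI(1)] KI by (auto intro!: mem F_mul insert.hyps)
      moreover have "Rel (\<Sum>t\<in>K. sc (a t) (w t)) (\<Sum>t\<in>K. sc (a t * t) (w t))"
        using insert by blast
      ultimately show ?case using insert.hyps by (simp add: Radd)
    qed
    from this[of "insert j J"] insert.prems(3) insert.hyps
    have "Rel 0 (\<Sum>t\<in>insert j J. sc (a t * t) (w t))" by simp
    moreover have "(\<Sum>t\<in>insert j J. sc (a t * t) (w t)) \<in> Z"
      using insert.prems insert.hyps assms(2) by (intro mem) (auto intro!: F_mul)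
    ultimately have s: "(\<Sum>t\<in>insert j J. sc (a t * t) (w t)) = 0" using Rinj by blast
    \<comment> \<open>Subtracting j times the original dependency removes the term of j. The other
      coefficients are only multiplied by the nonzero factors t - j, and the induction hypothesis
      applies.\<close>
    have "(\<Sum>t\<in>insert j J. sc (a t * (t - j)) (w t))
        = (\<Sum>t\<in>insert j J. sc (a t * t) (w t) - sc j (sc (a t) (w t)))"
      using insert.prems(2) jI JI by (intro sum.cong refl)
        (auto simp: sc_sc right_diff_distrib sc_diff_l F_mul F_comm[of j] sc_0)
    also have "\<dots> = 0 - (\<Sum>t\<in>insert j J. sc j (sc (a t) (w t)))"
      by (simp add: sum_subtractf s)
    also have "(\<Sum>t\<in>insert j J. sc j (sc (a t) (w t))) = sc j (\<Sum>t\<in>insert j J. sc (a t) (w t))"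
      by (rule sc_sum[OF jI(2), symmetric])
    finally have "(\<Sum>t\<in>insert j J. sc (a t * (t - j)) (w t)) = 0" 
      using insert.prems(3) jI by (simp add: sc_zero)
    then have "(\<Sum>t\<in>J. sc (a t * (t - j)) (w t)) = 0" using insert.hyps by (simp add: sc_0)
    then have "\<forall>t\<in>J. a t * (t - j) = 0"
      using insert.IH[of "\<lambda>t. a t * (t - j)"] JI jI insert.prems(2) by (auto intro!: F_mul F_diff)
    then have aJ: "\<forall>t\<in>J. a t = 0" using insert.hyps by auto
    then have "(\<Sum>t\<in>J. sc (a t) (w t)) = 0" by (simp add: sc_0)
    then have "sc (a j) (w j) = 0" using insert.prems(3) insert.hyps by simp
    then have "a j = 0" using sc_eq_0 ev[OF jI(1)] insert.prems(2)[of j] by blast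
    then show ?case using aJ by simp
  qed
  show ?thesis
    using indep_card[OF assms(1,3), of w] ev ind[of I] by auto
qed

text \<open>Take L of maximal dimension among the subspaces that contain S and miss x. Adjoining any
  further t would bring x into the span, and this equation can be solved for t; hence L and x span
  T.\<close>

lemma maximal_avoiding:
  assumes "fdim n T" "subsp S" "S \<subseteq> T" "x \<in> T" "x \<notin> S"
  shows "\<exists>L k. S \<subseteq> L \<and> L \<subseteq> T \<and> fdim k L \<and> n = Suc k \<and> x \<notin> L \<and> ext x L = T"
proof -
  let ?P = "\<lambda>k. \<exists>L. S \<subseteq> L \<and> L \<subseteq> T \<and> fdim k L \<and> x \<notin> L"
  have T: "subsp T" using assms(1) fdim_subsp by blast
  have ex: "\<exists>k. ?P k" using fdim_subspace[OF assms(1-3)] assms by blast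
  have bd: "\<And>k. ?P k \<Longrightarrow> k \<le> n" using fdim_le assms(1) by blast
  define k where "k = (GREATEST k. ?P k)"
  have "?P k" unfolding k_def using ex bd by (rule GreatestI_ex_nat)
  then obtain L where L: "S \<subseteq> L" "L \<subseteq> T" "fdim k L" "x \<notin> L" by blast
  have max: "?P j \<Longrightarrow> j \<le> k" for j unfolding k_def using bd by (intro Greatest_le_nat)
  note Ls = fdim_subsp[OF L(3)]
  have "T \<subseteq> ext x L"
  proof
    fix t assume t: "t \<in> T"
    show "t \<in> ext x L"
    proof (rule ccontr)
      assume nt: "t \<notin> ext x L"
      then have "t \<notin> L" using ext_mono by blast
      then have 1: "fdim (Suc k) (ext t L)" using L fdim_Suc by blast
      have "S \<subseteq> ext t L" using L ext_mono by blast
      moreover have "ext t L \<subseteq> T" using ext_sub[OF T L(2) t] .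
      moreover have "\<not> Suc k \<le> k" by simp
      ultimately have "x \<in> ext t L" using max[of "Suc k"] 1 by blast
      then obtain a l where a: "a \<in> F" "l \<in> L" "x = sc a t + l" by (rule extE)
      have a0: "a \<noteq> 0" using a L by (auto simp: sc_0)
      have "x - l = sc a t" using a by simp
      then have "sc (inverse a) (x - l) = t" using sc_inverse[OF a(1) a0] by simp
      then have "t = sc (inverse a) x + sc (- inverse a) l"
        using sc_diff[OF F_inv[OF a(1)], of x l] sc_neg[OF F_inv[OF a(1)], of l] by simp
      moreover have "sc (inverse a) x + sc (- inverse a) l \<in> ext x L"
        using a Ls by (intro extI) (auto intro: subsp_cl F_cl)
      ultimately show False using nt by simp
    qed
  qed
  then have eq: "ext x L = T" using ext_sub[OF T L(2) assms(4)] by blast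
  then have "n = Suc k" using fdim_unique[OF assms(1)] fdim_Suc[OF L(4,3)] by simp
  then show ?thesis using L eq by blast
qed

text \<open>The form is the coordinate along x with respect to the hyperplane of
  \<open>maximal_avoiding\<close>. The definite description leaves it unspecified outside T.\<close>

lemma functional_exists:
  assumes "fdim n T" "subsp S" "S \<subseteq> T" "x \<in> T" "x \<notin> S"
  shows "\<exists>f. (\<forall>z\<in>T. f z \<in> F) \<and> (\<forall>y\<in>T. \<forall>z\<in>T. f (y + z) = f y + f z) \<and>
    (\<forall>a\<in>F. \<forall>z\<in>T. f (sc a z) = a * f z) \<and> (\<forall>z\<in>S. f z = 0) \<and> f x = 1"
proof -
  obtain L k where L: "S \<subseteq> L" "L \<subseteq> T" "fdim k L" "x \<notin> L" "ext x L = T"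
    using maximal_avoiding[OF assms] by blast
  note Ls = fdim_subsp[OF L(3)]
  define f where "f = (\<lambda>z. THE a. a \<in> F \<and> (\<exists>l\<in>L. z = sc a x + l))"
  have f: "f (sc a x + l) = a" if "a \<in> F" "l \<in> L" for a l
    unfolding f_def
  proof (rule the_equality)
    show "a \<in> F \<and> (\<exists>l'\<in>L. sc a x + l = sc a x + l')" using that by blast
    fix b assume b: "b \<in> F \<and> (\<exists>l'\<in>L. sc a x + l = sc b x + l')"
    then obtain l' where l': "l' \<in> L" "sc a x + l = sc b x + l'" by blast
    then have "sc (b - a) x = l - l'" using that b by (simp add: sc_diff_l algebra_simps)
    then have "sc (b - a) x \<in> L" using that l' Ls by (auto intro: subsp_cl)
    then have "b - a = 0"
      using sc_inverse[of "b - a" x] subsp_sc[OF Ls, of "inverse (b - a)"] that b L(4) F_diff F_inv by metis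
    then show "b = a" by simp
  qed
  have rep: "\<exists>a l. a \<in> F \<and> l \<in> L \<and> z = sc a x + l" if "z \<in> T" for z
    using that L(5) by (blast elim: extE)
  have "f z \<in> F" if "z \<in> T" for z using rep[OF that] f by auto
  moreover have "f (y + z) = f y + f z" if yz: "y \<in> T" "z \<in> T" for y z
  proof -
    obtain a l b m where *: "a \<in> F" "l \<in> L" "y = sc a x + l" "b \<in> F" "m \<in> L" "z = sc b x + m"
      using rep yz by meson
    have "y + z = sc (a + b) x + (l + m)" using * by (simp add: sc_plus algebra_simps)
    then have "f (y + z) = a + b" using f[OF F_add[OF *(1,4)] subsp_add[OF Ls *(2,5)]] by simp
    then show ?thesis using * f by simp
  qed
  moreover have "f (sc a z) = a * f z" if az: "a \<in> F" "z \<in> T" for a z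
  proof -
    obtain b m where *: "b \<in> F" "m \<in> L" "z = sc b x + m" using rep az by meson
    have "sc a z = sc (a * b) x + sc a m" using * az by (simp add: sc_add sc_sc)
    then show ?thesis using f[of "a * b" "sc a m"] * az Ls f by (simp add: F_mul subsp_sc)
  qed
  moreover have "f z = 0" if "z \<in> S" for z
    using f[of 0 z] that L F_0 by (auto simp: sc_0)
  moreover have "f x = 1" using f[of 1 0] F_1 subsp_0[OF Ls] by (simp add: sc_1)
  ultimately show ?thesis by blast
qed

end

section \<open>Linear maps between F-spaces, rank and nullity\<close>

locale fspace2 = fspace F sc + W: fspace F sc'
  for F :: "'d :: division_ring set" and sc :: "'d \<Rightarrow> 'w :: ab_group_add \<Rightarrow> 'w"
    and sc' :: "'d \<Rightarrow> 'u :: ab_group_add \<Rightarrow> 'u"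
begin

definition lin :: "'w set \<Rightarrow> ('w \<Rightarrow> 'u) \<Rightarrow> bool" where
  "lin S f \<longleftrightarrow> (\<forall>x\<in>S. \<forall>y\<in>S. f (x + y) = f x + f y) \<and> (\<forall>a\<in>F. \<forall>x\<in>S. f (sc a x) = sc' a (f x))"

lemma lin_add: "lin S f \<Longrightarrow> x \<in> S \<Longrightarrow> y \<in> S \<Longrightarrow> f (x + y) = f x + f y"
  and lin_sc: "lin S f \<Longrightarrow> a \<in> F \<Longrightarrow> x \<in> S \<Longrightarrow> f (sc a x) = sc' a (f x)"
  unfolding lin_def by auto

lemma lin_0: "lin S f \<Longrightarrow> subsp S \<Longrightarrow> f 0 = 0"
  using lin_sc[of S f 0 0] F_0 subsp_0 by (simp add: sc_0 W.sc_0)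

lemma lin_mono: "lin S f \<Longrightarrow> T \<subseteq> S \<Longrightarrow> lin T f"
  unfolding lin_def by blast

lemma lin_diff: "lin S f \<Longrightarrow> subsp S \<Longrightarrow> x \<in> S \<Longrightarrow> y \<in> S \<Longrightarrow> f (x - y) = f x - f y"
  using lin_add[of S f "x - y" y] subsp_diff[of S x y] by simp

lemma subsp_image: "lin S f \<Longrightarrow> subsp S \<Longrightarrow> W.subsp (f ` S)"
  unfolding W.subsp_def
  by (auto simp: lin_add[symmetric] lin_sc[symmetric] intro!: imageI subsp_cl)
    (metis image_eqI lin_0 subsp_0)

lemma subsp_kernel: "lin S f \<Longrightarrow> subsp S \<Longrightarrow> subsp {x \<in> S. f x = 0}"
  unfolding subsp_def[of "Collect _"]
  by (auto simp: lin_add lin_sc lin_0 W.sc_zero intro: subsp_cl)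

lemma image_ext: "lin S f \<Longrightarrow> subsp S \<Longrightarrow> E \<subseteq> S \<Longrightarrow> v \<in> S \<Longrightarrow> f ` ext v E = W.ext (f v) (f ` E)"
  unfolding ext_def W.ext_def
  by (auto simp: lin_add lin_sc subsp_sc subset_iff image_iff) (metis lin_add lin_sc subsp_sc subsetD)+

lemma fdim_inj_image:
  assumes "fdim n S" "lin S f" "\<And>x. x \<in> S \<Longrightarrow> f x = 0 \<Longrightarrow> x = 0"
  shows "W.fdim n (f ` S)"
  using assms
proof (induction rule: fdim.induct)
  case fdim_0
  then have "f 0 = 0" using lin_0 fdim_subsp[OF fdim.fdim_0] by blast
  then show ?case using W.fdim_0 by simp
next
  case (fdim_Suc v E n)
  have E: "subsp E" "E \<subseteq> ext v E" "subsp (ext v E)" "v \<in> ext v E"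
    using fdim_subsp[OF fdim_Suc.hyps(2)] ext_mono subsp_ext ext_base by auto
  have "W.fdim n (f ` E)"
    using fdim_Suc.IH[OF lin_mono[OF fdim_Suc.prems(1) E(2)]] fdim_Suc.prems(2) E by blast
  moreover have "f v \<notin> f ` E"
  proof
    assume "f v \<in> f ` E"
    then obtain x where x: "x \<in> E" "f v = f x" by blast
    then have "f (v - x) = 0" using lin_diff[OF fdim_Suc.prems(1) E(3,4)] E by auto
    then have "v = x" using fdim_Suc.prems(2)[of "v - x"] subsp_diff[OF E(3,4)] x E by auto
    then show False using fdim_Suc.hyps x by blast
  qed
  ultimately show ?case
    using W.fdim_Suc image_ext[OF fdim_Suc.prems(1) E(3,2,4)] by simp
qed

lemma fdim_image:
  assumes "fdim n S" "lin S f"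
  shows "\<exists>r\<le>n. W.fdim r (f ` S)"
  using assms
proof (induction rule: fdim.induct)
  case fdim_0
  then have "f 0 = 0" using lin_0 fdim_subsp[OF fdim.fdim_0] by blast
  then show ?case using W.fdim_0 by auto
next
  case (fdim_Suc v E n)
  have E: "subsp E" "E \<subseteq> ext v E" "subsp (ext v E)" "v \<in> ext v E"
    using fdim_subsp[OF fdim_Suc.hyps(2)] ext_mono subsp_ext ext_base by auto
  obtain r where r: "r \<le> n" "W.fdim r (f ` E)"
    using fdim_Suc.IH[OF lin_mono[OF fdim_Suc.prems(1) E(2)]] by blast
  have eq: "f ` ext v E = W.ext (f v) (f ` E)" using image_ext[OF fdim_Suc.prems(1) E(3,2,4)] .
  show ?case
  proof (cases "f v \<in> f ` E")
    case True
    then have "W.ext (f v) (f ` E) = f ` E"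
      using W.ext_sub[OF W.fdim_subsp[OF r(2)], of "f ` E"] W.ext_mono by blast
    then show ?thesis using r eq by (metis le_SucI)
  next
    case False
    then show ?thesis using W.fdim_Suc r eq by (metis Suc_le_mono)
  qed
qed

text \<open>C is a complement of the kernel, found by lifting the image one vector at a time. For
  evaluation at x it provides a space of operators that are determined by their value at x.\<close>

lemma section_exists:
  assumes "W.fdim r (f ` S)" "lin S f" "subsp S"
  shows "\<exists>C. C \<subseteq> S \<and> fdim r C \<and> (\<forall>x\<in>C. f x = 0 \<longrightarrow> x = 0) \<and> f ` C = f ` S"
proof -
  have "\<exists>C. C \<subseteq> S \<and> fdim r C \<and> (\<forall>x\<in>C. f x = 0 \<longrightarrow> x = 0) \<and> f ` C = I"
    if "W.fdim r I" "I \<subseteq> f ` S" for I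
    using that
  proof (induction rule: W.fdim.induct)
    case fdim_0
    then show ?case using fdim.fdim_0 subsp_0[OF assms(3)] lin_0[OF assms(2,3)]
      by (intro exI[of _ "{0}"]) auto
  next
    case (fdim_Suc v E n)
    have E: "W.subsp E" using W.fdim_subsp fdim_Suc.hyps by blast
    have "E \<subseteq> f ` S" using fdim_Suc.prems W.ext_mono by blast
    then obtain C where C: "C \<subseteq> S" "fdim n C" "\<forall>x\<in>C. f x = 0 \<longrightarrow> x = 0" "f ` C = E"
      using fdim_Suc.IH by blast
    obtain s where s: "s \<in> S" "f s = v" using W.ext_base[OF E, of v] fdim_Suc.prems by blast
    have sC: "s \<notin> C" using s C(4) fdim_Suc.hyps(1) by blast
    note Cs = fdim_subsp[OF C(2)]
    have "x = 0" if x: "x \<in> ext s C" "f x = 0" for x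
    proof -
      obtain a c where a: "a \<in> F" "c \<in> C" "x = sc a s + c" using x by (blast elim: extE)
      have cS: "c \<in> S" "sc a s \<in> S" using a C s subsp_sc[OF assms(3)] by auto
      have 0: "sc' a v + f c = 0" using x a lin_add[OF assms(2) cS(2,1)] lin_sc[OF assms(2) a(1) s(1)] s by simp
      have "a = 0"
      proof (rule ccontr)
        assume a0: "a \<noteq> 0"
        have "v = sc' (inverse a) (sc' a v)" using W.sc_inverse[OF a(1) a0] by simp
        also have "sc' a v = - f c" using 0 by (simp add: eq_neg_iff_add_eq_0)
        finally have "v = sc' (inverse a) (- f c)" .
        moreover have "sc' (inverse a) (- f c) \<in> E"
          using C(4) a E by (auto intro!: W.subsp_cl F_inv)
        ultimately show False using fdim_Suc.hyps by simp
      qed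
      then show ?thesis using a C(3) x by (simp add: sc_0)
    qed
    moreover have "fdim (Suc n) (ext s C)" using fdim.fdim_Suc[OF sC C(2)] .
    moreover have "ext s C \<subseteq> S" using ext_sub[OF assms(3) C(1) s(1)] .
    moreover have "f ` ext s C = W.ext v E" using image_ext[OF assms(2,3) C(1) s(1)] s C by simp
    ultimately show ?case by blast
  qed
  then show ?thesis using assms(1) by blast
qed

text \<open>The dimension of S is a conclusion here, not a premise: this is how spaces of operators
  acquire a dimension in \<open>dim_bound\<close>. The induction runs over subspaces of the image
  and counts their preimages.\<close>

lemma rank_nullity:
  assumes "W.fdim r (f ` S)" "fdim k {x \<in> S. f x = 0}" "lin S f" "subsp S"
  shows "fdim (r + k) S"
proof -
  have "fdim (r + k) {x \<in> S. f x \<in> I}" if "W.fdim r I" "I \<subseteq> f ` S" for I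
    using that
  proof (induction rule: W.fdim.induct)
    case fdim_0
    then show ?case using assms(2) by simp
  next
    case (fdim_Suc v E n)
    have E: "W.subsp E" using W.fdim_subsp fdim_Suc.hyps by blast
    have "E \<subseteq> f ` S" using fdim_Suc.prems W.ext_mono by blast
    then have IH: "fdim (n + k) {x \<in> S. f x \<in> E}" using fdim_Suc.IH by blast
    obtain s where s: "s \<in> S" "f s = v" using W.ext_base[OF E, of v] fdim_Suc.prems by blast
    have "{x \<in> S. f x \<in> W.ext v E} = ext s {x \<in> S. f x \<in> E}"
    proof
      show "{x \<in> S. f x \<in> W.ext v E} \<subseteq> ext s {x \<in> S. f x \<in> E}"
      proof clarify
        fix x assume x: "x \<in> S" "f x \<in> W.ext v E"
        then obtain a y where a: "a \<in> F" "y \<in> E" "f x = sc' a v + y" by (blast elim: W.extE)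
        have "f (x - sc a s) = y" 
          using lin_diff[OF assms(3,4) x(1), of "sc a s"] lin_sc[OF assms(3) a(1) s(1)] s subsp_sc[OF assms(4) a(1) s(1)] a
          by simp
        then have "x - sc a s \<in> {x \<in> S. f x \<in> E}" using x s a assms(4) by (auto intro: subsp_cl)
        then show "x \<in> ext s {x \<in> S. f x \<in> E}" using extI[OF a(1), of "x - sc a s" _ s] by simp
      qed
      show "ext s {x \<in> S. f x \<in> E} \<subseteq> {x \<in> S. f x \<in> W.ext v E}"
      proof
        fix x assume "x \<in> ext s {x \<in> S. f x \<in> E}"
        then obtain a y where a: "a \<in> F" "y \<in> S" "f y \<in> E" "x = sc a s + y" by (blast elim: extE)
        moreover have "f x = sc' a v + f y"
          using lin_add[OF assms(3), of "sc a s" y] lin_sc[OF assms(3) a(1) s(1)] s assms(4) a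
          by (simp add: subsp_sc)
        ultimately show "x \<in> {x \<in> S. f x \<in> W.ext v E}"
          using W.extI[OF a(1,3), of v] s assms(4) by (simp add: subsp_add subsp_sc)
      qed
    qed
    moreover have "s \<notin> {x \<in> S. f x \<in> E}" using s fdim_Suc.hyps by blast
    ultimately show ?case using fdim.fdim_Suc[OF _ IH] by simp
  qed
  moreover have "{x \<in> S. f x \<in> f ` S} = S" by blast
  ultimately show ?thesis using assms(1) by (metis order_refl)
qed

lemma fdim_kernel:
  assumes "fdim n S" "lin S f"
  shows "\<exists>r k. W.fdim r (f ` S) \<and> fdim k {x \<in> S. f x = 0} \<and> n = r + k"
proof -
  have S: "subsp S" using assms fdim_subsp by blast
  obtain r where r: "W.fdim r (f ` S)" using fdim_image[OF assms] by blast
  obtain k where k: "fdim k {x \<in> S. f x = 0}"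
    using fdim_subspace[OF assms(1) subsp_kernel[OF assms(2) S]] by blast
  show ?thesis using rank_nullity[OF r k assms(2) S] fdim_unique[OF assms(1)] r k by blast
qed

end

section \<open>Division rings of quadratic type\<close>

text \<open>The argument uses only these properties of an associated pair, which hold in all four cases.\<close>

locale quad = central_field F for F :: "'d :: division_ring set" +
  fixes d :: nat and \<sigma> e :: "'d \<Rightarrow> 'd"
  assumes D_dim: "fspace.fdim F (*) d UNIV"
    and conj_add: "\<sigma> (x + y) = \<sigma> x + \<sigma> y"
    and conj_mult: "\<sigma> (x * y) = \<sigma> y * \<sigma> x"
    and conj_conj: "\<sigma> (\<sigma> x) = x"
    and conj_F: "a \<in> F \<Longrightarrow> \<sigma> a = a"
    and e_F: "e x \<in> F"
    and e_add: "e (x + y) = e x + e y"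
    and e_sc: "a \<in> F \<Longrightarrow> e (a * x) = a * e x"
    and e_comm: "e (x * y) = e (y * x)"
    and e_conj: "e (\<sigma> x) = e x"
    and e_nonzero: "\<exists>x. e x \<noteq> 0"
    and e_skew: "e x = 0 \<Longrightarrow> \<sigma> x = - x"
    and norm_F: "x * \<sigma> x \<in> F"
begin

sublocale D: fspace F "(*)"
  by unfold_locales (auto simp: algebra_simps)

sublocale DD: fspace2 F "(*)" "(*)" ..

lemma conj_0: "\<sigma> 0 = 0" and conj_1: "\<sigma> 1 = 1"
  using F_0 F_1 conj_F by auto

lemma conj_neg: "\<sigma> (- x) = - \<sigma> x"
  using conj_add[of x "- x"] by (simp add: conj_0 eq_neg_iff_add_eq_0 add.commute)

lemma conj_eq_0: "\<sigma> x = 0 \<longleftrightarrow> x = 0"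
  by (metis conj_conj conj_0)

lemma conj_inject: "\<sigma> x = \<sigma> y \<longleftrightarrow> x = y"
  by (metis conj_conj)

text \<open>The norm is central, so \<open>x * (\<sigma> x * x) = x * (x * \<sigma> x)\<close>, and
  x can be cancelled.\<close>

lemma norm_comm: "\<sigma> x * x = x * \<sigma> x"
proof (cases "x = 0")
  case False
  have "x * (\<sigma> x * x) = x * (x * \<sigma> x)"
    using F_comm[OF norm_F, of x x] by (simp add: mult.assoc)
  then show ?thesis using False by simp
qed (simp add: conj_0)

lemma norm_F': "\<sigma> x * x \<in> F"
  by (simp add: norm_comm norm_F)

lemma norm_eq_0: "\<sigma> x * x = 0 \<longleftrightarrow> x = 0"
  by (auto simp: conj_eq_0)

lemma inverse_conj: "x \<noteq> 0 \<Longrightarrow> inverse x = inverse (\<sigma> x * x) * \<sigma> x"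
proof -
  assume x: "x \<noteq> 0"
  have "inverse (\<sigma> x * x) * \<sigma> x * x = 1" using x norm_eq_0[of x] by (simp only: mult.assoc left_inverse not_False_eq_True)
  then have "inverse (\<sigma> x * x) * \<sigma> x * (x * inverse x) = inverse x" by (simp add: mult.assoc[symmetric])
  then show ?thesis using x by simp
qed

lemma divide_mult: "b \<noteq> 0 \<Longrightarrow> (a :: 'd) / b * b = a"
  by (simp add: divide_inverse mult.assoc)

lemma e_0: "e 0 = 0"
  using e_add[of 0 0] by simp

lemma e_neg: "e (- x) = - e x"
  using e_add[of x "- x"] by (simp add: e_0 eq_neg_iff_add_eq_0 add.commute)

lemma e_diff: "e (x - y) = e x - e y"
  using e_add[of x "- y"] by (simp add: e_neg)

lemma e_sc_r: "a \<in> F \<Longrightarrow> e (x * a) = a * e x"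
  using e_sc[of a x] F_comm[of a x] by simp

text \<open>For w \<noteq> 0 every element is of the form \<open>w * (inverse w * x)\<close>, so the
  pairing is nondegenerate as soon as e is nonzero.\<close>

lemma e_nondeg: "(\<And>y. e (w * y) = 0) \<Longrightarrow> w = 0"
proof (rule ccontr)
  assume a: "\<And>y. e (w * y) = 0" "w \<noteq> 0"
  obtain x where "e x \<noteq> 0" using e_nonzero by blast
  then show False using a(1)[of "inverse w * x"] a(2) by (simp add: mult.assoc[symmetric])
qed

lemma e_nondeg_l: "(\<And>y. e (y * w) = 0) \<Longrightarrow> w = 0"
  using e_nondeg[of w] e_comm[of _ w] by simp

text \<open>Cyclicity of e brings u next to \<sigma> u, and their product is a scalar of F that
  leaves e. So for u \<noteq> 0 the vanishing of \<open>e (\<sigma> u * x * u)\<close> depends on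
  \<open>e x\<close> alone.\<close>

lemma e_norm: "e (\<sigma> u * x * u) = (\<sigma> u * u) * e x"
proof -
  have "e (\<sigma> u * x * u) = e ((u * \<sigma> u) * x)"
    using e_comm[of "\<sigma> u * x" u] by (simp add: mult.assoc)
  then show ?thesis using e_sc[OF norm_F] by (simp add: norm_comm)
qed

lemma e_skew_sum: "e (x - \<sigma> x) = 0"
  by (simp add: e_diff e_conj)

lemma D_F_dim: "D.fdim 1 F"
proof -
  have "F = D.ext 1 {0}" unfolding D.ext_def by auto
  then show ?thesis using D.fdim_Suc[OF _ D.fdim_0, of 1] by simp
qed

lemma d_pos: "d > 0"
proof (rule ccontr)
  assume "\<not> d > 0"
  then have "(UNIV :: 'd set) = {0}" using D_dim D.fdim_0D by auto
  then show False by (metis UNIV_I singletonD zero_neq_one)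
qed

lemma d_eq_1: "d = 1 \<Longrightarrow> F = UNIV"
  using D.fdim_eq[of 1 UNIV F] D_dim D_F_dim by simp

lemma F_proper: "d \<noteq> 1 \<Longrightarrow> F \<noteq> UNIV"
  using D.fdim_unique[OF D_F_dim, of d] D_dim by auto

lemma form_kernel:
  assumes "D.fdim n S" "\<And>x y. x \<in> S \<Longrightarrow> y \<in> S \<Longrightarrow> g (x + y) = g x + g y"
    and "\<And>a x. a \<in> F \<Longrightarrow> x \<in> S \<Longrightarrow> g (a * x) = a * g x" and "\<And>x. x \<in> S \<Longrightarrow> g x \<in> F"
  shows "\<exists>k. D.fdim k {x \<in> S. g x = 0} \<and> n \<le> Suc k"
proof -
  have l: "DD.lin S g" unfolding DD.lin_def using assms by auto
  obtain r k where *: "D.fdim r (g ` S)" "D.fdim k {x \<in> S. g x = 0}" "n = r + k"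
    using DD.fdim_kernel[OF assms(1) l] by blast
  have "r \<le> 1" using D.fdim_le[OF D_F_dim *(1)] assms(4) by blast
  then show ?thesis using * by auto
qed

text \<open>Each new generator of S imposes one F-linear condition on w, so the annihilator loses at
  most one dimension.\<close>

lemma perp_dim:
  assumes "D.fdim k S"
  shows "\<exists>m. D.fdim m {w. \<forall>x\<in>S. e (w * x) = 0} \<and> d \<le> m + k"
  using assms
proof (induction rule: D.fdim.induct)
  case fdim_0
  then show ?case using D_dim by (auto simp: e_0)
next
  case (fdim_Suc v S k)
  then obtain m where m: "D.fdim m {w. \<forall>x\<in>S. e (w * x) = 0}" "d \<le> m + k" by blast
  have 0: "0 \<in> S" using D.fdim_subsp[OF fdim_Suc.hyps(2)] D.subsp_0 by blast
  have "{w. \<forall>x\<in>D.ext v S. e (w * x) = 0} = {w \<in> {w. \<forall>x\<in>S. e (w * x) = 0}. e (w * v) = 0}"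
  proof (intro equalityI subsetI)
    fix w assume "w \<in> {w. \<forall>x\<in>D.ext v S. e (w * x) = 0}"
    then show "w \<in> {w \<in> {w. \<forall>x\<in>S. e (w * x) = 0}. e (w * v) = 0}"
      using D.ext_mono D.ext_base[OF D.fdim_subsp[OF fdim_Suc.hyps(2)]] by blast
  next
    fix w assume w: "w \<in> {w \<in> {w. \<forall>x\<in>S. e (w * x) = 0}. e (w * v) = 0}"
    have "e (w * x) = 0" if x: "x \<in> D.ext v S" for x
    proof -
      obtain a y where a: "a \<in> F" "y \<in> S" "x = a * v + y" using x by (rule D.extE)
      have "w * x = a * (w * v) + w * y" using F_comm[OF a(1), of w] a by (simp add: distrib_left mult.assoc[symmetric])
      then show ?thesis using w a by (simp add: e_add e_sc)
    qed
    then show "w \<in> {w. \<forall>x\<in>D.ext v S. e (w * x) = 0}" by blast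
  qed
  moreover from form_kernel[OF m(1), of "\<lambda>w. e (w * v)"]
  obtain k' where "D.fdim k' {w \<in> {w. \<forall>x\<in>S. e (w * x) = 0}. e (w * v) = 0}" "m \<le> Suc k'"
    by (auto simp: distrib_right e_add e_sc mult.assoc e_F)
  ultimately show ?case using m(2) by (intro exI[of _ k']) simp
qed

text \<open>By a dimension count the annihilator of the kernel of a nonzero g contains some w
  \<noteq> 0. The form of w vanishes where g does, so it is proportional to g, and rescaling w by an
  element of F makes them equal.\<close>

lemma form_rep:
  assumes "\<And>x y. g (x + y) = g x + g y" "\<And>a x. a \<in> F \<Longrightarrow> g (a * x) = a * g x" "\<And>x. g x \<in> F"
  shows "\<exists>!w. \<forall>x. e (w * x) = g x"
proof (rule ex_ex1I)
  fix w w' assume "\<forall>x. e (w * x) = g x" "\<forall>x. e (w' * x) = g x"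
  then have "e ((w - w') * x) = 0" for x by (simp add: left_diff_distrib e_diff)
  then have "w - w' = 0" by (rule e_nondeg)
  then show "w = w'" by simp
next
  show "\<exists>w. \<forall>x. e (w * x) = g x"
  proof (cases "\<forall>x. g x = 0")
    case True
    then show ?thesis by (intro exI[of _ 0]) (simp add: e_0)
  next
    case False
    then obtain x0 where x0: "g x0 \<noteq> 0" by blast
    have l: "DD.lin UNIV g" unfolding DD.lin_def using assms by auto
    obtain r k where *: "D.fdim r (range g)" "D.fdim k {x. g x = 0}" "d = r + k"
      using DD.fdim_kernel[OF D_dim l] by auto
    have "r \<noteq> 0" 
    proof
      assume "r = 0"
      then have "range g = {0}" using *(1) D.fdim_0D by simp
      then show False using x0 by blast
    qed
    moreover obtain m where m: "D.fdim m {w. \<forall>x\<in>{x. g x = 0}. e (w * x) = 0}" "d \<le> m + k"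
      using perp_dim[OF *(2)] by blast
    ultimately have "m \<noteq> 0" using *(3) by simp
    have "\<exists>w\<in>{w. \<forall>x\<in>{x. g x = 0}. e (w * x) = 0}. w \<noteq> 0"
    proof (rule ccontr)
      assume "\<not> ?thesis"
      then have "{w. \<forall>x\<in>{x. g x = 0}. e (w * x) = 0} = {0}" by (auto simp: e_0)
      then have "D.fdim m {0}" using m(1) by simp
      then show False using D.fdim_unique[OF D.fdim_0] \<open>m \<noteq> 0\<close> by blast
    qed
    then obtain w where w: "w \<noteq> 0" "\<And>x. g x = 0 \<Longrightarrow> e (w * x) = 0" by blast
    have dec: "e (w * x) = g x / g x0 * e (w * x0)" for x
    proof -
      define a where "a = g x / g x0"
      have a: "a \<in> F" using assms(3) F_div by (simp add: a_def)
      have g0: "g 0 = 0" using assms(1)[of 0 0] by simp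
      have gn: "g (- y) = - g y" for y using assms(1)[of y "- y"] by (simp add: g0 eq_neg_iff_add_eq_0 add.commute)
      have "g (x - a * x0) = 0"
        using assms(1)[of x "- (a * x0)"] assms(2)[OF a, of x0] by (simp add: gn) (simp add: a_def divide_inverse mult.assoc x0)
      then have "e (w * (x - a * x0)) = 0" using w by blast
      moreover have "w * (a * x0) = a * (w * x0)" using F_comm[OF a, of w] by (simp add: mult.assoc[symmetric])
      ultimately show ?thesis using a by (simp add: a_def[symmetric] right_diff_distrib e_diff e_sc)
    qed
    have nz: "e (w * x0) \<noteq> 0"
    proof
      assume "e (w * x0) = 0"
      then have "e (w * y) = 0" for y using dec[of y] by simp
      then show False using w(1) e_nondeg[of w] by simp
    qed
    define b where "b = g x0 / e (w * x0)"
    have b: "b \<in> F" using assms(3) e_F F_div by (simp add: b_def)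
    have bw: "e (b * w * x) = g x" for x
    proof -
      have c: "g x / g x0 * e (w * x0) = e (w * x0) * (g x / g x0)" by (rule F_comm[OF e_F, symmetric])
      have "e (b * w * x) = b * e (w * x)" by (simp only: mult.assoc e_sc[OF b])
      also have "\<dots> = b * (e (w * x0) * (g x / g x0))" by (simp only: dec[of x] c)
      also have "\<dots> = g x0 * (g x / g x0)"
        using divide_mult[OF nz, of "g x0"] by (simp only: b_def mult.assoc[symmetric])
      also have "\<dots> = g x / g x0 * g x0" by (rule F_comm[OF assms(3)])
      also have "\<dots> = g x" using x0 by (rule divide_mult)
      finally show ?thesis .
    qed
    show ?thesis by (rule exI[of _ "b * w"]) (simp only: bw simp_thms)
  qed
qed

text \<open>The form of z vanishes on the kernel of the form of p, so it is a multiple of it;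
  nondegeneracy carries this over to z and p. The factor is read off at a point where the form of p
  is nonzero.\<close>

lemma perp_perp:
  assumes "p \<noteq> 0" "\<And>a. e (p * a) = 0 \<Longrightarrow> e (z * a) = 0"
  shows "\<exists>s\<in>F. z = s * p"
proof -
  obtain a1 where a1: "e (p * a1) \<noteq> 0" using e_nondeg[of p] assms(1) by blast
  define s where "s = e (z * a1) / e (p * a1)"
  have s: "s \<in> F" using e_F F_div by (simp add: s_def)
  have "e ((z - s * p) * y) = 0" for y
  proof -
    define t where "t = e (p * y) / e (p * a1)"
    have t: "t \<in> F" using e_F F_div by (simp add: t_def)
    have m: "w * (t * a1) = t * (w * a1)" for w using F_comm[OF t, of w] by (simp add: mult.assoc[symmetric])
    have "e (p * (y - t * a1)) = 0" using t divide_mult[OF a1] by (simp add: right_diff_distrib m e_diff e_sc) (simp add: t_def)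
    then have "e (z * (y - t * a1)) = 0" by (rule assms(2))
    then have "e (z * y) = t * e (z * a1)" using t by (simp add: right_diff_distrib m e_diff e_sc)
    also have "\<dots> = s * e (p * y)"
    proof -
      have "e (p * y) = t * e (p * a1)" using divide_mult[OF a1] by (simp add: t_def)
      then have "s * e (p * y) = s * (e (p * a1) * t)" using F_comm[OF t, of "e (p * a1)"] by simp
      also have "\<dots> = e (z * a1) * t" using divide_mult[OF a1] by (simp add: s_def mult.assoc[symmetric])
      finally show ?thesis using F_comm[OF t, of "e (z * a1)"] by simp
    qed
    finally show ?thesis using s by (simp add: left_diff_distrib e_diff e_sc mult.assoc)
  qed
  then have "z - s * p = 0" by (rule e_nondeg)
  then show ?thesis using s by auto
qed

end

section \<open>Trivial spectrum spaces of operators\<close>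

locale quad_space = quad F d \<sigma> e for F :: "'d :: division_ring set" and d \<sigma> e +
  fixes rs :: "'v :: ab_group_add \<Rightarrow> 'd \<Rightarrow> 'v" (infixl \<open>\<star>\<close> 75)
  assumes rs_add: "(x + y) \<star> a = x \<star> a + y \<star> a"
    and rs_plus: "x \<star> (a + b) = x \<star> a + x \<star> b"
    and rs_rs: "x \<star> a \<star> b = x \<star> (a * b)"
    and rs_1: "x \<star> 1 = x"
begin

sublocale V: fspace F "\<lambda>a v. v \<star> a"
  by unfold_locales (auto simp: rs_add rs_plus rs_rs rs_1 F_comm)

sublocale O: fspace F "\<lambda>a M v. M v \<star> a"
  by unfold_locales (auto simp: rs_add rs_plus rs_rs rs_1 F_comm fun_eq_iff)

sublocale OV: fspace2 F "\<lambda>a M v. M v \<star> a" "\<lambda>a v. v \<star> a" ..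
sublocale OO: fspace2 F "\<lambda>a M v. M v \<star> a" "\<lambda>a M v. M v \<star> a" ..
sublocale DV: fspace2 F "(*)" "\<lambda>a v. v \<star> a" ..
sublocale VD: fspace2 F "\<lambda>a v. v \<star> a" "(*)" ..

lemma rs_0: "0 \<star> a = 0"
  using rs_add[of 0 0 a] by simp

lemma rs_zero: "x \<star> 0 = 0"
  using rs_plus[of x 0 0] by simp

lemma rs_neg: "(- x) \<star> a = - (x \<star> a)"
  using rs_add[of x "- x" a] by (simp add: rs_0 eq_neg_iff_add_eq_0 add.commute)

lemma rs_minus: "x \<star> (- a) = - (x \<star> a)"
  using rs_plus[of x a "- a"] by (simp add: rs_zero eq_neg_iff_add_eq_0 add.commute)

lemma rs_diff: "(x - y) \<star> a = x \<star> a - y \<star> a"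
  using rs_add[of x "- y" a] by (simp add: rs_neg)

lemma rs_diff_r: "x \<star> (a - b) = x \<star> a - x \<star> b"
  using rs_plus[of x a "- b"] by (simp add: rs_minus)

lemma rs_inverse: "a \<noteq> 0 \<Longrightarrow> x \<star> a \<star> inverse a = x" and rs_inverse': "a \<noteq> 0 \<Longrightarrow> x \<star> inverse a \<star> a = x"
  by (simp_all add: rs_rs rs_1)

lemma rs_eq_0: "x \<star> a = 0 \<longleftrightarrow> x = 0 \<or> a = 0"
  using rs_inverse[of a x] by (cases "a = 0") (auto simp: rs_0 rs_zero)

lemmas rs_simps = rs_add rs_plus rs_rs rs_1 rs_0 rs_zero rs_neg rs_minus rs_diff rs_diff_r

definition Dsub :: "'v set \<Rightarrow> bool" where
  "Dsub E \<longleftrightarrow> 0 \<in> E \<and> (\<forall>x\<in>E. \<forall>y\<in>E. x + y \<in> E) \<and> (\<forall>x\<in>E. \<forall>a. x \<star> a \<in> E)"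

lemma Dsub_0: "Dsub E \<Longrightarrow> 0 \<in> E"
  and Dsub_add: "Dsub E \<Longrightarrow> x \<in> E \<Longrightarrow> y \<in> E \<Longrightarrow> x + y \<in> E"
  and Dsub_rs: "Dsub E \<Longrightarrow> x \<in> E \<Longrightarrow> x \<star> a \<in> E"
  unfolding Dsub_def by auto

lemma Dsub_subsp: "Dsub E \<Longrightarrow> V.subsp E"
  unfolding Dsub_def V.subsp_def by auto

lemma Dsub_neg: "Dsub E \<Longrightarrow> x \<in> E \<Longrightarrow> - x \<in> E"
  using V.subsp_neg Dsub_subsp by blast

lemma Dsub_diff: "Dsub E \<Longrightarrow> x \<in> E \<Longrightarrow> y \<in> E \<Longrightarrow> x - y \<in> E"
  using V.subsp_diff Dsub_subsp by blast

lemmas Dsub_cl = Dsub_0 Dsub_add Dsub_rs Dsub_neg Dsub_diff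

lemma Dsub_rs_iff: "Dsub E \<Longrightarrow> a \<noteq> 0 \<Longrightarrow> x \<star> a \<in> E \<longleftrightarrow> x \<in> E"
  using Dsub_rs[of E x a] Dsub_rs[of E "x \<star> a" "inverse a"] by (auto simp: rs_inverse)

text \<open>Operators are total functions that vanish off E. Equality of functions is then equality
  on E, and \<open>restr\<close> yields operators of subspaces without a change of type.\<close>

definition End :: "'v set \<Rightarrow> ('v \<Rightarrow> 'v) set" where
  "End E = {M. (\<forall>x\<in>E. M x \<in> E) \<and> (\<forall>x\<in>E. \<forall>y\<in>E. M (x + y) = M x + M y) \<and>
     (\<forall>x\<in>E. \<forall>a. M (x \<star> a) = M x \<star> a) \<and> (\<forall>x. x \<notin> E \<longrightarrow> M x = 0)}"

lemma End_mem: "M \<in> End E \<Longrightarrow> x \<in> E \<Longrightarrow> M x \<in> E"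
  and End_add: "M \<in> End E \<Longrightarrow> x \<in> E \<Longrightarrow> y \<in> E \<Longrightarrow> M (x + y) = M x + M y"
  and End_rs: "M \<in> End E \<Longrightarrow> x \<in> E \<Longrightarrow> M (x \<star> a) = M x \<star> a"
  and End_out: "M \<in> End E \<Longrightarrow> x \<notin> E \<Longrightarrow> M x = 0"
  unfolding End_def by auto

lemma End_0: "M \<in> End E \<Longrightarrow> M 0 = 0"
  using End_out[of M E 0] End_rs[of M E 0 0] by (cases "0 \<in> E") (auto simp: rs_simps)

lemma End_diff: "M \<in> End E \<Longrightarrow> Dsub E \<Longrightarrow> x \<in> E \<Longrightarrow> y \<in> E \<Longrightarrow> M (x - y) = M x - M y"
  using End_add[of M E "x - y" y] Dsub_diff[of E x y] by simp

lemma End_eqI: "M \<in> End E \<Longrightarrow> N \<in> End E \<Longrightarrow> (\<And>x. x \<in> E \<Longrightarrow> M x = N x) \<Longrightarrow> M = N"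
  using End_out[of M E] End_out[of N E] by (intro HOL.ext) (metis (full_types))

lemma End_subsp: "Dsub E \<Longrightarrow> O.subsp (End E)"
  unfolding O.subsp_def
proof (intro conjI ballI)
  assume E: "Dsub E"
  show "0 \<in> End E" by (auto simp: End_def rs_simps Dsub_0[OF E])
  fix M assume M: "M \<in> End E"
  show "M + N \<in> End E" if "N \<in> End E" for N
    using M that by (auto simp: End_def rs_simps Dsub_add[OF E])
  fix a assume a: "a \<in> F"
  show "(\<lambda>v. M v \<star> a) \<in> End E"
    using M by (auto simp: End_def rs_simps Dsub_rs[OF E] F_comm[OF a])
qed

definition restr :: "'v set \<Rightarrow> ('v \<Rightarrow> 'v) \<Rightarrow> 'v \<Rightarrow> 'v" where
  "restr H M = (\<lambda>x. if x \<in> H then M x else 0)"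

lemma restr_in [simp]: "x \<in> H \<Longrightarrow> restr H M x = M x"
  by (simp add: restr_def)

lemma restr_End: "M \<in> End E \<Longrightarrow> Dsub H \<Longrightarrow> H \<subseteq> E \<Longrightarrow> (\<And>x. x \<in> H \<Longrightarrow> M x \<in> H) \<Longrightarrow> restr H M \<in> End H"
  by (auto simp: End_def restr_def Dsub_cl subset_iff)

lemma restr_lin: "OO.lin S (restr H)"
  by (auto simp: OO.lin_def restr_def fun_eq_iff rs_0)

lemma restr_diff: "restr H (M - N) = restr H M - restr H N"
  by (auto simp: restr_def fun_eq_iff)

lemma restr_restr: "G \<subseteq> H \<Longrightarrow> restr G (restr H M) = restr G M"
  by (auto simp: restr_def fun_eq_iff)

lemma eval_lin: "OV.lin S (\<lambda>M. M x)"
  by (auto simp: OV.lin_def)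

definition tspec :: "'v set \<Rightarrow> ('v \<Rightarrow> 'v) set \<Rightarrow> bool" where
  "tspec E V \<longleftrightarrow> O.subsp V \<and> V \<subseteq> End E \<and> (\<forall>M\<in>V. \<forall>x\<in>E. M x = x \<longrightarrow> x = 0)"

lemma tspec_subsp: "tspec E V \<Longrightarrow> O.subsp V"
  and tspec_End: "tspec E V \<Longrightarrow> M \<in> V \<Longrightarrow> M \<in> End E"
  and tspec_fix: "tspec E V \<Longrightarrow> M \<in> V \<Longrightarrow> x \<in> E \<Longrightarrow> M x = x \<Longrightarrow> x = 0"
  unfolding tspec_def by auto

lemma tspec_notin: "tspec E V \<Longrightarrow> x \<in> E \<Longrightarrow> x \<noteq> 0 \<Longrightarrow> x \<notin> (\<lambda>M. M x) ` V"
  using tspec_fix[of E V _ x] by force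

lemma eval_subsp: "O.subsp V \<Longrightarrow> V.subsp ((\<lambda>M. M x) ` V)"
  using OV.subsp_image[OF eval_lin] .

end

section \<open>Regular vectors of a trivial spectrum space\<close>

context quad_space
begin

text \<open>x is chosen with V x of maximal dimension r. If M kills x while M y leaves V x, then
  passing from x to y - x t cannot raise the rank, so that every t in F is an eigenvalue of a pencil
  on an r-dimensional space of operators. F has too many elements for this.\<close>

lemma regular_exists:
  assumes E: "Dsub E" "V.fdim N E" "E \<noteq> {0}" and V: "tspec E V"
    and card: "infinite F \<or> N \<le> card F"
  shows "\<exists>x\<in>E. x \<noteq> 0 \<and> (\<forall>M\<in>V. M x = 0 \<longrightarrow> (\<forall>y\<in>E. M y \<in> (\<lambda>M. M x) ` V))"
proof -
  note Vs = tspec_subsp[OF V]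
  have im: "(\<lambda>M. M x) ` V \<subseteq> E" if "x \<in> E" for x
    using End_mem[OF tspec_End[OF V] that] by (rule image_subsetI)
  have dim: "\<exists>r\<le>N. V.fdim r ((\<lambda>M. M x) ` V)" if "x \<in> E" for x
    using V.fdim_subspace[OF E(2) eval_subsp[OF Vs] im[OF that]] by blast
  define P where "P = (\<lambda>r. \<exists>x\<in>E. x \<noteq> 0 \<and> V.fdim r ((\<lambda>M. M x) ` V))"
  have exP: "\<exists>r. P r" unfolding P_def using dim E(3) Dsub_0[OF E(1)] by blast
  have bdP: "P r \<Longrightarrow> r \<le> N" for r unfolding P_def using V.fdim_le[OF E(2)] im by blast
  define r where "r = (GREATEST r. P r)"
  have "P r" unfolding r_def using exP bdP by (rule GreatestI_ex_nat)
  then obtain x where x: "x \<in> E" "x \<noteq> 0" "V.fdim r ((\<lambda>M. M x) ` V)" unfolding P_def by blast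
  have max: "P j \<Longrightarrow> j \<le> r" for j unfolding r_def using bdP by (intro Greatest_le_nat)
  \<comment> \<open>Since x itself is missed by V x, the rank is strictly smaller than N, and F has
    room for r + 1 scalars.\<close>
  have rN: "r < N"
  proof -
    obtain m where m: "m \<le> N" "V.fdim m ((\<lambda>M. M x) ` V)" "m = N \<longrightarrow> (\<lambda>M. M x) ` V = E"
      using V.fdim_subspace[OF E(2) eval_subsp[OF Vs] im[OF x(1)]] by blast
    moreover have "(\<lambda>M. M x) ` V \<noteq> E" using tspec_notin[OF V x(1,2)] x(1) by blast
    moreover have "m = r" using V.fdim_unique[OF x(3) m(2)] .
    ultimately show ?thesis by auto
  qed
  have "M y \<in> (\<lambda>M. M x) ` V" if M: "M \<in> V" "M x = 0" and y: "y \<in> E" for M y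
  proof (rule ccontr)
    assume nin: "M y \<notin> (\<lambda>M. M x) ` V"
    obtain C where C: "C \<subseteq> V" "O.fdim r C" "\<forall>K\<in>C. K x = 0 \<longrightarrow> K = 0"
      using OV.section_exists[OF x(3) eval_lin Vs] by blast
    note Cs = O.fdim_subsp[OF C(2)]
    have MC: "M \<notin> C"
    proof
      assume "M \<in> C"
      then have "M = 0" using C(3) M(2) by simp
      then show False using nin V.subsp_0[OF eval_subsp[OF Vs]] by simp
    qed
    have dC: "O.fdim (Suc r) (O.ext M C)" using O.fdim_Suc[OF MC C(2)] .
    have CV: "O.ext M C \<subseteq> V" using O.ext_sub[OF Vs C(1) M(1)] .
    \<comment> \<open>The equation K x t = K y is taken modulo the line M y F: an operator in
      \<open>O.ext M C\<close> that kills y - x t contains an unknown multiple of M, which is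
      absorbed in s.\<close>
    define Rel where "Rel = (\<lambda>K K'. \<exists>s\<in>F. K' x = K y + M y \<star> s)"
    have ev: "\<exists>K. K \<in> C \<and> K \<noteq> 0 \<and> Rel K (\<lambda>v. K v \<star> t)" if t: "t \<in> F" for t
    proof -
      define z where "z = y - x \<star> t"
      have z: "z \<in> E" using x y E by (simp add: z_def Dsub_cl)
      have le: "r' \<le> r" if "V.fdim r' ((\<lambda>M. M z) ` V)" for r'
      \<comment> \<open>Maximality of r speaks of nonzero vectors only, and y may be a multiple of
        x. For z = 0 the image is zero.\<close>
      proof (cases "z = 0")
        case True
        then have "(\<lambda>M. M z) ` V \<subseteq> {0}" using End_0 tspec_End[OF V] by auto
        moreover have "0 \<in> (\<lambda>M. M z) ` V" using O.subsp_0[OF Vs] by (intro image_eqI[of _ _ 0]) auto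
        ultimately have "(\<lambda>M. M z) ` V = {0}" by blast
        then show ?thesis using that V.fdim_unique[OF V.fdim_0] by (metis le0)
      next
        case False
        then show ?thesis using max z that unfolding P_def by blast
      qed
      have "\<not> (\<forall>K\<in>O.ext M C. K z = 0 \<longrightarrow> K = 0)"
      proof
        assume "\<forall>K\<in>O.ext M C. K z = 0 \<longrightarrow> K = 0"
        then have f: "V.fdim (Suc r) ((\<lambda>K. K z) ` O.ext M C)" using OV.fdim_inj_image[OF dC eval_lin, of z] by simp
        obtain r' where r': "V.fdim r' ((\<lambda>M. M z) ` V)" using dim[OF z] by blast
        have "Suc r \<le> r'" using V.fdim_le[OF r' f] image_mono[OF CV, of "\<lambda>M. M z"] by simp
        then show False using le[OF r'] by simp
      qed
      then obtain L where L: "L \<in> O.ext M C" "L z = 0" "L \<noteq> 0" by blast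
      then obtain s K where K: "s \<in> F" "K \<in> C" "L = (\<lambda>v. M v \<star> s) + K" by (blast elim: O.extE)
      have KE: "K \<in> End E" "M \<in> End E" using K C M tspec_End[OF V] by auto
      have "L z = M y \<star> s + (K y - K x \<star> t)"
        using K KE M x y E by (simp add: z_def End_diff End_rs Dsub_cl rs_simps)
      then have "K x \<star> t = K y + M y \<star> s" using L(2) by (simp add: algebra_simps)
      moreover have "K \<noteq> 0"
      proof
        assume "K = 0"
        then have "M y \<star> s = 0" using calculation by (simp add: rs_0)
        then have "s = 0" using nin V.subsp_0[OF eval_subsp[OF Vs]] by (auto simp: rs_eq_0)
        then show False using K \<open>K = 0\<close> L(3) by (auto simp: rs_zero fun_eq_iff)
      qed
      ultimately show ?thesis using K(1,2) unfolding Rel_def by (intro exI[of _ K] conjI bexI[of _ s])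
    qed
    obtain I where I: "I \<subseteq> F" "finite I" "card I = Suc r"
    proof (cases "finite F")
      case True
      then show ?thesis using card rN that obtain_subset_with_card_n[of "Suc r" F] by auto
    next
      case False
      then show ?thesis using infinite_arbitrarily_large[of F "Suc r"] that by blast
    qed
    define w where "w = (\<lambda>t. SOME K. K \<in> C \<and> K \<noteq> 0 \<and> Rel K (\<lambda>v. K v \<star> t))"
    have w: "w t \<in> C \<and> w t \<noteq> 0 \<and> Rel (w t) (\<lambda>v. w t v \<star> t)" if "t \<in> F" for t
      unfolding w_def using someI_ex[OF ev[OF that]] .
    have "card I \<le> r"
    proof (rule O.pencil[OF I(2,1) C(2), of Rel w])
      show "Rel 0 0" unfolding Rel_def by (rule bexI[OF _ F_0]) (simp add: rs_zero)
      show "Rel (K + L) (K' + L')" if KL: "Rel K K'" "Rel L L'" for K L K' L'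
      proof -
        obtain s t where st: "s \<in> F" "K' x = K y + M y \<star> s" "t \<in> F" "L' x = L y + M y \<star> t"
          using KL unfolding Rel_def by blast
        have "(K' + L') x = (K + L) y + M y \<star> (s + t)" by (simp add: st rs_plus algebra_simps)
        then show ?thesis using F_add[OF st(1,3)] unfolding Rel_def by blast
      qed
      show "Rel (\<lambda>v. K v \<star> a) (\<lambda>v. K' v \<star> a)" if a: "a \<in> F" "Rel K K'" for a K K'
      proof -
        obtain s where s: "s \<in> F" "K' x = K y + M y \<star> s" using a(2) unfolding Rel_def by blast
        have "K' x \<star> a = K y \<star> a + M y \<star> (s * a)" by (simp add: s rs_simps)
        then show ?thesis using F_mul[OF s(1) a(1)] unfolding Rel_def by blast
      qed
      show "w t \<in> C \<and> w t \<noteq> 0 \<and> Rel (w t) (\<lambda>v. w t v \<star> t)" if "t \<in> I" for t using w[of t] that I(1) by (simp add: subset_iff)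
      show "K = 0" if K: "K \<in> C" "Rel 0 K" for K
      proof -
        obtain s where s: "s \<in> F" "K x = M y \<star> s" using K unfolding Rel_def by auto
        have "s = 0"
        proof (rule ccontr)
          assume s0: "s \<noteq> 0"
          have "M y = K x \<star> inverse s" using s s0 by (simp add: rs_inverse)
          moreover have "K x \<star> inverse s \<in> (\<lambda>M. M x) ` V"
            using V.subsp_sc[OF eval_subsp[OF Vs] F_inv[OF s(1)] imageI] K(1) C(1) by (simp add: subset_iff)
          ultimately show False using nin by simp
        qed
        then show ?thesis using s K C by (simp add: rs_zero)
      qed
    qed
    then show False using I by simp
  qed
  then show ?thesis using x by blast
qed

end

section \<open>The dimension bound and the case of equality\<close>

context quad_space
begin

lemma rs_F: "a \<in> F \<Longrightarrow> x \<star> (a * b) = x \<star> b \<star> a"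
  using F_comm[of a b] by (simp add: rs_rs)

text \<open>For fixed z the map a \<mapsto> f (z \<star> a) is an F-linear form on the division
  ring. Its representing element from \<open>form_rep\<close> is \<phi> z, and the uniqueness of
  representation makes \<phi> linear over the division ring.\<close>

lemma Dform_exists:
  assumes E: "Dsub E"
    and f: "\<And>y z. y \<in> E \<Longrightarrow> z \<in> E \<Longrightarrow> f (y + z) = f y + f z"
      "\<And>a z. a \<in> F \<Longrightarrow> z \<in> E \<Longrightarrow> f (z \<star> a) = a * f z" "\<And>z. z \<in> E \<Longrightarrow> f z \<in> F"
  shows "\<exists>\<phi>. (\<forall>z\<in>E. e (\<phi> z) = f z) \<and> (\<forall>y\<in>E. \<forall>z\<in>E. \<phi> (y + z) = \<phi> y + \<phi> z) \<and>
    (\<forall>z\<in>E. \<forall>a. \<phi> (z \<star> a) = \<phi> z * a)"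
proof -
  have ex: "\<exists>!w. \<forall>a. e (w * a) = f (z \<star> a)" if z: "z \<in> E" for z
    using f z E by (intro form_rep) (auto simp: rs_plus Dsub_rs rs_F)
  define \<phi> where "\<phi> = (\<lambda>z. THE w. \<forall>a. e (w * a) = f (z \<star> a))"
  have phi: "e (\<phi> z * a) = f (z \<star> a)" if "z \<in> E" for z a
    using theI'[OF ex[OF that]] unfolding \<phi>_def by (rule spec)
  have uniq: "w = \<phi> z" if "z \<in> E" "\<And>a. e (w * a) = f (z \<star> a)" for z w
  proof -
    have "e ((w - \<phi> z) * a) = 0" for a using phi[OF that(1)] that(2) by (simp add: left_diff_distrib e_diff)
    then have "w - \<phi> z = 0" by (rule e_nondeg)
    then show ?thesis by simp
  qed
  have "e (\<phi> z) = f z" if "z \<in> E" for z using phi[OF that, of 1] by (simp add: rs_1)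
  moreover have "\<phi> (y + z) = \<phi> y + \<phi> z" if "y \<in> E" "z \<in> E" for y z
    using that E by (intro uniq[symmetric]) (auto simp: distrib_right e_add phi rs_add f Dsub_cl)
  moreover have "\<phi> (z \<star> b) = \<phi> z * b" if "z \<in> E" for z b
    using that E by (intro uniq[symmetric]) (auto simp: mult.assoc phi rs_rs Dsub_cl)
  ultimately show ?thesis by (intro exI[of _ \<phi>]) simp
qed

text \<open>The summand is the dimension over F of a hyperplane in a space of dimension k over the
  division ring. As d is positive, the subtraction is never truncated.\<close>

definition bd :: "nat \<Rightarrow> nat" where
  "bd n = (\<Sum>k=1..n. k * d - 1)"

lemma bd_0: "bd 0 = 0" and bd_Suc: "bd (Suc n) = bd n + (Suc n * d - 1)"
  by (simp_all add: bd_def)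

lemma zero_space: "V.fdim (n * d) E \<Longrightarrow> E = {0} \<longleftrightarrow> n = 0"
proof
  assume n: "V.fdim (n * d) E"
  show "n = 0" if "E = {0}"
    using V.fdim_unique[OF V.fdim_0, of "n * d"] n that d_pos by simp
  show "E = {0}" if "n = 0"
    using n that V.fdim_0D by simp
qed

lemma kernel_dim:
  assumes E: "Dsub E" "V.fdim (Suc n * d) E"
    and phi: "\<And>y z. y \<in> E \<Longrightarrow> z \<in> E \<Longrightarrow> \<phi> (y + z) = \<phi> y + \<phi> z" "\<And>z a. z \<in> E \<Longrightarrow> \<phi> (z \<star> a) = \<phi> z * a"
    and x: "x \<in> E" "\<phi> x \<noteq> 0"
  shows "V.fdim (n * d) {z \<in> E. \<phi> z = 0}"
proof -
  have l: "VD.lin E \<phi>" unfolding VD.lin_def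
  proof (intro conjI ballI)
    fix a z assume "a \<in> F" "z \<in> E"
    then show "\<phi> (z \<star> a) = a * \<phi> z" using phi(2)[of z a] F_comm[of a "\<phi> z"] by simp
  qed (use phi(1) in blast)
  have "y \<in> \<phi> ` E" for y
    using phi(2)[OF x(1), of "inverse (\<phi> x) * y"] x E(1)
    by (intro image_eqI[of _ _ "x \<star> (inverse (\<phi> x) * y)"]) (auto simp: mult.assoc[symmetric] Dsub_rs)
  then have "\<phi> ` E = UNIV" by blast
  then obtain r k where "D.fdim r UNIV" "V.fdim k {z \<in> E. \<phi> z = 0}" "Suc n * d = r + k"
    using VD.fdim_kernel[OF E(2) l] by auto
  then show ?thesis using D.fdim_unique[OF D_dim] by fastforce
qed

lemma form_kernel_dim:
  assumes E: "V.fdim m E" "x \<in> E" "f x \<noteq> 0"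
    and f: "\<And>y z. y \<in> E \<Longrightarrow> z \<in> E \<Longrightarrow> f (y + z) = f y + f z"
      "\<And>a z. a \<in> F \<Longrightarrow> z \<in> E \<Longrightarrow> f (z \<star> a) = a * f z" "\<And>z. z \<in> E \<Longrightarrow> f z \<in> F"
  shows "V.fdim (m - 1) {z \<in> E. f z = 0}"
proof -
  have l: "VD.lin E f" using f by (auto simp: VD.lin_def)
  obtain r k where *: "D.fdim r (f ` E)" "V.fdim k {z \<in> E. f z = 0}" "m = r + k"
    using VD.fdim_kernel[OF E(1) l] by blast
  have "f ` E \<subseteq> F" using f(3) by blast
  then have "r \<le> 1" using D.fdim_le[OF D_F_dim *(1)] by blast
  moreover have "r \<noteq> 0"
  proof
    assume "r = 0"
    then have "f ` E = {0}" using *(1) D.fdim_0D by simp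
    then show False using E by blast
  qed
  ultimately show ?thesis using * by (metis One_nat_def add_diff_cancel_left' le_Suc_eq le_zero_eq)
qed

definition regular_split :: "'v set \<Rightarrow> ('v \<Rightarrow> 'v) set \<Rightarrow> 'v \<Rightarrow> ('v \<Rightarrow> 'd) \<Rightarrow> bool" where
  "regular_split E V x \<phi> \<longleftrightarrow> x \<in> E \<and> e (\<phi> x) \<noteq> 0 \<and>
     (\<forall>y\<in>E. \<forall>z\<in>E. \<phi> (y + z) = \<phi> y + \<phi> z) \<and> (\<forall>z\<in>E. \<forall>a. \<phi> (z \<star> a) = \<phi> z * a) \<and>
     (\<forall>M\<in>V. e (\<phi> (M x)) = 0) \<and> (\<forall>M\<in>V. M x = 0 \<longrightarrow> (\<forall>y\<in>E. \<phi> (M y) = 0))"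

lemma regular_split_exists:
  assumes E: "Dsub E" "V.fdim (Suc n * d) E" and V: "tspec E V"
    and card: "infinite F \<or> Suc n * d \<le> card F"
  shows "\<exists>x \<phi>. regular_split E V x \<phi>"
proof -
  have "E \<noteq> {0}" using zero_space[OF E(2)] by simp
  then obtain x where x: "x \<in> E" "x \<noteq> 0"
    and reg: "\<forall>M\<in>V. M x = 0 \<longrightarrow> (\<forall>y\<in>E. M y \<in> (\<lambda>M. M x) ` V)"
    using regular_exists[OF E _ V card] by blast
  have im: "(\<lambda>M. M x) ` V \<subseteq> E"
    using End_mem[OF tspec_End[OF V] x(1)] by (rule image_subsetI)
  define im_V where "im_V = (\<lambda>M. M x) ` V"
  have im_V: "V.subsp im_V" "im_V \<subseteq> E" "x \<notin> im_V"
    unfolding im_V_def by (rule eval_subsp[OF tspec_subsp[OF V]], rule im, rule tspec_notin[OF V x])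
  obtain f where f: "(\<forall>z\<in>E. f z \<in> F) \<and> (\<forall>y\<in>E. \<forall>z\<in>E. f (y + z) = f y + f z) \<and>
    (\<forall>a\<in>F. \<forall>z\<in>E. f (z \<star> a) = a * f z) \<and> (\<forall>z\<in>im_V. f z = 0) \<and> f x = 1"
    using V.functional_exists[OF E(2) im_V(1,2) x(1) im_V(3)] by (rule exE)
  have "\<exists>\<phi>. (\<forall>z\<in>E. e (\<phi> z) = f z) \<and> (\<forall>y\<in>E. \<forall>z\<in>E. \<phi> (y + z) = \<phi> y + \<phi> z) \<and>
    (\<forall>z\<in>E. \<forall>a. \<phi> (z \<star> a) = \<phi> z * a)"
    using f by (intro Dform_exists[OF E(1)]) simp_all
  then obtain \<phi> where p: "(\<forall>z\<in>E. e (\<phi> z) = f z) \<and> (\<forall>y\<in>E. \<forall>z\<in>E. \<phi> (y + z) = \<phi> y + \<phi> z) \<and>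
    (\<forall>z\<in>E. \<forall>a. \<phi> (z \<star> a) = \<phi> z * a)" by (rule exE)
  note phi = conjunct1[OF p] conjunct1[OF conjunct2[OF p]] conjunct2[OF conjunct2[OF p]]
  have fX: "f z = 0" if "z \<in> im_V" for z using f that by simp
  have fM: "f (M x) = 0" if "M \<in> V" for M using fX[of "M x"] imageI[OF that, of "\<lambda>M. M x"] by (simp add: im_V_def)
  have "e (\<phi> (M x)) = 0" if "M \<in> V" for M
    using fM[OF that] bspec[OF phi(1) End_mem[OF tspec_End[OF V that] x(1)]] by simp
  moreover have "\<phi> (M y) = 0" if M: "M \<in> V" "M x = 0" and y: "y \<in> E" for M y
  proof (rule e_nondeg)
    fix a
    have ME: "M \<in> End E" using tspec_End[OF V M(1)] .
    \<comment> \<open>Regularity alone gives only \<open>e (\<phi> (M y)) = 0\<close>. Moving an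
      arbitrary a inside M, where it changes y to y \<star> a, upgrades this to \<phi> (M y) =
      0.\<close>
    have "e (\<phi> (M y) * a) = e (\<phi> (M (y \<star> a)))"
      using phi(3) End_mem[OF ME y] End_rs[OF ME y] by simp
    also have "\<dots> = f (M (y \<star> a))" using phi(1) End_mem[OF ME] Dsub_rs[OF E(1) y] by simp
    also have "\<dots> = 0" using fX[of "M (y \<star> a)"] reg M Dsub_rs[OF E(1) y] by (simp add: im_V_def)
    finally show "e (\<phi> (M y) * a) = 0" .
  qed
  ultimately have "regular_split E V x \<phi>"
    unfolding regular_split_def using x phi f by simp
  then show ?thesis by blast
qed

context
  fixes E V x \<phi> H V'
  assumes E: "Dsub E" and V: "tspec E V" and spl: "regular_split E V x \<phi>"
  defines "H \<equiv> {y \<in> E. \<phi> y = 0}" and "V' \<equiv> restr H ` {M \<in> V. M x = 0}"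
begin

lemma rs_x: "x \<in> E" and rs_p: "e (\<phi> x) \<noteq> 0" and rs_p0: "\<phi> x \<noteq> 0"
  and rs_phi_add: "y \<in> E \<Longrightarrow> z \<in> E \<Longrightarrow> \<phi> (y + z) = \<phi> y + \<phi> z"
  and rs_phi_rs: "z \<in> E \<Longrightarrow> \<phi> (z \<star> a) = \<phi> z * a"
  and rs_phi_Mx: "M \<in> V \<Longrightarrow> e (\<phi> (M x)) = 0"
  and rs_phi_ker: "M \<in> V \<Longrightarrow> M x = 0 \<Longrightarrow> y \<in> E \<Longrightarrow> \<phi> (M y) = 0"
  using spl unfolding regular_split_def by (auto simp: e_0)

lemma split_Dsub: "Dsub H"
  unfolding Dsub_def H_def
  using rs_phi_add rs_phi_rs[OF Dsub_0[OF E], of 0] rs_phi_rs E by (auto simp: rs_zero Dsub_cl)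

lemma split_H: "H \<subseteq> E"
  by (auto simp: H_def)

lemma split_dec: "v \<in> E \<Longrightarrow> v - x \<star> (inverse (\<phi> x) * \<phi> v) \<in> H"
proof -
  assume v: "v \<in> E"
  define u where "u = inverse (\<phi> x) * \<phi> v"
  have xu: "x \<star> u \<in> E" using rs_x E by (simp add: Dsub_rs)
  have "\<phi> (v - x \<star> u) + \<phi> (x \<star> u) = \<phi> v"
    using rs_phi_add[of "v - x \<star> u" "x \<star> u"] v xu E by (simp add: Dsub_diff)
  moreover have "\<phi> (x \<star> u) = \<phi> v" using rs_phi_rs[OF rs_x] rs_p0 by (simp add: u_def mult.assoc[symmetric])
  ultimately show ?thesis using v xu E by (simp add: u_def H_def Dsub_diff)
qed

lemma split_obtain:
  assumes "v \<in> E" obtains u y where "y \<in> H" "v = x \<star> u + y"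
  using split_dec[OF assms] that[of _ "inverse (\<phi> x) * \<phi> v"] by simp

lemma split_phi: "y \<in> H \<Longrightarrow> \<phi> (x \<star> u + y) = \<phi> x * u"
  using rs_phi_add[of "x \<star> u" y] rs_phi_rs[OF rs_x] rs_x E by (simp add: H_def Dsub_rs)

lemma split_tspec: "tspec H V'"
  unfolding tspec_def
proof (intro conjI ballI impI subsetI)
  have l: "OV.lin V (\<lambda>M. M x)" by (rule eval_lin)
  show "O.subsp V'" unfolding V'_def
    by (intro OO.subsp_image[OF restr_lin] OV.subsp_kernel[OF l tspec_subsp[OF V]])
  fix M assume "M \<in> V'"
  then obtain N where N: "N \<in> V" "N x = 0" "M = restr H N" unfolding V'_def by blast
  have NE: "N \<in> End E" using tspec_End[OF V N(1)] .
  have NH: "N y \<in> H" if "y \<in> H" for y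
    using rs_phi_ker[OF N(1,2)] End_mem[OF NE] that by (simp add: H_def)
  then show "M \<in> End H" unfolding N(3) by (rule restr_End[OF NE split_Dsub split_H])
  fix y assume y: "y \<in> H" "M y = y"
  then show "y = 0" using tspec_fix[OF V N(1), of y] N(3) split_H by auto
qed

lemma split_inj: "M \<in> V \<Longrightarrow> M x = 0 \<Longrightarrow> restr H M = 0 \<Longrightarrow> M = 0"
proof -
  assume M: "M \<in> V" "M x = 0" "restr H M = 0"
  have ME: "M \<in> End E" using tspec_End[OF V M(1)] .
  have "M v = 0" for v
  proof (cases "v \<in> E")
    case True
    then obtain u y where u: "y \<in> H" "v = x \<star> u + y" by (rule split_obtain)
    have "M y = 0" using u(1)  using fun_cong[OF M(3), of y] by simp
    then show ?thesis
      using u ME M(2) End_add[OF ME, of "x \<star> u" y] End_rs[OF ME rs_x] rs_x E split_H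
      by (auto simp: Dsub_rs rs_0)
  qed (use End_out[OF ME] in simp)
  then show "M = 0" by (auto simp: fun_eq_iff)
qed

lemma split_dim: "O.fdim k V' \<Longrightarrow> O.fdim k {M \<in> V. M x = 0}"
proof -
  assume k: "O.fdim k V'"
  have s: "O.subsp {M \<in> V. M x = 0}" using OV.subsp_kernel[OF eval_lin tspec_subsp[OF V]] .
  have "{M \<in> {M \<in> V. M x = 0}. restr H M = 0} = {0}"
    using split_inj O.subsp_0[OF s] by (auto simp: restr_def)
  then have "O.fdim 0 {M \<in> {M \<in> V. M x = 0}. restr H M = 0}" using O.fdim_0 by simp
  from OO.rank_nullity[OF k[unfolded V'_def] this restr_lin s] show ?thesis by simp
qed

lemma split_image: "(\<lambda>M. M x) ` V \<subseteq> {z \<in> E. e (\<phi> z) = 0}"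
  using rs_phi_Mx End_mem[OF tspec_End[OF V] rs_x] by auto

lemma split_hyper_dim:
  assumes "V.fdim m E"
  shows "V.fdim (m - 1) {z \<in> E. e (\<phi> z) = 0}"
  using rs_phi_add rs_phi_rs rs_p rs_x e_F
  by (intro form_kernel_dim[OF assms rs_x]) (auto simp: e_add e_sc_r)

end

theorem dim_bound:
  assumes "Dsub E" "V.fdim (n * d) E" "tspec E V" "infinite F \<or> n * d \<le> card F"
  shows "\<exists>k\<le>bd n. O.fdim k V"
  using assms
proof (induction n arbitrary: E V)
  case 0
  then have "E = {0}" using zero_space by blast
  have "M = 0" if "M \<in> V" for M
  proof -
    have ME: "M \<in> End E" using tspec_End[OF 0(3) that] .
    have "M v = 0" for v using End_0[OF ME] End_out[OF ME, of v] \<open>E = {0}\<close> by (cases "v = 0") auto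
    then show ?thesis by (simp add: fun_eq_iff)
  qed
  then have "V = {0}" using O.subsp_0[OF tspec_subsp[OF 0(3)]] by blast
  then show ?case using O.fdim_0 by (simp add: bd_0)
next
  case (Suc n)
  obtain x \<phi> where s: "regular_split E V x \<phi>" using regular_split_exists[OF Suc.prems] by blast
  define H where "H = {y \<in> E. \<phi> y = 0}"
  define V' where "V' = restr H ` {M \<in> V. M x = 0}"
  note sp = Suc.prems(1,3) s
  have "V.fdim (n * d) H" unfolding H_def
    by (rule kernel_dim[OF Suc.prems(1,2) rs_phi_add[OF sp] rs_phi_rs[OF sp] rs_x[OF sp] rs_p0[OF sp]])
  moreover have "tspec H V'" using split_tspec[OF sp] unfolding H_def V'_def .
  moreover have "Dsub H" using split_Dsub[OF sp] unfolding H_def .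
  moreover have "infinite F \<or> n * d \<le> card F" using Suc.prems(4) by auto
  ultimately obtain k where k: "k \<le> bd n" "O.fdim k V'" using Suc.IH by blast
  have k': "O.fdim k {M \<in> V. M x = 0}" using split_dim[OF sp] k(2) unfolding H_def V'_def by blast
  define im_V where "im_V = (\<lambda>M. M x) ` V"
  obtain r where r: "r \<le> Suc n * d - 1" "V.fdim r im_V"
    using V.fdim_subspace[OF split_hyper_dim[OF sp Suc.prems(2)] eval_subsp[OF tspec_subsp[OF Suc.prems(3)]] split_image[OF sp]]
    unfolding im_V_def[symmetric] by blast
  have "O.fdim (r + k) V" using OV.rank_nullity[OF r(2)[unfolded im_V_def] k' eval_lin tspec_subsp[OF Suc.prems(3)]] .
  moreover have "r + k \<le> bd (Suc n)" using r k by (simp add: bd_Suc)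
  ultimately show ?case by blast
qed

text \<open>The bound is the sum of an estimate for V' and one for V x. Equality in the sum forces
  equality in both, so V' is optimal on H and V x is a full hyperplane.\<close>

lemma optimal_split:
  assumes E: "Dsub E" "V.fdim (Suc n * d) E" and V: "tspec E V" "O.fdim (bd (Suc n)) V"
    and card: "infinite F \<or> Suc n * d \<le> card F" and s: "regular_split E V x \<phi>"
  defines "H \<equiv> {y \<in> E. \<phi> y = 0}" and "V' \<equiv> restr {y \<in> E. \<phi> y = 0} ` {M \<in> V. M x = 0}"
  shows "V.fdim (n * d) H" "O.fdim (bd n) V'"
    "z \<in> E \<Longrightarrow> e (\<phi> z) = 0 \<Longrightarrow> \<exists>M\<in>V. M x = z"
proof -
  note sp = E(1) V(1) s
  show H: "V.fdim (n * d) H" unfolding H_def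
    by (rule kernel_dim[OF E rs_phi_add[OF sp] rs_phi_rs[OF sp] rs_x[OF sp] rs_p0[OF sp]])
  have t: "tspec H V'" using split_tspec[OF sp] unfolding H_def V'_def .
  have DH: "Dsub H" using split_Dsub[OF sp] unfolding H_def .
  have "infinite F \<or> n * d \<le> card F" using card by auto
  then obtain k where k: "k \<le> bd n" "O.fdim k V'" using dim_bound[OF DH H t] by blast
  have k': "O.fdim k {M \<in> V. M x = 0}" using split_dim[OF sp] k(2) unfolding H_def V'_def by blast
  define im_V where "im_V = (\<lambda>M. M x) ` V"
  define im_W where "im_W = {z \<in> E. e (\<phi> z) = 0}"
  have im_V: "V.subsp im_V" "im_V \<subseteq> im_W" and im_W: "V.fdim (Suc n * d - 1) im_W"
    unfolding im_V_def im_W_def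
    by (rule eval_subsp[OF tspec_subsp[OF V(1)]], rule split_image[OF sp], rule split_hyper_dim[OF sp E(2)])
  obtain r where r: "r \<le> Suc n * d - 1" "V.fdim r im_V" "r = Suc n * d - 1 \<longrightarrow> im_V = im_W"
    using V.fdim_subspace[OF im_W im_V] by blast
  have "O.fdim (r + k) V" using OV.rank_nullity[OF r(2)[unfolded im_V_def] k' eval_lin tspec_subsp[OF V(1)]] .
  then have "r + k = bd (Suc n)" using O.fdim_unique[OF V(2)] by blast
  then have "k = bd n" and r': "r = Suc n * d - 1" using r(1) k(1) by (simp_all add: bd_Suc)
  then show "O.fdim (bd n) V'" using k by simp
  assume "z \<in> E" "e (\<phi> z) = 0"
  then have "z \<in> (\<lambda>M. M x) ` V" using r(3) r' by (simp add: im_V_def im_W_def)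
  then show "\<exists>M\<in>V. M x = z" by auto
qed

end

context fspace
begin

text \<open>Compare the eigenvalues at x, x0 and x + x0: either they agree, or the comparison makes
  x a multiple of x0 and linearity decides.\<close>

lemma scalar_map:
  assumes S: "subsp S" and L: "\<And>x y. x \<in> S \<Longrightarrow> y \<in> S \<Longrightarrow> L (x + y) = L x + L y"
    "\<And>a x. a \<in> F \<Longrightarrow> x \<in> S \<Longrightarrow> L (sc a x) = sc a (L x)"
    and ev: "\<And>x. x \<in> S \<Longrightarrow> \<exists>s\<in>F. L x = sc s x"
  shows "\<exists>s\<in>F. \<forall>x\<in>S. L x = sc s x"
proof (cases "S = {0}")
  case True
  then show ?thesis using ev[of 0] by auto
next
  case False
  then obtain x0 where x0: "x0 \<in> S" "x0 \<noteq> 0" using subsp_0[OF S] by auto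
  obtain s where s: "s \<in> F" "L x0 = sc s x0" using ev[OF x0(1)] by auto
  have "L x = sc s x" if x: "x \<in> S" for x
  proof -
    obtain s1 where s1: "s1 \<in> F" "L x = sc s1 x" using ev[OF x] by auto
    obtain s2 where s2: "s2 \<in> F" "L (x + x0) = sc s2 (x + x0)"
      using ev[OF subsp_add[OF S x x0(1)]] by auto
    have eq: "sc (s1 - s2) x = sc (s2 - s) x0"
      using s s1 s2 L(1)[OF x x0(1)] by (simp add: sc_diff_l sc_add algebra_simps)
    show ?thesis
    proof (cases "s1 = s2")
      case True
      then have "sc (s2 - s) x0 = 0" using eq by (simp add: sc_0)
      then have "s2 = s" using x0(2) sc_eq_0[OF F_diff[OF s2(1) s(1)]] by simp
      then show ?thesis using True s1 by simp
    next
      case False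
      define r where "r = inverse (s1 - s2) * (s2 - s)"
      have r: "r \<in> F" using s s1 s2 by (simp add: r_def F_cl)
      have "x = sc (inverse (s1 - s2)) (sc (s1 - s2) x)" using False s1 s2 by (simp add: sc_inverse F_cl)
      then have xr: "x = sc r x0" using s s1 s2 by (simp add: eq sc_sc F_cl r_def)
      then have "L x = sc r (L x0)" using L(2)[OF r x0(1)] by simp
      also have "\<dots> = sc s x" using r s F_comm[OF r, of s] by (simp add: xr sc_sc)
      finally show ?thesis .
    qed
  qed
  then show ?thesis using s(1) by blast
qed

end

section \<open>Operator spaces described by a sesquilinear form\<close>

context quad_space
begin

definition sesq :: "'v set \<Rightarrow> ('v \<Rightarrow> 'v \<Rightarrow> 'd) \<Rightarrow> bool" where
  "sesq E b \<longleftrightarrow> (\<forall>x\<in>E. \<forall>y\<in>E. \<forall>z\<in>E. b (x + y) z = b x z + b y z \<and> b z (x + y) = b z x + b z y) \<and>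
     (\<forall>x\<in>E. \<forall>y\<in>E. \<forall>a. b (x \<star> a) y = \<sigma> a * b x y \<and> b x (y \<star> a) = b x y * a)"

definition form_on :: "'v set \<Rightarrow> 'v set \<Rightarrow> ('v \<Rightarrow> 'v \<Rightarrow> 'd) \<Rightarrow> bool" where
  "form_on E H b \<longleftrightarrow> Dsub H \<and> H \<subset> E \<and> sesq E b \<and>
     (\<forall>h\<in>H. \<forall>v\<in>E. b h v = 0 \<and> b v h = 0) \<and> (\<forall>v\<in>E. v \<notin> H \<longrightarrow> e (b v v) \<noteq> 0)"

text \<open>The space induced on H is not a separate parameter: it is the image of V under
  \<open>restr H\<close>. Membership is characterised only within \<open>End E\<close>, so lemmas
  that need V inside \<open>End E\<close> assume it on their own.\<close>

definition structured :: "'v set \<Rightarrow> 'v set \<Rightarrow> ('v \<Rightarrow> 'v \<Rightarrow> 'd) \<Rightarrow> ('v \<Rightarrow> 'v) set \<Rightarrow> bool" where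
  "structured E H b V \<longleftrightarrow> form_on E H b \<and>
     (\<forall>N\<in>End E. N \<in> V \<longleftrightarrow> (\<forall>h\<in>H. N h \<in> H) \<and> restr H N \<in> restr H ` V \<and> (\<forall>v\<in>E. e (b v (N v)) = 0))"

lemma form_on_Dsub: "form_on E H b \<Longrightarrow> Dsub H"
  and form_on_sub: "form_on E H b \<Longrightarrow> H \<subseteq> E"
  and form_on_proper: "form_on E H b \<Longrightarrow> H \<noteq> E"
  and form_on_l: "form_on E H b \<Longrightarrow> h \<in> H \<Longrightarrow> v \<in> E \<Longrightarrow> b h v = 0"
  and form_on_r: "form_on E H b \<Longrightarrow> h \<in> H \<Longrightarrow> v \<in> E \<Longrightarrow> b v h = 0"
  and form_on_pos: "form_on E H b \<Longrightarrow> v \<in> E \<Longrightarrow> v \<notin> H \<Longrightarrow> e (b v v) \<noteq> 0"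
  and form_add_l: "form_on E H b \<Longrightarrow> x \<in> E \<Longrightarrow> y \<in> E \<Longrightarrow> z \<in> E \<Longrightarrow> b (x + y) z = b x z + b y z"
  and form_add_r: "form_on E H b \<Longrightarrow> x \<in> E \<Longrightarrow> y \<in> E \<Longrightarrow> z \<in> E \<Longrightarrow> b z (x + y) = b z x + b z y"
  and form_rs_l: "form_on E H b \<Longrightarrow> x \<in> E \<Longrightarrow> y \<in> E \<Longrightarrow> b (x \<star> a) y = \<sigma> a * b x y"
  and form_rs_r: "form_on E H b \<Longrightarrow> x \<in> E \<Longrightarrow> y \<in> E \<Longrightarrow> b x (y \<star> a) = b x y * a"
  unfolding form_on_def sesq_def by auto

lemma form_diff_r: "form_on E H b \<Longrightarrow> Dsub E \<Longrightarrow> x \<in> E \<Longrightarrow> y \<in> E \<Longrightarrow> z \<in> E \<Longrightarrow> b z (x - y) = b z x - b z y"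
  using form_add_r[of E H b "x - y" y z] Dsub_diff[of E x y] by simp

lemma form_diff_l: "form_on E H b \<Longrightarrow> Dsub E \<Longrightarrow> x \<in> E \<Longrightarrow> y \<in> E \<Longrightarrow> z \<in> E \<Longrightarrow> b (x - y) z = b x z - b y z"
  using form_add_l[of E H b "x - y" y z] Dsub_diff[of E x y] by simp

lemma form_on_pos0: "form_on E H b \<Longrightarrow> v \<in> E \<Longrightarrow> v \<notin> H \<Longrightarrow> b v v \<noteq> 0"
  using form_on_pos e_0 by force

lemma form_left_ker: "form_on E H b \<Longrightarrow> v \<in> E \<Longrightarrow> b v v = 0 \<Longrightarrow> v \<in> H"
  using form_on_pos0 by blast

lemma structured_form: "structured E H b V \<Longrightarrow> form_on E H b"
  and structured_iff: "structured E H b V \<Longrightarrow> N \<in> End E \<Longrightarrow>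
    N \<in> V \<longleftrightarrow> (\<forall>h\<in>H. N h \<in> H) \<and> restr H N \<in> restr H ` V \<and> (\<forall>v\<in>E. e (b v (N v)) = 0)"
  unfolding structured_def by auto

text \<open>Outside \<open>H\<close> the evaluations are full hyperplanes: relative to the decomposition of \<open>E\<close> as
  \<open>y\<close> plus the left orthogonal of \<open>y\<close>, one can write down an element of \<open>V\<close> sending \<open>y\<close> to \<open>z\<close>.\<close>

lemma structured_hyperplane:
  assumes E: "Dsub E" and V: "O.subsp V" and st: "structured E H b V"
    and y: "y \<in> E" "y \<notin> H" and z: "z \<in> E" "e (b y z) = 0"
  shows "\<exists>N\<in>V. N y = z \<and> (\<forall>h\<in>H. N h = 0)"
proof -
  note f = structured_form[OF st]
  define q where "q = b y y"
  have q: "q \<noteq> 0" using form_on_pos0[OF f y] by (simp add: q_def)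
  \<comment> \<open>c v is the y-coordinate of v for which the rest s v is left orthogonal to y. The
    outer \<sigma> makes it linear from the right, since b is conjugate linear in its first
    argument.\<close>
  define c where "c = (\<lambda>v. \<sigma> (b v y * inverse q))"
  define s where "s = (\<lambda>v. v - y \<star> c v)"
  \<comment> \<open>Forced by the cross terms of \<open>e (b v (N v))\<close>: with this choice they
    add up to a difference w - \<sigma> w, which e kills.\<close>
  define t where "t = (\<lambda>v. - (inverse q * \<sigma> (b v z)))"
  define N where "N = (\<lambda>v. if v \<in> E then z \<star> c v + y \<star> t (s v) else 0)"
  have c_add: "c (v + w) = c v + c w" if "v \<in> E" "w \<in> E" for v w
    using that y by (simp add: c_def form_add_l[OF f] conj_add distrib_right)
  have c_rs: "c (v \<star> a) = c v * a" if "v \<in> E" for v a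
    using that y by (simp add: c_def form_rs_l[OF f] conj_mult conj_conj mult.assoc)
  have s_E: "s v \<in> E" if "v \<in> E" for v using that y E by (simp add: s_def Dsub_cl)
  have s_add: "s (v + w) = s v + s w" if "v \<in> E" "w \<in> E" for v w
    using that by (simp add: s_def c_add rs_simps)
  have s_rs: "s (v \<star> a) = s v \<star> a" if "v \<in> E" for v a
    using that by (simp add: s_def c_rs rs_simps)
  have t_add: "t (v + w) = t v + t w" if "v \<in> E" "w \<in> E" for v w
    using that z by (simp add: t_def form_add_l[OF f] conj_add distrib_left)
  have t_rs: "t (v \<star> a) = t v * a" if "v \<in> E" for v a
    using that z by (simp add: t_def form_rs_l[OF f] conj_mult conj_conj mult.assoc)
  have NE: "N \<in> End E"
    unfolding End_def using y z E
    by (auto simp: N_def Dsub_cl c_add c_rs s_add s_rs t_add t_rs s_E rs_simps)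
  have s_y: "b (s v) y = 0" if "v \<in> E" for v
  proof -
    have "b (s v) y = b v y - \<sigma> (c v) * q"
      using that y E by (simp add: s_def form_diff_l[OF f] form_rs_l[OF f] Dsub_cl q_def)
    also have "\<sigma> (c v) * q = b v y" using q by (simp add: c_def conj_conj mult.assoc)
    finally show ?thesis by simp
  qed
  have "e (b v (N v)) = 0" if v: "v \<in> E" for v
  proof -
    have 1: "v = y \<star> c v + s v" by (simp add: s_def)
    have "b v (N v) = b (y \<star> c v + s v) (z \<star> c v + y \<star> t (s v))" using v 1 by (simp add: N_def)
    also have "\<dots> = \<sigma> (c v) * b y z * c v + \<sigma> (c v) * (q * t (s v)) + b (s v) z * c v + b (s v) y * t (s v)"
      using v y z E s_E[OF v]
      by (simp add: form_add_l[OF f] form_add_r[OF f] form_rs_l[OF f] form_rs_r[OF f] Dsub_cl q_def mult.assoc algebra_simps)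
    also have "q * t (s v) = - \<sigma> (b (s v) z)" using q by (simp add: t_def mult.assoc[symmetric])
    also have "b (s v) y = 0" using s_y[OF v] .
    finally have "b v (N v) = \<sigma> (c v) * b y z * c v + (b (s v) z * c v - \<sigma> (b (s v) z * c v))"
      by (simp add: conj_mult)
    then show ?thesis using e_norm[of "c v" "b y z"] z by (simp add: e_add e_skew_sum)
  qed
  moreover have N0: "N h = 0" if h: "h \<in> H" for h
  proof -
    have hE: "h \<in> E" using h form_on_sub[OF f] by blast
    have "c h = 0" using form_on_l[OF f h y(1)] by (simp add: c_def conj_0)
    moreover from this have "s h = h" by (simp add: s_def rs_zero)
    moreover have "t h = 0" using form_on_l[OF f h z(1)] by (simp add: t_def conj_0)
    ultimately show ?thesis using hE by (simp add: N_def rs_zero)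
  qed
  moreover have "restr H N = restr H 0" using N0 by (auto simp: restr_def)
  moreover have "0 \<in> V" using O.subsp_0[OF V] .
  ultimately have "N \<in> V" using structured_iff[OF st NE] Dsub_0[OF form_on_Dsub[OF f]] by auto
  moreover have "N y = z"
  proof -
    have "c y = 1" using q by (simp add: c_def q_def conj_1)
    moreover from this have "s y = 0" by (simp add: s_def rs_1)
    moreover have "t 0 = 0"
      using form_on_l[OF f Dsub_0[OF form_on_Dsub[OF f]] z(1)] by (simp add: t_def conj_0)
    ultimately show ?thesis using y by (simp add: N_def rs_simps)
  qed
  ultimately show ?thesis using N0 by auto
qed

end

text \<open>What a regular split of an optimal space leaves behind: \<open>A\<close> is the
  coordinate along x, \<open>C\<close> the projection to H, and \<phi> v = p * A v. By
  \<open>V_surj\<close> and \<open>V_a\<close>, the vectors M x fill the hyperplane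
  \<open>e (p * A z) = 0\<close>; by \<open>V_ker\<close>, operators that kill x map E into
  H.\<close>

locale hyperplane_split = quad_space F d \<sigma> e rs
  for F :: "'d :: division_ring set" and d \<sigma> e and rs :: "'v :: ab_group_add \<Rightarrow> 'd \<Rightarrow> 'v" (infixl \<open>\<star>\<close> 75) +
  fixes E H :: "'v set" and V V' :: "('v \<Rightarrow> 'v) set" and x :: 'v and p :: 'd
    and A :: "'v \<Rightarrow> 'd" and C :: "'v \<Rightarrow> 'v" and n :: nat
  assumes E: "Dsub E" and E_dim: "V.fdim (Suc n * d) E" and H: "Dsub H" and H_dim: "V.fdim (n * d) H"
    and HE: "H \<subseteq> E" and xE: "x \<in> E"
    and C_H: "v \<in> E \<Longrightarrow> C v \<in> H" and AC: "v \<in> E \<Longrightarrow> v = x \<star> A v + C v"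
    and A_eq: "y \<in> H \<Longrightarrow> A (x \<star> u + y) = u" and C_eq: "y \<in> H \<Longrightarrow> C (x \<star> u + y) = y"
    and V: "tspec E V" and V_surj: "e (p * a) = 0 \<Longrightarrow> c \<in> H \<Longrightarrow> \<exists>M\<in>V. M x = x \<star> a + c"
    and V_a: "M \<in> V \<Longrightarrow> e (p * A (M x)) = 0"
    and V_ker: "M \<in> V \<Longrightarrow> M x = 0 \<Longrightarrow> y \<in> E \<Longrightarrow> A (M y) = 0"
    and V'_eq: "V' = restr H ` {M \<in> V. M x = 0}" and V': "tspec H V'" and V'_dim: "O.fdim (bd n) V'"
    and ep: "e p \<noteq> 0"
    and card: "infinite F \<or> Suc n * d \<le> card F"
begin

lemma p0: "p \<noteq> 0" using ep e_0 by auto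

lemma A_add: "v \<in> E \<Longrightarrow> w \<in> E \<Longrightarrow> A (v + w) = A v + A w"
  and C_add: "v \<in> E \<Longrightarrow> w \<in> E \<Longrightarrow> C (v + w) = C v + C w"
proof -
  assume vw: "v \<in> E" "w \<in> E"
  have eq: "v + w = x \<star> (A v + A w) + (C v + C w)"
    using AC[OF vw(1)] AC[OF vw(2)] by (metis (no_types, lifting) add.assoc add.left_commute rs_plus)
  have c: "C v + C w \<in> H" using C_H vw H by (simp add: Dsub_cl)
  show "A (v + w) = A v + A w" using A_eq[OF c, of "A v + A w"] eq by simp
  show "C (v + w) = C v + C w" using C_eq[OF c, of "A v + A w"] eq by simp
qed

lemma A_rs: "v \<in> E \<Longrightarrow> A (v \<star> a) = A v * a" and C_rs: "v \<in> E \<Longrightarrow> C (v \<star> a) = C v \<star> a"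
proof -
  assume v: "v \<in> E"
  have "(x \<star> A v + C v) \<star> a = x \<star> (A v * a) + C v \<star> a" by (simp only: rs_add rs_rs)
  then have eq: "v \<star> a = x \<star> (A v * a) + C v \<star> a" using AC[OF v] by simp
  have c: "C v \<star> a \<in> H" using C_H[OF v] H by (simp add: Dsub_cl)
  show "A (v \<star> a) = A v * a" using A_eq[OF c, of "A v * a"] eq by simp
  show "C (v \<star> a) = C v \<star> a" using C_eq[OF c, of "A v * a"] eq by simp
qed

lemma A_H: "y \<in> H \<Longrightarrow> A y = 0" and C_Hid: "y \<in> H \<Longrightarrow> C y = y"
  using A_eq[of y 0] C_eq[of y 0] by (simp_all add: rs_zero)

lemma A_x: "A (x \<star> u) = u" and C_x: "C (x \<star> u) = 0" and A_x1: "A x = 1" and C_x1: "C x = 0"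
  using A_eq[OF Dsub_0[OF H], of u] C_eq[OF Dsub_0[OF H], of u]
    A_eq[OF Dsub_0[OF H], of 1] C_eq[OF Dsub_0[OF H], of 1] by (simp_all add: rs_1)

lemma inE: "y \<in> H \<Longrightarrow> y \<in> E" "y \<in> H \<Longrightarrow> x \<star> u + y \<in> E" "x \<star> u \<in> E"
  using HE E xE by (auto simp: Dsub_cl)

lemma V_End: "M \<in> V \<Longrightarrow> M \<in> End E"
  using tspec_End[OF V] .

lemma M_E: "M \<in> V \<Longrightarrow> v \<in> E \<Longrightarrow> M v \<in> E"
  using End_mem[OF V_End] .

lemma M_dec: "M \<in> V \<Longrightarrow> y \<in> H \<Longrightarrow> M (x \<star> u + y) = M x \<star> u + M y"
  using End_add[OF V_End, of M "x \<star> u" y] End_rs[OF V_End xE, of M u] inE by simp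

lemma A_M: "M \<in> V \<Longrightarrow> y \<in> H \<Longrightarrow> A (M (x \<star> u + y)) = A (M x) * u + A (M y)"
  and C_M: "M \<in> V \<Longrightarrow> y \<in> H \<Longrightarrow> C (M (x \<star> u + y)) = C (M x) \<star> u + C (M y)"
  using M_E[of M x] M_E[of M y] xE inE(1)[of y] E by (simp_all add: M_dec A_add C_add A_rs C_rs Dsub_cl)

lemma surj_c: "c \<in> H \<Longrightarrow> \<exists>M\<in>V. A (M x) = 0 \<and> C (M x) = c"
  using V_surj[of 0 c] A_H[of c] C_Hid[of c] by (auto simp: e_0 rs_zero)

lemma surj_a: "e (p * a) = 0 \<Longrightarrow> \<exists>M\<in>V. A (M x) = a \<and> C (M x) = 0"
  using V_surj[of a 0] Dsub_0[OF H] A_x[of a] C_x[of a] by (metis add_0_right)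

lemma lift_V': "N \<in> V' \<Longrightarrow> \<exists>M\<in>V. M x = 0 \<and> (\<forall>y\<in>H. M y = N y)"
  unfolding V'_eq by auto

lemma Mv: "M \<in> V \<Longrightarrow> M x = 0 \<Longrightarrow> y \<in> H \<Longrightarrow> M (x \<star> u + y) = M y"
  by (simp add: M_dec rs_0)

end

text \<open>Adds the structure (H0, b) that the induction hypothesis gives to V'. Over the division
  ring n is the dimension of H and h that of H0.\<close>

locale induction_step = hyperplane_split F d \<sigma> e rs E H V V' x p A C n
  for F :: "'d :: division_ring set" and d \<sigma> e and rs :: "'v :: ab_group_add \<Rightarrow> 'd \<Rightarrow> 'v" (infixl \<open>\<star>\<close> 75)
    and E H V V' x p A C n +
  fixes H0 :: "'v set" and b :: "'v \<Rightarrow> 'v \<Rightarrow> 'd" and h :: nat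
  assumes st: "structured H H0 b V'" and n: "n \<noteq> 0"
    and H0_dim: "V.fdim (h * d) H0" and B_dim: "O.fdim (bd h) (restr H0 ` V')"
begin

lemmas f = structured_form[OF st]
lemmas H0 = form_on_Dsub[OF f] and H0H = form_on_sub[OF f]
lemmas b_simps = form_add_l[OF f] form_add_r[OF f] form_rs_l[OF f] form_rs_r[OF f]
lemmas b0 = form_on_l[OF f] form_on_r[OF f]

text \<open>Since v = x u + y is not in V v, some F-linear form g has g v = 1 and vanishes on V v.
  On H it kills V' y, which is a full hyperplane, so it is \<beta> times \<open>e (b y _)\<close>;
  on x D it is represented by an element w. The conclusions spell out g (M v) = 0 and g v \<noteq>
  0.\<close>

lemma key_equation:
  assumes y: "y \<in> H" "y \<notin> H0"
  shows "\<exists>w. \<exists>\<beta>\<in>F. (\<forall>M\<in>V. e (w * (A (M x) * u + A (M y))) + \<beta> * (e (b y (C (M x)) * u) + e (b y (C (M y)))) = 0) \<and>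
    e (w * u) + \<beta> * e (b y y) \<noteq> 0"
proof -
  define v where "v = x \<star> u + y"
  have v: "v \<in> E" "v \<noteq> 0"
    using inE(2)[OF y(1)] C_eq[OF y(1), of u] C_Hid[OF Dsub_0[OF H]] y(2) Dsub_0[OF H0] by (auto simp: v_def)
  define im_V where "im_V = (\<lambda>M. M v) ` V"
  have im_V: "V.subsp im_V" "im_V \<subseteq> E" "v \<notin> im_V"
    unfolding im_V_def
    by (rule eval_subsp[OF tspec_subsp[OF V]], rule image_subsetI, rule M_E[OF _ v(1)], assumption, rule tspec_notin[OF V v])
  obtain g where g: "(\<forall>z\<in>E. g z \<in> F) \<and> (\<forall>y\<in>E. \<forall>z\<in>E. g (y + z) = g y + g z) \<and>
    (\<forall>a\<in>F. \<forall>z\<in>E. g (z \<star> a) = a * g z) \<and> (\<forall>z\<in>im_V. g z = 0) \<and> g v = 1"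
    using V.functional_exists[OF E_dim im_V(1,2) v(1) im_V(3)] by (rule exE)
  have g_F: "g z \<in> F" if "z \<in> E" for z using g that by simp
  have g_add: "g (y + z) = g y + g z" if "y \<in> E" "z \<in> E" for y z using g that by simp
  have g_rs: "g (z \<star> a) = a * g z" if "a \<in> F" "z \<in> E" for a z using g that by simp
  have g_M: "g (M v) = 0" if "M \<in> V" for M
  proof -
    have "M v \<in> im_V" unfolding im_V_def using that by (rule imageI)
    then show ?thesis using g by simp
  qed
  have "\<exists>!w. \<forall>a. e (w * a) = g (x \<star> a)"
    using g_add g_rs g_F inE(3) by (intro form_rep) (auto simp: rs_plus rs_F)
  then obtain w where w: "\<And>a. e (w * a) = g (x \<star> a)" by auto
  define q where "q = e (b y y)"
  have q: "q \<noteq> 0" "q \<in> F" using form_on_pos[OF f y] e_F by (auto simp: q_def)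
  define \<beta> where "\<beta> = g y / q"
  have \<beta>: "\<beta> \<in> F" using g_F inE y q F_div by (simp add: \<beta>_def)
  have gH: "g z = \<beta> * e (b y z)" if z: "z \<in> H" for z
  proof -
    define s where "s = e (b y z) / q"
    have s: "s \<in> F" using e_F q F_div by (simp add: s_def)
    have zH: "z - y \<star> s \<in> H" using z y H by (simp add: Dsub_cl)
    have "e (b y (z - y \<star> s)) = e (b y z) - s * q"
      using z y H s by (simp add: form_diff_r[OF f] Dsub_cl b_simps e_diff e_sc_r q_def[symmetric])
    then have "e (b y (z - y \<star> s)) = 0"
      using divide_mult[OF q(1), of "e (b y z)"] by (simp add: s_def)
    then obtain N where "N \<in> V'" "N y = z - y \<star> s"
      using structured_hyperplane[OF H tspec_subsp[OF V'] st y zH] by auto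
    then obtain M where M: "M \<in> V" "M x = 0" "M y = z - y \<star> s" using lift_V'[of N] y(1) by auto
    then have "g (z - y \<star> s) = 0" using g_M[OF M(1)] Mv[OF M(1,2) y(1), of u] by (simp add: v_def)
    then have "g z = s * g y"
      using g_add[of "z - y \<star> s" "y \<star> s"] g_rs[OF s, of y] inE(1)[OF zH] inE(1)[OF y(1)] E by (simp add: Dsub_cl)
    also have "\<dots> = \<beta> * e (b y z)"
      using g_F[OF inE(1)[OF y(1)]] e_F[of "b y z"] q(2) F_inv[OF q(2)] F_comm
      by (simp add: s_def \<beta>_def divide_inverse) (metis F_comm F_mul mult.assoc)
    finally show ?thesis .
  qed
  have gv: "g z = e (w * A z) + \<beta> * e (b y (C z))" if z: "z \<in> E" for z
  proof -
    have "g z = g (x \<star> A z + C z)" using AC[OF z] by simp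
    then show ?thesis using g_add[of "x \<star> A z" "C z"] inE C_H[OF z] w gH by simp
  qed
  have "e (w * (A (M x) * u + A (M y))) + \<beta> * (e (b y (C (M x)) * u) + e (b y (C (M y)))) = 0" if M: "M \<in> V" for M
  proof -
    have "C (M x) \<in> H" "C (M y) \<in> H" using C_H M_E[OF M] xE inE y by auto
    then show ?thesis
      using gv[of "M v"] g_M[OF M] M_E[OF M v(1)] y H
      by (simp add: v_def A_M[OF M y(1)] C_M[OF M y(1)] b_simps Dsub_cl e_add)
  qed
  moreover have "e (w * u) + \<beta> * e (b y y) \<noteq> 0"
    using gv[OF v(1)] g y by (simp add: v_def A_eq C_eq)
  ultimately show ?thesis using \<beta> by (intro exI[of _ w] bexI[of _ \<beta>]) simp_all
qed

end

context quad
begin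

text \<open>Dividing by u on the left amounts to multiplying by \<sigma> u, because the norm of u is
  a scalar of F.\<close>

lemma norm_conj_rep:
  assumes "u \<noteq> 0" "s \<in> F" "u * w = s * p"
  shows "\<exists>r\<in>F. w = r * (\<sigma> u * p) \<and> (s \<noteq> 0 \<longrightarrow> r \<noteq> 0)"
proof -
  define r where "r = s * inverse (\<sigma> u * u)"
  have "w = inverse u * (u * w)" using assms(1) by (simp add: mult.assoc[symmetric])
  also have "\<dots> = s * (inverse u * p)"
    unfolding assms(3) using F_comm[OF assms(2), of "inverse u"] by (simp add: mult.assoc[symmetric])
  also have "\<dots> = r * (\<sigma> u * p)" unfolding inverse_conj[OF assms(1)] r_def by (simp only: mult.assoc)
  finally have "w = r * (\<sigma> u * p)" .
  moreover have "r \<in> F" using assms(2) F_cl norm_F' by (simp add: r_def)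
  moreover have "s \<noteq> 0 \<longrightarrow> r \<noteq> 0" using assms(1) norm_eq_0[of u] by (simp add: r_def)
  ultimately show ?thesis by blast
qed

end

context central_field
begin

lemma F_left_comm: "t \<in> F \<Longrightarrow> z * (t * u) = t * (z * u)"
  using F_comm[of t z] by (simp add: mult.assoc[symmetric])

end

section \<open>The alternative for a single vector y outside H0\<close>

context induction_step
begin

text \<open>Think of a form g with g x z = \<nu> p A z and g y z = w0 A z + b y (C z). At v = x u +
  y the three clauses are the part of \<open>e (g v (M v)) = 0\<close> that is linear in u, its
  constant part, and \<open>e (g v v) \<noteq> 0\<close>. The part quadratic in u vanishes by
  \<open>V_a\<close>.\<close>

definition caseA :: "'v \<Rightarrow> 'd \<Rightarrow> 'd \<Rightarrow> bool" where
  "caseA y \<nu> w0 \<longleftrightarrow> (\<forall>M\<in>V. \<nu> * \<sigma> (p * A (M y)) = - (w0 * A (M x)) - b y (C (M x))) \<and>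
     (\<forall>M\<in>V. e (w0 * A (M y)) + e (b y (C (M y))) = 0) \<and>
     (\<forall>u. e (w0 * u) + \<nu> * (\<sigma> u * u) * e p + e (b y y) \<noteq> 0)"

text \<open>The decoupled alternative, a limit of \<open>caseA\<close> for infinite \<nu>: no M y
  has a component along x.\<close>

definition caseB :: "'v \<Rightarrow> bool" where
  "caseB y \<longleftrightarrow> (\<forall>M\<in>V. A (M y) = 0) \<and> (\<forall>M\<in>V. A (M x) = 0 \<longrightarrow> e (b y (C (M y))) = 0)"

lemma CM: "M \<in> V \<Longrightarrow> y \<in> E \<Longrightarrow> C (M y) \<in> H"
  using C_H M_E by simp

lemma d1_F: "d = 1 \<Longrightarrow> z \<in> F"
  using d_eq_1 by simp

text \<open>The hyperplane \<open>e (p * a) = 0\<close> of a one-dimensional space is zero. For d =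
  1 this makes all A (M x) vanish, the reason for the separate arguments below.\<close>

lemma d1_a: assumes "d = 1" "e (p * a) = 0" shows "a = 0"
proof -
  have "e ((p * a) * y) = 0" for y using e_sc_r[OF d1_F[OF assms(1)], of "p * a" y] assms(2) by simp
  then have "p * a = 0" by (rule e_nondeg)
  then show ?thesis using p0 by simp
qed

text \<open>Here n \<ge> 1 and d \<ge> 2, so F has at least four elements. The third scalar serves
  as an evaluation point for quadratic identities.\<close>

lemma F_elt: assumes "d \<noteq> 1" shows "\<exists>t\<in>F. t \<noteq> 0 \<and> t \<noteq> 1"
proof (rule ccontr)
  assume "\<not> ?thesis"
  then have s: "F \<subseteq> {0, 1}" by auto
  then have "finite F" "card F \<le> 2" using finite_subset[OF s] card_mono[OF _ s] by auto
  then have "Suc n * d \<le> 2" using card by simp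
  moreover have "2 * 2 \<le> Suc n * d" using n assms d_pos by (intro mult_le_mono) auto
  ultimately show False by simp
qed

lemma perp_a: assumes "\<And>M. M \<in> V \<Longrightarrow> e (z * A (M x)) = 0" shows "\<exists>s\<in>F. z = s * p"
proof (rule perp_perp[OF p0])
  fix a assume "e (p * a) = 0"
  then obtain M where "M \<in> V" "A (M x) = a" using surj_a by auto
  then show "e (z * a) = 0" using assms by auto
qed

context  fixes y assumes y: "y \<in> H" "y \<notin> H0"
begin

text \<open>The annihilator, under the pairing of e, of the components A (M y) of the M with A (M x)
  = 0. It turns out to be zero, which leads to \<open>caseA\<close>, or everything, which leads to
  \<open>caseB\<close>.\<close>

definition Zy :: "'d set" where
  "Zy = {w. \<forall>M\<in>V. A (M x) = 0 \<longrightarrow> e (w * A (M y)) = 0}"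

lemma ey: "e (b y y) \<noteq> 0" and by0: "b y y \<noteq> 0"
  using form_on_pos[OF f y] form_on_pos0[OF f y] by auto


text \<open>Among the M with A (M x) = 0 the vector C (M x) is arbitrary in H, and b y y is
  invertible.\<close>

lemma b_nondeg:
  assumes "\<And>M. M \<in> V \<Longrightarrow> A (M x) = 0 \<Longrightarrow> e (b y (C (M x)) * u) = 0" shows "u = 0"
proof (rule e_nondeg_l)
  fix z
  have "y \<star> (inverse (b y y) * z) \<in> H" using y H by (simp add: Dsub_cl)
  then obtain M where M: "M \<in> V" "A (M x) = 0" "C (M x) = y \<star> (inverse (b y y) * z)" using surj_c by auto
  then show "e (z * u) = 0"
    using assms[OF M(1,2)] y by0 by (simp add: b_simps mult.assoc[symmetric])
qed

lemma Zy_subsp: "D.subsp Zy"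
  unfolding D.subsp_def Zy_def by (auto simp: e_0 distrib_right e_add mult.assoc e_sc)

text \<open>The key equation normalised to \<beta> = 1. A solution with \<beta> = 0 is the
  degenerate alternative of the next lemma, and its w lies in \<open>Zy\<close>.\<close>

definition good :: "'d \<Rightarrow> 'd \<Rightarrow> bool" where
  "good u w \<longleftrightarrow> (\<forall>M\<in>V. e (w * (A (M x) * u + A (M y))) + (e (b y (C (M x)) * u) + e (b y (C (M y)))) = 0) \<and>
     e (w * u) + e (b y y) \<noteq> 0"

lemma good_or_degenerate:
  "(\<exists>w. good u w) \<or> (\<exists>w\<in>Zy. (\<forall>M\<in>V. e (w * (A (M x) * u + A (M y))) = 0) \<and> e (w * u) \<noteq> 0)"
proof -
  obtain w \<beta> where \<beta>: "\<beta> \<in> F" and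
    1: "\<And>M. M \<in> V \<Longrightarrow> e (w * (A (M x) * u + A (M y))) + \<beta> * (e (b y (C (M x)) * u) + e (b y (C (M y)))) = 0" and
    2: "e (w * u) + \<beta> * e (b y y) \<noteq> 0"
    using key_equation[OF y, of u] by auto
  show ?thesis
  proof (cases "\<beta> = 0")
    case True
    have w: "e (w * (A (M x) * u + A (M y))) = 0" if "M \<in> V" for M using 1[OF that] True by simp
    have "w \<in> Zy" unfolding Zy_def using w by force
    then show ?thesis using w 2 True by (intro disjI2 bexI[of _ w]) simp_all
  next
    case False
    have i: "inverse \<beta> \<in> F" using \<beta> F_inv by simp
    have c: "inverse \<beta> * (z1 + \<beta> * z2) = inverse \<beta> * z1 + z2" for z1 z2
      using False by (simp add: distrib_left mult.assoc[symmetric])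
    have "good u (inverse \<beta> * w)" unfolding good_def
    proof (intro conjI ballI)
      fix M assume M: "M \<in> V"
      show "e (inverse \<beta> * w * (A (M x) * u + A (M y))) + (e (b y (C (M x)) * u) + e (b y (C (M y)))) = 0"
        using c[of "e (w * (A (M x) * u + A (M y)))" "e (b y (C (M x)) * u) + e (b y (C (M y)))"] 
        unfolding 1[OF M] mult.assoc e_sc[OF i] by simp
    next
      have "inverse \<beta> * (e (w * u) + \<beta> * e (b y y)) \<noteq> 0" using 2 False by simp
      then show "e (inverse \<beta> * w * u) + e (b y y) \<noteq> 0" unfolding c mult.assoc e_sc[OF i] .
    qed
    then show ?thesis by blast
  qed
qed

lemma good_unique:
  assumes "M \<in> V" "A (M x) = 0" "good u w"
  shows "e (w * A (M y)) = - e (b y (C (M x)) * u) - e (b y (C (M y)))"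
  using assms unfolding good_def by (auto simp: eq_neg_iff_add_eq_0 algebra_simps)

text \<open>With \<open>Zy\<close> zero there is no degenerate alternative, and each u has exactly
  one good w. Its dependence on u is F-affine, so that replacing u by t u turns the key equation
  into a quadratic polynomial in t, whose coefficients vanish separately.\<close>

lemma caseA_intro:
  assumes Z: "Zy \<subseteq> {0}"
  shows "\<exists>\<nu>\<in>F. \<exists>w0. \<nu> \<noteq> 0 \<and> caseA y \<nu> w0"
proof -
  have ex: "\<exists>w. good u w" for u using good_or_degenerate[of u] Z by (auto simp: e_0)
  define W where "W = (\<lambda>u. SOME w. good u w)"
  have W: "good u (W u)" for u unfolding W_def using someI_ex[OF ex] .
  define w0 where "w0 = W 0"
  define w1 where "w1 = (\<lambda>u. W u - w0)"
  have w1: "e (w1 u * A (M y)) = - e (b y (C (M x)) * u)" if "M \<in> V" "A (M x) = 0" for M u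
    using good_unique[OF that W[of u]] good_unique[OF that W[of 0]]
    by (simp add: w1_def w0_def left_diff_distrib e_diff e_0)
  have Z0: "w = 0" if "\<And>M. M \<in> V \<Longrightarrow> A (M x) = 0 \<Longrightarrow> e (w * A (M y)) = 0" for w
    using that Z unfolding Zy_def by auto
  have w1_add: "w1 (u + v) = w1 u + w1 v" for u v
  proof -
    have "w1 (u + v) - (w1 u + w1 v) = 0"
      by (rule Z0) (simp add: left_diff_distrib distrib_right distrib_left e_diff e_add w1)
    then show ?thesis by simp
  qed
  have w1_sc: "w1 (t * u) = t * w1 u" if t: "t \<in> F" for t u
  proof -
    have m: "z * (t * u) = t * (z * u)" for z using F_comm[OF t, of z] by (simp add: mult.assoc[symmetric])
    have "w1 (t * u) - t * w1 u = 0"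
      by (rule Z0) (simp add: left_diff_distrib e_diff mult.assoc e_sc[OF t] w1 m)
    then show ?thesis by simp
  qed
  have Wt: "W (t * u) = w0 + t * w1 u" if "t \<in> F" for t u
    using w1_sc[OF that, of u] by (simp add: w1_def algebra_simps)
  \<comment> \<open>The coefficients of the second, first and zeroth power of t.\<close>
  define Q where "Q = (\<lambda>M u. e (w1 u * (A (M x) * u)))"
  define L where "L = (\<lambda>M u. e (w0 * (A (M x) * u)) + e (w1 u * A (M y)) + e (b y (C (M x)) * u))"
  define K where "K = (\<lambda>M. e (w0 * A (M y)) + e (b y (C (M y))))"
  have poly: "t * (t * Q M u) + t * L M u + K M = 0" if M: "M \<in> V" and t: "t \<in> F" for M u t
  proof -
    have s1: "e (w0 * (A (M x) * (t * u))) = t * e (w0 * (A (M x) * u))"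
      by (simp only: F_left_comm[OF t, of "A (M x)"] F_left_comm[OF t, of w0] e_sc[OF t])
    have s2: "e (t * w1 u * (A (M x) * (t * u))) = t * (t * Q M u)"
      by (simp only: F_left_comm[OF t, of "A (M x)"] F_left_comm[OF t, of "w1 u"] mult.assoc e_sc[OF t] Q_def)
    have s3: "e (t * w1 u * A (M y)) = t * e (w1 u * A (M y))" by (simp only: mult.assoc e_sc[OF t])
    have s4: "e (b y (C (M x)) * (t * u)) = t * e (b y (C (M x)) * u)"
      by (simp only: F_left_comm[OF t, of "b y (C (M x))"] e_sc[OF t])
    have "e (W (t * u) * (A (M x) * (t * u) + A (M y))) + (e (b y (C (M x)) * (t * u)) + e (b y (C (M y)))) = 0"
      using bspec[OF conjunct1[OF W[of "t * u", unfolded good_def]] M] .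
    then show ?thesis unfolding Wt[OF t] distrib_left distrib_right e_add s1 s2 s3 s4 L_def K_def
      by (simp only: add.assoc add.commute add.left_commute)
  qed
  have K: "K M = 0" if "M \<in> V" for M using poly[OF that F_0] by simp
  have QL: "Q M u = 0 \<and> L M u = 0" if M: "M \<in> V" for M u
  proof -
    have 1: "Q M u + L M u = 0" using poly[OF M F_1] K[OF M] by simp
    show ?thesis
    \<comment> \<open>A quadratic polynomial is killed by the points 0, 1 and a third one from
      \<open>F_elt\<close>. For d = 1 the third point may be missing, but there Q vanishes because A
      (M x) = 0.\<close>
    proof (cases "d = 1")
      case True
      have "A (M x) = 0" using d1_a[OF True V_a[OF M]] .
      then have "Q M u = 0" by (simp add: Q_def e_0)
      then show ?thesis using 1 by simp
    next
      case False
      then obtain t where t: "t \<in> F" "t \<noteq> 0" "t \<noteq> 1" using F_elt by auto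
      have "t * (t * Q M u + L M u) = 0" using poly[OF M t(1)] K[OF M] by (simp add: distrib_left)
      then have "t * Q M u + L M u = 0" using t by simp
      then have "(t - 1) * Q M u = 0" using 1 by (simp add: left_diff_distrib eq_neg_iff_add_eq_0[symmetric])
      then show ?thesis using t 1 by auto
    qed
  qed
  have rep: "\<exists>s\<in>F. w1 u = s * (\<sigma> u * p)" for u
  proof (cases "u = 0")
    case True
    then show ?thesis using w1_add[of 0 0] F_0 by (intro bexI[of _ 0]) auto
  next
    case False
    \<comment> \<open>Q = 0 says that u * w1 u is orthogonal to all A (M x), which fill the
      hyperplane of p. Hence it is an F-multiple of p, and w1 u one of \<sigma> u * p.\<close>
    have pe: "e (u * w1 u * A (M x)) = 0" if "M \<in> V" for M
      using QL[OF that, of u] e_comm[of u "w1 u * A (M x)"] by (simp add: Q_def mult.assoc)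
    have "\<exists>s\<in>F. u * w1 u = s * p" by (rule perp_a) (rule pe)
    then obtain s where s: "s \<in> F" "u * w1 u = s * p" by (rule bexE)
    show ?thesis using norm_conj_rep[OF False s] by blast
  qed
  have pp: "z * p * inverse p = z" for z using p0 by (simp add: mult.assoc)
  \<comment> \<open>So far the factor depends on u. Composing with \<sigma> and cancelling p gives
    an F-linear map of the division ring for which every element is an eigenvector, so
    \<open>scalar_map\<close> makes the factor uniform.\<close>
  have "\<exists>s\<in>F. \<forall>u\<in>UNIV. w1 (\<sigma> u) * inverse p = s * u"
  proof (rule D.scalar_map)
    show "D.subsp UNIV" by (simp add: D.subsp_def)
    show "w1 (\<sigma> (u + v)) * inverse p = w1 (\<sigma> u) * inverse p + w1 (\<sigma> v) * inverse p" for u v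
      by (simp add: conj_add w1_add distrib_right)
    show "w1 (\<sigma> (a * u)) * inverse p = a * (w1 (\<sigma> u) * inverse p)" if a: "a \<in> F" for a u
      using w1_sc[OF a, of "\<sigma> u"] F_comm[OF a, of "\<sigma> u"] by (simp add: conj_mult conj_F[OF a] mult.assoc)
    show "\<exists>s\<in>F. w1 (\<sigma> u) * inverse p = s * u" for u
    proof -
      obtain s where s: "s \<in> F" "w1 (\<sigma> u) = s * (\<sigma> (\<sigma> u) * p)" using rep[of "\<sigma> u"] by (rule bexE)
      have "w1 (\<sigma> u) * inverse p = s * u"
        unfolding s(2) conj_conj using pp[of u] by (simp add: mult.assoc)
      then show ?thesis using s(1) by (rule bexI)
    qed
  qed
  then obtain \<nu> where \<nu>_F: "\<nu> \<in> F" and \<nu>_eq: "\<forall>u\<in>UNIV. w1 (\<sigma> u) * inverse p = \<nu> * u"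
    by (rule bexE)
  have \<nu>2: "w1 (\<sigma> u) * inverse p = \<nu> * u" for u using \<nu>_eq by (rule bspec) simp
  note \<nu> = \<nu>_F \<nu>2
  have w1_eq: "w1 u = \<nu> * (\<sigma> u * p)" for u
  proof -
    have "w1 u = w1 u * inverse p * p" using p0 by (simp add: mult.assoc)
    also have "w1 u * inverse p = \<nu> * \<sigma> u" using \<nu>(2)[of "\<sigma> u"] by (simp add: conj_conj)
    finally show ?thesis by (simp add: mult.assoc)
  qed
  have "\<nu> \<noteq> 0"
  proof
    assume "\<nu> = 0"
    then have "w1 1 = 0" by (simp add: w1_eq)
    then have b1: "e (b y (C (M x)) * 1) = 0" if "M \<in> V" "A (M x) = 0" for M
      using w1[OF that, of 1] by (simp add: e_0)
    have "(1 :: 'd) = 0" by (rule b_nondeg) (rule b1)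
    then show False by simp
  qed
  moreover have "caseA y \<nu> w0" unfolding caseA_def
  proof (intro conjI ballI allI)
    fix M assume M: "M \<in> V"
    have "e ((w0 * A (M x) + \<nu> * \<sigma> (p * A (M y)) + b y (C (M x))) * u) = 0" for u
    proof -
      have "e (\<sigma> u * p * A (M y)) = e (\<sigma> (p * A (M y)) * u)"
        using e_conj[of "\<sigma> u * (p * A (M y))"] by (simp add: conj_mult conj_conj mult.assoc)
      then have "e (w1 u * A (M y)) = e (\<nu> * \<sigma> (p * A (M y)) * u)"
        by (simp add: w1_eq mult.assoc e_sc[OF \<nu>(1)])
      then show ?thesis using QL[OF M, of u] by (simp add: L_def distrib_right e_add mult.assoc)
    qed
    then have "w0 * A (M x) + \<nu> * \<sigma> (p * A (M y)) + b y (C (M x)) = 0" by (rule e_nondeg)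
    then show "\<nu> * \<sigma> (p * A (M y)) = - (w0 * A (M x)) - b y (C (M x))" 
      by (simp add: eq_diff_eq eq_neg_iff_add_eq_0 algebra_simps)
    show "e (w0 * A (M y)) + e (b y (C (M y))) = 0" using K[OF M] by (simp add: K_def)
  next
    fix u
    have "W u = w0 + \<nu> * (\<sigma> u * p)" using w1_eq[of u] by (simp add: w1_def algebra_simps)
    then show "e (w0 * u) + \<nu> * (\<sigma> u * u) * e p + e (b y y) \<noteq> 0"
      using W[of u] e_norm[of u p] unfolding good_def
      by (simp add: distrib_right e_add mult.assoc e_sc[OF \<nu>(1)])
  qed
  ultimately show ?thesis using \<nu>(1) by blast
qed

text \<open>For u outside this subspace, \<open>good (t * u) w\<close> holds for at most one scalar
  t: two solutions would have a difference that represents the functional of a nonzero multiple of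
  u.\<close>

definition By :: "'d set" where
  "By = {u. \<exists>w. \<forall>M\<in>V. A (M x) = 0 \<longrightarrow> e (w * A (M y)) = e (b y (C (M x)) * u)}"

lemma By_subsp: "D.subsp By"
  unfolding D.subsp_def By_def
proof (intro conjI ballI; clarify?)
  show "\<exists>w. \<forall>M\<in>V. A (M x) = 0 \<longrightarrow> e (w * A (M y)) = e (b y (C (M x)) * 0)"
    by (rule exI[of _ 0]) (simp add: e_0)
next
  fix u v w w'
  assume "\<forall>M\<in>V. A (M x) = 0 \<longrightarrow> e (w * A (M y)) = e (b y (C (M x)) * u)"
    "\<forall>M\<in>V. A (M x) = 0 \<longrightarrow> e (w' * A (M y)) = e (b y (C (M x)) * v)"
  then show "\<exists>w. \<forall>M\<in>V. A (M x) = 0 \<longrightarrow> e (w * A (M y)) = e (b y (C (M x)) * (u + v))"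
    by (intro exI[of _ "w + w'"]) (simp add: distrib_right distrib_left e_add)
next
  fix a u w
  assume a: "a \<in> F" and 1: "\<forall>M\<in>V. A (M x) = 0 \<longrightarrow> e (w * A (M y)) = e (b y (C (M x)) * u)"
  have m: "z * (a * u) = a * (z * u)" for z using F_comm[OF a, of z] by (simp add: mult.assoc[symmetric])
  show "\<exists>w. \<forall>M\<in>V. A (M x) = 0 \<longrightarrow> e (w * A (M y)) = e (b y (C (M x)) * (a * u))"
    using 1 by (intro exI[of _ "a * w"]) (simp add: mult.assoc e_sc[OF a] m)
qed

text \<open>In the relation of \<open>By\<close>, w determines u by \<open>b_nondeg\<close>, and u =
  0 belongs exactly to the w in \<open>Zy\<close>. If every u occurred, the w would form a space of
  dimension d + z inside the d-dimensional division ring.\<close>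

lemma By_proper:
  assumes "D.fdim z Zy" "z \<noteq> 0" shows "By \<noteq> UNIV"
proof
  assume all: "By = UNIV"
  define rel where "rel = (\<lambda>w u. \<forall>M\<in>V. A (M x) = 0 \<longrightarrow> e (w * A (M y)) = e (b y (C (M x)) * u))"
  have By_rel: "By = {u. \<exists>w. rel w u}" unfolding By_def rel_def ..
  have rel_u: "u = v" if "rel w u" "rel w v" for w u v
  proof -
    have "u - v = 0"
    proof (rule b_nondeg)
      fix M assume "M \<in> V" "A (M x) = 0"
      then show "e (b y (C (M x)) * (u - v)) = 0"
        using that unfolding rel_def by (simp add: right_diff_distrib e_diff)
    qed
    then show ?thesis by simp
  qed
  define B where "B = {w. \<exists>u. rel w u}"
  define U where "U = (\<lambda>w. THE u. rel w u)"
  have U_eq: "U w = u" if "rel w u" for w u unfolding U_def using that rel_u by (intro the_equality)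
  have r_add: "rel (w + w') (u + u')" if "rel w u" "rel w' u'" for w w' u u'
    using that unfolding rel_def by (simp add: distrib_right distrib_left e_add)
  have r_sc: "rel (a * w) (a * u)" if a: "a \<in> F" and 1: "rel w u" for a w u
  proof -
    have m: "z * (a * u) = a * (z * u)" for z using F_comm[OF a, of z] by (simp add: mult.assoc[symmetric])
    show ?thesis using 1 unfolding rel_def by (simp add: mult.assoc e_sc[OF a] m)
  qed
  have r0: "rel w 0 \<longleftrightarrow> w \<in> Zy" for w unfolding rel_def Zy_def by (simp add: e_0)
  have sB: "D.subsp B" unfolding D.subsp_def B_def
  proof (intro conjI ballI; (elim CollectE exE)?)
    show "0 \<in> {w. \<exists>u. rel w u}" using r0[of 0] D.subsp_0[OF Zy_subsp] by auto
  next
    fix w w' u u' assume "rel w u" "rel w' u'"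
    then show "w + w' \<in> {w. \<exists>u. rel w u}" using r_add[of w u w' u'] by auto
  next
    fix a w u assume "a \<in> F" "rel w u"
    then show "a * w \<in> {w. \<exists>u. rel w u}" using r_sc[of a w u] by auto
  qed
  obtain m where m: "m \<le> d" "D.fdim m B" using D.fdim_subspace[OF D_dim sB] by blast
  have relU: "rel w (U w)" if "w \<in> B" for w using that U_eq unfolding B_def by auto
  have l: "DD.lin B U" unfolding DD.lin_def
    using U_eq[OF r_add[OF relU relU]] U_eq[OF r_sc[OF _ relU]] by simp
  obtain r k where rk: "D.fdim r (U ` B)" "D.fdim k {w \<in> B. U w = 0}" "m = r + k"
    using DD.fdim_kernel[OF m(2) l] by blast
  have UB: "u \<in> U ` B" for u
  proof -
    have "u \<in> By" using all by simp
    then obtain w where "rel w u" unfolding By_rel by blast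
    then show ?thesis using U_eq[of w u] by (intro image_eqI[of _ _ w]) (auto simp: B_def)
  qed
  have "U ` B = UNIV" using UB by auto
  then have "r = d" using rk(1) D.fdim_unique[OF D_dim] by simp
  moreover have "{w \<in> B. U w = 0} = Zy"
  proof (intro equalityI subsetI)
    fix w assume "w \<in> {w \<in> B. U w = 0}"
    then show "w \<in> Zy" using relU[of w] r0[of w] by simp
  next
    fix w assume "w \<in> Zy"
    then have "rel w 0" using r0 by simp
    then show "w \<in> {w \<in> B. U w = 0}" using U_eq[of w 0] by (auto simp: B_def)
  qed
  then have "k = z" using rk(2) D.fdim_unique[OF assms(1)] by simp
  ultimately show False using m(1) rk(3) assms(2) by simp
qed

text \<open>Fix u outside \<open>By\<close>. Of z + 2 scalars t at most one is good, so at least z +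
  1 are eigenvalues of a pencil on \<open>Zy\<close>, which has dimension z. The pencil is therefore
  singular, and its singular vector is an F-multiple of \<sigma> u * p. These elements, for u off a
  proper subspace, span the division ring.\<close>

lemma Zy_full:
  assumes w: "w \<in> Zy" "w \<noteq> 0" shows "Zy = UNIV"
proof (cases "d = 1")
  case True
  have "v \<in> Zy" for v
    using D.subsp_sc[OF Zy_subsp d1_F[OF True] w(1), of "v * inverse w"] w(2) by (simp add: mult.assoc)
  then show ?thesis by blast
next
  case False
  obtain z where z: "z \<le> d" "D.fdim z Zy" using D.fdim_subspace[OF D_dim Zy_subsp] by blast
  have "z \<noteq> 0"
  proof
    assume "z = 0"
    then have "Zy = {0}" using z D.fdim_0D by simp
    then show False using w by simp
  qed
  then obtain u0 where u0: "u0 \<notin> By" using By_proper[OF z(2)] by auto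
  have key: "\<sigma> u * p \<in> Zy" if u: "u \<notin> By" for u
  proof -
    have un0: "u \<noteq> 0" using u D.subsp_0[OF By_subsp] by auto
    have one: "t = t'" if t: "t \<in> F" "t' \<in> F" "good (t * u) w" "good (t' * u) w'" for t t' w w'
    proof (rule ccontr)
      assume ne: "t \<noteq> t'"
      have tt: "t' - t \<in> F" using t F_diff by simp
      have "e ((w - w') * A (M y)) = e (b y (C (M x)) * ((t' - t) * u))" if M: "M \<in> V" "A (M x) = 0" for M
        using good_unique[OF M t(3)] good_unique[OF M t(4)]
        by (simp add: left_diff_distrib right_diff_distrib e_diff)
      then have "(t' - t) * u \<in> By" unfolding By_def by blast
      then have "inverse (t' - t) * ((t' - t) * u) \<in> By" using D.subsp_sc[OF By_subsp F_inv[OF tt]] by simp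
      then show False using u ne by (simp add: mult.assoc[symmetric])
    qed
    obtain I0 where I0: "I0 \<subseteq> F" "finite I0" "card I0 = z + 2"
    proof (cases "finite F")
      case True
      \<comment> \<open>From z \<le> d and d \<ge> 2 follows z + 2 \<le> 2 * d, and n \<noteq> 0
        puts this within the bound on F.\<close>
      have "2 * d \<le> Suc n * d" using n by (intro mult_le_mono1) simp
      then have "z + 2 \<le> card F" using card True z(1) False d_pos by linarith
      then show ?thesis using that obtain_subset_with_card_n[of "z + 2" F] by auto
    next
      case False
      then show ?thesis using infinite_arbitrarily_large[of F "z + 2"] that by blast
    qed
    define I where "I = {t \<in> I0. \<not> (\<exists>w. good (t * u) w)}"
    have same: "t = t'" if t: "t \<in> I0 - I" "t' \<in> I0 - I" for t t'
    proof -
      obtain w w' where "good (t * u) w" "good (t' * u) w'" using t unfolding I_def by auto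
      then show ?thesis using one t I0(1) by (meson DiffD1 subsetD)
    qed
    have fin: "finite (I0 - I)" using I0(2) by simp
    have "card (I0 - I) \<le> Suc 0" using same unfolding card_le_Suc0_iff_eq[OF fin] by blast
    moreover have "card (I0 - I) = card I0 - card I"
      using I0(2) unfolding I_def by (intro card_Diff_subset) auto
    ultimately have cI: "card I > z" using I0(3) by simp
    have I: "I \<subseteq> F" "finite I" using I0 unfolding I_def by auto
    define Rel where "Rel = (\<lambda>w w'. \<forall>M\<in>V. e (w' * (A (M x) * u)) = - e (w * A (M y)))"
    have ev: "\<exists>w. w \<in> Zy \<and> w \<noteq> 0 \<and> Rel w (t * w)" if t: "t \<in> I" for t
    proof -
      have tF: "t \<in> F" using t I by blast
      have ng: "\<not> (\<exists>w. good (t * u) w)" using t by (simp add: I_def)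
      have "\<exists>w\<in>Zy. (\<forall>M\<in>V. e (w * (A (M x) * (t * u) + A (M y))) = 0) \<and> e (w * (t * u)) \<noteq> 0"
        using good_or_degenerate[of "t * u"] ng by (simp only: simp_thms)
      then obtain w where w: "w \<in> Zy" "\<forall>M\<in>V. e (w * (A (M x) * (t * u) + A (M y))) = 0" "e (w * (t * u)) \<noteq> 0"
        by (elim bexE conjE) (rule that)
      have m: "w * (A (M x) * (t * u)) = t * w * (A (M x) * u)" for M
        by (simp only: F_left_comm[OF tF] mult.assoc)
      have "Rel w (t * w)" unfolding Rel_def
      proof
        fix M assume "M \<in> V"
        from bspec[OF w(2) this] show "e (t * w * (A (M x) * u)) = - e (w * A (M y))"
          unfolding distrib_left e_add m by (simp only: eq_neg_iff_add_eq_0)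
      qed
      moreover have "w \<noteq> 0" using w(3) e_0 by auto
      ultimately show ?thesis using w(1) by blast
    qed
    define wt where "wt = (\<lambda>t. SOME w. w \<in> Zy \<and> w \<noteq> 0 \<and> Rel w (t * w))"
    have wt: "wt t \<in> Zy \<and> wt t \<noteq> 0 \<and> Rel (wt t) (t * wt t)" if "t \<in> I" for t
      unfolding wt_def using someI_ex[OF ev[OF that]] .
    have "\<exists>w\<in>Zy. w \<noteq> 0 \<and> Rel 0 w"
    proof (rule ccontr)
      assume no: "\<not> ?thesis"
      have "card I \<le> z"
      proof (rule D.pencil[OF I(2,1) z(2), of Rel wt])
        show "Rel 0 0" by (simp add: Rel_def e_0)
        show "Rel (v + v') (w + w')" if "Rel v w" "Rel v' w'" for v w v' w'
          using that unfolding Rel_def by (simp add: distrib_right e_add)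
        show "Rel (a * v) (a * w)" if "a \<in> F" "Rel v w" for v w a
          using that unfolding Rel_def by (simp add: mult.assoc e_sc)
        show "wt t \<in> Zy \<and> wt t \<noteq> 0 \<and> Rel (wt t) (t * wt t)" if "t \<in> I" for t using wt[OF that] .
        show "v = 0" if "v \<in> Zy" "Rel 0 v" for v using no that by blast
      qed
      then show False using cI by simp
    qed
    then obtain w where w: "w \<in> Zy" "w \<noteq> 0" "Rel 0 w" by blast
    have pe: "e (u * w * A (M x)) = 0" if "M \<in> V" for M
      using w(3) that e_comm[of u "w * A (M x)"] unfolding Rel_def by (simp add: e_0 mult.assoc)
    have "\<exists>s\<in>F. u * w = s * p" by (rule perp_a) (rule pe)
    then obtain s where s: "s \<in> F" "u * w = s * p" by (rule bexE)
    have "s \<noteq> 0" using s(2) un0 w(2) by auto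
    then obtain r where r: "r \<in> F" "w = r * (\<sigma> u * p)" "r \<noteq> 0" using norm_conj_rep[OF un0 s] by blast
    have "\<sigma> u * p = inverse r * w" using r by (simp add: mult.assoc[symmetric])
    then show ?thesis using D.subsp_sc[OF Zy_subsp F_inv[OF r(1)] w(1)] by simp
  qed
  have key': "\<sigma> u * p \<in> Zy" for u
  proof (cases "u \<in> By")
    case True
    \<comment> \<open>An element of \<open>By\<close> is a difference of two elements outside
      it.\<close>
    have "u + u0 \<notin> By" using D.subsp_diff[OF By_subsp _ True, of "u + u0"] u0 by auto
    then have "\<sigma> (u + u0) * p - \<sigma> u0 * p \<in> Zy" using D.subsp_diff[OF Zy_subsp key key[OF u0]] by blast
    then show ?thesis by (simp add: conj_add distrib_right)
  qed (rule key)
  have "v \<in> Zy" for v using key'[of "\<sigma> (v * inverse p)"] p0 by (simp add: conj_conj mult.assoc)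
  then show ?thesis by blast
qed

lemma caseB_intro:
  assumes Z: "Zy = UNIV" shows "caseB y"
proof -
  have l0: "A (M y) = 0" if "M \<in> V" "A (M x) = 0" for M
  proof (rule e_nondeg_l)
    fix w
    have "w \<in> Zy" using Z by simp
    then show "e (w * A (M y)) = 0" using that unfolding Zy_def by blast
  qed
  have k0: "e (b y (C (M y))) = 0" if M: "M \<in> V" "A (M x) = 0" for M
    using good_or_degenerate[of 0] M l0[OF M] unfolding good_def by (auto simp: e_0)
  have "A (M y) = 0" if M: "M \<in> V" for M
  proof (rule ccontr)
    assume l: "A (M y) \<noteq> 0"
    have a1: "1 - A (M x) \<noteq> 0" using V_a[OF M] ep by auto
    \<comment> \<open>This u solves A (M x) * u + A (M y) = u, so the degenerate alternative would
      make \<open>e (w * u)\<close> both zero and nonzero. The inverse exists because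
      \<open>e (p * A (M x)) = 0\<close> and e p \<noteq> 0. A good w is ruled out by
      \<open>b_nondeg\<close>.\<close>
    define u where "u = inverse (1 - A (M x)) * A (M y)"
    have u0: "u \<noteq> 0" using l a1 by (simp add: u_def)
    have "(1 - A (M x)) * u = A (M y)" using a1 by (simp add: u_def mult.assoc[symmetric])
    then have ueq: "A (M x) * u + A (M y) = u" by (simp add: left_diff_distrib algebra_simps)
    have "\<not> good u w" for w
    proof
      assume g: "good u w"
      have bu: "e (b y (C (N x)) * u) = 0" if "N \<in> V" "A (N x) = 0" for N
        using good_unique[OF that g] l0[OF that] k0[OF that] by (simp add: e_0)
      have "u = 0" by (rule b_nondeg) (rule bu)
      then show False using u0 by simp
    qed
    then show False using good_or_degenerate[of u] M ueq by auto
  qed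
  then show ?thesis unfolding caseB_def using k0 by blast
qed

lemma dichotomy: "caseB y \<or> (\<exists>\<nu>\<in>F. \<exists>w0. \<nu> \<noteq> 0 \<and> caseA y \<nu> w0)"
  using caseA_intro caseB_intro Zy_full by blast

end

end

section \<open>The alternative does not depend on y\<close>

context induction_step
begin

lemma AM_add: "M \<in> V \<Longrightarrow> y \<in> H \<Longrightarrow> z \<in> H \<Longrightarrow> A (M (y + z)) = A (M y) + A (M z)"
  and CM_add: "M \<in> V \<Longrightarrow> y \<in> H \<Longrightarrow> z \<in> H \<Longrightarrow> C (M (y + z)) = C (M y) + C (M z)"
  using End_add[OF V_End, of M y z] inE M_E[of M y] M_E[of M z] by (simp_all add: A_add C_add)

lemma AM_rs: "M \<in> V \<Longrightarrow> y \<in> H \<Longrightarrow> A (M (y \<star> s)) = A (M y) * s"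
  and CM_rs: "M \<in> V \<Longrightarrow> y \<in> H \<Longrightarrow> C (M (y \<star> s)) = C (M y) \<star> s"
  using End_rs[OF V_End, of M y s] inE M_E[of M y] by (simp_all add: A_rs C_rs)

lemma H0_in: "z \<in> H0 \<Longrightarrow> z \<in> H" using H0H by blast

lemma add_H0: "y \<in> H \<Longrightarrow> z \<in> H0 \<Longrightarrow> y + z \<in> H"
  "y \<notin> H0 \<Longrightarrow> z \<in> H0 \<Longrightarrow> y + z \<notin> H0"
  using Dsub_add[OF H] H0_in Dsub_diff[OF H0, of "y + z" z] by auto

lemma b_add_H0: "y \<in> H \<Longrightarrow> z \<in> H0 \<Longrightarrow> v \<in> H \<Longrightarrow> b (y + z) v = b y v"
  using b0(1)[of z v] H0_in[of z] by (simp add: b_simps)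

lemma b_add_H0_self: "y \<in> H \<Longrightarrow> z \<in> H0 \<Longrightarrow> b (y + z) (y + z) = b y y"
  using b0(2)[of z y] H0_in[of z] add_H0(1)[of y z] by (simp add: b_add_H0 b_simps)

lemma caseA_1: "caseA y \<nu> w0 \<Longrightarrow> M \<in> V \<Longrightarrow> \<nu> * \<sigma> (p * A (M y)) = - (w0 * A (M x)) - b y (C (M x))"
  and caseA_2: "caseA y \<nu> w0 \<Longrightarrow> M \<in> V \<Longrightarrow> e (w0 * A (M y)) + e (b y (C (M y))) = 0"
  and caseA_3: "caseA y \<nu> w0 \<Longrightarrow> e (w0 * u) + \<nu> * (\<sigma> u * u) * e p + e (b y y) \<noteq> 0"
  unfolding caseA_def by auto

text \<open>Puts both alternatives on one scale: \<mu> is 0 in \<open>caseB\<close> and - inverse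
  \<nu> in \<open>caseA\<close>. Constancy of \<mu> then settles the choice of the alternative and
  the value of \<nu> together.\<close>

definition ratio :: "'v \<Rightarrow> 'd \<Rightarrow> bool" where
  "ratio y \<mu> \<longleftrightarrow> (\<forall>M\<in>V. A (M x) = 0 \<longrightarrow> p * A (M y) = \<mu> * \<sigma> (b y (C (M x))))"

lemma ratioD: "ratio y \<mu> \<Longrightarrow> M \<in> V \<Longrightarrow> A (M x) = 0 \<Longrightarrow> p * A (M y) = \<mu> * \<sigma> (b y (C (M x)))"
  unfolding ratio_def by simp

lemma ratio_B: "caseB y \<Longrightarrow> ratio y 0"
  unfolding caseB_def ratio_def by simp

lemma ratio_A: assumes "caseA y \<nu> w0" "\<nu> \<in> F" "\<nu> \<noteq> 0" shows "ratio y (- inverse \<nu>)"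
  unfolding ratio_def
proof (intro ballI impI)
  fix M assume M: "M \<in> V" "A (M x) = 0"
  have "\<nu> * \<sigma> (p * A (M y)) = - b y (C (M x))" using assms(1) M unfolding caseA_def by simp
  then have "\<sigma> (\<nu> * \<sigma> (p * A (M y))) = - \<sigma> (b y (C (M x)))" by (simp add: conj_neg)
  then have "p * A (M y) * \<nu> = - \<sigma> (b y (C (M x)))"
    by (simp only: conj_mult[of \<nu>] conj_conj conj_F[OF assms(2)])
  then have "\<nu> * (p * A (M y)) = - \<sigma> (b y (C (M x)))" by (simp only: F_comm[OF assms(2)])
  then have "inverse \<nu> * (\<nu> * (p * A (M y))) = inverse \<nu> * (- \<sigma> (b y (C (M x))))" by (simp only:)
  then show "p * A (M y) = - inverse \<nu> * \<sigma> (b y (C (M x)))"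
    using assms(3) by (simp add: mult.assoc[symmetric])
qed

lemma ratio_unique:
  assumes y: "y \<in> H" "y \<notin> H0" and r: "ratio y \<mu>" "ratio y \<mu>'" shows "\<mu> = \<mu>'"
proof -
  obtain M where M: "M \<in> V" "A (M x) = 0" "C (M x) = y" using surj_c[OF y(1)] by auto
  have "\<mu> * \<sigma> (b y y) = \<mu>' * \<sigma> (b y y)"
    unfolding ratioD[OF r(1) M(1,2), unfolded M(3), symmetric] ratioD[OF r(2) M(1,2), unfolded M(3), symmetric] ..
  moreover have "\<sigma> (b y y) \<noteq> 0" using by0[OF y] conj_eq_0 by simp
  ultimately show ?thesis by simp
qed

lemma ratio_exists:
  assumes y: "y \<in> H" "y \<notin> H0" shows "\<exists>\<mu>\<in>F. ratio y \<mu>"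
  using dichotomy[OF y]
proof
  assume "caseB y"
  then show ?thesis using ratio_B F_0 by blast
next
  assume "\<exists>\<nu>\<in>F. \<exists>w0. \<nu> \<noteq> 0 \<and> caseA y \<nu> w0"
  then obtain \<nu> w0 where *: "\<nu> \<in> F" "\<nu> \<noteq> 0" "caseA y \<nu> w0" by blast
  show ?thesis using ratio_A[OF *(3,1,2)] F_neg[OF F_inv[OF *(1)]] by blast
qed

lemma ratio_rs: assumes "y \<in> H" "ratio y \<mu>" shows "ratio (y \<star> s) \<mu>"
  unfolding ratio_def
proof (intro ballI impI)
  fix M assume M: "M \<in> V" "A (M x) = 0"
  have "p * A (M (y \<star> s)) = p * A (M y) * s" using AM_rs[OF M(1) assms(1)] by (simp add: mult.assoc)
  also have "\<dots> = \<mu> * \<sigma> (b y (C (M x))) * s" using ratioD[OF assms(2) M] by simp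
  also have "\<dots> = \<mu> * \<sigma> (b (y \<star> s) (C (M x)))"
    using assms(1) CM[OF M(1) xE] by (simp add: b_simps conj_mult conj_conj mult.assoc)
  finally show "p * A (M (y \<star> s)) = \<mu> * \<sigma> (b (y \<star> s) (C (M x)))" .
qed

text \<open>The defining equation is additive in y. Comparing y, y' and y + y' puts the vector z,
  with coefficients \<eta> - \<mu> and \<eta> - \<mu>', into the left radical of b, which is H0.
  Independence modulo H0 makes both coefficients zero.\<close>

lemma ratio_indep:
  assumes y: "y \<in> H" "y \<notin> H0" and y': "y' \<in> H" "y' \<notin> H0"
    and ind: "\<And>s. s \<in> F \<Longrightarrow> y' - y \<star> s \<notin> H0"
    and r: "ratio y \<mu>" "\<mu> \<in> F" "ratio y' \<mu>'" "\<mu>' \<in> F"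
  shows "\<mu> = \<mu>'"
proof -
  have yy: "y + y' \<in> H" using y y' H by (simp add: Dsub_add)
  have "y + y' \<notin> H0" using ind[OF F_neg[OF F_1]] by (simp add: rs_minus rs_1 add.commute)
  then obtain \<eta> where \<eta>: "\<eta> \<in> F" "ratio (y + y') \<eta>" using ratio_exists[OF yy] by blast
  define z where "z = y \<star> (\<eta> - \<mu>) + y' \<star> (\<eta> - \<mu>')"
  have F': "\<eta> - \<mu> \<in> F" "\<eta> - \<mu>' \<in> F" using \<eta> r F_diff by auto
  have zH: "z \<in> H" using y y' H by (simp add: z_def Dsub_cl)
  have "b z c = 0" if c: "c \<in> H" for c
  proof -
    obtain M where M: "M \<in> V" "A (M x) = 0" "C (M x) = c" using surj_c[OF c] by auto
    have "\<eta> * \<sigma> (b (y + y') c) = \<mu> * \<sigma> (b y c) + \<mu>' * \<sigma> (b y' c)"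
      using ratioD[OF \<eta>(2) M(1,2)] ratioD[OF r(1) M(1,2)] ratioD[OF r(3) M(1,2)]
      by (simp add: M(3) AM_add[OF M(1) y(1) y'(1)] distrib_left)
    then have "\<eta> * \<sigma> (b y c) + \<eta> * \<sigma> (b y' c) = \<mu> * \<sigma> (b y c) + \<mu>' * \<sigma> (b y' c)"
      using y y' c by (simp add: b_simps conj_add distrib_left)
    then have "(\<eta> - \<mu>) * \<sigma> (b y c) + (\<eta> - \<mu>') * \<sigma> (b y' c) = 0"
      by (simp add: left_diff_distrib algebra_simps)
    moreover have "\<sigma> (b z c) = (\<eta> - \<mu>) * \<sigma> (b y c) + (\<eta> - \<mu>') * \<sigma> (b y' c)"
      using y y' c H F_comm[OF F'(1), of "\<sigma> (b y c)"] F_comm[OF F'(2), of "\<sigma> (b y' c)"]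
      by (simp add: z_def b_simps Dsub_cl conj_add conj_mult conj_conj)
    ultimately show ?thesis using conj_eq_0[of "b z c"] by simp
  qed
  then have zH0: "z \<in> H0" using form_left_ker[OF f zH] zH by simp
  have "\<eta> = \<mu>'"
  proof (rule ccontr)
    assume ne: "\<eta> \<noteq> \<mu>'"
    define i where "i = inverse (\<eta> - \<mu>')"
    have i: "i \<in> F" using F' F_inv by (simp add: i_def)
    have "z \<star> i = y \<star> ((\<eta> - \<mu>) * i) + y' \<star> ((\<eta> - \<mu>') * i)" by (simp add: z_def rs_add rs_rs)
    also have "(\<eta> - \<mu>') * i = 1" using ne by (simp add: i_def)
    finally have "z \<star> i = y' - y \<star> (- ((\<eta> - \<mu>) * i))" by (simp add: rs_1 rs_minus add.commute)
    moreover have "- ((\<eta> - \<mu>) * i) \<in> F" using F' i F_cl by simp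
    ultimately show False using ind Dsub_rs[OF H0 zH0, of i] by metis
  qed
  moreover have "\<eta> = \<mu>"
  proof (rule ccontr)
    assume ne: "\<eta> \<noteq> \<mu>"
    have "y \<star> (\<eta> - \<mu>) \<in> H0" using zH0 \<open>\<eta> = \<mu>'\<close> by (simp add: z_def rs_zero)
    then show False using Dsub_rs_iff[OF H0, of "\<eta> - \<mu>" y] ne y by simp
  qed
  ultimately show ?thesis by simp
qed

lemma F_elt': assumes "d = 1 \<Longrightarrow> n \<noteq> 1" shows "\<exists>t\<in>F. t \<noteq> 0 \<and> t \<noteq> 1"
proof (cases "d = 1")
  case True
  show ?thesis
  proof (rule ccontr)
    assume "\<not> ?thesis"
    then have s: "F \<subseteq> {0, 1}" by auto
    then have "finite F" "card F \<le> 2" using finite_subset[OF s] card_mono[OF _ s] by auto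
    then show False using card True assms n by auto
  qed
qed (rule F_elt)

lemma d1_line: assumes "d = 1" "n = 1" "y \<in> H" "y \<noteq> 0" "z \<in> H" shows "\<exists>s\<in>F. z = y \<star> s"
proof -
  have "V.fdim 1 (V.ext y {0})" using V.fdim_Suc[OF _ V.fdim_0, of y] assms(4) by simp
  moreover have "V.ext y {0} \<subseteq> H"
    using V.ext_sub[OF Dsub_subsp[OF H], of "{0}" y] assms(3) Dsub_0[OF H] by simp
  moreover have "V.fdim 1 H" using H_dim assms by simp
  ultimately have "V.ext y {0} = H" using V.fdim_eq by blast
  then have "z \<in> V.ext y {0}" using assms(5) by simp
  then obtain a w where "a \<in> F" "w \<in> {0}" "z = y \<star> a + w" by (rule V.extE)
  then show ?thesis by auto
qed

text \<open>If the ratio changed from y to y + g, it would be affine along the line y + g t and take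
  every value in F. The cross term w0 then turns out to be the same at all points with nonzero
  ratio, and the nonisotropy clause of \<open>caseA\<close> fails for a suitable t.\<close>

lemma ratio_special:
  assumes d1: "d = 1" and y: "y \<in> H" "y \<notin> H0" and g: "g \<in> H0"
    and r: "ratio y \<mu>" "ratio (y + g) \<mu>'"
  shows "\<mu> = \<mu>'"
proof (rule ccontr)
  assume ne: "\<mu> \<noteq> \<mu>'"
  have FF: "z \<in> F" for z using d1_F[OF d1] .
  have cm: "a * b = b * a" for a b :: 'd using F_comm[OF FF] .
  have lc: "a * (b * c) = b * (a * c)" for a b c :: 'd using F_left_comm[OF FF] .
  have gH: "g \<in> H" using H0_in g .
  have g0: "g \<noteq> 0" using ratio_unique[OF y r(1)] r(2) ne by auto
  \<comment> \<open>H contains g \<noteq> 0 inside H0 and y outside, so it is not a line. Hence F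
    has more than two elements.\<close>
  have n1: "n \<noteq> 1"
  proof
    assume "n = 1"
    then obtain s where "y = g \<star> s" using d1_line[OF d1 _ gH g0 y(1)] by blast
    then show False using y(2) Dsub_rs[OF H0 g] by simp
  qed
  obtain rr :: 'd where rr: "rr \<noteq> 0" "rr \<noteq> 1" using F_elt' n1 by blast
  define \<delta> where "\<delta> = \<mu>' - \<mu>"
  have \<delta>: "\<delta> \<noteq> 0" using ne by (simp add: \<delta>_def)
  have aff: "ratio (y + g \<star> t) (\<mu> + t * \<delta>)" for t
    unfolding ratio_def
  proof (intro ballI impI)
    fix M assume M: "M \<in> V" "A (M x) = 0"
    have c: "C (M x) \<in> H" using CM[OF M(1) xE] .
    define B where "B = \<sigma> (b y (C (M x)))"
    have "p * A (M (y + g)) = \<mu>' * B" using ratioD[OF r(2) M] b_add_H0[OF y(1) g c] by (simp add: B_def)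
    then have 1: "p * A (M g) = \<delta> * B"
      using ratioD[OF r(1) M] unfolding AM_add[OF M(1) y(1) gH] distrib_left \<delta>_def left_diff_distrib B_def
      by (simp add: eq_diff_eq add.commute)
    have "p * A (M (y + g \<star> t)) = p * A (M y) + p * A (M g) * t"
      using AM_add[OF M(1) y(1) Dsub_rs[OF H gH, of t]] AM_rs[OF M(1) gH] by (simp add: distrib_left mult.assoc)
    also have "\<dots> = (\<mu> + t * \<delta>) * B" unfolding 1 using ratioD[OF r(1) M]
      by (simp add: B_def distrib_right) (simp add: cm[of _ t] mult.assoc)
    also have "B = \<sigma> (b (y + g \<star> t) (C (M x)))"
      using b_add_H0[OF y(1) Dsub_rs[OF H0 g, of t] c] by (simp add: B_def)
    finally show "p * A (M (y + g \<star> t)) = (\<mu> + t * \<delta>) * \<sigma> (b (y + g \<star> t) (C (M x)))" .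
  qed
  \<comment> \<open>Reparametrise the line so that the ratio at parameter t is t: decoupled at t =
    0, and \<open>caseA\<close> with \<nu> = - inverse t elsewhere.\<close>
  define t0 where "t0 = - (\<mu> * inverse \<delta>)"
  define y0 where "y0 = y + g \<star> t0"
  define g1 where "g1 = g \<star> inverse \<delta>"
  have g1: "g1 \<in> H0" "g1 \<in> H" using g gH Dsub_rs H0 H by (auto simp: g1_def)
  have y0: "y0 \<in> H" "y0 \<notin> H0" using add_H0 y Dsub_rs[OF H0 g, of t0] by (auto simp: y0_def)
  have line: "ratio (y0 + g1 \<star> t) t" for t
  proof -
    have "y0 + g1 \<star> t = y + g \<star> (t0 + inverse \<delta> * t)" by (simp add: y0_def g1_def rs_simps add.assoc)
    moreover have "t0 * \<delta> = - \<mu>" using \<delta> by (simp add: t0_def mult.assoc)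
    moreover have "inverse \<delta> * t * \<delta> = t" using \<delta> cm[of "inverse \<delta>" t] by (simp add: mult.assoc)
    ultimately have "\<mu> + (t0 + inverse \<delta> * t) * \<delta> = t" "y0 + g1 \<star> t = y + g \<star> (t0 + inverse \<delta> * t)"
      by (simp_all add: distrib_right)
    then show ?thesis using aff[of "t0 + inverse \<delta> * t"] by simp
  qed
  have r0: "ratio y0 0" using line[of 0] by (simp add: rs_zero)
  have B0: "caseB y0"
    using dichotomy[OF y0]
  proof
    assume "\<exists>\<nu>\<in>F. \<exists>w0. \<nu> \<noteq> 0 \<and> caseA y0 \<nu> w0"
    then obtain \<nu> w0 where *: "\<nu> \<in> F" "\<nu> \<noteq> 0" "caseA y0 \<nu> w0" by blast
    then have "- inverse \<nu> = 0" using ratio_unique[OF y0 ratio_A[OF *(3,1,2)] r0] by blast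
    then show ?thesis using *(2) by simp
  qed
  define q where "q = b y0 y0"
  have q: "q \<noteq> 0" using by0[OF y0] by (simp add: q_def)
  \<comment> \<open>A test operator with b y0 (C (M1 x)) = 1. Inserted in the second clause of
    \<open>caseA\<close> it gives w0 = - gg * p for every t \<noteq> 0.\<close>
  obtain M1 where M1: "M1 \<in> V" "A (M1 x) = 0" "C (M1 x) = y0 \<star> inverse q"
    using surj_c[OF Dsub_rs[OF H y0(1), of "inverse q"]] by auto
  define \<gamma> where "\<gamma> = e (b y0 (C (M1 g1)))"
  have e1: "e z = z * e 1" for z using e_sc[OF FF, of z 1] by simp
  have e1n: "e 1 \<noteq> 0" using ep e1[of p] by auto
  define gg where "gg = \<gamma> * inverse (e 1)"
  have contra: "- (gg * p * u) - inverse t * (u * u * p) + q \<noteq> 0" if t: "t \<noteq> 0" for t u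
  proof -
    define yt where "yt = y0 + g1 \<star> t"
    have gt: "g1 \<star> t \<in> H0" "g1 \<star> t \<in> H" using g1 Dsub_rs H0 H by auto
    have yt: "yt \<in> H" "yt \<notin> H0" using add_H0 y0 gt(1) by (auto simp: yt_def)
    have rt: "ratio yt t" using line by (simp add: yt_def)
    have "\<not> caseB yt" using ratio_unique[OF yt rt ratio_B] t by blast
    then obtain \<nu> w0 where *: "\<nu> \<in> F" "\<nu> \<noteq> 0" "caseA yt \<nu> w0" using dichotomy[OF yt] by blast
    have "- inverse \<nu> = t" using ratio_unique[OF yt ratio_A[OF *(3,1,2)] rt] .
    then have \<nu>: "\<nu> = - inverse t" by (simp add: \<open>- inverse \<nu> = t\<close>[symmetric])
    have bt: "b yt z = b y0 z" if "z \<in> H" for z using b_add_H0[OF y0(1) gt(1) that] by (simp add: yt_def)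
    have "b y0 (C (M1 x)) = 1" unfolding M1(3) using y0 q by (simp add: b_simps q_def[symmetric])
    then have "p * A (M1 yt) = t"
      using ratioD[OF rt M1(1,2)] bt[OF CM[OF M1(1) xE]] by (simp add: conj_1)
    then have At: "A (M1 yt) = inverse p * t" using p0 
    proof -
      have "inverse p * (p * A (M1 yt)) = inverse p * t" using \<open>p * A (M1 yt) = t\<close> by simp
      then show ?thesis using p0 by (simp add: mult.assoc[symmetric])
    qed
    have "C (M1 yt) = C (M1 y0) + C (M1 g1) \<star> t"
      unfolding yt_def CM_add[OF M1(1) y0(1) gt(2)] CM_rs[OF M1(1) g1(2)] ..
    moreover have "C (M1 y0) \<in> H" "C (M1 g1) \<in> H" using CM[OF M1(1)] inE y0 g1 by auto
    ultimately have "e (b yt (C (M1 yt))) = e (b y0 (C (M1 y0))) + e (b y0 (C (M1 g1)) * t)"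
      using bt[OF CM[OF M1(1) inE(1)[OF yt(1)]]] y0 H by (simp add: b_simps Dsub_cl e_add)
    also have "e (b y0 (C (M1 y0))) = 0" using B0 M1 unfolding caseB_def by simp
    also have "e (b y0 (C (M1 g1)) * t) = t * \<gamma>" using e_sc_r[OF FF] by (simp add: \<gamma>_def)
    finally have "e (w0 * A (M1 yt)) + t * \<gamma> = 0" using caseA_2[OF *(3) M1(1)] by simp
    then have "t * (e (w0 * inverse p) + \<gamma>) = 0"
      unfolding At using e_sc_r[OF FF, of "w0 * inverse p" t] by (simp add: mult.assoc distrib_left)
    then have "e (w0 * inverse p) = - \<gamma>" using t by (simp add: eq_neg_iff_add_eq_0)
    then have "w0 * inverse p * e 1 = - \<gamma>" unfolding e1[of "w0 * inverse p"] .
    then have "w0 * inverse p * (e 1 * inverse (e 1)) = - gg"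
      unfolding gg_def mult.assoc[symmetric] by simp
    then have "w0 * inverse p = - gg" using e1n by simp
    then have "w0 * (inverse p * p) = - gg * p" by (simp only: mult.assoc[symmetric])
    then have w0: "w0 = - gg * p" using p0 by simp
    have "e (w0 * u) + \<nu> * (\<sigma> u * u) * e p + e (b yt yt) \<noteq> 0" using *(3) unfolding caseA_def by simp
    moreover have "b yt yt = q" using b_add_H0_self[OF y0(1) gt(1)] by (simp add: yt_def q_def)
    moreover have "e (w0 * u) = - (gg * p * u) * e 1" using e1[of "- (gg * p * u)"] by (simp add: w0)
    moreover have "\<nu> * (\<sigma> u * u) * e p = - (inverse t * (u * u * p)) * e 1"
      using e1[of p] by (simp add: \<nu> conj_F[OF FF] mult.assoc)
    moreover have "e q = q * e 1" by (rule e1)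
    ultimately have "(- (gg * p * u) - inverse t * (u * u * p) + q) * e 1 \<noteq> 0"
      by (simp add: distrib_right left_diff_distrib)
    then show ?thesis by auto
  qed
  \<comment> \<open>For fixed u the expression in \<open>contra\<close> is affine in inverse t. If
    both coefficients are nonzero, it vanishes at some t \<noteq> 0.\<close>
  have "\<exists>u. u \<noteq> 0 \<and> q - gg * p * u \<noteq> 0"
  proof (cases "q = gg * p")
    case True
    have "q - gg * p * rr = q * (1 - rr)" unfolding True by (simp add: right_diff_distrib)
    then show ?thesis using rr q by (intro exI[of _ rr]) simp
  qed (intro exI[of _ 1], simp)
  then obtain u where u: "u \<noteq> 0" "q - gg * p * u \<noteq> 0" by blast
  define t where "t = u * u * p * inverse (q - gg * p * u)"
  have t0': "t \<noteq> 0" using u p0 by (simp add: t_def)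
  have "inverse t * (u * u * p) = q - gg * p * u"
  proof -
    have "u * u * p = t * (q - gg * p * u)" using u(2) by (simp add: t_def mult.assoc)
    then have "inverse t * (u * u * p) = (inverse t * t) * (q - gg * p * u)" by (simp only: mult.assoc)
    then show ?thesis using t0' by simp
  qed
  then show False using contra[OF t0', of u] by simp
qed

text \<open>Vectors that are F-dependent modulo H0 are compared through a third one, independent of
  both. If there is none, then y D equals y F modulo H0, which forces d = 1.\<close>

lemma ratio_const:
  assumes y: "y \<in> H" "y \<notin> H0" and y': "y' \<in> H" "y' \<notin> H0"
    and r: "ratio y \<mu>" "\<mu> \<in> F" "ratio y' \<mu>'" "\<mu>' \<in> F"
  shows "\<mu> = \<mu>'"
proof (cases "\<forall>s\<in>F. y' - y \<star> s \<notin> H0")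
  case True
  then show ?thesis using ratio_indep[OF y y' _ r] by simp
next
  case False
  then obtain s where s: "s \<in> F" "y' - y \<star> s \<in> H0" by blast
  define g where "g = y' - y \<star> s"
  have g: "g \<in> H0" using s by (simp add: g_def)
  have y'eq: "y' = y \<star> s + g" by (simp add: g_def)
  have "s \<noteq> 0" using y'eq y'(2) g by (auto simp: rs_zero)
  then have ys: "y \<star> s \<in> H" "y \<star> s \<notin> H0" using y Dsub_rs[OF H] Dsub_rs_iff[OF H0] by auto
  show ?thesis
  proof (cases "\<exists>z\<in>H. \<forall>s\<in>F. z - y \<star> s \<notin> H0")
    case True
    then obtain z where z: "z \<in> H" "\<And>s. s \<in> F \<Longrightarrow> z - y \<star> s \<notin> H0" by blast
    have z0: "z \<notin> H0" using z(2)[OF F_0] by (simp add: rs_zero)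
    obtain \<eta> where \<eta>: "\<eta> \<in> F" "ratio z \<eta>" using ratio_exists[OF z(1) z0] by blast
    have "z - y' \<star> t \<notin> H0" if t: "t \<in> F" for t
    proof
      assume "z - y' \<star> t \<in> H0"
      then have "z - y' \<star> t + g \<star> t \<in> H0" using Dsub_add[OF H0] Dsub_rs[OF H0 g] by blast
      then have "z - y \<star> (s * t) \<in> H0" by (simp add: y'eq rs_simps algebra_simps)
      then show False using z(2)[OF F_mul[OF s(1) t]] by simp
    qed
    then have "\<mu>' = \<eta>" using ratio_indep[OF y' z(1) z0 _ r(3,4) \<eta>(2,1)] by simp
    moreover have "\<mu> = \<eta>" using ratio_indep[OF y z(1) z0 z(2) r(1,2) \<eta>(2,1)] by simp
    ultimately show ?thesis by simp
  next
    case False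
    have "l \<in> F" for l
    proof -
      obtain t where t: "t \<in> F" "y \<star> l - y \<star> t \<in> H0" using False Dsub_rs[OF H y(1), of l] by blast
      then have "y \<star> (l - t) \<in> H0" by (simp add: rs_diff_r)
      then have "l - t = 0" using Dsub_rs_iff[OF H0, of "l - t" y] y by auto
      then show ?thesis using t by simp
    qed
    then have "d = 1" using F_proper by blast
    then show ?thesis using ratio_special[OF _ ys g ratio_rs[OF y(1) r(1)]] r(3) y'eq by simp
  qed
qed

text \<open>If a single y is not decoupled, its ratio is nonzero, and constancy of the ratio gives
  every other vector \<open>caseA\<close> with the same \<nu>.\<close>

lemma uniform_cases:
  "(\<forall>y\<in>H. y \<notin> H0 \<longrightarrow> caseB y) \<or>
   (\<exists>\<nu>\<in>F. \<nu> \<noteq> 0 \<and> (\<forall>y\<in>H. y \<notin> H0 \<longrightarrow> (\<exists>w0. caseA y \<nu> w0)))"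
proof (cases "\<exists>y\<in>H. y \<notin> H0 \<and> \<not> caseB y")
  case True
  then obtain y where y: "y \<in> H" "y \<notin> H0" "\<not> caseB y" by blast
  then obtain \<nu> w0 where *: "\<nu> \<in> F" "\<nu> \<noteq> 0" "caseA y \<nu> w0" using dichotomy[OF y(1,2)] by blast
  have iF: "- inverse \<nu> \<in> F" using * F_cl by simp
  have "\<exists>w0. caseA z \<nu> w0" if z: "z \<in> H" "z \<notin> H0" for z
    using dichotomy[OF z]
  proof
    assume "caseB z"
    then have "- inverse \<nu> = 0" using ratio_const[OF y(1,2) z ratio_A[OF *(3,1,2)] iF ratio_B F_0] by blast
    then show ?thesis using * by simp
  next
    assume "\<exists>\<nu>\<in>F. \<exists>w0. \<nu> \<noteq> 0 \<and> caseA z \<nu> w0"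
    then obtain \<nu>' w0' where star2: "\<nu>' \<in> F" "\<nu>' \<noteq> 0" "caseA z \<nu>' w0'" by blast
    have "- inverse \<nu>' \<in> F" using star2 F_cl by simp
    then have "- inverse \<nu> = - inverse \<nu>'"
      using ratio_const[OF y(1,2) z ratio_A[OF *(3,1,2)] iF ratio_A[OF star2(3,1,2)]] by blast
    then have "\<nu> = \<nu>'" by simp
    then show ?thesis using star2 by blast
  qed
  then show ?thesis using * by blast
qed blast

end

section \<open>Reassembling V from V' and the hyperplane V x\<close>

context hyperplane_split
begin

definition solved :: bool where
  "solved \<longleftrightarrow> (\<exists>K g k. structured E K g V \<and> V.fdim (k * d) K \<and> O.fdim (bd k) (restr K ` V) \<and> k \<le> n)"

text \<open>An operator that kills x is determined by its restriction to H, so V' already knows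
  whether it belongs to V.\<close>

lemma kernel_member:
  assumes N: "N \<in> End E" "N x = 0" "restr H N \<in> V'"
  shows "N \<in> V"
proof -
  obtain M where M: "M \<in> V" "M x = 0" "restr H N = restr H M" using N(3) unfolding V'_eq by auto
  have "N = M"
  proof (rule End_eqI[OF N(1) V_End[OF M(1)]])
    fix v assume v: "v \<in> E"
    have "N (C v) = M (C v)" using fun_cong[OF M(3), of "C v"] C_H[OF v] by simp
    moreover have "N (x \<star> A v + C v) = N x \<star> A v + N (C v)"
      using End_add[OF N(1), of "x \<star> A v" "C v"] End_rs[OF N(1) xE] inE C_H[OF v] by simp
    moreover have "M (x \<star> A v + C v) = M x \<star> A v + M (C v)" by (rule M_dec[OF M(1) C_H[OF v]])
    ultimately show "N v = M v" using AC[OF v] N(2) M(2) by simp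
  qed
  then show ?thesis using M(1) by simp
qed

text \<open>Only operators that kill x have to be tested. For a general N, orthogonality at v = x
  puts N x into the hyperplane filled by V x, which \<open>gx\<close> identifies; so some M in V
  agrees with N at x, and N - M kills x.\<close>

lemma assemble:
  assumes g: "form_on E K g"
    and K: "\<And>M z. M \<in> V \<Longrightarrow> z \<in> K \<Longrightarrow> M z \<in> K"
    and gM: "\<And>M v. M \<in> V \<Longrightarrow> v \<in> E \<Longrightarrow> e (g v (M v)) = 0"
    and mem: "\<And>N. N \<in> End E \<Longrightarrow> N x = 0 \<Longrightarrow> (\<And>z. z \<in> K \<Longrightarrow> N z \<in> K) \<Longrightarrow> restr K N \<in> restr K ` V \<Longrightarrow>
      (\<And>v. v \<in> E \<Longrightarrow> e (g v (N v)) = 0) \<Longrightarrow> N \<in> V"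
    and gx: "\<And>z. z \<in> E \<Longrightarrow> g x z = p * A z"
  shows "structured E K g V"
  unfolding structured_def
proof (intro conjI ballI iffI; (elim conjE)?)
  show "form_on E K g" by (rule g)
next
  fix N assume "N \<in> V"
  then show "\<And>h. h \<in> K \<Longrightarrow> N h \<in> K" "restr K N \<in> restr K ` V" "\<And>v. v \<in> E \<Longrightarrow> e (g v (N v)) = 0"
    using K gM by auto
next
  fix N assume N: "N \<in> End E" "\<forall>h\<in>K. N h \<in> K" "restr K N \<in> restr K ` V" "\<forall>v\<in>E. e (g v (N v)) = 0"
  have Nx: "N x \<in> E" using End_mem[OF N(1) xE] .
  have "e (p * A (N x)) = 0" using bspec[OF N(4) xE] gx[OF Nx] by simp
  then obtain M where M: "M \<in> V" "M x = x \<star> A (N x) + C (N x)" using V_surj C_H[OF Nx] by blast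
  have Mx: "M x = N x" using M(2) AC[OF Nx] by simp
  have sub: "O.subsp (restr K ` V)" using OO.subsp_image[OF restr_lin tspec_subsp[OF V]] .
  have "N - M \<in> V"
  proof (rule mem)
    show "N - M \<in> End E" using O.subsp_diff[OF End_subsp[OF E] N(1) V_End[OF M(1)]] .
    show "(N - M) x = 0" using Mx by simp
    show "(N - M) z \<in> K" if "z \<in> K" for z
      using Dsub_diff[OF form_on_Dsub[OF g]] N(2) K[OF M(1) that] that by simp
    show "restr K (N - M) \<in> restr K ` V"
      unfolding restr_diff using O.subsp_diff[OF sub N(3) imageI[OF M(1)]] .
    show "e (g v ((N - M) v)) = 0" if v: "v \<in> E" for v
      using form_diff_r[OF g E End_mem[OF N(1) v] M_E[OF M(1) v] v] bspec[OF N(4) v] gM[OF M(1) v]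
      by (simp add: e_diff)
  qed
  then have "N - M + M \<in> V" using O.subsp_add[OF tspec_subsp[OF V]] M(1) by blast
  then show "N \<in> V" by simp
qed

lemma tspec_restr:
  assumes K: "Dsub K" "K \<subseteq> E" "\<And>M z. M \<in> V \<Longrightarrow> z \<in> K \<Longrightarrow> M z \<in> K"
  shows "tspec K (restr K ` V)"
  unfolding tspec_def
proof (intro conjI ballI impI subsetI)
  show "O.subsp (restr K ` V)" using OO.subsp_image[OF restr_lin tspec_subsp[OF V]] .
  fix N assume "N \<in> restr K ` V"
  then obtain M where M: "M \<in> V" "N = restr K M" by blast
  then show "N \<in> End K" using restr_End[OF V_End[OF M(1)] K(1,2)] K(3)[OF M(1)] by simp
  fix z assume "z \<in> K" "N z = z"
  then show "z = 0" using tspec_fix[OF V M(1), of z] K(2) M(2) by auto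
qed

text \<open>On K, the restrictions from V' are among those from V and already have the largest
  dimension that \<open>dim_bound\<close> permits. Passing to all of V therefore adds
  nothing.\<close>

lemma restr_optimal:
  assumes K: "Dsub K" "K \<subseteq> H" "\<And>M z. M \<in> V \<Longrightarrow> z \<in> K \<Longrightarrow> M z \<in> K"
    and dim: "V.fdim (k * d) K" "O.fdim (bd k) (restr K ` V')" and k: "k \<le> n"
  shows "restr K ` V = restr K ` V'"
proof -
  have sub: "restr K ` V' \<subseteq> restr K ` V"
    unfolding V'_eq image_image restr_restr[OF K(2)] by auto
  have "infinite F \<or> k * d \<le> card F" using card k by (meson le_SucI le_trans mult_le_mono1)
  moreover have "tspec K (restr K ` V)"
  proof (rule tspec_restr[OF K(1)])
    show "K \<subseteq> E" using K(2) HE by blast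
    show "M z \<in> K" if "M \<in> V" "z \<in> K" for M z using K(3)[OF that] .
  qed
  ultimately obtain m where m: "m \<le> bd k" "O.fdim m (restr K ` V)"
    using dim_bound[OF K(1) dim(1)] by blast
  then have "m = bd k" using O.fdim_le[OF m(2) dim(2) sub] by simp
  then show ?thesis using O.fdim_eq[OF m(2), of "restr K ` V'"] dim(2) sub by simp
qed

text \<open>When V preserves H, the form needs to see only the coordinate along x. Its radical is H,
  and nonisotropy reduces to e p \<noteq> 0 by \<open>e_norm\<close>.\<close>

lemma final_B:
  assumes l: "\<And>M y. M \<in> V \<Longrightarrow> y \<in> H \<Longrightarrow> A (M y) = 0"
  shows solved
proof -
  define g where "g = (\<lambda>v w. \<sigma> (A v) * p * A w)"
  have MH: "M z \<in> H" if "M \<in> V" "z \<in> H" for M z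
    using AC[OF M_E[OF that(1) inE(1)[OF that(2)]]] l[OF that] C_H[OF M_E[OF that(1) inE(1)[OF that(2)]]]
    by (simp add: rs_zero)
  have eqV': "restr H ` V = V'"
  proof -
    have 1: "restr H M = M" if "M \<in> V'" for M
      using End_out[OF tspec_End[OF V' that]] by (auto simp: restr_def fun_eq_iff)
    then have "restr H ` V' = V'" by force
    moreover have "restr H ` V = restr H ` V'"
    proof (rule restr_optimal[OF H order_refl _ H_dim])
      show "M z \<in> H" if "M \<in> V" "z \<in> H" for M z using MH[OF that] .
      show "O.fdim (bd n) (restr H ` V')" using calculation V'_dim by simp
    qed simp
    ultimately show ?thesis by simp
  qed
  have AM: "A (M v) = A (M x) * A v" if M: "M \<in> V" and v: "v \<in> E" for M v
    using A_M[OF M C_H[OF v], of "A v"] AC[OF v] l[OF M C_H[OF v]] by simp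
  have fo: "form_on E H g"
    unfolding form_on_def sesq_def
  proof (intro conjI ballI allI impI)
    show "H \<subset> E" using HE xE A_H[of x] A_x1 by auto
    fix v assume v: "v \<in> E" "v \<notin> H"
    have "A v \<noteq> 0"
    proof
      assume "A v = 0"
      then show False using AC[OF v(1)] C_H[OF v(1)] v(2) by (simp add: rs_zero)
    qed
    then have "(\<sigma> (A v) * A v) * e p \<noteq> 0" using ep norm_eq_0[of "A v"] by simp
    then show "e (g v v) \<noteq> 0" by (simp only: g_def e_norm not_False_eq_True)
  qed (auto simp: g_def A_add A_rs A_H H conj_add conj_mult conj_0 distrib_left distrib_right mult.assoc)
  have "structured E H g V"
  proof (rule assemble[OF fo])
    fix M v assume M: "M \<in> V" and v: "v \<in> E"
    have "e (g v (M v)) = e (\<sigma> (A v) * (p * A (M x)) * A v)" by (simp add: g_def AM[OF M v] mult.assoc)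
    then show "e (g v (M v)) = 0" using V_a[OF M] by (simp only: e_norm mult_zero_right)
  next
    fix N assume "N \<in> End E" "N x = 0" "restr H N \<in> restr H ` V"
    then show "N \<in> V" using kernel_member eqV' by simp
  qed (simp_all add: MH g_def A_x1 conj_1)
  then show ?thesis unfolding solved_def using H_dim V'_dim eqV' by (intro exI[of _ H] exI[of _ g] exI[of _ n]) simp
qed

end

section \<open>The glued alternative, normalised to \<nu> = 1\<close>

context induction_step
begin

context
  assumes all_A: "\<And>y. y \<in> H \<Longrightarrow> y \<notin> H0 \<Longrightarrow> \<exists>w. caseA y 1 w"
begin

text \<open>Destined to be the entry at (y, x) of the final form. The choice operator gives no
  control over the dependence on y, which the next lemmas establish.\<close>

definition W :: "'v \<Rightarrow> 'd" where
  "W y = (SOME w. caseA y 1 w)"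

lemma W: "y \<in> H \<Longrightarrow> y \<notin> H0 \<Longrightarrow> caseA y 1 (W y)"
  unfolding W_def using someI_ex[OF all_A] .

lemma W1: "y \<in> H \<Longrightarrow> y \<notin> H0 \<Longrightarrow> M \<in> V \<Longrightarrow> \<sigma> (p * A (M y)) = - (W y * A (M x)) - b y (C (M x))"
  using caseA_1[OF W] by simp

lemma W2: "y \<in> H \<Longrightarrow> y \<notin> H0 \<Longrightarrow> M \<in> V \<Longrightarrow> e (W y * A (M y)) + e (b y (C (M y))) = 0"
  using caseA_2[OF W] .

lemma W3: "y \<in> H \<Longrightarrow> y \<notin> H0 \<Longrightarrow> e (W y * u) + (\<sigma> u * u) * e p + e (b y y) \<noteq> 0"
  using caseA_3[OF W, of y u] by simp

text \<open>If A (M x) = 0, the first clause computes A (M y) from b y (C (M x)), and C (M x) is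
  arbitrary in H.\<close>

lemma AM_onto:
  assumes y: "y \<in> H" "y \<notin> H0" shows "\<exists>M\<in>V. A (M x) = 0 \<and> A (M y) = z"
proof -
  define c where "c = y \<star> (- (inverse (b y y) * \<sigma> (p * z)))"
  have c: "c \<in> H" using y H by (simp add: c_def Dsub_rs)
  obtain M where M: "M \<in> V" "A (M x) = 0" "C (M x) = c" using surj_c[OF c] by auto
  have "b y c = - (b y y * inverse (b y y) * \<sigma> (p * z))" using y by (simp add: c_def b_simps mult.assoc)
  then have "b y c = - \<sigma> (p * z)" using by0[OF y] by simp
  then have "\<sigma> (p * A (M y)) = \<sigma> (p * z)" using W1[OF y M(1)] M by simp
  then have "p * A (M y) = p * z" using conj_inject by blast
  then show ?thesis using p0 M by auto
qed

text \<open>Otherwise W varies affinely along y + g t, while b y does not change. For u with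
  \<open>e (L * u) \<noteq> 0\<close> the expression in \<open>W3\<close> is then a nonconstant
  affine function of t on F and has a zero there.\<close>

lemma W_add_H0:
  assumes y: "y \<in> H" "y \<notin> H0" and g: "g \<in> H0" shows "W (y + g) = W y"
proof (rule ccontr)
  assume ne: "W (y + g) \<noteq> W y"
  define L where "L = W (y + g) - W y"
  have L0: "L \<noteq> 0" using ne by (simp add: L_def)
  have gH: "g \<in> H" using H0_in g .
  have diff: "e ((W (y + g \<star> t) - W y) * A (M y)) = - (e (b y (C (M g))) * t)" 
    if t: "t \<in> F" and M: "M \<in> V" "A (M x) = 0" for t M
  proof -
    have gt: "g \<star> t \<in> H0" "g \<star> t \<in> H" using g gH Dsub_rs H0 H by auto
    have yt: "y + g \<star> t \<in> H" "y + g \<star> t \<notin> H0" using add_H0 y gt(1) by auto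
    have CH: "C (M y) \<in> H" "C (M g) \<in> H" "C (M x) \<in> H" using CM[OF M(1)] inE y gH xE by auto
    have bt: "b (y + g \<star> t) z = b y z" if "z \<in> H" for z using b_add_H0[OF y(1) gt(1) that] .
    have "\<sigma> (p * A (M (y + g \<star> t))) = \<sigma> (p * A (M y))"
      unfolding W1[OF yt M(1)] W1[OF y M(1)] bt[OF CH(3)] M(2) by simp
    then have A: "A (M (y + g \<star> t)) = A (M y)" using p0 conj_inject by simp
    have Ct: "C (M (y + g \<star> t)) = C (M y) + C (M g) \<star> t"
      unfolding CM_add[OF M(1) y(1) gt(2)] CM_rs[OF M(1) gH] ..
    have CtH: "C (M (y + g \<star> t)) \<in> H" using CM[OF M(1) inE(1)[OF yt(1)]] .
    have "e (b y (C (M (y + g \<star> t)))) = e (b y (C (M y))) + e (b y (C (M g))) * t"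
      unfolding Ct using y CH H F_comm[OF t, of "e (b y (C (M g)))"]
      by (simp add: b_simps Dsub_rs e_add e_sc_r[OF t])
    then have eb: "e (b (y + g \<star> t) (C (M (y + g \<star> t)))) = e (b y (C (M y))) + e (b y (C (M g))) * t"
      unfolding bt[OF CtH] .
    have "R' - R = (R' + (P + Q)) - (R + P) - Q" for R' R P Q :: 'd by (simp add: algebra_simps)
    from this[of "e (W (y + g \<star> t) * A (M y))" "e (W y * A (M y))" "e (b y (C (M y)))" "e (b y (C (M g))) * t"]
    show ?thesis using W2[OF yt M(1)] W2[OF y M(1)] unfolding A eb by (simp add: left_diff_distrib e_diff)
  qed
  have lin: "W (y + g \<star> t) - W y = t * L" if t: "t \<in> F" for t
  proof -
    have "e ((W (y + g \<star> t) - W y - t * L) * z) = 0" for z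
    proof -
      obtain M where M: "M \<in> V" "A (M x) = 0" "A (M y) = z" using AM_onto[OF y] by blast
      have "e (L * z) = - e (b y (C (M g)))" using diff[OF F_1 M(1,2)] M(3) by (simp add: L_def rs_1)
      then have "e (t * L * z) = - (e (b y (C (M g))) * t)"
        using F_comm[OF t, of "e (b y (C (M g)))"] by (simp add: mult.assoc e_sc[OF t])
      then show ?thesis using diff[OF t M(1,2)] M(3) by (simp add: left_diff_distrib e_diff)
    qed
    then have "W (y + g \<star> t) - W y - t * L = 0" by (rule e_nondeg)
    then show ?thesis by simp
  qed
  obtain u where u: "e (L * u) \<noteq> 0" using e_nondeg[of L] L0 by blast
  define s where "s = e (W y * u) + (\<sigma> u * u) * e p + e (b y y)"
  have s: "s \<in> F" using e_F norm_F' F_cl by (simp add: s_def)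
  define t where "t = - s / e (L * u)"
  have t: "t \<in> F" using s e_F F_cl by (simp add: t_def)
  have gt: "g \<star> t \<in> H0" using g Dsub_rs H0 by auto
  have "W (y + g \<star> t) = W y + t * L" using lin[OF t] by (simp add: algebra_simps)
  have "e (W (y + g \<star> t) * u) = e (W y * u) - s"
  proof -
    have "t * e (L * u) = - s" unfolding t_def by (rule divide_mult[OF u])
    then show ?thesis unfolding \<open>W (y + g \<star> t) = W y + t * L\<close> by (simp add: distrib_right e_add mult.assoc e_sc[OF t])
  qed
  then have "e (W (y + g \<star> t) * u) + (\<sigma> u * u) * e p + e (b (y + g \<star> t) (y + g \<star> t)) = 0"
    using b_add_H0_self[OF y(1) gt] by (simp add: s_def)
  then show False using W3[OF add_H0(1)[OF y(1) gt] add_H0(2)[OF y(2) gt], of u] by simp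
qed

lemma regular_point: obtains y where "y \<in> H" "y \<notin> H0"
  using form_on_proper[OF f] H0H by blast

text \<open>The first clause has the same right-hand side at y and at y + g, as neither W nor b
  changes.\<close>

lemma AM_H0: assumes M: "M \<in> V" and g: "g \<in> H0" shows "A (M g) = 0"
proof -
  obtain y where y: "y \<in> H" "y \<notin> H0" by (rule regular_point)
  have yg: "y + g \<in> H" "y + g \<notin> H0" using add_H0 y g by auto
  have "\<sigma> (p * A (M (y + g))) = \<sigma> (p * A (M y))"
    unfolding W1[OF yg M] W1[OF y M] W_add_H0[OF y g] b_add_H0[OF y(1) g CM[OF M xE]] ..
  then have "A (M (y + g)) = A (M y)" using p0 conj_inject by simp
  then show ?thesis using AM_add[OF M y(1) H0_in[OF g]] by simp
qed

text \<open>With z the H-component of M g, the second clauses at y and at y + g differ by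
  \<open>e (b y z)\<close>, which therefore vanishes for all y outside H0. If z were outside H0,
  taking y = z would contradict nonisotropy.\<close>

lemma H0_invariant: assumes M: "M \<in> V" and g: "g \<in> H0" shows "M g \<in> H0"
proof -
  have gH: "g \<in> H" using H0_in g .
  define z where "z = C (M g)"
  have z: "z \<in> H" using CM[OF M inE(1)[OF gH]] by (simp add: z_def)
  have ez: "e (b y z) = 0" if y: "y \<in> H" "y \<notin> H0" for y
  proof -
    have yg: "y + g \<in> H" "y + g \<notin> H0" using add_H0 y g by auto
    have "e (b (y + g) (C (M (y + g)))) = e (b y (C (M y))) + e (b y z)"
      using b_add_H0[OF y(1) g CM[OF M inE(1)[OF yg(1)]]] CM_add[OF M y(1) gH] y z CM[OF M inE(1)[OF y(1)]]
      by (simp add: b_simps z_def e_add)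
    then have "(e (W y * A (M y)) + e (b y (C (M y)))) + e (b y z) = 0" using W2[OF yg M]
      by (simp add: W_add_H0[OF y g] AM_add[OF M y(1) gH] AM_H0[OF M g] add.assoc)
    then show ?thesis unfolding W2[OF y M] by simp
  qed
  have "z \<in> H0" using ez[of z] form_on_pos[OF f z] z by blast
  moreover have "M g = z"
    using AC[OF M_E[OF M inE(1)[OF gH]]] AM_H0[OF M g] by (simp add: z_def rs_zero)
  ultimately show ?thesis by simp
qed

text \<open>The hyperplane \<open>e (p * a) = 0\<close> contains some a \<noteq> 0. An operator with
  M x = x \<star> a removes b from the first clause, which then expresses W y through A (M y); and
  that is linear in y.\<close>

lemma omega_d:
  assumes d: "d \<noteq> 1"
  shows "\<exists>\<omega>. (\<forall>y\<in>H. \<forall>z\<in>H. \<omega> (y + z) = \<omega> y + \<omega> z) \<and> (\<forall>y\<in>H. \<forall>a. \<omega> (y \<star> a) = \<omega> y * a) \<and>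
    (\<forall>y\<in>H0. \<omega> y = 0) \<and> (\<forall>y\<in>H. y \<notin> H0 \<longrightarrow> W y = \<sigma> (\<omega> y) * p)"
proof -
  obtain k where k: "D.fdim k {a. e (p * a) = 0}" "d \<le> Suc k"
    using form_kernel[OF D_dim, of "\<lambda>a. e (p * a)"] by (auto simp: distrib_left e_add e_F F_left_comm e_sc)
  have "\<exists>a. e (p * a) = 0 \<and> a \<noteq> 0"
  proof (rule ccontr)
    assume "\<not> ?thesis"
    then have "{a. e (p * a) = 0} = {0}" by (auto simp: e_0)
    then have "k = 0" using k(1) D.fdim_unique[OF D.fdim_0, of k] by simp
    then show False using k(2) d d_pos by simp
  qed
  then obtain a where a: "e (p * a) = 0" "a \<noteq> 0" by blast
  obtain M where M: "M \<in> V" "A (M x) = a" "C (M x) = 0" using surj_a[OF a(1)] by blast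
  define \<omega> where "\<omega> = (\<lambda>y. - (\<sigma> (inverse a * inverse p) * (p * A (M y))))"
  have "W y = \<sigma> (\<omega> y) * p" if y: "y \<in> H" "y \<notin> H0" for y
  proof -
    have "\<sigma> (p * A (M y)) = - (W y * a)"
      using W1[OF y M(1)] M b0(2)[OF Dsub_0[OF H0] y(1)] by simp
    moreover have "\<sigma> (\<omega> y) = - (\<sigma> (p * A (M y)) * (inverse a * inverse p))"
      by (simp only: \<omega>_def conj_neg conj_mult[of "\<sigma> (inverse a * inverse p)"] conj_conj)
    ultimately have "\<sigma> (\<omega> y) = W y * a * (inverse a * inverse p)" by simp
    also have "\<dots> = W y * (a * inverse a) * inverse p" by (simp only: mult.assoc)
    also have "\<dots> = W y * inverse p" using a(2) by simp
    finally show ?thesis using p0 by (simp add: mult.assoc)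
  qed
  then show ?thesis using AM_H0[OF M(1)]
    by (intro exI[of _ \<omega>]) (simp add: \<omega>_def AM_add[OF M(1)] AM_rs[OF M(1)] distrib_left mult.assoc)
qed

text \<open>Now all A (M x) vanish and W drops out of the first clause. The second clause takes
  over: it becomes \<open>om\<close>, which ties \<omega> y to C (M x) and C (M y), and suitable
  choices of C (M x) give homogeneity and additivity.\<close>

lemma omega_1:
  assumes d1: "d = 1"
  shows "\<exists>\<omega>. (\<forall>y\<in>H. \<forall>z\<in>H. \<omega> (y + z) = \<omega> y + \<omega> z) \<and> (\<forall>y\<in>H. \<forall>a. \<omega> (y \<star> a) = \<omega> y * a) \<and>
    (\<forall>y\<in>H0. \<omega> y = 0) \<and> (\<forall>y\<in>H. y \<notin> H0 \<longrightarrow> W y = \<sigma> (\<omega> y) * p)"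
proof -
  have FF: "z \<in> F" for z using d1_F[OF d1] .
  have cm: "a * b = b * a" for a b :: 'd using F_comm[OF FF] .
  have sig: "\<sigma> a = a" for a using conj_F[OF FF] .
  have ez: "z = 0" if "e z = 0" for z
  proof (rule e_nondeg)
    show "e (z * a) = 0" for a using e_sc_r[OF FF, of z a] that by simp
  qed
  define \<omega> where "\<omega> = (\<lambda>y. if y \<in> H0 then 0 else W y * inverse p)"
  have om: "\<omega> y * b y (C (M x)) = b y (C (M y))" if y: "y \<in> H" "y \<notin> H0" and M: "M \<in> V" for y M
  proof -
    have "A (M x) = 0" using d1_a[OF d1 V_a[OF M]] .
    then have "p * A (M y) = - b y (C (M x))" using W1[OF y M] by (simp add: sig)
    then have "inverse p * (p * A (M y)) = - (inverse p * b y (C (M x)))" by simp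
    then have Ay: "A (M y) = - (inverse p * b y (C (M x)))" using p0 by (simp add: mult.assoc[symmetric])
    have "W y * A (M y) + b y (C (M y)) = 0" using ez[of "W y * A (M y) + b y (C (M y))"] W2[OF y M] by (simp add: e_add)
    then show ?thesis using y by (simp add: \<omega>_def Ay mult.assoc eq_neg_iff_add_eq_0 add.commute)
  qed
  have om_H0: "\<omega> (y + g) = \<omega> y" if "y \<in> H" "g \<in> H0" for y g
  proof (cases "y \<in> H0")
    case True
    then show ?thesis using that Dsub_add[OF H0] by (simp add: \<omega>_def)
  next
    case False
    then show ?thesis using that add_H0(2)[OF False that(2)] W_add_H0[OF that(1) False that(2)] by (simp add: \<omega>_def)
  qed
  have om_rs: "\<omega> (y \<star> s) = \<omega> y * s" if y: "y \<in> H" for y s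
  proof (cases "y \<in> H0 \<or> s = 0")
    case True
    then show ?thesis using Dsub_rs[OF H0] Dsub_0[OF H0] by (auto simp: \<omega>_def rs_zero)
  next
    case False
    then have y0: "y \<notin> H0" and s: "s \<noteq> 0" by auto
    have ys: "y \<star> s \<in> H" "y \<star> s \<notin> H0" using Dsub_rs[OF H y] Dsub_rs_iff[OF H0 s] y0 by auto
    obtain M where M: "M \<in> V" "C (M x) = y" using surj_c[OF y] by auto
    have CH: "C (M y) \<in> H" using CM[OF M(1) inE(1)[OF y]] .
    have 1: "\<omega> (y \<star> s) * (s * b y y) = s * (b y (C (M y)) * s)"
      using om[OF ys M(1)] unfolding M(2) CM_rs[OF M(1) y] using y CH H
      by (simp add: b_simps sig Dsub_rs mult.assoc)
    have "s * (b y (C (M y)) * s) = \<omega> y * s * (s * b y y)"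
      using om[OF y y0 M(1)] unfolding M(2) by (metis cm mult.assoc)
    with 1 have "\<omega> (y \<star> s) * (s * b y y) = \<omega> y * s * (s * b y y)" by simp
    then show ?thesis using s by0[OF y y0] by simp
  qed
  have om_add: "\<omega> (y + z) = \<omega> y + \<omega> z" if y: "y \<in> H" and z: "z \<in> H" for y z
  proof (cases "y \<in> H0")
    case True
    then show ?thesis using om_H0[OF z True] by (simp add: \<omega>_def add.commute)
  next
    case y0: False
    show ?thesis
    proof (cases "\<exists>s. z - y \<star> s \<in> H0")
      case True
      then obtain s where s: "z - y \<star> s \<in> H0" by blast
      define g where "g = z - y \<star> s"
      have g: "g \<in> H0" and zeq: "z = y \<star> s + g" using s by (auto simp: g_def)
      have "y + z = y \<star> (1 + s) + g" by (simp add: zeq rs_simps add.assoc)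
      then have "\<omega> (y + z) = \<omega> y * (1 + s)" using om_H0[OF Dsub_rs[OF H y] g] om_rs[OF y] by simp
      moreover have "\<omega> z = \<omega> y * s" using om_H0[OF Dsub_rs[OF H y] g] om_rs[OF y] by (simp add: zeq)
      ultimately show ?thesis by (simp add: distrib_left)
    next
      case ind: False
      have z0: "z \<notin> H0" using ind by (metis diff_zero rs_zero)
      have "n \<noteq> 1"
      proof
        assume n1: "n = 1"
        have "y \<noteq> 0" using y0 Dsub_0[OF H0] by auto
        then obtain s where "z = y \<star> s" using d1_line[OF d1 n1 y _ z] by blast
        moreover have "z - y \<star> s \<notin> H0" using ind by blast
        ultimately show False using Dsub_0[OF H0] by simp
      qed
      then obtain r :: 'd where r: "r \<noteq> 0" "r \<noteq> 1" using F_elt' by blast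
      \<comment> \<open>One orthogonalisation step: c is right orthogonal to w, so b v c equals b c
        c and is nonzero.\<close>
      have dual: "\<exists>c\<in>H. b v c = 1 \<and> b w c = 0"
        if v: "v \<in> H" and w: "w \<in> H" "w \<notin> H0" and ni: "\<And>s. v - w \<star> s \<notin> H0" for v w
      proof -
        define s where "s = inverse (b w w) * b w v"
        define c where "c = v - w \<star> s"
        have c: "c \<in> H" "c \<notin> H0" using v w ni H by (auto simp: c_def Dsub_cl)
        have bw: "b w c = 0" using v w H by0[OF w] by (simp add: c_def s_def form_diff_r[OF f] Dsub_cl b_simps mult.assoc[symmetric])
        have "b c c = b v c - s * b w c" using v w c H by (simp add: c_def form_diff_l[OF f] Dsub_cl b_simps sig)
        then have bv: "b v c \<noteq> 0" using by0[OF c] bw by simp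
        have "c \<star> inverse (b v c) \<in> H" using c H by (simp add: Dsub_rs)
        moreover have "b v (c \<star> inverse (b v c)) = 1" "b w (c \<star> inverse (b v c)) = 0"
          using v w c bv bw by (auto simp: b_simps)
        ultimately show ?thesis by blast
      qed
      have ni: "y - z \<star> s \<notin> H0" for s
      proof
        assume a: "y - z \<star> s \<in> H0"
        have "s \<noteq> 0" using a y0 by (auto simp: rs_zero)
        have "(y - z \<star> s) \<star> (- inverse s) = z - y \<star> inverse s"
          using \<open>s \<noteq> 0\<close> by (simp add: rs_diff rs_rs rs_minus rs_1)
        then show False using ind Dsub_rs[OF H0 a, of "- inverse s"] by metis
      qed
      obtain c1 where c1: "c1 \<in> H" "b y c1 = 1" "b z c1 = 0" using dual[OF y z z0 ni] by blast
      obtain c2 where c2: "c2 \<in> H" "b z c2 = 1" "b y c2 = 0" using dual[OF z y y0] ind by blast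
      obtain M1 where M1: "M1 \<in> V" "C (M1 x) = c1" using surj_c[OF c1(1)] by auto
      obtain M2 where M2: "M2 \<in> V" "C (M2 x) = c2" using surj_c[OF c2(1)] by auto
      define X1 where "X1 = b y (C (M1 z)) + b z (C (M1 y))"
      define X2 where "X2 = b y (C (M2 z)) + b z (C (M2 y))"
      have yz: "y + z \<star> t \<in> H" "y + z \<star> t \<notin> H0" for t
        using y z H ni[of "- t"] by (auto simp: Dsub_cl rs_minus)
      have CH: "C (M1 y) \<in> H" "C (M1 z) \<in> H" "C (M2 y) \<in> H" "C (M2 z) \<in> H"
        using CM[OF M1(1)] CM[OF M2(1)] inE y z by auto
      \<comment> \<open>Two operators compute \<omega> (y + z t) as two affine functions of t. Their
        agreement at t = 1 and t = r identifies the slope X1 with \<omega> z.\<close>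
      have e1: "\<omega> (y + z \<star> t) = \<omega> y + t * X1" for t
      proof -
        have "\<omega> (y + z \<star> t) * b (y + z \<star> t) c1 = b (y + z \<star> t) (C (M1 y) + C (M1 z) \<star> t)"
          using om[OF yz M1(1), of t] unfolding M1(2) CM_add[OF M1(1) y Dsub_rs[OF H z]] CM_rs[OF M1(1) z] .
        moreover have "b y (C (M1 y)) = \<omega> y" "b z (C (M1 z)) = 0"
          using om[OF y y0 M1(1)] om[OF z z0 M1(1)] c1 by (simp_all add: M1(2))
        ultimately show ?thesis using y z c1 CH H
          by (simp add: b_simps sig Dsub_cl X1_def distrib_left) (simp add: cm[of _ t] add.assoc)
      qed
      have e2: "\<omega> (y + z \<star> t) = t * \<omega> z + X2" if t: "t \<noteq> 0" for t
      proof -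
        have "\<omega> (y + z \<star> t) * b (y + z \<star> t) c2 = b (y + z \<star> t) (C (M2 y) + C (M2 z) \<star> t)"
          using om[OF yz M2(1), of t] unfolding M2(2) CM_add[OF M2(1) y Dsub_rs[OF H z]] CM_rs[OF M2(1) z] .
        moreover have "b z (C (M2 z)) = \<omega> z" "b y (C (M2 y)) = 0"
          using om[OF y y0 M2(1)] om[OF z z0 M2(1)] c2 by (simp_all add: M2(2))
        ultimately have "\<omega> (y + z \<star> t) * t = (t * \<omega> z + X2) * t" using y z c2 CH H
          by (simp add: b_simps sig Dsub_cl X2_def distrib_left distrib_right) (simp add: cm[of _ t] mult.assoc add.assoc add.left_commute add.commute)
        then show ?thesis using t by simp
      qed
      have 1: "\<omega> y + X1 = \<omega> z + X2" using e1[of 1] e2[of 1] by simp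
      have 2: "\<omega> y + r * X1 = r * \<omega> z + X2" using e1[of r] e2[OF r(1)] by simp
      have "(r - 1) * (X1 - \<omega> z) = (\<omega> y + r * X1) - (\<omega> y + X1) - (r * \<omega> z + X2) + (\<omega> z + X2)"
        by (simp add: algebra_simps)
      also have "\<dots> = 0" unfolding 1 2 by simp
      finally have "X1 = \<omega> z" using r by simp
      then show ?thesis using e1[of 1] by (simp add: rs_1)
    qed
  qed
  have "W y = \<sigma> (\<omega> y) * p" if "y \<in> H" "y \<notin> H0" for y
    using that p0 by (simp add: sig \<omega>_def mult.assoc)
  moreover have "\<omega> y = 0" if "y \<in> H0" for y using that by (simp add: \<omega>_def)
  ultimately show ?thesis using om_add om_rs by (intro exI[of _ \<omega>]) simp
qed

text \<open>The form has p at (x, x), zero at (x, y), W y at (y, x) and b on H, so its radical is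
  H0. Orthogonality of V and nonisotropy are the clauses of \<open>caseA\<close> at v = x u +
  y.\<close>

lemma final_A:
  assumes hn: "h \<le> n"
  shows solved
proof -
  have "\<exists>\<omega>. (\<forall>y\<in>H. \<forall>z\<in>H. \<omega> (y + z) = \<omega> y + \<omega> z) \<and> (\<forall>y\<in>H. \<forall>a. \<omega> (y \<star> a) = \<omega> y * a) \<and>
    (\<forall>y\<in>H0. \<omega> y = 0) \<and> (\<forall>y\<in>H. y \<notin> H0 \<longrightarrow> W y = \<sigma> (\<omega> y) * p)"
    using omega_d omega_1 by (cases "d = 1") auto
  then obtain \<omega> where om: "(\<forall>y\<in>H. \<forall>z\<in>H. \<omega> (y + z) = \<omega> y + \<omega> z) \<and> (\<forall>y\<in>H. \<forall>a. \<omega> (y \<star> a) = \<omega> y * a) \<and>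
    (\<forall>y\<in>H0. \<omega> y = 0) \<and> (\<forall>y\<in>H. y \<notin> H0 \<longrightarrow> W y = \<sigma> (\<omega> y) * p)" by (rule exE)
  have om_add: "\<omega> (y + z) = \<omega> y + \<omega> z" if "y \<in> H" "z \<in> H" for y z using om that by simp
  have om_rs: "\<omega> (y \<star> a) = \<omega> y * a" if "y \<in> H" for y a using om that by simp
  have om_0: "\<omega> y = 0" if "y \<in> H0" for y using om that by simp
  have om_W: "W y = \<sigma> (\<omega> y) * p" if "y \<in> H" "y \<notin> H0" for y using om that by simp
  define g where "g = (\<lambda>v w. \<sigma> (A v + \<omega> (C v)) * p * A w + b (C v) (C w))"
  have eqB: "restr H0 ` V = restr H0 ` V'"
  proof (rule restr_optimal[OF H0 H0H _ H0_dim B_dim hn])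
    show "M z \<in> H0" if "M \<in> V" "z \<in> H0" for M z using H0_invariant[OF that] .
  qed
  have AC0: "A z = 0" "C z = z" if "z \<in> H0" for z using A_H C_Hid H0_in that by auto
  have fo: "form_on E H0 g"
    unfolding form_on_def
  proof (intro conjI ballI impI)
    show "Dsub H0" by (rule H0)
    show "H0 \<subset> E" using H0H HE xE A_x1 A_H[of x] by auto
    show "sesq E g"
      unfolding sesq_def
      by (auto simp: g_def A_add C_add A_rs C_rs om_add om_rs C_H b_simps conj_add conj_mult distrib_left distrib_right mult.assoc)
    show "g z v = 0" "g v z = 0" if "z \<in> H0" "v \<in> E" for z v
      using that b0 C_H by (auto simp: g_def AC0 om_0 conj_0)
    fix v assume v: "v \<in> E" "v \<notin> H0"
    have eq: "e (g v v) = (\<sigma> (A v) * A v) * e p + e (\<sigma> (\<omega> (C v)) * p * A v) + e (b (C v) (C v))"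
      by (simp add: g_def conj_add distrib_right e_add e_norm)
    show "e (g v v) \<noteq> 0"
    proof (cases "C v \<in> H0")
      case True
      have "A v \<noteq> 0"
      proof
        assume "A v = 0"
        then have "v = C v" using AC[OF v(1)] by (simp add: rs_zero)
        then show False using True v(2) by simp
      qed
      then have "(\<sigma> (A v) * A v) * e p \<noteq> 0" using ep norm_eq_0[of "A v"] by simp
      then show ?thesis unfolding eq using b0(1)[OF True C_H[OF v(1)]] by (simp add: om_0[OF True] conj_0 e_0)
    next
      case False
      then show ?thesis unfolding eq using W3[OF C_H[OF v(1)] False, of "A v"] om_W[OF C_H[OF v(1)] False]
        by (simp add: add.commute)
    qed
  qed
  have "structured E H0 g V"
  proof (rule assemble[OF fo])
    show "M z \<in> H0" if "M \<in> V" "z \<in> H0" for M z using H0_invariant[OF that] .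
    show "g x z = p * A z" if "z \<in> E" for z
      using b0(1)[OF Dsub_0[OF H0] C_H[OF that]] om_0[OF Dsub_0[OF H0]] by (simp add: g_def A_x1 C_x1 conj_1)
  next
    fix M v assume M: "M \<in> V" and v: "v \<in> E"
    define u y where "u = A v" and "y = C v"
    have y: "y \<in> H" "v = x \<star> u + y" using C_H[OF v] AC[OF v] by (auto simp: u_def y_def)
    have AMv: "A (M v) = A (M x) * u + A (M y)" and CMv: "C (M v) = C (M x) \<star> u + C (M y)"
      unfolding y(2) using A_M[OF M y(1)] C_M[OF M y(1)] by auto
    have CH: "C (M x) \<in> H" "C (M y) \<in> H" using CM[OF M] xE inE y by auto
    have n0: "e (\<sigma> u * (p * A (M x)) * u) = 0" using V_a[OF M] by (simp only: e_norm mult_zero_right)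
    have gv: "g v (M v) = \<sigma> (u + \<omega> y) * p * (A (M x) * u + A (M y)) + b y (C (M x) \<star> u + C (M y))"
      by (simp add: g_def AMv CMv u_def y_def)
    show "e (g v (M v)) = 0"
    proof (cases "y \<in> H0")
      case True
      have "b y (C (M x) \<star> u + C (M y)) = 0" using b0(1)[OF True] CH H by (simp add: Dsub_cl)
      then show ?thesis using n0 AM_H0[OF M True] by (simp add: gv om_0[OF True] mult.assoc)
    next
      case False
      have "e (\<sigma> u * p * A (M y)) = e (\<sigma> (p * A (M y)) * u)"
        using e_conj[of "\<sigma> u * (p * A (M y))"] by (simp add: conj_mult conj_conj mult.assoc)
      also have "\<dots> = e ((- (W y * A (M x)) - b y (C (M x))) * u)" by (simp only: W1[OF y(1) False M])
      finally have 1: "e (\<sigma> u * p * A (M y)) = - e (W y * A (M x) * u) - e (b y (C (M x)) * u)"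
        by (simp add: left_diff_distrib e_diff e_neg)
      have "e (g v (M v)) = e (\<sigma> u * (p * A (M x)) * u) + e (\<sigma> u * p * A (M y)) + e (W y * A (M x) * u)
          + e (W y * A (M y)) + e (b y (C (M x)) * u) + e (b y (C (M y)))"
        using y(1) CH H om_W[OF y(1) False]
        by (simp add: gv conj_add b_simps Dsub_cl distrib_left distrib_right e_add mult.assoc add_ac)
      also have "\<dots> = e (W y * A (M y)) + e (b y (C (M y)))" unfolding n0 1 by simp
      also have "\<dots> = 0" using W2[OF y(1) False M] .
      finally show ?thesis .
    qed
  next
    fix N assume N: "N \<in> End E" "N x = 0" "\<And>z. z \<in> H0 \<Longrightarrow> N z \<in> H0" "restr H0 N \<in> restr H0 ` V"
      "\<And>v. v \<in> E \<Longrightarrow> e (g v (N v)) = 0"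
    have eqn: "e (\<sigma> (u + \<omega> y) * p * A (N y)) + e (b y (C (N y))) = 0" if y: "y \<in> H" for u y
    proof -
      have "N (x \<star> u + y) = N y"
        using End_add[OF N(1), of "x \<star> u" y] End_rs[OF N(1) xE, of u] inE y N(2) by (simp add: rs_0)
      then show ?thesis using N(5)[OF inE(2)[OF y, of u]] A_eq[OF y, of u] C_eq[OF y, of u] by (simp add: g_def e_add)
    qed
    \<comment> \<open>For fixed y the equation holds for all u. Subtracting the one for u = 0
      isolates \<open>e (\<sigma> u * p * A (N y))\<close>, so N y has no component along x.\<close>
    have AN: "A (N y) = 0" if y: "y \<in> H" for y
    proof -
      have "p * A (N y) = 0"
      proof (rule e_nondeg_l)
        fix u
        have "e (\<sigma> (\<sigma> u) * p * A (N y)) = 0"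
          using eqn[OF y, of "\<sigma> u"] eqn[OF y, of 0] by (simp add: conj_add distrib_right e_add add.assoc)
        then show "e (u * (p * A (N y))) = 0" by (simp add: conj_conj mult.assoc)
      qed
      then show ?thesis using p0 by simp
    qed
    have NC: "N y = C (N y)" if y: "y \<in> H" for y
      using AC[OF End_mem[OF N(1) inE(1)[OF y]]] AN[OF y] by (simp add: rs_zero)
    have NH: "N y \<in> H" if y: "y \<in> H" for y
      using NC[OF y] C_H[OF End_mem[OF N(1) inE(1)[OF y]]] by simp
    have RE: "restr H N \<in> End H" using restr_End[OF N(1) H HE NH] .
    have "restr H N \<in> V'"
      unfolding structured_iff[OF st RE]
    proof (intro conjI ballI)
      show "restr H N z \<in> H0" if "z \<in> H0" for z using N(3)[OF that] H0_in[OF that] by simp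
      show "restr H0 (restr H N) \<in> restr H0 ` V'" using N(4) eqB restr_restr[OF H0H] by simp
      show "e (b v (restr H N v)) = 0" if "v \<in> H" for v
        using eqn[OF that, of 0] AN[OF that] NC[OF that] that by (simp add: e_0)
    qed
    then show "N \<in> V" using kernel_member N(1,2) by blast
  qed
  then show ?thesis unfolding solved_def using H0_dim B_dim eqB hn by (intro exI[of _ H0] exI[of _ g] exI[of _ h]) simp
qed

end

text \<open>A nonzero factor from F changes neither the radical of b nor the orthogonality
  conditions. Dividing by \<nu> reduces \<open>caseA\<close> to \<nu> = 1.\<close>

lemma induction_step_scaled:
  assumes i: "i \<in> F" "i \<noteq> 0"
  shows "induction_step F d \<sigma> e rs E H V V' x p A C n H0 (\<lambda>v w. i * b v w) h"
proof -
  have fo: "form_on H H0 (\<lambda>v w. i * b v w)"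
    using form_on_pos[OF f] i
    unfolding form_on_def sesq_def
    by (auto simp: H0 H0H form_on_proper[OF f] b_simps b0 distrib_left F_left_comm[OF i(1)] mult.assoc e_sc psubset_eq)
  have "structured H H0 (\<lambda>v w. i * b v w) V'"
    unfolding structured_def
  proof (intro conjI fo ballI)
    fix N assume N: "N \<in> End H"
    have "(\<forall>v\<in>H. e (i * b v (N v)) = 0) \<longleftrightarrow> (\<forall>v\<in>H. e (b v (N v)) = 0)"
      using i by (simp add: e_sc)
    then show "(N \<in> V') = ((\<forall>h\<in>H0. N h \<in> H0) \<and> restr H0 N \<in> restr H0 ` V' \<and> (\<forall>v\<in>H. e (i * b v (N v)) = 0))"
      using structured_iff[OF st N] by simp
  qed
  then show ?thesis by unfold_locales (rule n H0_dim B_dim | assumption)+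
qed

lemma solved_step: assumes "h \<le> n" shows solved
  using uniform_cases
proof
  assume B: "\<forall>y\<in>H. y \<notin> H0 \<longrightarrow> caseB y"
  obtain y0 where y0: "y0 \<in> H" "y0 \<notin> H0" using form_on_proper[OF f] H0H by blast
  have l: "A (M y) = 0" if "M \<in> V" "y \<in> H" "y \<notin> H0" for M y
    using B that unfolding caseB_def by simp
  show solved
  proof (rule final_B)
    fix M y assume M: "M \<in> V" and y: "y \<in> H"
    show "A (M y) = 0"
    proof (cases "y \<in> H0")
      case True
      \<comment> \<open>The alternative only speaks of vectors outside H0; a vector in H0 is a
        difference of two of them.\<close>
      have "A (M (y0 + y)) = 0" using l[OF M add_H0(1)[OF y0(1) True] add_H0(2)[OF y0(2) True]] .
      then show ?thesis using AM_add[OF M y0(1) y] l[OF M y0] by simp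
    qed (rule l[OF M y])
  qed
next
  assume "\<exists>\<nu>\<in>F. \<nu> \<noteq> 0 \<and> (\<forall>y\<in>H. y \<notin> H0 \<longrightarrow> (\<exists>w0. caseA y \<nu> w0))"
  then obtain \<nu> where \<nu>: "\<nu> \<in> F" "\<nu> \<noteq> 0" "\<And>y. y \<in> H \<Longrightarrow> y \<notin> H0 \<Longrightarrow> \<exists>w0. caseA y \<nu> w0" by blast
  define i where "i = inverse \<nu>"
  have i: "i \<in> F" "i \<noteq> 0" "i * \<nu> = 1" using \<nu> F_inv by (auto simp: i_def)
  interpret S: induction_step F d \<sigma> e rs E H V V' x p A C n H0 "\<lambda>v w. i * b v w" h
    by (rule induction_step_scaled[OF i(1,2)])
  have ex: "\<exists>w. S.caseA y 1 w" if y: "y \<in> H" "y \<notin> H0" for y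
  proof -
    obtain w0 where w0: "caseA y \<nu> w0" using \<nu>(3)[OF y] by blast
    have "S.caseA y 1 (i * w0)"
      unfolding S.caseA_def
    proof (intro conjI ballI allI)
      fix M assume M: "M \<in> V"
      have "i * (\<nu> * \<sigma> (p * A (M y))) = i * (- (w0 * A (M x)) - b y (C (M x)))" using caseA_1[OF w0 M] by simp
      then show "1 * \<sigma> (p * A (M y)) = - (i * w0 * A (M x)) - i * b y (C (M x))"
        using i(3) by (simp add: mult.assoc[symmetric] right_diff_distrib)
      have "i * (e (w0 * A (M y)) + e (b y (C (M y)))) = 0" using caseA_2[OF w0 M] by simp
      then show "e (i * w0 * A (M y)) + e (i * b y (C (M y))) = 0"
        by (simp add: distrib_left mult.assoc e_sc[OF i(1)])
    next
      fix u
      have "i * (e (w0 * u) + \<nu> * (\<sigma> u * u) * e p + e (b y y)) \<noteq> 0" using caseA_3[OF w0] i(2) by simp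
      moreover have "i * (\<nu> * (\<sigma> u * u) * e p) = (\<sigma> u * u) * e p" using i(3) by (simp add: mult.assoc[symmetric])
      ultimately show "e (i * w0 * u) + 1 * (\<sigma> u * u) * e p + e (i * b y y) \<noteq> 0"
        by (simp add: distrib_left mult.assoc e_sc[OF i(1)])
    qed
    then show ?thesis by blast
  qed
  show solved
  proof (rule S.final_A)
    show "\<exists>w. S.caseA y 1 w" if "y \<in> H" "y \<notin> H0" for y using ex[OF that] .
  qed (rule assms)
qed

end

section \<open>Existence of the structure, by induction on the dimension\<close>

context quad_space
begin

lemma hyperplane_split_intro:
  assumes E: "Dsub E" "V.fdim (Suc n * d) E" and V: "tspec E V" "O.fdim (bd (Suc n)) V"
    and card: "infinite F \<or> Suc n * d \<le> card F" and s: "regular_split E V x \<phi>"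
  shows "hyperplane_split F d \<sigma> e rs E {y \<in> E. \<phi> y = 0} V (restr {y \<in> E. \<phi> y = 0} ` {M \<in> V. M x = 0})
    x (\<phi> x) (\<lambda>v. inverse (\<phi> x) * \<phi> v) (\<lambda>v. v - x \<star> (inverse (\<phi> x) * \<phi> v)) n"
proof -
  note sp = E(1) V(1) s
  note o = optimal_split[OF E V card s]
  have p0: "\<phi> x \<noteq> 0" using rs_p0[OF sp] .
  have ii: "\<phi> x * (inverse (\<phi> x) * z) = z" for z using p0 by (simp add: mult.assoc[symmetric])
  have ph: "inverse (\<phi> x) * \<phi> (x \<star> u + y) = u" if "y \<in> E" "\<phi> y = 0" for u y
    using split_phi[OF sp, of y u] that p0 by (simp add: mult.assoc[symmetric])
  show ?thesis
  proof unfold_locales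
    show "Dsub E" "V.fdim (Suc n * d) E" "tspec E V" "infinite F \<or> Suc n * d \<le> card F" by fact+
    show "Dsub {y \<in> E. \<phi> y = 0}" by (rule split_Dsub[OF sp])
    show "V.fdim (n * d) {y \<in> E. \<phi> y = 0}" by (rule o(1))
    show "{y \<in> E. \<phi> y = 0} \<subseteq> E" by auto
    show "x \<in> E" by (rule rs_x[OF sp])
    show "v - x \<star> (inverse (\<phi> x) * \<phi> v) \<in> {y \<in> E. \<phi> y = 0}" if "v \<in> E" for v by (rule split_dec[OF sp that])
    show "v = x \<star> (inverse (\<phi> x) * \<phi> v) + (v - x \<star> (inverse (\<phi> x) * \<phi> v))" for v by simp
    show "inverse (\<phi> x) * \<phi> (x \<star> u + y) = u" if "y \<in> {y \<in> E. \<phi> y = 0}" for y u using ph that by simp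
    show "x \<star> u + y - x \<star> (inverse (\<phi> x) * \<phi> (x \<star> u + y)) = y" if "y \<in> {y \<in> E. \<phi> y = 0}" for y u using ph that by simp
    show "\<exists>M\<in>V. M x = x \<star> a + c" if a: "e (\<phi> x * a) = 0" and c: "c \<in> {y \<in> E. \<phi> y = 0}" for a c
    proof (rule o(3))
      show "x \<star> a + c \<in> E" using E(1) rs_x[OF sp] c by (simp add: Dsub_cl)
      show "e (\<phi> (x \<star> a + c)) = 0" using split_phi[OF sp c, of a] a by simp
    qed
    show "e (\<phi> x * (inverse (\<phi> x) * \<phi> (M x))) = 0" if "M \<in> V" for M
      unfolding ii by (rule rs_phi_Mx[OF sp that])
    show "inverse (\<phi> x) * \<phi> (M y) = 0" if "M \<in> V" "M x = 0" "y \<in> E" for M y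
      using rs_phi_ker[OF sp that] by simp
    show "tspec {y \<in> E. \<phi> y = 0} (restr {y \<in> E. \<phi> y = 0} ` {M \<in> V. M x = 0})" by (rule split_tspec[OF sp])
    show "O.fdim (bd n) (restr {y \<in> E. \<phi> y = 0} ` {M \<in> V. M x = 0})" by (rule o(2))
    show "e (\<phi> x) \<noteq> 0" by (rule rs_p[OF sp])
  qed simp_all
qed

theorem structure_exists:
  assumes "Dsub E" "V.fdim (Suc n * d) E" "tspec E V" "O.fdim (bd (Suc n)) V" "infinite F \<or> Suc n * d \<le> card F"
  shows "\<exists>K g k. structured E K g V \<and> V.fdim (k * d) K \<and> O.fdim (bd k) (restr K ` V) \<and> k \<le> n"
  using assms
proof (induction n arbitrary: E V)
  case (0 E V)
  note prems = 0
  obtain x \<phi> where s: "regular_split E V x \<phi>"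
    using regular_split_exists[OF prems(1,2,3,5)] by blast
  interpret S: hyperplane_split F d \<sigma> e rs E "{y \<in> E. \<phi> y = 0}" V "restr {y \<in> E. \<phi> y = 0} ` {M \<in> V. M x = 0}"
    x "\<phi> x" "\<lambda>v. inverse (\<phi> x) * \<phi> v" "\<lambda>v. v - x \<star> (inverse (\<phi> x) * \<phi> v)" 0
    by (rule hyperplane_split_intro[OF prems s])
  have "{y \<in> E. \<phi> y = 0} = {0}" using S.H_dim zero_space[of 0 "{y \<in> E. \<phi> y = 0}"] by simp
  then have "y = 0" if "y \<in> {y \<in> E. \<phi> y = 0}" for y using that by blast
  then have "S.solved"
    using End_0[OF S.V_End] S.A_H[OF Dsub_0[OF S.H]] by (intro S.final_B) metis
  then show ?case unfolding S.solved_def by blast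
next
  case (Suc n E V)
  note prems = Suc.prems
  obtain x \<phi> where s: "regular_split E V x \<phi>"
    using regular_split_exists[OF prems(1,2,3,5)] by blast
  interpret S: hyperplane_split F d \<sigma> e rs E "{y \<in> E. \<phi> y = 0}" V "restr {y \<in> E. \<phi> y = 0} ` {M \<in> V. M x = 0}"
    x "\<phi> x" "\<lambda>v. inverse (\<phi> x) * \<phi> v" "\<lambda>v. v - x \<star> (inverse (\<phi> x) * \<phi> v)" "Suc n"
    by (rule hyperplane_split_intro[OF prems s])
  have "infinite F \<or> Suc n * d \<le> card F" using prems(5) by auto
  then obtain K g k where K: "structured {y \<in> E. \<phi> y = 0} K g (restr {y \<in> E. \<phi> y = 0} ` {M \<in> V. M x = 0})"
    "V.fdim (k * d) K" "O.fdim (bd k) (restr K ` restr {y \<in> E. \<phi> y = 0} ` {M \<in> V. M x = 0})" "k \<le> n"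
    using Suc.IH[OF S.H S.H_dim S.V' S.V'_dim] by blast
  interpret T: induction_step F d \<sigma> e rs E "{y \<in> E. \<phi> y = 0}" V "restr {y \<in> E. \<phi> y = 0} ` {M \<in> V. M x = 0}"
    x "\<phi> x" "\<lambda>v. inverse (\<phi> x) * \<phi> v" "\<lambda>v. v - x \<star> (inverse (\<phi> x) * \<phi> v)" "Suc n" K g k
    by unfold_locales (rule K | simp)+
  have "S.solved" using T.solved_step K(4) by simp
  then show ?case unfolding S.solved_def by blast
qed

end

section \<open>Spectrum, dimension and uniqueness for structured spaces\<close>

context quad_space
begin

lemma structured_subsp:
  assumes E: "Dsub E" and st: "structured E H b V" and VE: "V \<subseteq> End E" and B: "O.subsp (restr H ` V)"
  shows "O.subsp V"
proof -
  note f = structured_form[OF st]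
  have HE: "H \<subseteq> E" using form_on_sub[OF f] .
  have cond: "N \<in> V" if "N \<in> End E" "\<And>h. h \<in> H \<Longrightarrow> N h \<in> H" "restr H N \<in> restr H ` V" "\<And>v. v \<in> E \<Longrightarrow> e (b v (N v)) = 0" for N
    using structured_iff[OF st that(1)] that by simp
  have V1: "N h \<in> H" if "N \<in> V" "h \<in> H" for N h using structured_iff[OF st, of N] that VE by auto
  have V2: "e (b v (N v)) = 0" if "N \<in> V" "v \<in> E" for N v using structured_iff[OF st, of N] that VE by auto
  have VE': "N \<in> End E" if "N \<in> V" for N using VE that by auto
  note ES = End_subsp[OF E]
  note HD = form_on_Dsub[OF f]
  show ?thesis unfolding O.subsp_def
  proof (intro conjI ballI)
    show "0 \<in> V"
    proof (rule cond)
      show "0 \<in> End E" using O.subsp_0[OF ES] .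
      show "(0::'v \<Rightarrow> 'v) h \<in> H" if "h \<in> H" for h using Dsub_0[OF HD] by simp
      have "restr H 0 = 0" by (simp add: restr_def fun_eq_iff)
      then show "restr H 0 \<in> restr H ` V" using O.subsp_0[OF B] by simp
      show "e (b v ((0::'v \<Rightarrow> 'v) v)) = 0" if "v \<in> E" for v
        using form_on_r[OF f Dsub_0[OF HD] that] by (simp add: e_0)
    qed
    fix N assume N: "N \<in> V"
    { fix M assume M: "M \<in> V"
      show "N + M \<in> V"
      proof (rule cond)
        show "N + M \<in> End E" using O.subsp_add[OF ES VE'[OF N] VE'[OF M]] .
        show "(N + M) h \<in> H" if "h \<in> H" for h using V1[OF N that] V1[OF M that] Dsub_add[OF HD] by simp
        have "restr H (N + M) = restr H N + restr H M" by (auto simp: restr_def fun_eq_iff)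
        then show "restr H (N + M) \<in> restr H ` V" using O.subsp_add[OF B imageI[OF N] imageI[OF M]] by simp
        show "e (b v ((N + M) v)) = 0" if v: "v \<in> E" for v
          using form_add_r[OF f End_mem[OF VE'[OF N] v] End_mem[OF VE'[OF M] v] v] V2[OF N v] V2[OF M v] by (simp add: e_add)
      qed }
    fix a assume a: "a \<in> F"
    show "(\<lambda>v. N v \<star> a) \<in> V"
    proof (rule cond)
      show "(\<lambda>v. N v \<star> a) \<in> End E" using O.subsp_sc[OF ES a VE'[OF N]] .
      show "N h \<star> a \<in> H" if "h \<in> H" for h using V1[OF N that] Dsub_rs[OF HD] by simp
      have "restr H (\<lambda>v. N v \<star> a) = (\<lambda>v. restr H N v \<star> a)" by (auto simp: restr_def fun_eq_iff rs_0)
      then show "restr H (\<lambda>v. N v \<star> a) \<in> restr H ` V" using O.subsp_sc[OF B a imageI[OF N]] by simp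
      show "e (b v (N v \<star> a)) = 0" if v: "v \<in> E" for v
        using form_rs_r[OF f v End_mem[OF VE'[OF N] v], of a] V2[OF N v] e_sc_r[OF a] by simp
    qed
  qed
qed

text \<open>A fixed vector v outside H would have
  \<open>e (b v v) = e (b v (M v)) = 0\<close>.\<close>

lemma structured_tspec:
  assumes E: "Dsub E" and st: "structured E H b V" and VE: "V \<subseteq> End E" and B: "tspec H (restr H ` V)"
  shows "tspec E V"
  unfolding tspec_def
proof (intro conjI ballI impI)
  note f = structured_form[OF st]
  show "O.subsp V" using structured_subsp[OF E st VE tspec_subsp[OF B]] .
  show "V \<subseteq> End E" by (rule VE)
  fix M v assume M: "M \<in> V" and v: "v \<in> E" "M v = v"
  have ME: "M \<in> End E" using VE M by blast
  show "v = 0"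
  proof (cases "v \<in> H")
    case True
    then show ?thesis using tspec_fix[OF B imageI[OF M] True] v by simp
  next
    case False
    have "e (b v (M v)) = 0" using structured_iff[OF st ME] M v(1) by simp
    then show ?thesis using form_on_pos[OF f v(1) False] v(2) by simp
  qed
qed

lemma structured_image:
  assumes E: "Dsub E" and V: "O.subsp V" "V \<subseteq> End E" and st: "structured E H b V"
    and x: "x \<in> E" "x \<notin> H"
  shows "(\<lambda>M. M x) ` V = {z \<in> E. e (b x z) = 0}"
proof (intro equalityI subsetI)
  fix z assume "z \<in> (\<lambda>M. M x) ` V"
  then obtain M where M: "M \<in> V" "z = M x" by auto
  have ME: "M \<in> End E" using V(2) M(1) by blast
  show "z \<in> {z \<in> E. e (b x z) = 0}"
    using End_mem[OF ME x(1)] structured_iff[OF st ME] M x(1) by simp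
next
  fix z assume "z \<in> {z \<in> E. e (b x z) = 0}"
  then obtain N where "N \<in> V" "N x = z" using structured_hyperplane[OF E V(1) st x, of z] by auto
  then show "z \<in> (\<lambda>M. M x) ` V" by auto
qed

text \<open>The count of \<open>dim_bound\<close> with equalities throughout. For x outside H, V x
  is a hyperplane, and the operators that kill x restrict injectively to a structured space on the
  right orthogonal G of x. The descent ends when G has shrunk to H.\<close>

lemma structured_dim:
  assumes "Dsub E" "V.fdim (n * d) E" "O.subsp V" "V \<subseteq> End E" "structured E H b V"
    and "V.fdim (h * d) H" "O.fdim (bd h) (restr H ` V)"
  shows "O.fdim (bd n) V"
  using assms
proof (induction n arbitrary: E V)
  case (0 E V)
  have "E = {0}" using 0(2) zero_space[of 0 E] by simp
  then show ?case using form_on_proper[OF structured_form[OF 0(5)]] form_on_sub[OF structured_form[OF 0(5)]]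
      Dsub_0[OF form_on_Dsub[OF structured_form[OF 0(5)]]] by blast
next
  case (Suc n E V)
  note E = Suc.prems(1,2) and V = Suc.prems(3,4) and st = Suc.prems(5) and Hd = Suc.prems(6) and Bd = Suc.prems(7)
  note f = structured_form[OF st]
  note H = form_on_Dsub[OF f] and HE = form_on_sub[OF f]
  obtain x where x: "x \<in> E" "x \<notin> H" using form_on_proper[OF f] HE by blast
  have bx: "b x x \<noteq> 0" using form_on_pos0[OF f x] .
  define G where "G = {z \<in> E. b x z = 0}"
  define U where "U = {M \<in> V. M x = 0}"
  have VE: "M \<in> End E" if "M \<in> V" for M using V(2) that by blast
  have G: "Dsub G" unfolding Dsub_def G_def
    using E(1) x form_add_r[OF f _ _ x(1)] form_rs_r[OF f x(1)] form_on_r[OF f Dsub_0[OF H] x(1)]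
    by (auto simp: Dsub_cl)
  have GE: "G \<subseteq> E" unfolding G_def by blast
  have G_dim: "V.fdim (n * d) G" unfolding G_def
    by (rule kernel_dim[where \<phi> = "b x" and x = x, OF E])
      (simp_all add: x(1) bx form_add_r[OF f _ _ x(1)] form_rs_r[OF f x(1)])
  have HG: "H \<subseteq> G" using form_on_r[OF f _ x(1)] HE unfolding G_def by auto
  have dec: "v - x \<star> (inverse (b x x) * b x v) \<in> G" if "v \<in> E" for v
    using that x E bx unfolding G_def
    by (simp add: form_diff_r[OF f E(1)] form_rs_r[OF f] Dsub_cl mult.assoc[symmetric])
  have Us: "O.subsp U" unfolding U_def by (rule OV.subsp_kernel[OF eval_lin V(1)])
  have UV: "M \<in> V" "M x = 0" if "M \<in> U" for M using that unfolding U_def by auto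
  have gM: "e (b v (M v)) = 0" "h \<in> H \<Longrightarrow> M h \<in> H" if "M \<in> V" "v \<in> E" for M v h
    using structured_iff[OF st VE[OF that(1)]] that by auto
  have Ux: "M (x \<star> l + y) = M y" if "M \<in> U" "y \<in> E" for M l y
    using End_add[OF VE[OF UV(1)[OF that(1)]], of "x \<star> l" y] End_rs[OF VE[OF UV(1)[OF that(1)]] x(1)] UV(2)[OF that(1)]
      that x(1) E(1) by (simp add: Dsub_cl rs_0)
  have UG: "M y \<in> G" if M: "M \<in> U" and y: "y \<in> E" for M y
  proof -
    have My: "M y \<in> E" using End_mem[OF VE[OF UV(1)[OF M]] y] .
    have "b x (M y) = 0"
    proof (rule e_nondeg_l)
      fix l
      \<comment> \<open>M has the same value at x \<star> \<sigma> l + y and at y. Subtracting the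
        two orthogonality relations leaves \<open>e (l * b x (M y)) = 0\<close> for every l.\<close>
      have "e (b (x \<star> \<sigma> l + y) (M y)) = 0"
        using gM(1)[OF UV(1)[OF M], of "x \<star> \<sigma> l + y"] Ux[OF M y] x y E(1) by (simp add: Dsub_cl)
      then show "e (l * b x (M y)) = 0"
        using gM(1)[OF UV(1)[OF M] y] x y My E(1)
        by (simp add: form_add_l[OF f] form_rs_l[OF f] Dsub_cl conj_conj e_add)
    qed
    then show ?thesis using My unfolding G_def by simp
  qed
  have resU: "restr H ` U = restr H ` V"
  proof (intro equalityI subsetI)
    fix R assume "R \<in> restr H ` V"
    then obtain N where N: "N \<in> V" "R = restr H N" by blast
    obtain N' where N': "N' \<in> V" "N' x = N x" "\<forall>h\<in>H. N' h = 0"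
      using structured_hyperplane[OF E(1) V(1) st x End_mem[OF VE[OF N(1)] x(1)] gM(1)[OF N(1) x(1)]] by auto
    have "N - N' \<in> U" unfolding U_def using O.subsp_diff[OF V(1) N(1) N'(1)] N'(2) by simp
    moreover have "restr H (N - N') = R" using N'(3) by (auto simp: N(2) restr_def fun_eq_iff)
    ultimately show "R \<in> restr H ` U" by blast
  qed (auto simp: U_def)
  have inj: "M = 0" if M: "M \<in> U" "restr G M = 0" for M
  proof -
    have "M v = 0" for v
    proof (cases "v \<in> E")
      case True
      define y where "y = v - x \<star> (inverse (b x x) * b x v)"
      have y: "y \<in> G" using dec[OF True] by (simp add: y_def)
      have "M y = 0" using fun_cong[OF M(2), of y] y by simp
      moreover have "v = x \<star> (inverse (b x x) * b x v) + y" by (simp add: y_def)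
      moreover have "M (x \<star> (inverse (b x x) * b x v) + y) = M y" using Ux[OF M(1)] y GE by blast
      ultimately show ?thesis by metis
    qed (use End_out[OF VE[OF UV(1)[OF M(1)]]] in simp)
    then show ?thesis by (simp add: fun_eq_iff)
  qed
  have res2: "restr H ` restr G ` U = restr H ` V"
    unfolding image_image restr_restr[OF HG] by (rule resU)
  have U'_End: "restr G ` U \<subseteq> End G"
  proof
    fix R assume "R \<in> restr G ` U"
    then obtain M where M: "M \<in> U" "R = restr G M" by blast
    show "R \<in> End G" unfolding M(2)
      using UG[OF M(1)] GE by (intro restr_End[OF VE[OF UV(1)[OF M(1)]] G GE]) auto
  qed
  have "O.fdim (bd n) (restr G ` U)"
  \<comment> \<open>\<open>form_on\<close> asks for a proper subspace, so the induction hypothesis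
    does not cover G = H. There the dimension is the one given on H.\<close>
  proof (cases "G = H")
    case True
    then have "h * d = n * d" using V.fdim_unique[OF Hd] G_dim by simp
    then have "h = n" using d_pos by simp
    then show ?thesis using Bd resU True by simp
  next
    case False
    have fG: "form_on G H b"
      using f HG False GE unfolding form_on_def sesq_def by (auto simp: subset_iff psubset_eq)
    have stG: "structured G H b (restr G ` U)"
      unfolding structured_def
    proof (intro conjI fG ballI iffI; (elim conjE)?)
      fix R assume "R \<in> restr G ` U"
      then obtain M where M: "M \<in> U" "R = restr G M" by blast
      show "R z \<in> H" if "z \<in> H" for z using gM(2)[OF UV(1)[OF M(1)] x(1) that] HG that by (auto simp: M(2))
      show "restr H R \<in> restr H ` restr G ` U" using M by blast
      show "e (b v (R v)) = 0" if "v \<in> G" for v using gM(1)[OF UV(1)[OF M(1)], of v] that GE by (auto simp: M(2))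
    next
      fix N assume N: "N \<in> End G" "\<forall>h\<in>H. N h \<in> H" "restr H N \<in> restr H ` restr G ` U" "\<forall>v\<in>G. e (b v (N v)) = 0"
      define c where "c = (\<lambda>v. v - x \<star> (inverse (b x x) * b x v))"
      \<comment> \<open>N is extended by zero on x D, along the decomposition of E into x D and
        G.\<close>
      define M where "M = (\<lambda>v. if v \<in> E then N (c v) else 0)"
      have cG: "c v \<in> G" if "v \<in> E" for v using dec[OF that] by (simp add: c_def)
      have c_add: "c (v + w) = c v + c w" if "v \<in> E" "w \<in> E" for v w
        using that x by (simp add: c_def form_add_r[OF f] distrib_left rs_plus)
      have c_rs: "c (v \<star> a) = c v \<star> a" if "v \<in> E" for v a
        using that x by (simp add: c_def form_rs_r[OF f] rs_diff rs_rs mult.assoc)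
      have cGid: "c v = v" if "v \<in> G" for v using that by (simp add: c_def G_def rs_zero)
      have ME: "M \<in> End E" unfolding End_def
        using E(1) GE End_mem[OF N(1)] End_add[OF N(1)] End_rs[OF N(1)] cG
        by (auto simp: M_def c_add c_rs Dsub_cl subset_iff)
      have MN: "M v = N v" if "v \<in> G" for v using that GE cGid by (auto simp: M_def)
      have "M \<in> V"
        unfolding structured_iff[OF st ME]
      proof (intro conjI ballI)
        show "M z \<in> H" if "z \<in> H" for z using N(2) MN[of z] that HG by auto
        have "restr H M = restr H N" using MN HG by (auto simp: restr_def fun_eq_iff)
        then show "restr H M \<in> restr H ` V" using N(3) res2 by simp
        fix v assume v: "v \<in> E"
        have Nc: "N (c v) \<in> G" using End_mem[OF N(1) cG[OF v]] .
        have "b v (M v) = b (x \<star> (inverse (b x x) * b x v) + c v) (N (c v))" using v by (simp add: M_def c_def)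
        also have "\<dots> = \<sigma> (inverse (b x x) * b x v) * b x (N (c v)) + b (c v) (N (c v))"
          using x cG[OF v] Nc GE E(1) by (simp add: form_add_l[OF f] form_rs_l[OF f] Dsub_cl subset_iff)
        also have "b x (N (c v)) = 0" using Nc by (simp add: G_def)
        finally show "e (b v (M v)) = 0" using N(4) cG[OF v] by simp
      qed
      moreover have "M x = 0"
      proof -
        have "c x = 0" using bx by (simp add: c_def rs_1)
        then show ?thesis using End_0[OF N(1)] by (simp add: M_def)
      qed
      moreover have "restr G M = N" using MN End_out[OF N(1)] by (auto simp: restr_def fun_eq_iff)
      ultimately show "N \<in> restr G ` U" unfolding U_def by blast
    qed
    show ?thesis
    proof (rule Suc.IH[OF G G_dim _ U'_End stG Hd])
      show "O.subsp (restr G ` U)" by (rule OO.subsp_image[OF restr_lin Us])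
      show "O.fdim (bd h) (restr H ` restr G ` U)" unfolding res2 by (rule Bd)
    qed
  qed
  moreover have "{M \<in> U. restr G M = 0} = {0}" using inj O.subsp_0[OF Us] by (auto simp: restr_def)
  then have "O.fdim 0 {M \<in> U. restr G M = 0}" using O.fdim_0 by simp
  ultimately have k: "O.fdim (bd n) U" using OO.rank_nullity[OF _ _ restr_lin Us, of "bd n" G 0] by simp
  have im: "(\<lambda>M. M x) ` V = {z \<in> E. e (b x z) = 0}" using structured_image[OF E(1) V st x] .
  have "V.fdim (Suc n * d - 1) {z \<in> E. e (b x z) = 0}"
    by (rule form_kernel_dim[where f = "\<lambda>z. e (b x z)", OF E(2) x(1)])
      (simp_all add: form_on_pos[OF f x] form_add_r[OF f _ _ x(1)] form_rs_r[OF f x(1)] e_add e_sc_r e_F)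
  from OV.rank_nullity[OF this[folded im] k[unfolded U_def] eval_lin V(1)]
  show ?case by (simp add: bd_Suc add.commute)
qed

text \<open>For x in H both V x and x F stay inside the proper subspace H. For x outside, V x is the
  kernel of a form whose value at x is nonzero.\<close>

lemma structured_kernel:
  assumes E: "Dsub E" and V: "O.subsp V" "V \<subseteq> End E" and st: "structured E H b V"
  shows "H = {x \<in> E. \<exists>z\<in>E. \<forall>s\<in>F. z - x \<star> s \<notin> (\<lambda>M. M x) ` V}"
proof (intro equalityI subsetI)
  note f = structured_form[OF st]
  note H = form_on_Dsub[OF f] and HE = form_on_sub[OF f]
  fix x assume x: "x \<in> H"
  obtain z where z: "z \<in> E" "z \<notin> H" using form_on_proper[OF f] HE by blast
  have "z - x \<star> s \<notin> (\<lambda>M. M x) ` V" for s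
  proof
    assume "z - x \<star> s \<in> (\<lambda>M. M x) ` V"
    then obtain M where M: "M \<in> V" "z - x \<star> s = M x" by auto
    have "M x \<in> H" using structured_iff[OF st, of M] M(1) V(2) x by auto
    then have "M x + x \<star> s \<in> H" using x H by (simp add: Dsub_cl)
    moreover have "M x + x \<star> s = z" using M(2) by (metis diff_add_cancel)
    ultimately show False using z by simp
  qed
  then show "x \<in> {x \<in> E. \<exists>z\<in>E. \<forall>s\<in>F. z - x \<star> s \<notin> (\<lambda>M. M x) ` V}" using z x HE by blast
next
  note f = structured_form[OF st]
  fix x assume "x \<in> {x \<in> E. \<exists>z\<in>E. \<forall>s\<in>F. z - x \<star> s \<notin> (\<lambda>M. M x) ` V}"
  then obtain z where x: "x \<in> E" and z: "z \<in> E" "\<forall>s\<in>F. z - x \<star> s \<notin> (\<lambda>M. M x) ` V" by blast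
  show "x \<in> H"
  proof (rule ccontr)
    assume xH: "x \<notin> H"
    have q: "e (b x x) \<noteq> 0" using form_on_pos[OF f x xH] .
    define s where "s = e (b x z) / e (b x x)"
    have s: "s \<in> F" using e_F F_div by (simp add: s_def)
    have "e (b x (z - x \<star> s)) = e (b x z) - s * e (b x x)"
      using x z E s by (simp add: form_diff_r[OF f] form_rs_r[OF f] Dsub_cl e_diff e_sc_r)
    then have "e (b x (z - x \<star> s)) = 0" using divide_mult[OF q, of "e (b x z)"] by (simp add: s_def)
    then have "z - x \<star> s \<in> (\<lambda>M. M x) ` V"
      unfolding structured_image[OF E V st x xH] using x z E by (simp add: Dsub_cl)
    then show False using z(2) s by blast
  qed
qed

lemma structured_form_unique:
  assumes E: "Dsub E" and V: "O.subsp V" "V \<subseteq> End E"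
    and st: "structured E H b V" and st': "structured E H b' V"
  shows "\<exists>\<alpha>\<in>F - {0}. \<forall>v\<in>E. \<forall>w\<in>E. b' v w = \<alpha> * b v w"
proof -
  note f = structured_form[OF st] and f' = structured_form[OF st']
  note H = form_on_Dsub[OF f] and HE = form_on_sub[OF f]
  interpret VF: fspace F "\<lambda>a g (z::'v). a * (g z :: 'd)"
    by unfold_locales (auto simp: fun_eq_iff distrib_left distrib_right mult.assoc)
  define G where "G = (\<lambda>v z. if z \<in> E then b v z else 0)"
  define G' where "G' = (\<lambda>v z. if z \<in> E then b' v z else 0)"
  have proportional: "\<exists>s\<in>F. \<forall>z\<in>E. b' v z = s * b v z" if v: "v \<in> E" for v
  proof (cases "v \<in> H")
    case True
    then show ?thesis using form_on_l[OF f] form_on_l[OF f'] F_0 by (intro bexI[of _ 0]) simp_all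
  next
    case False
    have q: "e (b v v) \<noteq> 0" using form_on_pos[OF f v False] .
    have zero: "e (b v z) = 0 \<Longrightarrow> e (b' v z) = 0" if "z \<in> E" for z
      using structured_image[OF E V st v False] structured_image[OF E V st' v False] that by blast
    define s where "s = e (b' v v) / e (b v v)"
    have s: "s \<in> F" using e_F F_div by (simp add: s_def)
    have sv: "s * e (b v v) = e (b' v v)" unfolding s_def by (rule divide_mult[OF q])
    have es: "e (b' v z) = s * e (b v z)" if z: "z \<in> E" for z
    proof -
      define t where "t = e (b v z) / e (b v v)"
      have t: "t \<in> F" using e_F F_div by (simp add: t_def)
      have tv: "t * e (b v v) = e (b v z)" unfolding t_def by (rule divide_mult[OF q])
      have zt: "z - v \<star> t \<in> E" using v z E by (simp add: Dsub_cl)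
      have "e (b v (z - v \<star> t)) = 0"
        using v z E t tv by (simp add: form_diff_r[OF f] form_rs_r[OF f] Dsub_cl e_diff e_sc_r)
      then have "e (b' v (z - v \<star> t)) = 0" by (rule zero[OF zt])
      then have "e (b' v z) = t * e (b' v v)"
        using v z E t by (simp add: form_diff_r[OF f'] form_rs_r[OF f'] Dsub_cl e_diff e_sc_r)
      also have "\<dots> = s * (t * e (b v v))" unfolding sv[symmetric] by (rule F_left_comm[OF s])
      finally show ?thesis unfolding tv .
    qed
    have "b' v z = s * b v z" if z: "z \<in> E" for z
    proof -
      have "e ((b' v z - s * b v z) * l) = 0" for l
        using es[OF Dsub_rs[OF E z, of l]] v z
        by (simp add: form_rs_r[OF f] form_rs_r[OF f'] left_diff_distrib e_diff mult.assoc e_sc[OF s])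
      then have "b' v z - s * b v z = 0" by (rule e_nondeg)
      then show ?thesis by simp
    qed
    then show ?thesis using s by blast
  qed
  \<comment> \<open>The factor still depends on v. Sending b v to b' v is well defined, because b v
    determines v modulo H, and F-linear; every vector is an eigenvector, so
    \<open>scalar_map\<close> yields one factor for all v. \<open>G\<close> and \<open>G'\<close>
    vanish off E to make the functions comparable.\<close>
  define L where "L = (\<lambda>g. G' (SOME v. v \<in> E \<and> G v = g))"
  have G_add: "G (v + w) = G v + G w" "G' (v + w) = G' v + G' w" if "v \<in> E" "w \<in> E" for v w
    using that by (auto simp: G_def G'_def fun_eq_iff form_add_l[OF f] form_add_l[OF f'])
  have G_sc: "G (v \<star> a) = (\<lambda>z. a * G v z)" "G' (v \<star> a) = (\<lambda>z. a * G' v z)" if "v \<in> E" "a \<in> F" for v a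
    using that by (auto simp: G_def G'_def fun_eq_iff form_rs_l[OF f] form_rs_l[OF f'] conj_F)
  have L: "L (G v) = G' v" if v: "v \<in> E" for v
  proof -
    have s: "(SOME w. w \<in> E \<and> G w = G v) \<in> E \<and> G (SOME w. w \<in> E \<and> G w = G v) = G v"
      using someI[of "\<lambda>w. w \<in> E \<and> G w = G v" v] v by simp
    define w where "w = (SOME w. w \<in> E \<and> G w = G v)"
    have w: "w \<in> E" "G w = G v" using s unfolding w_def by auto
    have wv: "w - v \<in> E" using w v E by (simp add: Dsub_cl)
    have "b (w - v) (w - v) = 0"
      using fun_cong[OF w(2), of "w - v"] w v wv E by (simp add: G_def form_diff_l[OF f])
    then have "w - v \<in> H" using form_left_ker[OF f wv] by simp
    then have "b' w z = b' v z" if "z \<in> E" for z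
      using form_on_l[OF f' _ that, of "w - v"] w v that E by (simp add: form_diff_l[OF f'])
    then show ?thesis unfolding L_def w_def[symmetric] by (auto simp: G'_def fun_eq_iff)
  qed
  have "\<exists>s\<in>F. \<forall>g\<in>G ` E. L g = (\<lambda>z. s * g z)"
  proof (rule VF.scalar_map)
    show "VF.subsp (G ` E)" unfolding VF.subsp_def
    proof (intro conjI ballI)
      show "0 \<in> G ` E" using form_on_l[OF f Dsub_0[OF H]] Dsub_0[OF E]
        by (intro image_eqI[of _ _ 0]) (auto simp: G_def fun_eq_iff)
      show "g + k \<in> G ` E" if "g \<in> G ` E" "k \<in> G ` E" for g k
        using that G_add(1)[symmetric] E by (auto simp: Dsub_cl)
      show "(\<lambda>z. a * g z) \<in> G ` E" if "a \<in> F" "g \<in> G ` E" for a g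
        using that G_sc(1)[symmetric] E by (auto simp: Dsub_cl)
    qed
    show "L (g + k) = L g + L k" if gk: "g \<in> G ` E" "k \<in> G ` E" for g k
    proof -
      obtain v w where "v \<in> E" "w \<in> E" "g = G v" "k = G w" using gk by auto
      then show ?thesis using L[OF Dsub_add[OF E]] L G_add by metis
    qed
    show "L (\<lambda>z. a * g z) = (\<lambda>z. a * L g z)" if ag: "a \<in> F" "g \<in> G ` E" for a g
    proof -
      obtain v where v: "v \<in> E" "g = G v" using ag(2) by blast
      then show ?thesis using L[OF Dsub_rs[OF E v(1), of a]] L[OF v(1)] G_sc[OF v(1) ag(1)] by simp
    qed
    show "\<exists>s\<in>F. L g = (\<lambda>z. s * g z)" if g: "g \<in> G ` E" for g
    proof -
      obtain v where v: "v \<in> E" "g = G v" using g by blast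
      obtain s where "s \<in> F" "\<forall>z\<in>E. b' v z = s * b v z" using proportional[OF v(1)] by blast
      then show ?thesis unfolding v(2) L[OF v(1)]
        by (intro bexI[of _ s]) (auto simp: G_def G'_def fun_eq_iff)
    qed
  qed
  then obtain s where s: "s \<in> F" "\<forall>g\<in>G ` E. L g = (\<lambda>z. s * g z)" by blast
  have eq: "b' v z = s * b v z" if "v \<in> E" "z \<in> E" for v z
    using fun_cong[OF bspec[OF s(2) imageI[OF that(1)], unfolded L[OF that(1)]], of z] that by (simp add: G_def G'_def)
  obtain z where z: "z \<in> E" "z \<notin> H" using form_on_proper[OF f] HE by blast
  have "s \<noteq> 0" using eq[OF z(1) z(1)] form_on_pos0[OF f' z] by auto
  then show ?thesis using s(1) eq by blast
qed

end

section \<open>Bases and matrices\<close>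

lemma mat_mult_entry:
  fixes L R :: "'a :: semiring_0 mat"
  assumes "L \<in> carrier_mat n m" "R \<in> carrier_mat m k" "i < n" "j < k"
  shows "(L * R) $$ (i, j) = (\<Sum>l<m. L $$ (i, l) * R $$ (l, j))"
  using assms by (auto simp: scalar_prod_def atLeast0LessThan)

section \<open>Quadratic expressions of matrices\<close>

context quad
begin

definition qform :: "nat \<Rightarrow> 'd mat \<Rightarrow> (nat \<Rightarrow> 'd) \<Rightarrow> 'd" where
  "qform m Q y = (\<Sum>i<m. \<Sum>j<m. \<sigma> (y i) * Q $$ (i, j) * y j)"

lemma e_sum: "e (sum g I) = (\<Sum>i\<in>I. e (g i))"
  by (induction I rule: infinite_finite_induct) (auto simp: e_0 e_add)

lemma conj_sum: "\<sigma> (sum g I) = (\<Sum>i\<in>I. \<sigma> (g i))"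
  by (induction I rule: infinite_finite_induct) (auto simp: conj_0 conj_add)

lemma qform_Suc:
  "qform (Suc m) Q y = qform m Q y + (\<Sum>i<m. \<sigma> (y i) * Q $$ (i, m) * y m + \<sigma> (y m) * Q $$ (m, i) * y i)
    + \<sigma> (y m) * Q $$ (m, m) * y m"
  by (simp add: qform_def sum.distrib algebra_simps)

lemma qform_single:
  assumes "k < m" shows "qform m Q (\<lambda>i. if i = k then a else 0) = \<sigma> a * Q $$ (k, k) * a"
proof -
  define y where "y = (\<lambda>i. if i = k then a else 0)"
  have r: "(\<Sum>j<m. g j * y j) = g k * a" for g :: "nat \<Rightarrow> 'd"
  proof -
    have "(\<Sum>j<m. g j * y j) = (\<Sum>j\<in>{k}. g j * y j)"
      using assms by (intro sum.mono_neutral_right) (auto simp: y_def)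
    then show ?thesis by (simp add: y_def)
  qed
  have "(\<Sum>i<m. \<sigma> (y i) * (Q $$ (i, k) * a)) = (\<Sum>i\<in>{k}. \<sigma> (y i) * (Q $$ (i, k) * a))"
    using assms by (intro sum.mono_neutral_right) (auto simp: y_def conj_0)
  then show ?thesis unfolding qform_def y_def[symmetric] r by (simp add: y_def mult.assoc)
qed

lemma qform_pair:
  assumes "k < m" "l < m" "k \<noteq> l"
  shows "qform m Q (\<lambda>i. if i = k then a else if i = l then c else 0)
    = \<sigma> a * Q $$ (k, k) * a + \<sigma> a * Q $$ (k, l) * c + \<sigma> c * Q $$ (l, k) * a + \<sigma> c * Q $$ (l, l) * c"
proof -
  define y where "y = (\<lambda>i. if i = k then a else if i = l then c else 0)"
  have r: "(\<Sum>j<m. g j * y j) = g k * a + g l * c" for g :: "nat \<Rightarrow> 'd"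
  proof -
    have "(\<Sum>j<m. g j * y j) = (\<Sum>j\<in>{k, l}. g j * y j)"
      using assms by (intro sum.mono_neutral_right) (auto simp: y_def)
    then show ?thesis using assms(3) by (simp add: y_def)
  qed
  have s: "(\<Sum>i<m. \<sigma> (y i) * g i) = \<sigma> a * g k + \<sigma> c * g l" for g :: "nat \<Rightarrow> 'd"
  proof -
    have "(\<Sum>i<m. \<sigma> (y i) * g i) = (\<Sum>i\<in>{k, l}. \<sigma> (y i) * g i)"
      using assms by (intro sum.mono_neutral_right) (auto simp: y_def conj_0)
    then show ?thesis using assms(3) by (simp add: y_def)
  qed
  have "qform m Q y = (\<Sum>i<m. \<sigma> (y i) * (Q $$ (i, k) * a + Q $$ (i, l) * c))"
    unfolding qform_def r by (simp add: distrib_left mult.assoc)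
  then show ?thesis unfolding s y_def[symmetric] by (simp add: distrib_left mult.assoc add_ac)
qed

text \<open>The off-diagonal entries of a skew matrix contribute in pairs w - \<sigma> w, which e
  kills. Conversely, vectors with one or two nonzero coordinates test the entries; on the diagonal,
  skewness comes from \<open>e_skew\<close>.\<close>

lemma SH_iff:
  assumes Q: "Q \<in> carrier_mat m m"
  shows "Q \<in> SH \<sigma> e m \<longleftrightarrow> (\<forall>y. e (qform m Q y) = 0)"
proof
  assume S: "Q \<in> SH \<sigma> e m"
  have st: "star \<sigma> Q = - Q" and dg: "\<And>i. i < m \<Longrightarrow> e (Q $$ (i, i)) = 0" using S unfolding SH_def by auto
  have sk: "\<sigma> (Q $$ (j, i)) = - Q $$ (i, j)" if "i < m" "j < m" for i j
    using arg_cong[OF st, of "\<lambda>M. M $$ (i, j)"] Q that by (simp add: star_def)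
  have "e (qform k Q y) = 0" if "k \<le> m" for k y
    using that
  proof (induction k)
    case 0
    then show ?case by (simp add: qform_def e_0)
  next
    case (Suc k)
    have "e (\<sigma> (y i) * Q $$ (i, k) * y k + \<sigma> (y k) * Q $$ (k, i) * y i) = 0" if i: "i < k" for i
    proof -
      have "Q $$ (k, i) = - \<sigma> (Q $$ (i, k))" using sk[of k i] i Suc.prems by simp
      then have "\<sigma> (y k) * Q $$ (k, i) * y i = - \<sigma> (\<sigma> (y i) * Q $$ (i, k) * y k)"
        by (simp add: conj_mult conj_conj mult.assoc)
      then show ?thesis using e_skew_sum by simp
    qed
    then have "e (\<Sum>i<k. \<sigma> (y i) * Q $$ (i, k) * y k + \<sigma> (y k) * Q $$ (k, i) * y i) = 0" by (simp add: e_sum)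
    moreover have "e (\<sigma> (y k) * Q $$ (k, k) * y k) = 0" using dg[of k] Suc.prems by (simp add: e_norm)
    ultimately show ?case using Suc by (simp add: qform_Suc e_add)
  qed
  then show "\<forall>y. e (qform m Q y) = 0" by blast
next
  assume a: "\<forall>y. e (qform m Q y) = 0"
  have dg: "e (Q $$ (k, k)) = 0" if k: "k < m" for k
    using spec[OF a, of "\<lambda>i. if i = k then 1 else 0"] unfolding qform_single[OF k] by (simp add: conj_1)
  have sk: "\<sigma> (Q $$ (l, k)) = - Q $$ (k, l)" if kl: "k < m" "l < m" for k l
  proof (cases "k = l")
    case True
    then show ?thesis using e_skew[OF dg] kl by simp
  next
    case False
    have "e ((\<sigma> (Q $$ (l, k)) + Q $$ (k, l)) * c) = 0" for c
    proof -
      have "e (Q $$ (k, k) + Q $$ (k, l) * c + \<sigma> c * Q $$ (l, k) + \<sigma> c * Q $$ (l, l) * c) = 0"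
        using spec[OF a, of "\<lambda>i. if i = k then 1 else if i = l then c else 0"]
        unfolding qform_pair[OF kl False] by (simp add: conj_1)
      then have "e (Q $$ (k, l) * c) + e (\<sigma> c * Q $$ (l, k)) = 0" using dg kl by (simp add: e_add e_norm)
      moreover have "e (\<sigma> c * Q $$ (l, k)) = e (\<sigma> (Q $$ (l, k)) * c)"
        using e_conj[of "\<sigma> c * Q $$ (l, k)"] by (simp add: conj_mult conj_conj)
      ultimately show ?thesis by (simp add: distrib_right e_add add.commute)
    qed
    then have "\<sigma> (Q $$ (l, k)) + Q $$ (k, l) = 0" by (rule e_nondeg)
    then show ?thesis by (simp add: eq_neg_iff_add_eq_0)
  qed
  have "star \<sigma> Q = - Q"
  proof (rule eq_matI)
    fix i j assume "i < dim_row (- Q)" "j < dim_col (- Q)"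
    then have "i < m" "j < m" using Q by auto
    then show "star \<sigma> Q $$ (i, j) = (- Q) $$ (i, j)" using sk Q by (simp add: star_def)
  qed (use Q in \<open>simp_all add: star_def\<close>)
  then show "Q \<in> SH \<sigma> e m" unfolding SH_def using Q dg by auto
qed

lemma nonisotropic_iff:
  assumes P: "P \<in> carrier_mat m m"
  shows "nonisotropic \<sigma> e m P \<longleftrightarrow> (\<forall>y. (\<exists>i<m. y i \<noteq> 0) \<longrightarrow> e (qform m P y) \<noteq> 0)"
proof -
  have ent: "(star \<sigma> V * P * V) $$ (0, 0) = qform m P (\<lambda>i. V $$ (i, 0))" if V: "V \<in> carrier_mat m 1" for V
  proof -
    have sV: "star \<sigma> V \<in> carrier_mat 1 m"
      using carrier_matD[OF V] by (intro carrier_matI) (simp_all add: star_def)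
    have 1: "(star \<sigma> V * P) $$ (0, j) = (\<Sum>i<m. \<sigma> (V $$ (i, 0)) * P $$ (i, j))" if "j < m" for j
    proof -
      have "(star \<sigma> V * P) $$ (0, j) = (\<Sum>l<m. star \<sigma> V $$ (0, l) * P $$ (l, j))"
        by (rule mat_mult_entry[OF sV P]) (use that in simp_all)
      also have "\<dots> = (\<Sum>i<m. \<sigma> (V $$ (i, 0)) * P $$ (i, j))"
        using V by (intro sum.cong refl) (simp add: star_def)
      finally show ?thesis .
    qed
    have 2: "star \<sigma> V * P \<in> carrier_mat 1 m" by (rule mult_carrier_mat[OF sV P])
    have "(star \<sigma> V * P * V) $$ (0, 0) = (\<Sum>j<m. (star \<sigma> V * P) $$ (0, j) * V $$ (j, 0))"
      by (rule mat_mult_entry[OF 2 V]) simp_all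
    also have "\<dots> = (\<Sum>j<m. (\<Sum>i<m. \<sigma> (V $$ (i, 0)) * P $$ (i, j)) * V $$ (j, 0))"
      by (intro sum.cong refl) (simp only: 1 lessThan_iff)
    also have "\<dots> = (\<Sum>j<m. \<Sum>i<m. \<sigma> (V $$ (i, 0)) * P $$ (i, j) * V $$ (j, 0))" by (simp add: sum_distrib_right)
    also have "\<dots> = qform m P (\<lambda>i. V $$ (i, 0))" unfolding qform_def by (rule sum.swap)
    finally show ?thesis .
  qed
  show ?thesis
  proof (intro iffI allI impI)
    fix y :: "nat \<Rightarrow> 'd" assume n: "nonisotropic \<sigma> e m P" and y: "\<exists>i<m. y i \<noteq> 0"
    define V where "V = mat m 1 (\<lambda>(i, j). y i)"
    obtain i where i: "i < m" "y i \<noteq> 0" using y by blast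
    have "V $$ (i, 0) \<noteq> 0\<^sub>m m 1 $$ (i, 0)" using i by (simp add: V_def)
    then have V0: "V \<noteq> 0\<^sub>m m 1" by auto
    have V: "V \<in> carrier_mat m 1" by (simp add: V_def)
    have "\<forall>V\<in>carrier_mat m 1. V \<noteq> 0\<^sub>m m 1 \<longrightarrow> e ((star \<sigma> V * P * V) $$ (0, 0)) \<noteq> 0"
      using n unfolding nonisotropic_def by (rule conjunct2)
    from mp[OF bspec[OF this V] V0] have "e (qform m P (\<lambda>i. V $$ (i, 0))) \<noteq> 0" unfolding ent[OF V] .
    moreover have "qform m P (\<lambda>i. V $$ (i, 0)) = qform m P y" unfolding qform_def by (intro sum.cong refl) (simp add: V_def)
    ultimately show "e (qform m P y) \<noteq> 0" by simp
  next
    assume a: "\<forall>y. (\<exists>i<m. y i \<noteq> 0) \<longrightarrow> e (qform m P y) \<noteq> 0"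
    show "nonisotropic \<sigma> e m P" unfolding nonisotropic_def
    proof (intro conjI ballI impI P)
      fix V :: "'d mat" assume V: "V \<in> carrier_mat m 1" "V \<noteq> 0\<^sub>m m 1"
      have "\<exists>i<m. V $$ (i, 0) \<noteq> 0"
      proof (rule ccontr)
        assume "\<not> ?thesis"
        then have "V = 0\<^sub>m m 1" using V(1) by (intro eq_matI) auto
        then show False using V(2) by simp
      qed
      from mp[OF spec[OF a] this] show "e ((star \<sigma> V * P * V) $$ (0, 0)) \<noteq> 0" unfolding ent[OF V(1)] .
    qed
  qed
qed

end

section \<open>Blocks of matrices and joints\<close>

lemma find_block:
  fixes ns :: "nat list"
  assumes "c < sum_list ns"
  shows "\<exists>j r. j < length ns \<and> r < ns ! j \<and> c = sum_list (take j ns) + r"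
  using assms
proof (induction ns rule: rev_induct)
  case (snoc m ns)
  show ?case
  proof (cases "c < sum_list ns")
    case True
    then obtain j r where "j < length ns" "r < ns ! j" "c = sum_list (take j ns) + r" using snoc.IH by blast
    then show ?thesis by (intro exI[of _ j] exI[of _ r]) (simp add: nth_append)
  next
    case False
    then show ?thesis using snoc.prems
      by (intro exI[of _ "length ns"] exI[of _ "c - sum_list ns"]) (simp add: nth_append)
  qed
qed simp

lemma block_bound: fixes ns :: "nat list" assumes "j < length ns" "r < ns ! j" shows "sum_list (take j ns) + r < sum_list ns"
proof -
  have "sum_list (take j ns) + ns ! j = sum_list (take (Suc j) ns)"
    using assms(1) by (simp add: take_Suc_conv_app_nth)
  also have "\<dots> \<le> sum_list ns"
    by (metis append_take_drop_id le_add1 sum_list_append)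
  finally show ?thesis using assms(2) by simp
qed

text \<open>The last block is split off because the recursion puts the earlier blocks on H and the
  last one on the form.\<close>

lemma joint_snoc:
  fixes M :: "'d :: division_ring mat"
  assumes len: "length Ms = length ns" and M: "M \<in> carrier_mat (sum_list ns + m) (sum_list ns + m)"
    and C: "C \<subseteq> carrier_mat m m"
  defines "h \<equiv> sum_list ns"
  shows "M \<in> joint (ns @ [m]) (Ms @ [C]) \<longleftrightarrow>
    mat h h (\<lambda>(i, j). M $$ (i, j)) \<in> joint ns Ms \<and> mat m m (\<lambda>(i, j). M $$ (h + i, h + j)) \<in> C \<and>
    (\<forall>i<m. \<forall>j<h. M $$ (h + i, j) = 0)" (is "_ \<longleftrightarrow> ?UL \<in> _ \<and> ?LR \<in> C \<and> ?Z")
proof -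
  let ?n = "length ns"
  have b1: "block (ns @ [m]) M i j = block ns ?UL i j" if "i < ?n" "j < ?n" for i j
    unfolding block_def using that block_bound
    by (intro eq_matI) (auto simp: nth_append h_def)
  have b2: "block (ns @ [m]) M ?n ?n = ?LR"
    unfolding block_def by (intro eq_matI) (auto simp: nth_append h_def)
  have b3: "(\<forall>j<?n. block (ns @ [m]) M ?n j = 0\<^sub>m m (ns ! j)) \<longleftrightarrow> ?Z"
  proof
    assume a: "\<forall>j<?n. block (ns @ [m]) M ?n j = 0\<^sub>m m (ns ! j)"
    show ?Z
    proof (intro allI impI)
      fix i c assume i: "i < m" and c: "c < h"
      obtain j r where j: "j < ?n" "r < ns ! j" "c = sum_list (take j ns) + r" using find_block c unfolding h_def by blast
      have "block (ns @ [m]) M ?n j $$ (i, r) = M $$ (h + i, c)"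
        using i j by (simp add: block_def nth_append h_def)
      moreover have "block (ns @ [m]) M ?n j $$ (i, r) = 0\<^sub>m m (ns ! j) $$ (i, r)" using a j(1) by simp
      ultimately show "M $$ (h + i, c) = 0" using i j by simp
    qed
  next
    assume Z: ?Z
    show "\<forall>j<?n. block (ns @ [m]) M ?n j = 0\<^sub>m m (ns ! j)"
      using Z block_bound unfolding block_def
      by (intro allI impI eq_matI) (auto simp: nth_append h_def)
  qed
  have 1: "(\<forall>i<?n. block (ns @ [m]) M i i \<in> Ms ! i) \<longleftrightarrow> (\<forall>i<?n. block ns ?UL i i \<in> Ms ! i)"
    by (simp add: b1)
  have 2: "(\<forall>i<?n. \<forall>j<i. block (ns @ [m]) M i j = 0\<^sub>m (ns ! i) (ns ! j)) \<longleftrightarrow>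
    (\<forall>i<?n. \<forall>j<i. block ns ?UL i j = 0\<^sub>m (ns ! i) (ns ! j))"
  proof -
    have "block (ns @ [m]) M i j = block ns ?UL i j" if "i < ?n" "j < i" for i j
      by (rule b1) (use that in simp_all)
    then show ?thesis by simp
  qed
  have "M \<in> joint (ns @ [m]) (Ms @ [C]) \<longleftrightarrow>
    (block (ns @ [m]) M ?n ?n \<in> C \<and> (\<forall>i<?n. block (ns @ [m]) M i i \<in> Ms ! i)) \<and>
    (\<forall>j<?n. block (ns @ [m]) M ?n j = 0\<^sub>m m (ns ! j)) \<and>
    (\<forall>i<?n. \<forall>j<i. block (ns @ [m]) M i j = 0\<^sub>m (ns ! i) (ns ! j))"
  proof -
    have "(\<forall>i<?n. \<forall>j<i. block (ns @ [m]) M i j = 0\<^sub>m ((ns @ [m]) ! i) ((ns @ [m]) ! j)) \<longleftrightarrow>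
      (\<forall>i<?n. \<forall>j<i. block (ns @ [m]) M i j = 0\<^sub>m (ns ! i) (ns ! j))"
      by (simp add: nth_append)
    moreover have "(\<forall>j<?n. block (ns @ [m]) M ?n j = 0\<^sub>m ((ns @ [m]) ! ?n) ((ns @ [m]) ! j)) \<longleftrightarrow>
      (\<forall>j<?n. block (ns @ [m]) M ?n j = 0\<^sub>m m (ns ! j))"
      by (simp add: nth_append)
    moreover have "(\<forall>i<?n. block (ns @ [m]) M i i \<in> (Ms @ [C]) ! i) \<longleftrightarrow> (\<forall>i<?n. block (ns @ [m]) M i i \<in> Ms ! i)"
      using len by (simp add: nth_append)
    moreover have "(Ms @ [C]) ! ?n = C" using len[symmetric] by simp
    ultimately show ?thesis using M unfolding joint_def by (simp add: All_less_Suc)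
  qed
  also have "\<dots> \<longleftrightarrow> (?LR \<in> C \<and> (\<forall>i<?n. block ns ?UL i i \<in> Ms ! i)) \<and> ?Z \<and>
    (\<forall>i<?n. \<forall>j<i. block ns ?UL i j = 0\<^sub>m (ns ! i) (ns ! j))"
    unfolding 1 2 b2 b3 ..
  moreover have "?UL \<in> joint ns Ms \<longleftrightarrow> (\<forall>i<?n. block ns ?UL i i \<in> Ms ! i) \<and>
    (\<forall>i<?n. \<forall>j<i. block ns ?UL i j = 0\<^sub>m (ns ! i) (ns ! j))"
    unfolding joint_def h_def by simp
  ultimately show ?thesis by argo
qed

section \<open>Bases of right spaces over the division ring\<close>

context quad_space
begin

definition comb :: "'v list \<Rightarrow> (nat \<Rightarrow> 'd) \<Rightarrow> 'v" where
  "comb bs f = (\<Sum>i<length bs. bs ! i \<star> f i)"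

definition basis :: "'v set \<Rightarrow> 'v list \<Rightarrow> bool" where
  "basis E bs \<longleftrightarrow> Dsub E \<and> set bs \<subseteq> E \<and> (\<forall>v\<in>E. \<exists>f. v = comb bs f) \<and>
     (\<forall>f. comb bs f = 0 \<longrightarrow> (\<forall>i<length bs. f i = 0))"

text \<open>Positions from the length of the list on are unspecified, as \<open>comb\<close> ignores
  them.\<close>

definition crd :: "'v list \<Rightarrow> 'v \<Rightarrow> nat \<Rightarrow> 'd" where
  "crd bs v = (SOME f. v = comb bs f)"

lemma comb_add: "comb bs (\<lambda>i. f i + g i) = comb bs f + comb bs g"
  and comb_rs: "comb bs f \<star> a = comb bs (\<lambda>i. f i * a)"
  and comb_0: "comb bs (\<lambda>i. 0) = 0"
proof -
  show "comb bs (\<lambda>i. f i + g i) = comb bs f + comb bs g" "comb bs (\<lambda>i. 0) = 0"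
    by (simp_all add: comb_def rs_plus sum.distrib rs_zero)
  have "sum g I \<star> a = (\<Sum>i\<in>I. g i \<star> a)" for g :: "nat \<Rightarrow> 'v" and I
    by (induction I rule: infinite_finite_induct) (auto simp: rs_0 rs_add)
  then show "comb bs f \<star> a = comb bs (\<lambda>i. f i * a)" by (simp add: comb_def rs_rs)
qed

lemma comb_diff: "comb bs (\<lambda>i. f i - g i) = comb bs f - comb bs g"
  using comb_add[of bs "\<lambda>i. f i - g i" g] by simp

lemma comb_cong: "(\<And>i. i < length bs \<Longrightarrow> f i = g i) \<Longrightarrow> comb bs f = comb bs g"
  unfolding comb_def by (intro sum.cong) auto

lemma comb_append: "comb (bs @ cs) f = comb bs f + comb cs (\<lambda>i. f (length bs + i))"
proof (induction cs rule: rev_induct)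
  case Nil
  show ?case by (simp add: comb_def)
next
  case (snoc c cs)
  have app: "comb (as @ [c]) g = comb as g + c \<star> g (length as)" for as g
  proof -
    have "(\<Sum>i<length as. (as @ [c]) ! i \<star> g i) = (\<Sum>i<length as. as ! i \<star> g i)"
      by (intro sum.cong refl) (simp add: nth_append)
    then show ?thesis by (simp add: comb_def)
  qed
  show ?case using snoc app[of "bs @ cs" f] by (simp add: app add.assoc)
qed

lemma basis_Dsub: "basis E bs \<Longrightarrow> Dsub E"
  and basis_mem: "basis E bs \<Longrightarrow> i < length bs \<Longrightarrow> bs ! i \<in> E"
  and basis_span: "basis E bs \<Longrightarrow> v \<in> E \<Longrightarrow> \<exists>f. v = comb bs f"
  and basis_indep: "basis E bs \<Longrightarrow> comb bs f = 0 \<Longrightarrow> i < length bs \<Longrightarrow> f i = 0"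
  unfolding basis_def by auto

lemma comb_mem: assumes "Dsub E" "set bs \<subseteq> E" shows "comb bs f \<in> E"
proof -
  have "(\<Sum>i\<in>I. bs ! i \<star> f i) \<in> E" if "I \<subseteq> {..<length bs}" for I
    using finite_subset[OF that] that
  proof (induction I rule: infinite_finite_induct)
    case (insert i I)
    then have "bs ! i \<in> E" using assms(2) by (auto simp: subset_iff)
    then show ?case using insert assms(1) by (simp add: Dsub_cl)
  qed (use assms in \<open>auto simp: Dsub_cl\<close>)
  then show ?thesis unfolding comb_def by blast
qed

lemma basis_comb: "basis E bs \<Longrightarrow> comb bs f \<in> E"
  using comb_mem unfolding basis_def by blast

lemma comb_inj: assumes "basis E bs" "comb bs f = comb bs g" "i < length bs" shows "f i = g i"
proof -
  have "comb bs (\<lambda>i. f i - g i) = 0" using assms(2) by (simp add: comb_diff)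
  from basis_indep[OF assms(1) this assms(3)] show ?thesis by simp
qed

lemma comb_crd: "basis E bs \<Longrightarrow> v \<in> E \<Longrightarrow> comb bs (crd bs v) = v"
  unfolding crd_def using someI_ex[OF basis_span] by metis

lemma crd_eqI: "basis E bs \<Longrightarrow> v = comb bs f \<Longrightarrow> i < length bs \<Longrightarrow> crd bs v i = f i"
  using comb_inj[of E bs "crd bs v" f i] comb_crd[of E bs v] basis_comb by metis

lemma crd_add: "basis E bs \<Longrightarrow> v \<in> E \<Longrightarrow> w \<in> E \<Longrightarrow> i < length bs \<Longrightarrow> crd bs (v + w) i = crd bs v i + crd bs w i"
  by (rule crd_eqI) (simp_all add: comb_add comb_crd)

lemma crd_rs: "basis E bs \<Longrightarrow> v \<in> E \<Longrightarrow> i < length bs \<Longrightarrow> crd bs (v \<star> a) i = crd bs v i * a"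
  by (rule crd_eqI) (simp_all add: comb_rs[symmetric] comb_crd)

lemma comb_delta: "j < length bs \<Longrightarrow> comb bs (\<lambda>i. if i = j then 1 else 0) = bs ! j"
proof -
  assume j: "j < length bs"
  have "(\<Sum>i<length bs. bs ! i \<star> (if i = j then 1 else 0)) = (\<Sum>i\<in>{j}. bs ! i \<star> (if i = j then 1 else 0))"
    using j by (intro sum.mono_neutral_right) (auto simp: rs_zero)
  then show ?thesis by (simp add: comb_def rs_1)
qed

lemma crd_basis: "basis E bs \<Longrightarrow> j < length bs \<Longrightarrow> i < length bs \<Longrightarrow> crd bs (bs ! j) i = (if i = j then 1 else 0)"
  by (rule crd_eqI) (simp_all add: comb_delta)

text \<open>The subspace is described twice, by equations in the remaining coordinates and as a
  span. The equations match zero blocks of matrices; the span refers to the shorter basis alone, as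
  the recursion requires.\<close>

lemma basis_take:
  assumes b: "basis E (hs @ vs)"
  defines "H \<equiv> {v \<in> E. \<forall>i<length vs. crd (hs @ vs) v (length hs + i) = 0}"
  shows "basis H hs" and "v \<in> H \<Longrightarrow> i < length hs \<Longrightarrow> crd (hs @ vs) v i = crd hs v i"
    and "H = range (comb hs)"
proof -
  have E: "Dsub E" using basis_Dsub[OF b] .
  have ch: "comb hs f = comb (hs @ vs) (\<lambda>i. if i < length hs then f i else 0)" for f
    unfolding comb_append by (simp add: comb_0 cong: comb_cong)
  have sub: "comb hs f \<in> H" for f
    using crd_eqI[OF b ch[of f]] basis_comb[OF b] by (simp add: H_def ch[of f])
  have rep: "v = comb hs (crd (hs @ vs) v)" if "v \<in> H" for v
  proof -
    have "v = comb (hs @ vs) (crd (hs @ vs) v)" using comb_crd[OF b] that by (simp add: H_def)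
    also have "\<dots> = comb hs (crd (hs @ vs) v) + comb vs (\<lambda>i. 0)"
      unfolding comb_append using that by (intro arg_cong2[where f = "(+)"] refl comb_cong) (simp add: H_def)
    finally show ?thesis by (simp add: comb_0)
  qed
  show bH: "basis H hs" unfolding basis_def
  proof (intro conjI ballI allI impI)
    show "Dsub H" unfolding Dsub_def H_def using E crd_add[OF b] crd_rs[OF b]
      crd_eqI[OF b, of 0 "\<lambda>i. 0"] by (auto simp: Dsub_cl comb_0)
    show "set hs \<subseteq> H"
    proof
      fix w assume "w \<in> set hs"
      then obtain j where "j < length hs" "w = hs ! j" by (auto simp: in_set_conv_nth)
      then show "w \<in> H" using sub[of "\<lambda>i. if i = j then 1 else 0"] comb_delta[of j hs] by simp
    qed
    show "\<exists>f. v = comb hs f" if "v \<in> H" for v using rep[OF that] by blast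
    fix f i assume "comb hs f = 0" "i < length hs"
    then show "f i = 0" using basis_indep[OF b, of "\<lambda>i. if i < length hs then f i else 0" i] ch[of f] by simp
  qed
  show "crd (hs @ vs) v i = crd hs v i" if "v \<in> H" "i < length hs"
    using crd_eqI[OF bH rep[OF that(1)] that(2)] by simp
  show "H = range (comb hs)" using sub rep by blast
qed

lemma basis_snoc_dim:
  assumes b: "basis E (hs @ [v])" and H: "V.fdim (length hs * d) (range (comb hs))"
  shows "V.fdim (Suc (length hs) * d) E"
proof -
  define \<phi> where "\<phi> = (\<lambda>w. crd (hs @ [v]) w (length hs))"
  have l: "VD.lin E \<phi>" unfolding VD.lin_def
  proof (intro conjI ballI)
    show "\<phi> (w + z) = \<phi> w + \<phi> z" if "w \<in> E" "z \<in> E" for w z using crd_add[OF b that] by (simp add: \<phi>_def)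
    show "\<phi> (w \<star> a) = a * \<phi> w" if "a \<in> F" "w \<in> E" for w a
      using crd_rs[OF b that(2), of "length hs" a] F_comm[OF that(1), of "\<phi> w"] by (simp add: \<phi>_def)
  qed
  have "\<phi> (v \<star> a) = a" for a
    using crd_rs[OF b basis_mem[OF b, of "length hs"], of "length hs" a] crd_basis[OF b, of "length hs" "length hs"]
    by (simp add: \<phi>_def nth_append)
  moreover have "v \<star> a \<in> E" for a using basis_mem[OF b, of "length hs"] basis_Dsub[OF b] by (simp add: nth_append Dsub_cl)
  ultimately have "a \<in> \<phi> ` E" for a by (intro image_eqI[of _ _ "v \<star> a"]) simp_all
  then have "\<phi> ` E = UNIV" by blast
  moreover have "{w \<in> E. \<phi> w = 0} = range (comb hs)" using basis_take(3)[OF b] by (simp add: \<phi>_def)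
  ultimately show ?thesis
    using VD.rank_nullity[of d \<phi> E "length hs * d"] D_dim H l Dsub_subsp[OF basis_Dsub[OF b]] by (simp add: add.commute)
qed

lemma basis_dim: "basis E bs \<Longrightarrow> V.fdim (length bs * d) E"
proof (induction bs arbitrary: E rule: rev_induct)
  case Nil
  then have "E = {0}" using basis_span[OF Nil] Dsub_0[OF basis_Dsub[OF Nil]] by (auto simp: comb_def)
  then show ?case using V.fdim_0 by simp
next
  case (snoc v bs)
  have "V.fdim (length bs * d) (range (comb bs))"
    using snoc.IH[OF basis_take(1)[OF snoc.prems]] basis_take(3)[OF snoc.prems] by simp
  then show ?case using basis_snoc_dim[OF snoc.prems] by simp
qed

lemma basis_extend_one:
  assumes b: "basis H hs" and E: "Dsub E" "H \<subseteq> E" and v: "v \<in> E" "v \<notin> H"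
  shows "basis {w + v \<star> a | w a. w \<in> H} (hs @ [v])" and "{w + v \<star> a | w a. w \<in> H} \<subseteq> E"
proof -
  have H: "Dsub H" using basis_Dsub[OF b] .
  have app: "comb (hs @ [v]) g = comb hs g + v \<star> g (length hs)" for g
    unfolding comb_append by (simp add: comb_def)
  show "{w + v \<star> a | w a. w \<in> H} \<subseteq> E" using E v by (auto simp: Dsub_cl)
  show "basis {w + v \<star> a | w a. w \<in> H} (hs @ [v])" unfolding basis_def
  proof (intro conjI ballI allI impI)
    show "Dsub {w + v \<star> a | w a. w \<in> H}" unfolding Dsub_def
    proof (intro conjI ballI allI)
      show "0 \<in> {w + v \<star> a | w a. w \<in> H}" using Dsub_0[OF H] by (intro CollectI exI[of _ 0]) (simp add: rs_zero)
      fix y assume "y \<in> {w + v \<star> a | w a. w \<in> H}"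
      then obtain w a where y: "w \<in> H" "y = w + v \<star> a" by blast
      { fix z assume "z \<in> {w + v \<star> a | w a. w \<in> H}"
        then obtain w' a' where z: "w' \<in> H" "z = w' + v \<star> a'" by blast
        have "y + z = (w + w') + v \<star> (a + a')" using y z by (simp add: rs_plus algebra_simps)
        then show "y + z \<in> {w + v \<star> a | w a. w \<in> H}" using Dsub_add[OF H y(1) z(1)] by blast }
      fix c
      have "y \<star> c = w \<star> c + v \<star> (a * c)" using y by (simp add: rs_add rs_rs)
      then show "y \<star> c \<in> {w + v \<star> a | w a. w \<in> H}" using Dsub_rs[OF H y(1)] by blast
    qed
    have "w \<in> {w + v \<star> a | w a. w \<in> H}" if "w \<in> H" for w
      using that by (intro CollectI exI[of _ w] exI[of _ 0]) (simp add: rs_zero)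
    moreover have "v \<in> {w + v \<star> a | w a. w \<in> H}"
      using Dsub_0[OF H] by (intro CollectI exI[of _ 0] exI[of _ 1]) (simp add: rs_1)
    moreover have "set hs \<subseteq> H" using b unfolding basis_def by blast
    ultimately show "set (hs @ [v]) \<subseteq> {w + v \<star> a | w a. w \<in> H}" by auto
    show "\<exists>f. y = comb (hs @ [v]) f" if yK: "y \<in> {w + v \<star> a | w a. w \<in> H}" for y
    proof -
      obtain w a where y: "w \<in> H" "y = w + v \<star> a" using yK by blast
      have "comb hs (\<lambda>i. if i < length hs then crd hs w i else a) = w"
        using comb_crd[OF b y(1)] by (simp cong: comb_cong)
      then show ?thesis unfolding y(2) by (intro exI[of _ "\<lambda>i. if i < length hs then crd hs w i else a"]) (simp add: app)
    qed
    fix g i assume g: "comb (hs @ [v]) g = 0" and i: "i < length (hs @ [v])"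
    have "v \<star> g (length hs) = - comb hs g" using g app[of g] by (simp add: eq_neg_iff_add_eq_0 add.commute)
    then have "v \<star> g (length hs) \<in> H" using basis_comb[OF b] Dsub_neg[OF H] by simp
    then have g0: "g (length hs) = 0" using Dsub_rs_iff[OF H, of "g (length hs)" v] v(2) by auto
    then have "comb hs g = 0" using g app[of g] by (simp add: rs_zero)
    then show "g i = 0" using basis_indep[OF b] g0 i by (cases "i = length hs") auto
  qed
qed

lemma basis_extend:
  assumes "basis H hs" "Dsub E" "H \<subseteq> E" "V.fdim (n * d) E"
  shows "\<exists>vs. basis E (hs @ vs)"
  using assms
proof (induction "n - length hs" arbitrary: H hs rule: less_induct)
  case less
  show ?case
  proof (cases "H = E")
    case True
    then show ?thesis using less.prems(1) by (intro exI[of _ "[]"]) simp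
  next
    case False
    then obtain v where v: "v \<in> E" "v \<notin> H" using less.prems(3) by blast
    define K where "K = {w + v \<star> a | w a. w \<in> H}"
    have K: "basis K (hs @ [v])" "K \<subseteq> E"
      using basis_extend_one[OF less.prems(1,2,3) v] unfolding K_def by auto
    have "length (hs @ [v]) * d \<le> n * d" using V.fdim_le[OF less.prems(4) basis_dim[OF K(1)] K(2)] .
    then have "length hs < n" using d_pos mult_le_cancel2[of "Suc (length hs)" d n] by simp
    then have "n - length (hs @ [v]) < n - length hs" by simp
    from less.hyps[OF this K(1) less.prems(2) K(2) less.prems(4)]
    obtain vs where "basis E ((hs @ [v]) @ vs)" by blast
    then show ?thesis by (intro exI[of _ "v # vs"]) simp
  qed
qed

end

section \<open>Operators and matrix spaces\<close>

lemma semiring_mat_ring: "semiring (mat_ring n :: 'd :: division_ring mat ring)"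
  by (rule semiring_mat)

lemma monoid_mat_ring: "Group.monoid (mat_ring n :: 'd :: division_ring mat ring)"
  using semiring_mat_ring by (rule semiring.axioms)

lemma mat_ring_simps:
  "carrier (mat_ring n) = carrier_mat n n" "mult (mat_ring n) = (*)" "one (mat_ring n) = 1\<^sub>m n"
  "zero (mat_ring n) = 0\<^sub>m n n" "add (mat_ring n) = (+)"
  by (simp_all add: ring_mat_def)

lemma GL_carrier: "P \<in> GL n \<Longrightarrow> P \<in> carrier_mat n n"
  using monoid.Units_closed[OF monoid_mat_ring] by (metis mat_ring_simps(1))

lemma GL_inv: assumes "P \<in> GL n"
  shows "inv\<^bsub>mat_ring n\<^esub> P \<in> carrier_mat n n" "inv\<^bsub>mat_ring n\<^esub> P * P = 1\<^sub>m n" "P * inv\<^bsub>mat_ring n\<^esub> P = 1\<^sub>m n"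
  using monoid.Units_inv_closed[OF monoid_mat_ring assms] monoid.Units_l_inv[OF monoid_mat_ring assms]
    monoid.Units_r_inv[OF monoid_mat_ring assms] by (simp_all add: mat_ring_simps)

lemma GL_I:
  assumes "P \<in> carrier_mat n n" "Q \<in> carrier_mat n n" "Q * P = 1\<^sub>m n" "P * Q = 1\<^sub>m n"
  shows "P \<in> GL n"
  unfolding Units_def mat_ring_simps using assms by blast

lemma GL_inv_GL: "P \<in> GL n \<Longrightarrow> inv\<^bsub>mat_ring n\<^esub> P \<in> GL n"
  by (rule monoid.Units_inv_Units[OF monoid_mat_ring])

lemma GL_mult: "P \<in> GL n \<Longrightarrow> Q \<in> GL n \<Longrightarrow> P * Q \<in> GL n"
  using monoid.Units_m_closed[OF monoid_mat_ring, of P n Q] by (simp add: mat_ring_simps)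

lemma GL_cancel: "P \<in> GL n \<Longrightarrow> L \<in> carrier_mat n k \<Longrightarrow> inv\<^bsub>mat_ring n\<^esub> P * (P * L) = L"
  and GL_cancel': "P \<in> GL n \<Longrightarrow> L \<in> carrier_mat n k \<Longrightarrow> P * (inv\<^bsub>mat_ring n\<^esub> P * L) = L"
  by (simp_all add: GL_inv GL_carrier flip: assoc_mult_mat[of _ n n _ n _ k])

section \<open>Operators attached to matrices\<close>

context quad_space
begin

text \<open>Matrices act on coordinate columns from the left and commute with scalars acting from
  the right, hence the right spaces.\<close>

definition op_of :: "'v list \<Rightarrow> 'v set \<Rightarrow> 'd mat \<Rightarrow> 'v \<Rightarrow> 'v" where
  "op_of bs E M = (\<lambda>v. if v \<in> E then comb bs (\<lambda>i. \<Sum>j<length bs. M $$ (i, j) * crd bs v j) else 0)"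

definition ops :: "'v list \<Rightarrow> 'v set \<Rightarrow> 'd mat set \<Rightarrow> ('v \<Rightarrow> 'v) set" where
  "ops bs E J = op_of bs E ` J"

definition mat_of :: "'v list \<Rightarrow> ('v \<Rightarrow> 'v) \<Rightarrow> 'd mat" where
  "mat_of bs N = mat (length bs) (length bs) (\<lambda>(i, j). crd bs (N (bs ! j)) i)"

lemma mat_of_carrier: "mat_of bs N \<in> carrier_mat (length bs) (length bs)"
  by (simp add: mat_of_def)

lemma op_of_crd: "basis E bs \<Longrightarrow> v \<in> E \<Longrightarrow> i < length bs \<Longrightarrow>
    crd bs (op_of bs E M v) i = (\<Sum>j<length bs. M $$ (i, j) * crd bs v j)"
  by (rule crd_eqI) (simp_all add: op_of_def)

lemma op_of_End: assumes b: "basis E bs" shows "op_of bs E M \<in> End E"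
  unfolding End_def mem_Collect_eq
proof (intro conjI ballI allI impI)
  have E: "Dsub E" by (rule basis_Dsub[OF b])
  show "op_of bs E M v \<in> E" if "v \<in> E" for v using basis_comb[OF b] that by (simp add: op_of_def)
  show "op_of bs E M v = 0" if "v \<notin> E" for v using that by (simp add: op_of_def)
  show "op_of bs E M (v + w) = op_of bs E M v + op_of bs E M w" if vw: "v \<in> E" "w \<in> E" for v w
    using vw Dsub_add[OF E vw] unfolding op_of_def
    by (simp add: crd_add[OF b vw] distrib_left sum.distrib comb_add[symmetric])
  show "op_of bs E M (v \<star> a) = op_of bs E M v \<star> a" if v: "v \<in> E" for v a
    using v Dsub_rs[OF E v, of a] unfolding op_of_def
    by (simp add: crd_rs[OF b v] comb_rs sum_distrib_right mult.assoc)
qed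

lemma End_comb: assumes "N \<in> End E" "Dsub E" "set bs \<subseteq> E" shows "N (comb bs f) = (\<Sum>j<length bs. N (bs ! j) \<star> f j)"
proof -
  have "(\<Sum>j\<in>I. bs ! j \<star> f j) \<in> E \<and> N (\<Sum>j\<in>I. bs ! j \<star> f j) = (\<Sum>j\<in>I. N (bs ! j) \<star> f j)" if "I \<subseteq> {..<length bs}" for I
    using finite_subset[OF that] that
  proof (induction I rule: infinite_finite_induct)
    case (insert i I)
    then have "bs ! i \<in> E" using assms(3) by (auto simp: subset_iff)
    then show ?case using insert assms(1,2) by (simp add: Dsub_cl End_add End_rs)
  qed (use assms End_0 in \<open>auto simp: Dsub_cl\<close>)
  then show ?thesis unfolding comb_def by blast
qed

lemma End_basis_eqI:
  assumes b: "basis E bs" and "M \<in> End E" "N \<in> End E" "\<And>j. j < length bs \<Longrightarrow> M (bs ! j) = N (bs ! j)"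
  shows "M = N"
proof (rule End_eqI[OF assms(2,3)])
  fix v assume v: "v \<in> E"
  have s: "set bs \<subseteq> E" using b unfolding basis_def by blast
  have "M (comb bs (crd bs v)) = N (comb bs (crd bs v))"
    unfolding End_comb[OF assms(2) basis_Dsub[OF b] s] End_comb[OF assms(3) basis_Dsub[OF b] s]
    using assms(4) by simp
  then show "M v = N v" by (simp add: comb_crd[OF b v])
qed

lemma op_of_basis:
  assumes b: "basis E bs" and j: "j < length bs"
  shows "op_of bs E M (bs ! j) = comb bs (\<lambda>i. M $$ (i, j))"
proof -
  have "(\<Sum>l<length bs. M $$ (i, l) * crd bs (bs ! j) l) = M $$ (i, j)" for i
  proof -
    have "(\<Sum>l<length bs. M $$ (i, l) * crd bs (bs ! j) l) = (\<Sum>l\<in>{j}. M $$ (i, l) * crd bs (bs ! j) l)"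
      using j crd_basis[OF b j] by (intro sum.mono_neutral_right) auto
    then show ?thesis using crd_basis[OF b j j] by simp
  qed
  then show ?thesis using basis_mem[OF b j] by (simp add: op_of_def)
qed

lemma mat_of_op: assumes b: "basis E bs" and M: "M \<in> carrier_mat (length bs) (length bs)"
  shows "mat_of bs (op_of bs E M) = M"
proof (rule eq_matI)
  fix i j assume "i < dim_row M" "j < dim_col M"
  then have ij: "i < length bs" "j < length bs" using M by auto
  then show "mat_of bs (op_of bs E M) $$ (i, j) = M $$ (i, j)"
    unfolding mat_of_def using crd_eqI[OF b op_of_basis[OF b ij(2)] ij(1)] by simp
qed (use M in \<open>simp_all add: mat_of_def\<close>)

lemma op_of_mat: assumes b: "basis E bs" and N: "N \<in> End E" shows "op_of bs E (mat_of bs N) = N"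
proof (rule End_basis_eqI[OF b op_of_End[OF b] N])
  fix j assume j: "j < length bs"
  have "op_of bs E (mat_of bs N) (bs ! j) = comb bs (\<lambda>i. mat_of bs N $$ (i, j))" by (rule op_of_basis[OF b j])
  also have "\<dots> = comb bs (crd bs (N (bs ! j)))" using j by (intro comb_cong) (simp add: mat_of_def)
  also have "\<dots> = N (bs ! j)" by (rule comb_crd[OF b End_mem[OF N basis_mem[OF b j]]])
  finally show "op_of bs E (mat_of bs N) (bs ! j) = N (bs ! j)" .
qed

lemma mem_ops:
  assumes b: "basis E bs" and N: "N \<in> End E" and J: "J \<subseteq> carrier_mat (length bs) (length bs)"
  shows "N \<in> ops bs E J \<longleftrightarrow> mat_of bs N \<in> J"
proof
  assume "N \<in> ops bs E J"
  then obtain M where M: "M \<in> J" "N = op_of bs E M" unfolding ops_def by (rule imageE)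
  have "M \<in> carrier_mat (length bs) (length bs)" using J M(1) by (rule subsetD)
  then show "mat_of bs N \<in> J" using mat_of_op[OF b] M by simp
next
  assume "mat_of bs N \<in> J"
  then have "op_of bs E (mat_of bs N) \<in> ops bs E J" unfolding ops_def by (rule imageI)
  then show "N \<in> ops bs E J" unfolding op_of_mat[OF b N] .
qed

lemma ops_End: "basis E bs \<Longrightarrow> ops bs E J \<subseteq> End E"
  unfolding ops_def using op_of_End by blast

lemma crd_End: "basis E bs \<Longrightarrow> N \<in> End E \<Longrightarrow> v \<in> E \<Longrightarrow> i < length bs \<Longrightarrow>
    crd bs (N v) i = (\<Sum>j<length bs. mat_of bs N $$ (i, j) * crd bs v j)"
  using op_of_crd[of E bs v i "mat_of bs N"] op_of_mat[of E bs N] by simp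

lemma op_of_mult:
  assumes b: "basis E bs" and M: "M \<in> carrier_mat (length bs) (length bs)" "N \<in> carrier_mat (length bs) (length bs)"
    and v: "v \<in> E"
  shows "op_of bs E (M * N) v = op_of bs E M (op_of bs E N v)"
proof -
  have m: "op_of bs E N v \<in> E" using End_mem[OF op_of_End[OF b] v] .
  have "(\<Sum>j<length bs. (M * N) $$ (i, j) * crd bs v j) = (\<Sum>j<length bs. M $$ (i, j) * crd bs (op_of bs E N v) j)"
    if i: "i < length bs" for i
  proof -
    have "(\<Sum>j<length bs. (M * N) $$ (i, j) * crd bs v j) = (\<Sum>j<length bs. (\<Sum>l<length bs. M $$ (i, l) * N $$ (l, j)) * crd bs v j)"
      by (intro sum.cong refl) (simp only: mat_mult_entry[OF M i] lessThan_iff)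
    also have "\<dots> = (\<Sum>l<length bs. \<Sum>j<length bs. M $$ (i, l) * (N $$ (l, j) * crd bs v j))"
      unfolding sum_distrib_right mult.assoc by (rule sum.swap)
    also have "\<dots> = (\<Sum>l<length bs. M $$ (i, l) * crd bs (op_of bs E N v) l)"
      by (intro sum.cong refl) (simp add: op_of_crd[OF b v] sum_distrib_left)
    finally show ?thesis .
  qed
  then show ?thesis using v m by (simp add: op_of_def[of bs E "M * N"] op_of_def[of bs E M] cong: comb_cong)
qed

lemma op_of_one: assumes b: "basis E bs" and v: "v \<in> E" shows "op_of bs E (1\<^sub>m (length bs)) v = v"
proof -
  have "(\<Sum>j<length bs. 1\<^sub>m (length bs) $$ (i, j) * crd bs v j) = crd bs v i" if i: "i < length bs" for i
  proof -
    have "(\<Sum>j<length bs. 1\<^sub>m (length bs) $$ (i, j) * crd bs v j) = (\<Sum>j\<in>{i}. 1\<^sub>m (length bs) $$ (i, j) * crd bs v j)"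
      using i by (intro sum.mono_neutral_right) auto
    then show ?thesis using i by simp
  qed
  then have "op_of bs E (1\<^sub>m (length bs)) v = comb bs (crd bs v)" using v by (simp add: op_of_def cong: comb_cong)
  then show ?thesis by (simp add: comb_crd[OF b v])
qed

lemma op_of_diff:
  assumes "M \<in> carrier_mat (length bs) (length bs)" "N \<in> carrier_mat (length bs) (length bs)"
  shows "op_of bs E (M - N) v = op_of bs E M v - op_of bs E N v"
proof -
  have "comb bs (\<lambda>i. \<Sum>j<length bs. (M - N) $$ (i, j) * crd bs v j) =
    comb bs (\<lambda>i. (\<Sum>j<length bs. M $$ (i, j) * crd bs v j) - (\<Sum>j<length bs. N $$ (i, j) * crd bs v j))"
    using assms by (intro comb_cong) (simp add: left_diff_distrib sum_subtractf)
  then show ?thesis by (simp add: op_of_def comb_diff)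
qed

lemma op_of_add:
  assumes "M \<in> carrier_mat (length bs) (length bs)" "N \<in> carrier_mat (length bs) (length bs)"
  shows "op_of bs E (M + N) v = op_of bs E M v + op_of bs E N v"
proof -
  have "comb bs (\<lambda>i. \<Sum>j<length bs. (M + N) $$ (i, j) * crd bs v j) =
    comb bs (\<lambda>i. (\<Sum>j<length bs. M $$ (i, j) * crd bs v j) + (\<Sum>j<length bs. N $$ (i, j) * crd bs v j))"
    using assms by (intro comb_cong) (simp add: distrib_right sum.distrib)
  then show ?thesis by (simp add: op_of_def comb_add)
qed

lemma op_of_smult:
  assumes "M \<in> carrier_mat (length bs) (length bs)" "a \<in> F"
  shows "op_of bs E (a \<cdot>\<^sub>m M) v = op_of bs E M v \<star> a"
proof -
  have "comb bs (\<lambda>i. \<Sum>j<length bs. (a \<cdot>\<^sub>m M) $$ (i, j) * crd bs v j) =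
    comb bs (\<lambda>i. (\<Sum>j<length bs. M $$ (i, j) * crd bs v j) * a)"
  proof (rule comb_cong)
    fix i assume i: "i < length bs"
    have "(\<Sum>j<length bs. (a \<cdot>\<^sub>m M) $$ (i, j) * crd bs v j) = a * (\<Sum>j<length bs. M $$ (i, j) * crd bs v j)"
      using assms(1) i by (simp add: sum_distrib_left mult.assoc)
    then show "(\<Sum>j<length bs. (a \<cdot>\<^sub>m M) $$ (i, j) * crd bs v j) = (\<Sum>j<length bs. M $$ (i, j) * crd bs v j) * a"
      using F_comm[OF assms(2)] by simp
  qed
  then show ?thesis by (simp add: op_of_def comb_rs rs_0)
qed

text \<open>An injective operator is surjective by dimension. The columns of Q are the coordinates
  of preimages of the basis vectors.\<close>

lemma inj_right_inverse:
  assumes b: "basis E bs" and M: "M \<in> carrier_mat (length bs) (length bs)"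
    and inj: "\<And>v. v \<in> E \<Longrightarrow> op_of bs E M v = 0 \<Longrightarrow> v = 0"
  shows "\<exists>Q\<in>carrier_mat (length bs) (length bs). M * Q = 1\<^sub>m (length bs)"
proof -
  interpret VV: fspace2 F "\<lambda>a v. v \<star> a" "\<lambda>a v. v \<star> a" ..
  note ME = op_of_End[OF b, of M]
  have l: "VV.lin E (op_of bs E M)" unfolding VV.lin_def
    by (intro conjI ballI) (simp_all add: End_add[OF ME] End_rs[OF ME])
  have im: "V.fdim (length bs * d) (op_of bs E M ` E)"
    by (rule VV.fdim_inj_image[OF basis_dim[OF b] l]) (rule inj)
  have "op_of bs E M ` E \<subseteq> E" using End_mem[OF ME] by (rule image_subsetI)
  from V.fdim_eq[OF basis_dim[OF b] im this] have surj: "op_of bs E M ` E = E" .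
  have "\<forall>j. \<exists>x. j < length bs \<longrightarrow> x \<in> E \<and> op_of bs E M x = bs ! j"
  proof
    fix j
    show "\<exists>x. j < length bs \<longrightarrow> x \<in> E \<and> op_of bs E M x = bs ! j"
    proof (cases "j < length bs")
      case True
      have "bs ! j \<in> op_of bs E M ` E" unfolding surj by (rule basis_mem[OF b True])
      then obtain x where "bs ! j = op_of bs E M x" "x \<in> E" by (rule imageE)
      then show ?thesis by (intro exI[of _ x]) simp
    qed simp
  qed
  then obtain x where x: "\<forall>j. j < length bs \<longrightarrow> x j \<in> E \<and> op_of bs E M (x j) = bs ! j" by (rule choice[THEN exE])
  define Q where "Q = mat (length bs) (length bs) (\<lambda>(i, j). crd bs (x j) i)"
  have Q: "Q \<in> carrier_mat (length bs) (length bs)" by (simp add: Q_def)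
  have "M * Q = 1\<^sub>m (length bs)"
  proof (rule eq_matI)
    fix i j assume "i < dim_row (1\<^sub>m (length bs) :: 'd mat)" "j < dim_col (1\<^sub>m (length bs) :: 'd mat)"
    then have ij: "i < length bs" "j < length bs" by simp_all
    have "(M * Q) $$ (i, j) = (\<Sum>l<length bs. M $$ (i, l) * Q $$ (l, j))" by (rule mat_mult_entry[OF M Q ij])
    also have "\<dots> = (\<Sum>l<length bs. M $$ (i, l) * crd bs (x j) l)" using ij by (simp add: Q_def)
    also have "\<dots> = crd bs (bs ! j) i" using op_of_crd[OF b _ ij(1), of "x j" M] x ij(2) by simp
    finally show "(M * Q) $$ (i, j) = 1\<^sub>m (length bs) $$ (i, j)" using crd_basis[OF b ij(2,1)] ij by simp
  qed (use M Q in auto)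
  then show ?thesis using Q by blast
qed

text \<open>A right inverse Q of M is injective, so it has a right inverse R in turn; then R = M,
  and Q is a two-sided inverse. With noncommuting entries this takes the place of
  determinants.\<close>

lemma GL_iff_inj:
  assumes b: "basis E bs" and M: "M \<in> carrier_mat (length bs) (length bs)"
  shows "M \<in> GL (length bs) \<longleftrightarrow> (\<forall>v\<in>E. op_of bs E M v = 0 \<longrightarrow> v = 0)"
proof
  assume "M \<in> GL (length bs)"
  note i = GL_inv[OF this]
  have z: "op_of bs E (inv\<^bsub>mat_ring (length bs)\<^esub> M) 0 = 0" by (rule End_0[OF op_of_End[OF b]])
  show "\<forall>v\<in>E. op_of bs E M v = 0 \<longrightarrow> v = 0"
    using op_of_mult[OF b i(1) M] op_of_one[OF b] unfolding i(2) by (metis z)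
next
  assume inj: "\<forall>v\<in>E. op_of bs E M v = 0 \<longrightarrow> v = 0"
  from inj_right_inverse[OF b M] inj obtain Q where
    Q: "Q \<in> carrier_mat (length bs) (length bs)" "M * Q = 1\<^sub>m (length bs)" by blast
  have z: "op_of bs E M 0 = 0" by (rule End_0[OF op_of_End[OF b]])
  have "\<exists>R\<in>carrier_mat (length bs) (length bs). Q * R = 1\<^sub>m (length bs)"
  proof (rule inj_right_inverse[OF b Q(1)])
    show "v = 0" if "v \<in> E" "op_of bs E Q v = 0" for v
      using op_of_mult[OF b M Q(1) that(1)] op_of_one[OF b that(1)] that(2) z unfolding Q(2) by simp
  qed
  then obtain R where R: "R \<in> carrier_mat (length bs) (length bs)" "Q * R = 1\<^sub>m (length bs)" by blast
  have "M = M * (Q * R)" unfolding R(2) using M by simp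
  also have "\<dots> = (M * Q) * R" using assoc_mult_mat[OF M Q(1) R(1)] by simp
  also have "\<dots> = R" unfolding Q(2) using R(1) by simp
  finally have "Q * M = 1\<^sub>m (length bs)" using R(2) by simp
  then show "M \<in> GL (length bs)" by (rule GL_I[OF M Q(1) _ Q(2)])
qed

end

section \<open>The coordinate space and invertible matrices\<close>

definition unit_vecs :: "nat \<Rightarrow> (nat \<Rightarrow> 'd :: division_ring) list" where
  "unit_vecs n = map (\<lambda>j i. if i = j then 1 else 0) [0..<n]"

lemma length_unit_vecs [simp]: "length (unit_vecs n) = n"
  by (simp add: unit_vecs_def)

definition coord_space :: "nat \<Rightarrow> (nat \<Rightarrow> 'd :: division_ring) set" where
  "coord_space n = {v. \<forall>i\<ge>n. v i = 0}"

context quad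
begin

sublocale S: quad_space F d \<sigma> e "\<lambda>v a i. v i * a :: 'd"
  by unfold_locales (auto simp: fun_eq_iff algebra_simps)

lemma unit_vecs_comb: "S.comb (unit_vecs n) f = (\<lambda>i. if i < n then f i else 0)"
proof
  fix i
  have s: "(sum g I) i = (\<Sum>j\<in>I. g j i)" for g :: "nat \<Rightarrow> nat \<Rightarrow> 'd" and I
    by (induction I rule: infinite_finite_induct) auto
  have "S.comb (unit_vecs n) f i = (\<Sum>j<n. (if i = j then 1 else 0) * f j)"
    unfolding S.comb_def s by (simp add: unit_vecs_def)
  also have "\<dots> = (if i < n then f i else 0)" by (simp add: if_distrib[of "\<lambda>x. x * _"] cong: if_cong)
  finally show "S.comb (unit_vecs n) f i = (if i < n then f i else 0)" .
qed

lemma unit_vecs_basis: "S.basis (coord_space n) (unit_vecs n)"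
  unfolding S.basis_def
proof (intro conjI ballI allI impI)
  show "S.Dsub (coord_space n)" by (auto simp: S.Dsub_def coord_space_def)
  show "set (unit_vecs n) \<subseteq> coord_space n" by (auto simp: unit_vecs_def coord_space_def)
  show "\<exists>f. v = S.comb (unit_vecs n) f" if "v \<in> coord_space n" for v
    using that by (intro exI[of _ v]) (auto simp: unit_vecs_comb coord_space_def fun_eq_iff)
  show "f i = 0" if "S.comb (unit_vecs n) f = 0" "i < length (unit_vecs n)" for f i
    using fun_cong[OF that(1), of i] that(2) by (simp add: unit_vecs_comb)
qed

lemma unit_vecs_crd: "v \<in> coord_space n \<Longrightarrow> i < n \<Longrightarrow> S.crd (unit_vecs n) v i = v i"
  by (rule S.crd_eqI[OF unit_vecs_basis]) (auto simp: unit_vecs_comb coord_space_def fun_eq_iff)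

lemma GL_I_inj:
  fixes M :: "'d mat" and n :: nat
  assumes M: "M \<in> carrier_mat n n"
    and inj: "\<And>y. (\<And>i. i < n \<Longrightarrow> (\<Sum>j<n. M $$ (i, j) * y j) = 0) \<Longrightarrow> \<forall>j<n. y j = 0"
  shows "M \<in> GL n"
proof -
  have "v = 0" if v: "v \<in> coord_space n" "S.op_of (unit_vecs n) (coord_space n) M v = 0" for v
  proof -
    have "(\<Sum>j<n. M $$ (i, j) * v j) = 0" if i: "i < n" for i
    proof -
      have z: "(0 :: nat \<Rightarrow> 'd) \<in> coord_space n" by (simp add: coord_space_def)
      have "S.crd (unit_vecs n) (S.op_of (unit_vecs n) (coord_space n) M v) i = (\<Sum>j<n. M $$ (i, j) * S.crd (unit_vecs n) v j)"
        using S.op_of_crd[OF unit_vecs_basis v(1), of i M] i by simp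
      also have "\<dots> = (\<Sum>j<n. M $$ (i, j) * v j)" by (intro sum.cong refl) (simp add: unit_vecs_crd[OF v(1)])
      finally show ?thesis unfolding v(2) unit_vecs_crd[OF z i] by simp
    qed
    from inj[OF this] have "v x = 0" for x using v(1) by (cases "x < n") (auto simp: coord_space_def)
    then show "v = 0" by (simp add: fun_eq_iff)
  qed
  then show ?thesis using S.GL_iff_inj[OF unit_vecs_basis, of M n] M by simp
qed

lemma GL_D_inj:
  fixes M :: "'d mat" and n :: nat
  assumes M: "M \<in> GL n" and y: "\<And>i. i < n \<Longrightarrow> (\<Sum>j<n. M $$ (i, j) * y j) = 0" and j: "j < n"
  shows "y j = 0"
proof -
  have MC: "M \<in> carrier_mat n n" by (rule GL_carrier[OF M])
  define Y where "Y = mat n 1 (\<lambda>(i, j). y i)"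
  have Y: "Y \<in> carrier_mat n 1" by (simp add: Y_def)
  have "M * Y = 0\<^sub>m n 1"
  proof (rule eq_matI)
    fix i k assume "i < dim_row (0\<^sub>m n 1 :: 'd mat)" "k < dim_col (0\<^sub>m n 1 :: 'd mat)"
    then have ik: "i < n" "k < 1" by simp_all
    have "(M * Y) $$ (i, k) = (\<Sum>l<n. M $$ (i, l) * Y $$ (l, k))" by (rule mat_mult_entry[OF MC Y ik])
    also have "\<dots> = (\<Sum>l<n. M $$ (i, l) * y l)" using ik by (simp add: Y_def)
    finally show "(M * Y) $$ (i, k) = 0\<^sub>m n 1 $$ (i, k)" using y[OF ik(1)] ik by simp
  qed (use MC Y in auto)
  then have "Y = inv\<^bsub>mat_ring n\<^esub> M * 0\<^sub>m n 1" using GL_cancel[OF M Y] by simp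
  also have "\<dots> = 0\<^sub>m n 1" using GL_inv(1)[OF M] by simp
  finally have "Y $$ (j, 0) = 0" using j by simp
  then show ?thesis using j by (simp add: Y_def)
qed

lemma GL_factor:
  fixes L R :: "'d mat"
  assumes "L \<in> carrier_mat n n" "R \<in> carrier_mat n n" "L * R \<in> GL n"
  shows "L \<in> GL n" "R \<in> GL n"
proof -
  show R: "R \<in> GL n"
  proof (rule GL_I_inj[OF assms(2)])
    fix y assume y: "\<And>i. i < n \<Longrightarrow> (\<Sum>j<n. R $$ (i, j) * y j) = 0"
    have "(\<Sum>j<n. (L * R) $$ (i, j) * y j) = 0" if i: "i < n" for i
    proof -
      have "(\<Sum>j<n. (L * R) $$ (i, j) * y j) = (\<Sum>j<n. (\<Sum>l<n. L $$ (i, l) * R $$ (l, j)) * y j)"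
        by (intro sum.cong refl) (simp only: mat_mult_entry[OF assms(1,2) i] lessThan_iff)
      also have "\<dots> = (\<Sum>l<n. \<Sum>j<n. L $$ (i, l) * (R $$ (l, j) * y j))"
        unfolding sum_distrib_right mult.assoc by (rule sum.swap)
      also have "\<dots> = (\<Sum>l<n. L $$ (i, l) * (\<Sum>j<n. R $$ (l, j) * y j))" by (simp add: sum_distrib_left)
      finally show ?thesis using y by simp
    qed
    then show "\<forall>j<n. y j = 0" using GL_D_inj[OF assms(3)] by blast
  qed
  have "L = (L * R) * inv\<^bsub>mat_ring n\<^esub> R"
    using assoc_mult_mat[OF assms(1,2) GL_inv(1)[OF R]] GL_inv(3)[OF R] assms(1) by simp
  then show "L \<in> GL n" using GL_mult[OF assms(3) GL_inv_GL[OF R]] by simp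
qed

text \<open>A nonzero vector killed by P would be isotropic.\<close>

lemma nonisotropic_GL: assumes "nonisotropic \<sigma> e m P" shows "P \<in> GL m"
proof (rule GL_I_inj)
  show P: "P \<in> carrier_mat m m" using assms by (simp add: nonisotropic_def)
  fix y assume y: "\<And>i. i < m \<Longrightarrow> (\<Sum>j<m. P $$ (i, j) * y j) = 0"
  have "qform m P y = (\<Sum>i<m. \<sigma> (y i) * (\<Sum>j<m. P $$ (i, j) * y j))"
    unfolding qform_def by (simp add: sum_distrib_left mult.assoc)
  also have "\<dots> = 0" using y by simp
  finally have "e (qform m P y) = 0" by (simp add: e_0)
  then show "\<forall>j<m. y j = 0" using assms unfolding nonisotropic_iff[OF P] by blast
qed

end

section \<open>Splitting off the last block of a joint of skew spaces\<close>

context quad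
begin

lemma SH_carrier: "SH \<sigma> e m \<subseteq> carrier_mat m m"
  by (auto simp: SH_def)

lemma GL_SH_iff:
  assumes "P \<in> GL m" "L \<in> carrier_mat m m"
  shows "L \<in> (\<lambda>M. inv\<^bsub>mat_ring m\<^esub> P * M) ` SH \<sigma> e m \<longleftrightarrow> P * L \<in> SH \<sigma> e m"
proof
  assume "L \<in> (\<lambda>M. inv\<^bsub>mat_ring m\<^esub> P * M) ` SH \<sigma> e m"
  then obtain M where M: "L = inv\<^bsub>mat_ring m\<^esub> P * M" "M \<in> SH \<sigma> e m" by (rule imageE)
  have "P * L = M" unfolding M(1) by (rule GL_cancel'[OF assms(1)]) (use M(2) SH_carrier in blast)
  then show "P * L \<in> SH \<sigma> e m" using M(2) by simp
next
  assume a: "P * L \<in> SH \<sigma> e m"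
  show "L \<in> (\<lambda>M. inv\<^bsub>mat_ring m\<^esub> P * M) ` SH \<sigma> e m"
    by (rule image_eqI[OF _ a]) (simp add: GL_cancel[OF assms])
qed

lemma nonisotropic_list_snoc:
  assumes "length Ps = length ns"
  shows "nonisotropic_list \<sigma> e (ns @ [m]) (Ps @ [P]) \<longleftrightarrow> nonisotropic_list \<sigma> e ns Ps \<and> P \<in> GL m \<and> nonisotropic \<sigma> e m P"
proof -
  have "(Ps @ [P]) ! length ns = P" using assms[symmetric] by simp
  moreover have "(\<forall>i<length ns. (Ps @ [P]) ! i \<in> GL ((ns @ [m]) ! i) \<and> nonisotropic \<sigma> e ((ns @ [m]) ! i) ((Ps @ [P]) ! i))
    \<longleftrightarrow> (\<forall>i<length ns. Ps ! i \<in> GL (ns ! i) \<and> nonisotropic \<sigma> e (ns ! i) (Ps ! i))"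
    using assms by (simp add: nth_append)
  ultimately show ?thesis using assms unfolding nonisotropic_list_def by (auto simp: All_less_Suc)
qed

lemma SH_joint_carrier: "SH_joint \<sigma> e ns Ps \<subseteq> carrier_mat (sum_list ns) (sum_list ns)"
  by (auto simp: SH_joint_def joint_def)

lemma SH_joint_snoc:
  assumes len: "length Ps = length ns" and M: "M \<in> carrier_mat (sum_list ns + m) (sum_list ns + m)" and P: "P \<in> GL m"
  defines "h \<equiv> sum_list ns"
  shows "M \<in> SH_joint \<sigma> e (ns @ [m]) (Ps @ [P]) \<longleftrightarrow>
    mat h h (\<lambda>(i, j). M $$ (i, j)) \<in> SH_joint \<sigma> e ns Ps \<and> P * mat m m (\<lambda>(i, j). M $$ (h + i, h + j)) \<in> SH \<sigma> e m \<and>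
    (\<forall>i<m. \<forall>j<h. M $$ (h + i, j) = 0)"
proof -
  define C where "C = (\<lambda>M. inv\<^bsub>mat_ring m\<^esub> P * M) ` SH \<sigma> e m"
  have C: "C \<subseteq> carrier_mat m m" unfolding C_def
    by (rule image_subsetI) (rule mult_carrier_mat[OF GL_inv(1)[OF P] subsetD[OF SH_carrier]])
  have eq: "SH_joint \<sigma> e (ns @ [m]) (Ps @ [P]) = joint (ns @ [m]) (map2 (\<lambda>k P. (\<lambda>M. inv\<^bsub>mat_ring k\<^esub> P * M) ` SH \<sigma> e k) ns Ps @ [C])"
    unfolding SH_joint_def C_def using len by simp
  have L: "mat m m (\<lambda>(i, j). M $$ (h + i, h + j)) \<in> carrier_mat m m" by simp
  have l: "length (map2 (\<lambda>k P. (\<lambda>M. inv\<^bsub>mat_ring k\<^esub> P * M) ` SH \<sigma> e k) ns Ps) = length ns" using len by simp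
  show ?thesis unfolding eq unfolding joint_snoc[OF l M C, folded h_def]
    unfolding C_def GL_SH_iff[OF P L] SH_joint_def ..
qed

end

section \<open>Joints as structured spaces\<close>

context quad_space
begin

text \<open>The sesquilinear form with Gram matrix P on the last m basis vectors, extended by zero
  to the first h.\<close>

definition block_form :: "'v list \<Rightarrow> nat \<Rightarrow> nat \<Rightarrow> 'd mat \<Rightarrow> 'v \<Rightarrow> 'v \<Rightarrow> 'd" where
  "block_form bs h m P v w = (\<Sum>i<m. \<Sum>j<m. \<sigma> (crd bs v (h + i)) * P $$ (i, j) * crd bs w (h + j))"

lemma block_form_on:
  assumes b: "basis E (hs @ vs)" and P: "nonisotropic \<sigma> e (length vs) P" and vs: "vs \<noteq> []"
  shows "form_on E (range (comb hs)) (block_form (hs @ vs) (length hs) (length vs) P)"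
proof -
  define bs h m H where "bs = hs @ vs" and "h = length hs" and "m = length vs" and "H = range (comb hs)"
  have b: "basis E bs" using b unfolding bs_def .
  have H: "H = {v \<in> E. \<forall>i<m. crd bs v (h + i) = 0}"
    using basis_take(3)[OF assms(1)] unfolding bs_def h_def m_def H_def by simp
  have n: "length bs = h + m" by (simp add: bs_def h_def m_def)
  have PC: "P \<in> carrier_mat m m" using P unfolding nonisotropic_def m_def by blast
  have "form_on E H (block_form bs h m P)" unfolding form_on_def sesq_def
  proof (intro conjI ballI allI impI)
    show "Dsub H" using basis_take(1)[OF assms(1)] basis_Dsub unfolding H bs_def h_def m_def by blast
    show "H \<subset> E"
    proof -
      have "bs ! h \<in> E" using basis_mem[OF b, of h] n vs m_def by simp
      moreover have "crd bs (bs ! h) (h + 0) = 1" using crd_basis[OF b, of h h] n vs m_def by simp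
      ultimately have "bs ! h \<in> E - H" using vs m_def unfolding H by force
      then show ?thesis unfolding H by blast
    qed
    fix v w assume v: "v \<in> E" and w: "w \<in> E"
    show "block_form bs h m P (v \<star> a) w = \<sigma> a * block_form bs h m P v w" for a
      unfolding block_form_def sum_distrib_left
      by (intro sum.cong refl) (simp add: crd_rs[OF b v] n conj_mult mult.assoc)
    show "block_form bs h m P v (w \<star> a) = block_form bs h m P v w * a" for a
      unfolding block_form_def sum_distrib_right
      by (intro sum.cong refl) (simp add: crd_rs[OF b w] n mult.assoc)
    fix z assume z: "z \<in> E"
    show "block_form bs h m P (v + w) z = block_form bs h m P v z + block_form bs h m P w z"
      unfolding block_form_def sum.distrib[symmetric]
      by (intro sum.cong refl) (simp add: crd_add[OF b v w] n conj_add algebra_simps)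
    show "block_form bs h m P z (v + w) = block_form bs h m P z v + block_form bs h m P z w"
      unfolding block_form_def sum.distrib[symmetric]
      by (intro sum.cong refl) (simp add: crd_add[OF b v w] n algebra_simps)
  next
    fix v w assume v: "v \<in> H" and w: "w \<in> E"
    show "block_form bs h m P v w = 0" "block_form bs h m P w v = 0"
      using v unfolding block_form_def H by (simp_all add: conj_0)
  next
    fix v assume v: "v \<in> E" "v \<notin> H"
    have "block_form bs h m P v v = qform m P (\<lambda>i. crd bs v (h + i))"
      by (simp add: block_form_def qform_def)
    then show "e (block_form bs h m P v v) \<noteq> 0"
      using v P unfolding m_def[symmetric] nonisotropic_iff[OF PC] H by auto
  qed
  then show ?thesis unfolding bs_def h_def m_def H_def .
qed

lemma sum_offset: "(\<Sum>j<h + m. g j) = (\<Sum>j<h. g j) + (\<Sum>j<m. g (h + j))" for g :: "nat \<Rightarrow> 'd"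
  by (induction m) (simp_all add: add.assoc)

text \<open>The dictionary for one block: zero entries below the diagonal mean that H is preserved,
  the upper left part is the restriction to H, and by \<open>SH_iff\<close> membership of P * L in
  \<open>SH\<close> is orthogonality for the block form.\<close>

lemma ops_block:
  assumes b: "basis E (hs @ vs)" and ns: "sum_list ns = length hs" and len: "length Ps = length ns"
    and P: "P \<in> GL (length vs)"
  defines "H \<equiv> range (comb hs)"
  shows "N \<in> End E \<Longrightarrow> N \<in> ops (hs @ vs) E (SH_joint \<sigma> e (ns @ [length vs]) (Ps @ [P])) \<longleftrightarrow>
      (\<forall>v\<in>H. N v \<in> H) \<and> restr H N \<in> ops hs H (SH_joint \<sigma> e ns Ps) \<and>
      (\<forall>v\<in>E. e (block_form (hs @ vs) (length hs) (length vs) P v (N v)) = 0)" (is "_ \<Longrightarrow> ?I N")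
    and "restr H ` ops (hs @ vs) E (SH_joint \<sigma> e (ns @ [length vs]) (Ps @ [P])) = ops hs H (SH_joint \<sigma> e ns Ps)"
proof -
  define bs h m where "bs = hs @ vs" and "h = length hs" and "m = length vs"
  have bb: "basis E bs" using b unfolding bs_def .
  have H: "H = {v \<in> E. \<forall>i<m. crd bs v (h + i) = 0}"
    using basis_take(3)[OF b] unfolding bs_def h_def m_def H_def by simp
  have bH: "basis H hs" using basis_take(1)[OF b] unfolding H bs_def h_def m_def .
  have crdH: "crd bs v i = crd hs v i" if "v \<in> H" "i < h" for v i
    using basis_take(2)[OF b, of v i] that unfolding H bs_def h_def m_def by simp
  have n: "length bs = h + m" by (simp add: bs_def h_def m_def)
  have PC: "P \<in> carrier_mat m m" using GL_carrier[OF P] unfolding m_def .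
  have DH: "Dsub H" and HE: "H \<subseteq> E" using basis_Dsub[OF bH] unfolding H by auto
  have nth: "bs ! j = hs ! j" if "j < h" for j using that by (simp add: bs_def h_def nth_append)
  define J where "J = SH_joint \<sigma> e (ns @ [m]) (Ps @ [P])"
  define J0 where "J0 = SH_joint \<sigma> e ns Ps"
  have JC: "J \<subseteq> carrier_mat (length bs) (length bs)" using SH_joint_carrier[of "ns @ [m]" "Ps @ [P]"] ns n
    unfolding J_def h_def by simp
  have J0C: "J0 \<subseteq> carrier_mat (length hs) (length hs)" using SH_joint_carrier[of ns Ps] ns unfolding J0_def by simp
  have stab: "(\<forall>v\<in>H. N v \<in> H) \<longleftrightarrow> (\<forall>i<m. \<forall>j<h. mat_of bs N $$ (h + i, j) = 0)" if N: "N \<in> End E" for N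
  proof
    assume a: "\<forall>v\<in>H. N v \<in> H"
    show "\<forall>i<m. \<forall>j<h. mat_of bs N $$ (h + i, j) = 0"
    proof (intro allI impI)
      fix i j assume ij: "i < m" "j < h"
      have "N (bs ! j) \<in> H" using a basis_mem[OF bH, of j] nth[OF ij(2)] ij(2) h_def by simp
      then show "mat_of bs N $$ (h + i, j) = 0" using ij n by (simp add: mat_of_def H)
    qed
  next
    assume a: "\<forall>i<m. \<forall>j<h. mat_of bs N $$ (h + i, j) = 0"
    show "\<forall>v\<in>H. N v \<in> H"
    proof
      fix v assume v: "v \<in> H"
      have vE: "v \<in> E" using v HE by blast
      have "crd bs (N v) (h + i) = 0" if i: "i < m" for i
        using crd_End[OF bb N vE, of "h + i"] a i v unfolding n sum_offset by (simp add: H)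
      then show "N v \<in> H" using End_mem[OF N vE] by (simp add: H)
    qed
  qed
  have UL: "mat_of hs (restr H N) = mat h h (\<lambda>(i, j). mat_of bs N $$ (i, j))"
    if N: "N \<in> End E" and st: "\<forall>v\<in>H. N v \<in> H" for N
  proof (rule eq_matI)
    fix i j assume "i < dim_row (mat h h (\<lambda>(i, j). mat_of bs N $$ (i, j)))" "j < dim_col (mat h h (\<lambda>(i, j). mat_of bs N $$ (i, j)))"
    then have ij: "i < h" "j < h" by simp_all
    have "hs ! j \<in> H" using basis_mem[OF bH, of j] ij(2) h_def by simp
    then show "mat_of hs (restr H N) $$ (i, j) = mat h h (\<lambda>(i, j). mat_of bs N $$ (i, j)) $$ (i, j)"
      using ij n nth[OF ij(2)] crdH[of "N (hs ! j)" i] st by (simp add: mat_of_def h_def[symmetric])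
  qed (simp_all add: mat_of_def h_def)
  have bf: "block_form bs h m P v (N v) = qform m (P * mat m m (\<lambda>(i, j). mat_of bs N $$ (h + i, h + j))) (\<lambda>i. crd bs v (h + i))"
    if N: "N \<in> End E" and st: "\<forall>v\<in>H. N v \<in> H" and v: "v \<in> E" for N v
  proof -
    define L where "L = mat m m (\<lambda>(i, j). mat_of bs N $$ (h + i, h + j))"
    have L: "L \<in> carrier_mat m m" by (simp add: L_def)
    have z: "\<forall>i<m. \<forall>j<h. mat_of bs N $$ (h + i, j) = 0" using st stab[OF N] by blast
    have c: "crd bs (N v) (h + j) = (\<Sum>l<m. L $$ (j, l) * crd bs v (h + l))" if j: "j < m" for j
      using crd_End[OF bb N v, of "h + j"] j z unfolding n sum_offset by (simp add: L_def)
    have "block_form bs h m P v (N v) = (\<Sum>i<m. \<Sum>j<m. \<Sum>l<m. \<sigma> (crd bs v (h + i)) * P $$ (i, j) * (L $$ (j, l) * crd bs v (h + l)))"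
      unfolding block_form_def by (intro sum.cong refl) (simp add: c sum_distrib_left)
    also have "\<dots> = (\<Sum>i<m. \<Sum>l<m. \<Sum>j<m. \<sigma> (crd bs v (h + i)) * P $$ (i, j) * (L $$ (j, l) * crd bs v (h + l)))"
      by (intro sum.cong refl sum.swap)
    also have "\<dots> = qform m (P * L) (\<lambda>i. crd bs v (h + i))"
      unfolding qform_def
    proof (intro sum.cong refl)
      fix i l assume "i \<in> {..<m}" "l \<in> {..<m}"
      then have "(P * L) $$ (i, l) = (\<Sum>j<m. P $$ (i, j) * L $$ (j, l))" by (intro mat_mult_entry[OF PC L]) simp_all
      then show "(\<Sum>j<m. \<sigma> (crd bs v (h + i)) * P $$ (i, j) * (L $$ (j, l) * crd bs v (h + l))) =
        \<sigma> (crd bs v (h + i)) * (P * L) $$ (i, l) * crd bs v (h + l)"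
        by (simp only: sum_distrib_left sum_distrib_right mult.assoc)
    qed
    finally show ?thesis unfolding L_def .
  qed
  have main: "N \<in> ops bs E J \<longleftrightarrow> (\<forall>v\<in>H. N v \<in> H) \<and> restr H N \<in> ops hs H J0 \<and> (\<forall>v\<in>E. e (block_form bs h m P v (N v)) = 0)"
    if N: "N \<in> End E" for N
  proof -
    define L where "L = mat m m (\<lambda>(i, j). mat_of bs N $$ (h + i, h + j))"
    have PL: "P * L \<in> carrier_mat m m" using PC by (simp add: L_def)
    have A: "mat_of bs N \<in> carrier_mat (sum_list ns + m) (sum_list ns + m)" using mat_of_carrier[of bs N] n ns h_def by simp
    have Pm: "P \<in> GL m" using P unfolding m_def .
    have 1: "N \<in> ops bs E J \<longleftrightarrow> mat h h (\<lambda>(i, j). mat_of bs N $$ (i, j)) \<in> J0 \<and> P * L \<in> SH \<sigma> e m \<and> (\<forall>v\<in>H. N v \<in> H)"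
      unfolding mem_ops[OF bb N JC] unfolding J_def SH_joint_snoc[OF len A Pm] stab[OF N] J0_def L_def ns h_def ..
    show ?thesis
    proof (cases "\<forall>v\<in>H. N v \<in> H")
      case True
      have rE: "restr H N \<in> End H" by (rule restr_End[OF N DH HE]) (use True in blast)
      have 2: "restr H N \<in> ops hs H J0 \<longleftrightarrow> mat h h (\<lambda>(i, j). mat_of bs N $$ (i, j)) \<in> J0"
        unfolding mem_ops[OF bH rE J0C] UL[OF N True] ..
      have 3: "(\<forall>v\<in>E. e (block_form bs h m P v (N v)) = 0) \<longleftrightarrow> P * L \<in> SH \<sigma> e m"
      proof
        assume a: "\<forall>v\<in>E. e (block_form bs h m P v (N v)) = 0"
        have "e (qform m (P * L) y) = 0" for y
        proof -
          \<comment> \<open>Truncated subtraction puts y 0 at the positions below h. Only the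
            positions from h on are read.\<close>
          define v where "v = comb bs (\<lambda>i. y (i - h))"
          have v: "v \<in> E" using basis_comb[OF bb] by (simp add: v_def)
          have "crd bs v (h + i) = y i" if "i < m" for i
            using crd_eqI[OF bb v_def, of "h + i"] that n by simp
          then have q: "qform m (P * L) (\<lambda>i. crd bs v (h + i)) = qform m (P * L) y"
            unfolding qform_def by (intro sum.cong refl) simp
          from bspec[OF a v] show ?thesis unfolding bf[OF N True v] L_def[symmetric] q .
        qed
        then show "P * L \<in> SH \<sigma> e m" unfolding SH_iff[OF PL] by blast
      next
        assume "P * L \<in> SH \<sigma> e m"
        then show "\<forall>v\<in>E. e (block_form bs h m P v (N v)) = 0" unfolding SH_iff[OF PL]
          using bf[OF N True] unfolding L_def by simp
      qed
      show ?thesis unfolding 1 2 3 using True by blast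
    next
      case False
      then show ?thesis unfolding 1 by blast
    qed
  qed
  then show "N \<in> End E \<Longrightarrow> ?I N" unfolding bs_def h_def m_def J_def J0_def .
  have "restr H ` ops bs E J = ops hs H J0"
  proof (intro equalityI subsetI)
    fix N' assume "N' \<in> restr H ` ops bs E J"
    then obtain N where N: "N' = restr H N" "N \<in> ops bs E J" by (rule imageE)
    have "N \<in> End E" by (rule subsetD[OF ops_End[OF bb] N(2)])
    from main[OF this] N show "N' \<in> ops hs H J0" by simp
  next
    fix N' assume "N' \<in> ops hs H J0"
    then obtain A where A: "N' = op_of hs H A" "A \<in> J0" unfolding ops_def by (rule imageE)
    have AC: "A \<in> carrier_mat h h" using subsetD[OF J0C A(2)] unfolding h_def .
    \<comment> \<open>A is extended by zero blocks. The zero diagonal block meets every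
      orthogonality condition, so restriction to H is onto.\<close>
    define M where "M = mat (h + m) (h + m) (\<lambda>(i, j). if i < h \<and> j < h then A $$ (i, j) else 0)"
    define N where "N = op_of bs E M"
    have N: "N \<in> End E" unfolding N_def by (rule op_of_End[OF bb])
    have mN: "mat_of bs N = M" unfolding N_def by (rule mat_of_op[OF bb]) (simp add: M_def n)
    have st: "\<forall>v\<in>H. N v \<in> H" unfolding stab[OF N] mN by (simp add: M_def)
    have rE: "restr H N \<in> End H" by (rule restr_End[OF N DH HE]) (use st in blast)
    have "mat h h (\<lambda>(i, j). M $$ (i, j)) = A" using AC by (intro eq_matI) (auto simp: M_def)
    then have "mat_of hs (restr H N) = A" unfolding UL[OF N st] mN .
    then have r: "restr H N = N'" using op_of_mat[OF bH rE] A(1) by simp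
    have z: "e (block_form bs h m P v (N v)) = 0" if v: "v \<in> E" for v
    proof -
      have "mat m m (\<lambda>(i, j). M $$ (h + i, h + j)) = 0\<^sub>m m m" by (intro eq_matI) (auto simp: M_def)
      then have "P * mat m m (\<lambda>(i, j). mat_of bs N $$ (h + i, h + j)) = 0\<^sub>m m m" using PC unfolding mN by simp
      then show ?thesis unfolding bf[OF N st v] by (simp add: qform_def e_0)
    qed
    have "N \<in> ops bs E J" unfolding main[OF N] r using st z \<open>N' \<in> ops hs H J0\<close> by blast
    then show "N' \<in> restr H ` ops bs E J" using r by (intro image_eqI[of _ _ N]) simp_all
  qed
  then show "restr H ` ops (hs @ vs) E (SH_joint \<sigma> e (ns @ [length vs]) (Ps @ [P])) = ops hs H (SH_joint \<sigma> e ns Ps)"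
    unfolding bs_def m_def J_def J0_def .
qed

lemma ops_structured:
  assumes b: "basis E (hs @ vs)" and ns: "sum_list ns = length hs" and len: "length Ps = length ns"
    and P: "nonisotropic \<sigma> e (length vs) P" and vs: "vs \<noteq> []"
  shows "structured E (range (comb hs)) (block_form (hs @ vs) (length hs) (length vs) P)
    (ops (hs @ vs) E (SH_joint \<sigma> e (ns @ [length vs]) (Ps @ [P])))"
  unfolding structured_def
proof (intro conjI ballI)
  have G: "P \<in> GL (length vs)" by (rule nonisotropic_GL[OF P])
  show "form_on E (range (comb hs)) (block_form (hs @ vs) (length hs) (length vs) P)" by (rule block_form_on[OF b P vs])
  show "(N \<in> ops (hs @ vs) E (SH_joint \<sigma> e (ns @ [length vs]) (Ps @ [P]))) =
    ((\<forall>h\<in>range (comb hs). N h \<in> range (comb hs)) \<and>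
     restr (range (comb hs)) N \<in> restr (range (comb hs)) ` ops (hs @ vs) E (SH_joint \<sigma> e (ns @ [length vs]) (Ps @ [P])) \<and>
     (\<forall>v\<in>E. e (block_form (hs @ vs) (length hs) (length vs) P v (N v)) = 0))" if N: "N \<in> End E" for N
    unfolding ops_block(2)[OF b ns len G] by (rule ops_block(1)[OF b ns len G N])
qed

text \<open>Each block makes a structured space over the earlier ones, so trivial spectrum and
  dimension propagate by \<open>structured_tspec\<close> and \<open>structured_dim\<close>.\<close>

lemma ops_tspec_dim:
  assumes "basis E bs" "length bs = sum_list ns" "\<forall>k\<in>set ns. 0 < k" "nonisotropic_list \<sigma> e ns Ps"
  shows "tspec E (ops bs E (SH_joint \<sigma> e ns Ps)) \<and> O.fdim (bd (sum_list ns)) (ops bs E (SH_joint \<sigma> e ns Ps))"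
  using assms
proof (induction ns arbitrary: E bs Ps rule: rev_induct)
  case Nil
  define V where "V = ops bs E (SH_joint \<sigma> e [] Ps)"
  have E: "E = {0}" using Nil.prems(2) zero_space[of 0 E] basis_dim[OF Nil.prems(1)] by simp
  have "V \<subseteq> {0}"
  proof
    fix N assume "N \<in> V"
    then have N: "N \<in> End E" using ops_End[OF Nil.prems(1)] unfolding V_def by blast
    have "N v = 0" for v using End_0[OF N] End_out[OF N] unfolding E by (cases "v = 0") simp_all
    then show "N \<in> {0}" by (simp add: fun_eq_iff)
  qed
  moreover have "SH_joint \<sigma> e [] Ps = carrier_mat 0 0" by (simp add: SH_joint_def joint_def)
  then have "V \<noteq> {}" unfolding V_def ops_def using zero_carrier_mat[of 0 0] by auto
  ultimately have V: "V = {0}" by blast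
  have "O.fdim 0 V" unfolding V by (rule O.fdim_0)
  moreover from this have "tspec E V" unfolding tspec_def using O.fdim_subsp[of 0 V] ops_End[OF Nil.prems(1)] E
    unfolding V_def by auto
  ultimately show ?case unfolding V_def by (simp add: bd_0)
next
  case (snoc m ns)
  obtain Ps' P where Ps: "Ps = Ps' @ [P]" "length Ps' = length ns"
    using snoc.prems(4) unfolding nonisotropic_list_def by (cases Ps rule: rev_cases) auto
  have ni: "nonisotropic_list \<sigma> e ns Ps'" "P \<in> GL m" "nonisotropic \<sigma> e m P"
    using snoc.prems(4) unfolding Ps(1) nonisotropic_list_snoc[OF Ps(2)] by auto
  define hs vs where "hs = take (sum_list ns) bs" and "vs = drop (sum_list ns) bs"
  have bs: "bs = hs @ vs" and l: "length hs = sum_list ns" "length vs = m"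
    using snoc.prems(2) by (simp_all add: hs_def vs_def)
  have b: "basis E (hs @ vs)" using snoc.prems(1) unfolding bs .
  define H V where "H = range (comb hs)" and "V = ops bs E (SH_joint \<sigma> e (ns @ [m]) Ps)"
  have vs0: "vs \<noteq> []" using l(2) snoc.prems(3) by auto
  have st: "structured E H (block_form bs (length hs) m P) V"
    using ops_structured[OF b l(1)[symmetric] Ps(2) _ vs0, of P] ni(3) unfolding l(2) H_def V_def Ps(1) bs by simp
  have r: "restr H ` V = ops hs H (SH_joint \<sigma> e ns Ps')"
    using ops_block(2)[OF b l(1)[symmetric] Ps(2), of P] ni(2) unfolding l(2) H_def V_def Ps(1) bs by simp
  have bH: "basis H hs" unfolding H_def using basis_take(1)[OF b] unfolding basis_take(3)[OF b] .
  have IH: "tspec H (restr H ` V)" "O.fdim (bd (sum_list ns)) (restr H ` V)"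
    using snoc.IH[OF bH l(1) _ ni(1)] snoc.prems(3) unfolding r by auto
  have VE: "V \<subseteq> End E" unfolding V_def by (rule ops_End[OF snoc.prems(1)])
  have t: "tspec E V" by (rule structured_tspec[OF basis_Dsub[OF snoc.prems(1)] st VE IH(1)])
  have "O.fdim (bd (length bs)) V"
    by (rule structured_dim[OF basis_Dsub[OF b] _ tspec_subsp[OF t] VE st _ IH(2)])
      (use basis_dim[OF snoc.prems(1)] basis_dim[OF bH] l in simp_all)
  then show ?case using t snoc.prems(2) unfolding V_def by simp
qed

end

section \<open>Optimal spaces are joints, in an essentially unique way\<close>

context quad_space
begin

lemma form_comb:
  assumes f: "form_on E H b" and E: "Dsub E" and vs: "set vs \<subseteq> E"
  shows "b (comb vs y) (comb vs z) = (\<Sum>i<length vs. \<Sum>j<length vs. \<sigma> (y i) * b (vs ! i) (vs ! j) * z j)"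
proof -
  have z0: "b w 0 = 0" "b 0 w = 0" if "w \<in> E" for w
    using form_rs_r[OF f that Dsub_0[OF E], of 0] form_rs_l[OF f Dsub_0[OF E] that, of 0] by (simp_all add: rs_0 conj_0)
  have r: "(\<Sum>j\<in>I. vs ! j \<star> z j) \<in> E \<and> b w (\<Sum>j\<in>I. vs ! j \<star> z j) = (\<Sum>j\<in>I. b w (vs ! j) * z j)"
    if w: "w \<in> E" and I: "I \<subseteq> {..<length vs}" for w I
    using finite_subset[OF I] I
  proof (induction I rule: infinite_finite_induct)
    case (insert i I)
    then have "vs ! i \<in> E" using vs by (auto simp: subset_iff)
    then show ?case using insert w E by (simp add: Dsub_cl form_add_r[OF f] form_rs_r[OF f])
  qed (use E z0 w in \<open>auto simp: Dsub_cl\<close>)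
  have l: "(\<Sum>j\<in>I. vs ! j \<star> y j) \<in> E \<and> b (\<Sum>j\<in>I. vs ! j \<star> y j) w = (\<Sum>j\<in>I. \<sigma> (y j) * b (vs ! j) w)"
    if w: "w \<in> E" and I: "I \<subseteq> {..<length vs}" for w I
    using finite_subset[OF I] I
  proof (induction I rule: infinite_finite_induct)
    case (insert i I)
    then have "vs ! i \<in> E" using vs by (auto simp: subset_iff)
    then show ?case using insert w E by (simp add: Dsub_cl form_add_l[OF f] form_rs_l[OF f])
  qed (use E z0 w in \<open>auto simp: Dsub_cl\<close>)
  have m: "comb vs z \<in> E" by (rule comb_mem[OF E vs])
  have "b (comb vs y) (comb vs z) = (\<Sum>i<length vs. \<sigma> (y i) * b (vs ! i) (comb vs z))"
    using l[OF m, of "{..<length vs}"] unfolding comb_def[of vs y] by simp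
  also have "\<dots> = (\<Sum>i<length vs. \<Sum>j<length vs. \<sigma> (y i) * b (vs ! i) (vs ! j) * z j)"
  proof (rule sum.cong[OF refl])
    fix i assume "i \<in> {..<length vs}"
    then have "vs ! i \<in> E" using vs by (auto simp: subset_iff)
    from r[OF this, of "{..<length vs}"]
    show "\<sigma> (y i) * b (vs ! i) (comb vs z) = (\<Sum>j<length vs. \<sigma> (y i) * b (vs ! i) (vs ! j) * z j)"
      unfolding comb_def by (simp add: sum_distrib_left mult.assoc)
  qed
  finally show ?thesis .
qed

lemma form_is_block_form:
  assumes b: "basis E (hs @ vs)" and f: "form_on E (range (comb hs)) g"
  defines "P \<equiv> mat (length vs) (length vs) (\<lambda>(i, j). g (vs ! i) (vs ! j))"
  shows "v \<in> E \<Longrightarrow> w \<in> E \<Longrightarrow> g v w = block_form (hs @ vs) (length hs) (length vs) P v w"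
    and "nonisotropic \<sigma> e (length vs) P"
proof -
  have E: "Dsub E" by (rule basis_Dsub[OF b])
  have sub: "set hs \<subseteq> E" "set vs \<subseteq> E" using b unfolding basis_def by auto
  have dec: "v = comb hs (crd (hs @ vs) v) + comb vs (\<lambda>i. crd (hs @ vs) v (length hs + i))" if "v \<in> E" for v
    using comb_crd[OF b that] unfolding comb_append by simp
  have E1: "comb hs f \<in> E" "comb vs f \<in> E" for f using comb_mem[OF E] sub by auto
  show g: "g v w = block_form (hs @ vs) (length hs) (length vs) P v w" if v: "v \<in> E" and w: "w \<in> E" for v w
  proof -
    have "g v w = g (comb vs (\<lambda>i. crd (hs @ vs) v (length hs + i))) w"
      using arg_cong[OF dec[OF v], of "\<lambda>v. g v w"] form_add_l[OF f E1(1) E1(2) w] form_on_l[OF f rangeI w] by simp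
    also have "\<dots> = g (comb vs (\<lambda>i. crd (hs @ vs) v (length hs + i))) (comb vs (\<lambda>i. crd (hs @ vs) w (length hs + i)))"
      using arg_cong[OF dec[OF w], of "g (comb vs (\<lambda>i. crd (hs @ vs) v (length hs + i)))"]
        form_add_r[OF f E1(1) E1(2) E1(2)] form_on_r[OF f rangeI E1(2)] by simp
    also have "\<dots> = block_form (hs @ vs) (length hs) (length vs) P v w"
      unfolding form_comb[OF f E sub(2)] block_form_def by (intro sum.cong refl) (simp add: P_def)
    finally show ?thesis .
  qed
  have PC: "P \<in> carrier_mat (length vs) (length vs)" by (simp add: P_def)
  show "nonisotropic \<sigma> e (length vs) P" unfolding nonisotropic_iff[OF PC]
  proof (intro allI impI)
    fix y :: "nat \<Rightarrow> 'd" assume "\<exists>i<length vs. y i \<noteq> 0"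
    then obtain i where i: "i < length vs" "y i \<noteq> 0" by blast
    have c: "comb vs y = comb (hs @ vs) (\<lambda>i. if i < length hs then 0 else y (i - length hs))"
      unfolding comb_append by (simp add: comb_0 cong: comb_cong)
    have k: "crd (hs @ vs) (comb vs y) (length hs + j) = y j" if "j < length vs" for j
      using crd_eqI[OF b c, of "length hs + j"] that by simp
    have "comb vs y \<notin> range (comb hs)"
      unfolding basis_take(3)[OF b, symmetric] using k[OF i(1)] i by auto
    from form_on_pos[OF f E1(2) this] have "e (g (comb vs y) (comb vs y)) \<noteq> 0" .
    moreover have "g (comb vs y) (comb vs y) = qform (length vs) P y"
      unfolding form_comb[OF f E sub(2)] qform_def by (intro sum.cong refl) (simp add: P_def)
    ultimately show "e (qform (length vs) P y) \<noteq> 0" by simp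
  qed
qed

lemma restr_tspec:
  assumes E: "Dsub E" and H: "Dsub H" "H \<subseteq> E" and V: "tspec E V" and st: "\<And>N v. N \<in> V \<Longrightarrow> v \<in> H \<Longrightarrow> N v \<in> H"
  shows "tspec H (restr H ` V)"
  unfolding tspec_def
proof (intro conjI ballI impI subsetI)
  show "O.subsp (restr H ` V)" by (rule OO.subsp_image[OF restr_lin tspec_subsp[OF V]])
  show "M \<in> End H" if "M \<in> restr H ` V" for M
  proof -
    obtain N where N: "M = restr H N" "N \<in> V" using \<open>M \<in> restr H ` V\<close> by (rule imageE)
    show ?thesis unfolding N(1) by (rule restr_End[OF tspec_End[OF V N(2)] H]) (rule st[OF N(2)])
  qed
  show "x = 0" if "M \<in> restr H ` V" "x \<in> H" "M x = x" for M x
  proof -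
    obtain N where N: "M = restr H N" "N \<in> V" using \<open>M \<in> restr H ` V\<close> by (rule imageE)
    have "N x = x" using that(2,3) unfolding N(1) by simp
    then show ?thesis using tspec_fix[OF V N(2), of x] that(2) H(2) by blast
  qed
qed

text \<open>Strong induction, since K may lie several dimensions below E; the drop is the size of
  the last block. A basis of K is extended to E, and P is the Gram matrix of the form on the new
  vectors.\<close>

theorem optimal_is_joint:
  assumes "Dsub E" "V.fdim (n * d) E" "tspec E V" "O.fdim (bd n) V" "infinite F \<or> n * d \<le> card F"
  shows "\<exists>bs ns Ps. basis E bs \<and> length bs = n \<and> sum_list ns = n \<and> (\<forall>k\<in>set ns. 0 < k) \<and>
    nonisotropic_list \<sigma> e ns Ps \<and> V = ops bs E (SH_joint \<sigma> e ns Ps)"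
  using assms
proof (induction n arbitrary: E V rule: less_induct)
  case (less n)
  show ?case
  proof (cases n)
    case 0
    have E: "E = {0}" using zero_space[OF less.prems(2)] 0 by simp
    have V: "V = {0}" using less.prems(4) O.fdim_0D unfolding 0 bd_0 by blast
    have b: "basis E []" unfolding basis_def using less.prems(1) E by (auto simp: comb_def)
    have ni: "nonisotropic_list \<sigma> e [] []" by (simp add: nonisotropic_list_def)
    have "O.fdim 0 (ops [] E (SH_joint \<sigma> e [] []))"
      using ops_tspec_dim[OF b _ _ ni] by (simp add: bd_0)
    then have "ops [] E (SH_joint \<sigma> e [] []) = {0}" by (rule O.fdim_0D)
    then show ?thesis using b ni V 0 by (intro exI[of _ "[]"]) simp
  next
    case (Suc k0)
    obtain K g k where st: "structured E K g V" and K: "V.fdim (k * d) K" "O.fdim (bd k) (restr K ` V)" "k \<le> k0"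
      using structure_exists[of E k0 V] less.prems unfolding Suc by blast
    note f = structured_form[OF st]
    have DK: "Dsub K" "K \<subseteq> E" using form_on_Dsub[OF f] form_on_sub[OF f] by auto
    have stab: "N v \<in> K" if "N \<in> V" "v \<in> K" for N v
      using structured_iff[OF st tspec_End[OF less.prems(3) that(1)]] that by blast
    have card: "infinite F \<or> k * d \<le> card F" using less.prems(5) K(3) Suc mult_le_mono1[of k n d] by auto
    have "k < n" using K(3) Suc by simp
    have t: "tspec K (restr K ` V)" by (rule restr_tspec[OF less.prems(1) DK less.prems(3)]) (rule stab)
    from less.IH[OF \<open>k < n\<close> DK(1) K(1) t K(2) card]
    obtain hs ns Ps where IH: "basis K hs" "length hs = k" "sum_list ns = k" "\<forall>j\<in>set ns. 0 < j"
      "nonisotropic_list \<sigma> e ns Ps" "restr K ` V = ops hs K (SH_joint \<sigma> e ns Ps)" by blast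
    obtain vs where b: "basis E (hs @ vs)" using basis_extend[OF IH(1) less.prems(1) DK(2) less.prems(2)] by blast
    have Kr: "K = range (comb hs)"
    proof (intro equalityI subsetI)
      show "v \<in> range (comb hs)" if "v \<in> K" for v using basis_span[OF IH(1) that] by blast
      show "v \<in> K" if "v \<in> range (comb hs)" for v using that basis_comb[OF IH(1)] by blast
    qed
    have ln: "length (hs @ vs) = n"
      using V.fdim_unique[OF basis_dim[OF b] less.prems(2)] d_pos by simp
    have vs: "vs \<noteq> []" using ln IH(2) \<open>k < n\<close> by auto
    define P where "P = mat (length vs) (length vs) (\<lambda>(i, j). g (vs ! i) (vs ! j))"
    have f': "form_on E (range (comb hs)) g" using f unfolding Kr .
    note P = form_is_block_form[OF b f', folded P_def]
    have len: "length Ps = length ns" using IH(5) unfolding nonisotropic_list_def by blast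
    have G: "P \<in> GL (length vs)" by (rule nonisotropic_GL[OF P(2)])
    have sl: "sum_list ns = length hs" using IH by simp
    define W where "W = ops (hs @ vs) E (SH_joint \<sigma> e (ns @ [length vs]) (Ps @ [P]))"
    have WE: "W \<subseteq> End E" unfolding W_def by (rule ops_End[OF b])
    have iff: "N \<in> V \<longleftrightarrow> N \<in> W" if N: "N \<in> End E" for N
    proof -
      have g: "g v (N v) = block_form (hs @ vs) (length hs) (length vs) P v (N v)" if "v \<in> E" for v
        by (rule P(1)[OF that End_mem[OF N that]])
      have "N \<in> V \<longleftrightarrow> (\<forall>v\<in>K. N v \<in> K) \<and> restr K N \<in> ops hs K (SH_joint \<sigma> e ns Ps) \<and> (\<forall>v\<in>E. e (g v (N v)) = 0)"
        using structured_iff[OF st N] unfolding IH(6) .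
      also have "\<dots> \<longleftrightarrow> N \<in> W" unfolding W_def ops_block(1)[OF b sl len G N] Kr using g by simp
      finally show ?thesis .
    qed
    have "V = W" using iff WE tspec_End[OF less.prems(3)] by blast
    moreover have "nonisotropic_list \<sigma> e (ns @ [length vs]) (Ps @ [P])"
      unfolding nonisotropic_list_snoc[OF len] using IH(5) G P(2) by simp
    moreover have "sum_list (ns @ [length vs]) = n" using sl ln by simp
    moreover have "\<forall>j\<in>set (ns @ [length vs]). 0 < j" using IH(4) vs by simp
    ultimately show ?thesis using b ln unfolding W_def by blast
  qed
qed

text \<open>R holds the coordinates of vs' along vs, and equality of the forms reads as P' being
  \<alpha> times \<open>star \<sigma> R * P * R\<close>. A vector killed by R is killed by P', so R
  is invertible. The congruence is given by \<open>star \<sigma> R\<close>, whose own star is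
  R.\<close>

lemma homo_star_congruent_of_forms:
  assumes b: "basis E (hs @ vs)" "basis E (hs' @ vs')" and m: "length vs = m" "length vs' = m"
    and P: "P \<in> GL m" "P' \<in> GL m" and \<alpha>: "\<alpha> \<in> F - {0}"
    and eq: "\<And>v w. v \<in> E \<Longrightarrow> w \<in> E \<Longrightarrow>
      block_form (hs' @ vs') (length hs') m P' v w = \<alpha> * block_form (hs @ vs) (length hs) m P v w"
  shows "homo_star_congruent F \<sigma> m P P'"
proof -
  define R where "R = mat m m (\<lambda>(l, j). crd (hs @ vs) (vs' ! j) (length hs + l))"
  have R: "R \<in> carrier_mat m m" by (simp add: R_def)
  have sR: "star \<sigma> R \<in> carrier_mat m m" using R by (simp add: star_def)
  have ssR: "star \<sigma> (star \<sigma> R) = R" using R by (intro eq_matI) (simp_all add: star_def conj_conj)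
  have PC: "P \<in> carrier_mat m m" "P' \<in> carrier_mat m m" using GL_carrier P by auto
  have ent: "P' $$ (i, j) = \<alpha> * (star \<sigma> R * P * R) $$ (i, j)" if ij: "i < m" "j < m" for i j
  proof -
    have vE: "vs' ! k \<in> E" if "k < m" for k using basis_mem[OF b(2), of "length hs' + k"] that m by simp
    have c: "crd (hs' @ vs') (vs' ! k) (length hs' + l) = (if l = k then 1 else 0)" if "k < m" "l < m" for k l
      using crd_basis[OF b(2), of "length hs' + k" "length hs' + l"] that m by simp
    have "block_form (hs' @ vs') (length hs') m P' (vs' ! i) (vs' ! j) =
      (\<Sum>k<m. \<Sum>l<m. \<sigma> (if k = i then 1 else 0) * P' $$ (k, l) * (if l = j then 1 else 0))"
      unfolding block_form_def by (intro sum.cong refl) (use ij c in simp)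
    also have "\<dots> = (\<Sum>k<m. \<Sum>l<m. if l = j then (if k = i then P' $$ (k, l) else 0) else 0)"
      by (intro sum.cong refl) (simp add: conj_0 conj_1)
    also have "\<dots> = P' $$ (i, j)" using ij by simp
    finally have 1: "P' $$ (i, j) = \<alpha> * block_form (hs @ vs) (length hs) m P (vs' ! i) (vs' ! j)"
      using eq[OF vE vE] ij by simp
    have sRP: "star \<sigma> R * P \<in> carrier_mat m m" using sR PC by simp
    have "(star \<sigma> R * P * R) $$ (i, j) = (\<Sum>l<m. (star \<sigma> R * P) $$ (i, l) * R $$ (l, j))"
      by (rule mat_mult_entry[OF sRP R ij])
    also have "\<dots> = (\<Sum>l<m. \<Sum>k<m. star \<sigma> R $$ (i, k) * P $$ (k, l) * R $$ (l, j))"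
    proof (rule sum.cong[OF refl])
      fix l assume "l \<in> {..<m}"
      then have "(star \<sigma> R * P) $$ (i, l) = (\<Sum>k<m. star \<sigma> R $$ (i, k) * P $$ (k, l))"
        by (intro mat_mult_entry[OF sR PC(1) ij(1)]) simp
      then show "(star \<sigma> R * P) $$ (i, l) * R $$ (l, j) = (\<Sum>k<m. star \<sigma> R $$ (i, k) * P $$ (k, l) * R $$ (l, j))"
        by (simp only: sum_distrib_right)
    qed
    also have "\<dots> = (\<Sum>k<m. \<Sum>l<m. star \<sigma> R $$ (i, k) * P $$ (k, l) * R $$ (l, j))" by (rule sum.swap)
    also have "\<dots> = block_form (hs @ vs) (length hs) m P (vs' ! i) (vs' ! j)"
      unfolding block_form_def using ij by (intro sum.cong refl) (simp add: star_def R_def)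
    finally show ?thesis using 1 by simp
  qed
  have P': "P' = \<alpha> \<cdot>\<^sub>m (star \<sigma> R * P * R)" using ent PC R by (intro eq_matI) (simp_all add: star_def)
  have "R \<in> GL m"
  proof (rule GL_I_inj[OF R])
    fix y assume y: "\<And>i. i < m \<Longrightarrow> (\<Sum>j<m. R $$ (i, j) * y j) = 0"
    have "(\<Sum>j<m. P' $$ (i, j) * y j) = 0" if i: "i < m" for i
    proof -
      have sRP: "star \<sigma> R * P \<in> carrier_mat m m" using sR PC by simp
      have "(\<Sum>j<m. P' $$ (i, j) * y j) = (\<Sum>j<m. \<Sum>l<m. \<alpha> * ((star \<sigma> R * P) $$ (i, l) * (R $$ (l, j) * y j)))"
      proof (rule sum.cong[OF refl])
        fix j assume "j \<in> {..<m}"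
        then have "P' $$ (i, j) = \<alpha> * (\<Sum>l<m. (star \<sigma> R * P) $$ (i, l) * R $$ (l, j))"
          using ent[OF i] mat_mult_entry[OF sRP R i] by simp
        then show "P' $$ (i, j) * y j = (\<Sum>l<m. \<alpha> * ((star \<sigma> R * P) $$ (i, l) * (R $$ (l, j) * y j)))"
          by (simp only: sum_distrib_left sum_distrib_right mult.assoc)
      qed
      also have "\<dots> = (\<Sum>l<m. \<Sum>j<m. \<alpha> * ((star \<sigma> R * P) $$ (i, l) * (R $$ (l, j) * y j)))" by (rule sum.swap)
      also have "\<dots> = (\<Sum>l<m. \<alpha> * ((star \<sigma> R * P) $$ (i, l) * (\<Sum>j<m. R $$ (l, j) * y j)))"
        by (simp only: sum_distrib_left)
      also have "\<dots> = 0" using y by simp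
      finally show ?thesis .
    qed
    then show "\<forall>j<m. y j = 0" using GL_D_inj[OF P(2)] by blast
  qed
  note RG = this
  have sRG: "star \<sigma> R \<in> GL m"
  proof -
    define Q where "Q = inv\<^bsub>mat_ring m\<^esub> R"
    have Q: "Q \<in> carrier_mat m m" "R * Q = 1\<^sub>m m" using GL_inv[OF RG] by (simp_all add: Q_def)
    have sQ: "star \<sigma> Q \<in> carrier_mat m m" using Q by (simp add: star_def)
    have "star \<sigma> Q * star \<sigma> R = 1\<^sub>m m"
    proof (rule eq_matI)
      fix i j assume "i < dim_row (1\<^sub>m m :: 'd mat)" "j < dim_col (1\<^sub>m m :: 'd mat)"
      then have ij: "i < m" "j < m" by simp_all
      have "(star \<sigma> Q * star \<sigma> R) $$ (i, j) = (\<Sum>l<m. \<sigma> (Q $$ (l, i)) * \<sigma> (R $$ (j, l)))"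
        using mat_mult_entry[OF sQ sR ij] ij Q(1) R by (simp add: star_def)
      also have "\<dots> = \<sigma> ((R * Q) $$ (j, i))" using mat_mult_entry[OF R Q(1) ij(2,1)] by (simp add: conj_sum conj_mult)
      finally show "(star \<sigma> Q * star \<sigma> R) $$ (i, j) = 1\<^sub>m m $$ (i, j)" using ij unfolding Q(2) by (simp add: conj_0 conj_1)
    qed (use sQ sR in auto)
    moreover have "1\<^sub>m m \<in> GL m" by (rule GL_I[of _ _ "1\<^sub>m m"]) simp_all
    ultimately show ?thesis using GL_factor(2)[OF sQ sR] by simp
  qed
  show ?thesis unfolding homo_star_congruent_def
    by (rule bexI[OF bexI[OF _ sRG] \<alpha>]) (simp only: ssR P')
qed

theorem ops_joint_unique:
  assumes "basis E bs" "basis E bs'" "length bs = sum_list ns" "length bs' = sum_list ns'"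
    and "\<forall>k\<in>set ns. 0 < k" "\<forall>k\<in>set ns'. 0 < k"
    and "nonisotropic_list \<sigma> e ns Ps" "nonisotropic_list \<sigma> e ns' Ps'"
    and "ops bs E (SH_joint \<sigma> e ns Ps) = ops bs' E (SH_joint \<sigma> e ns' Ps')"
  shows "ns = ns' \<and> (\<forall>i<length ns. homo_star_congruent F \<sigma> (ns ! i) (Ps ! i) (Ps' ! i))"
  using assms
proof (induction ns arbitrary: E bs bs' ns' Ps Ps' rule: rev_induct)
  case Nil
  have "sum_list ns' * d = 0 * d"
    using V.fdim_unique[OF basis_dim[OF Nil.prems(1)] basis_dim[OF Nil.prems(2)]] Nil.prems(3,4) by simp
  then have "sum_list ns' = 0" using d_pos by simp
  then have "ns' = []" using Nil.prems(6) by (cases ns') auto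
  then show ?case by simp
next
  case (snoc m ns)
  note pr = snoc.prems
  have n: "sum_list ns' = sum_list ns + m"
    using V.fdim_unique[OF basis_dim[OF pr(1)] basis_dim[OF pr(2)]] pr(3,4) d_pos by simp
  have m0: "0 < m" using pr(5) by simp
  then have "ns' \<noteq> []" using n by auto
  then obtain ns1 m' where ns': "ns' = ns1 @ [m']" by (cases ns' rule: rev_cases) auto
  have m0': "0 < m'" using pr(6) ns' by simp
  obtain Q P where Ps: "Ps = Q @ [P]" "length Q = length ns"
    using pr(7) unfolding nonisotropic_list_def by (cases Ps rule: rev_cases) auto
  obtain Q' P' where Ps': "Ps' = Q' @ [P']" "length Q' = length ns1"
    using pr(8) unfolding nonisotropic_list_def ns' by (cases Ps' rule: rev_cases) auto
  have ni: "nonisotropic_list \<sigma> e ns Q" "P \<in> GL m" "nonisotropic \<sigma> e m P"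
    using pr(7) unfolding Ps(1) nonisotropic_list_snoc[OF Ps(2)] by auto
  have ni': "nonisotropic_list \<sigma> e ns1 Q'" "P' \<in> GL m'" "nonisotropic \<sigma> e m' P'"
    using pr(8) unfolding Ps'(1) ns' nonisotropic_list_snoc[OF Ps'(2)] by auto
  define hs vs where "hs = take (sum_list ns) bs" and "vs = drop (sum_list ns) bs"
  have bs: "bs = hs @ vs" and l: "length hs = sum_list ns" "length vs = m"
    using pr(3) by (simp_all add: hs_def vs_def)
  define hs' vs' where "hs' = take (sum_list ns1) bs'" and "vs' = drop (sum_list ns1) bs'"
  have bs': "bs' = hs' @ vs'" and l': "length hs' = sum_list ns1" "length vs' = m'"
    using pr(4) unfolding ns' by (simp_all add: hs'_def vs'_def)
  have b: "basis E (hs @ vs)" "basis E (hs' @ vs')" using pr(1,2) unfolding bs bs' by simp_all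
  have vs0: "vs \<noteq> []" "vs' \<noteq> []" using l l' m0 m0' by auto
  define V where "V = ops bs E (SH_joint \<sigma> e (ns @ [m]) Ps)"
  define H H' where "H = range (comb hs)" and "H' = range (comb hs')"
  have st: "structured E H (block_form (hs @ vs) (length hs) m P) V"
    using ops_structured[OF b(1) l(1)[symmetric] Ps(2) _ vs0(1), of P] ni(3) unfolding l(2) H_def V_def Ps(1) bs by simp
  have st': "structured E H' (block_form (hs' @ vs') (length hs') m' P') V"
    using ops_structured[OF b(2) l'(1)[symmetric] Ps'(2) _ vs0(2), of P'] ni'(3)
    unfolding l'(2) H'_def V_def pr(9) Ps'(1) bs' ns' by simp
  have V: "O.subsp V" "V \<subseteq> End E"
    using ops_tspec_dim[OF pr(1,3,5,7)] tspec_subsp ops_End[OF pr(1)] unfolding V_def by auto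
  have E: "Dsub E" by (rule basis_Dsub[OF pr(1)])
  \<comment> \<open>The description of H in \<open>structured_kernel\<close> mentions only E and V,
    not the form or the basis.\<close>
  have HH: "H' = H" using structured_kernel[OF E V st] structured_kernel[OF E V st'] by simp
  have bH: "basis H hs" unfolding H_def using basis_take(1)[OF b(1)] unfolding basis_take(3)[OF b(1)] .
  have bH': "basis H hs'" unfolding HH[symmetric] H'_def using basis_take(1)[OF b(2)] unfolding basis_take(3)[OF b(2)] .
  have hh: "length hs' = length hs"
    using V.fdim_unique[OF basis_dim[OF bH] basis_dim[OF bH']] d_pos by simp
  have mm: "m' = m" using n l l' hh unfolding ns' by simp
  have r: "restr H ` V = ops hs H (SH_joint \<sigma> e ns Q)"
    using ops_block(2)[OF b(1) l(1)[symmetric] Ps(2), of P] ni(2) unfolding l(2) H_def V_def Ps(1) bs by simp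
  have r': "restr H' ` V = ops hs' H' (SH_joint \<sigma> e ns1 Q')"
    using ops_block(2)[OF b(2) l'(1)[symmetric] Ps'(2), of P'] ni'(2) unfolding l'(2) H'_def V_def pr(9) Ps'(1) bs' ns' by simp
  have eq: "ops hs H (SH_joint \<sigma> e ns Q) = ops hs' H (SH_joint \<sigma> e ns1 Q')" using r r' unfolding HH by simp
  have IH: "ns = ns1 \<and> (\<forall>i<length ns. homo_star_congruent F \<sigma> (ns ! i) (Q ! i) (Q' ! i))"
    by (rule snoc.IH[OF bH bH' l(1) l'(1) _ _ ni(1) ni'(1) eq]) (use pr(5,6) in \<open>simp_all add: ns'\<close>)
  obtain \<alpha> where \<alpha>: "\<alpha> \<in> F - {0}" "\<forall>v\<in>E. \<forall>w\<in>E. block_form (hs' @ vs') (length hs') m P' v w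
      = \<alpha> * block_form (hs @ vs) (length hs) m P v w"
    using structured_form_unique[OF E V st st'[unfolded HH mm]] by blast
  have "homo_star_congruent F \<sigma> m P P'"
    by (rule homo_star_congruent_of_forms[OF b l(2) l'(2)[unfolded mm] ni(2) ni'(2)[unfolded mm] \<alpha>(1)])
      (use \<alpha>(2) in blast)
  moreover have "(Q @ [P]) ! length ns = P" "(Q' @ [P']) ! length ns = P'"
    using Ps(2) Ps'(2) IH by (simp_all add: nth_append)
  ultimately show ?case using IH Ps(2) Ps'(2) unfolding ns' mm Ps(1) Ps'(1)
    by (auto simp: less_Suc_eq nth_append)
qed

end

section \<open>The matrix ring\<close>

lemma ring_mat_ring: "ring (mat_ring n :: 'd :: division_ring mat ring)"
proof (rule ringI)
  show "abelian_group (mat_ring n :: 'd mat ring)"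
  proof (rule abelian_groupI)
    show "\<exists>y\<in>carrier (mat_ring n). y \<oplus>\<^bsub>mat_ring n\<^esub> x = \<zero>\<^bsub>mat_ring n\<^esub>"
      if "x \<in> carrier (mat_ring n)" for x :: "'d mat"
      using that by (intro bexI[of _ "- x"]) (auto simp: mat_ring_simps)
  qed (auto simp: mat_ring_simps)
  show "Group.monoid (mat_ring n :: 'd mat ring)" by (rule monoid_mat_ring)
qed (auto simp: mat_ring_simps add_mult_distrib_mat mult_add_distrib_mat)

lemma scalar_mat_mult:
  fixes M :: "'d :: division_ring mat"
  assumes "M \<in> carrier_mat n n" shows "(a \<cdot>\<^sub>m 1\<^sub>m n) * M = a \<cdot>\<^sub>m M"
proof (rule eq_matI)
  fix i j assume "i < dim_row (a \<cdot>\<^sub>m M)" "j < dim_col (a \<cdot>\<^sub>m M)"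
  then have ij: "i < n" "j < n" using assms by auto
  have "((a \<cdot>\<^sub>m 1\<^sub>m n) * M) $$ (i, j) = (\<Sum>l<n. (a \<cdot>\<^sub>m 1\<^sub>m n) $$ (i, l) * M $$ (l, j))"
    by (rule mat_mult_entry[OF _ assms ij]) simp
  also have "\<dots> = (\<Sum>l<n. if l = i then a * M $$ (l, j) else 0)"
    using ij by (intro sum.cong refl) auto
  also have "\<dots> = (a \<cdot>\<^sub>m M) $$ (i, j)" using ij assms by simp
  finally show "((a \<cdot>\<^sub>m 1\<^sub>m n) * M) $$ (i, j) = (a \<cdot>\<^sub>m M) $$ (i, j)" .
qed (use assms in auto)

lemma mat_line_extension:
  fixes v :: "'d :: division_ring mat"
  assumes "v \<in> carrier_mat n n"
  shows "ring.line_extension (mat_ring n) (scalar_mats F n) v E = {a \<cdot>\<^sub>m v + x | a x. a \<in> F \<and> x \<in> E}"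
  unfolding ring.line_extension_def[OF ring_mat_ring] set_add_def set_mult_def r_coset_def scalar_mats_def
  by (auto simp: mat_ring_simps scalar_mat_mult[OF assms])

lemma ordered_partition_sum: "ordered_partition n ns \<Longrightarrow> sum_list ns = n"
  and ordered_partition_pos: "ordered_partition n ns \<Longrightarrow> \<forall>k\<in>set ns. 0 < k"
  by (simp_all add: ordered_partition_def)

section \<open>Transfer of dimension and spectrum to the matrix ring\<close>

context quad
begin

abbreviation coords :: "nat \<Rightarrow> (nat \<Rightarrow> 'd) set" where "coords \<equiv> coord_space"

definition mat_op :: "nat \<Rightarrow> 'd mat \<Rightarrow> (nat \<Rightarrow> 'd) \<Rightarrow> nat \<Rightarrow> 'd" where
  "mat_op n = S.op_of (unit_vecs n) (coords n)"

lemma mat_op_image: "S.ops (unit_vecs n) (coords n) J = mat_op n ` J"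
  by (simp add: S.ops_def mat_op_def)

lemma mat_op_End: "mat_op n M \<in> S.End (coords n)"
  unfolding mat_op_def by (rule S.op_of_End[OF unit_vecs_basis])

lemma mat_of_mat_op: "M \<in> carrier_mat n n \<Longrightarrow> S.mat_of (unit_vecs n) (mat_op n M) = M"
  unfolding mat_op_def by (rule S.mat_of_op[OF unit_vecs_basis]) (simp only: length_unit_vecs)

lemma mat_op_inj:
  assumes "M \<in> carrier_mat n n" "N \<in> carrier_mat n n" "mat_op n M = mat_op n N" shows "M = N"
  using arg_cong[OF assms(3), of "S.mat_of (unit_vecs n)"] unfolding mat_of_mat_op[OF assms(1)] mat_of_mat_op[OF assms(2)] .

lemma mat_op_surj: "N \<in> S.End (coords n) \<Longrightarrow> \<exists>M\<in>carrier_mat n n. N = mat_op n M"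
  using S.op_of_mat[OF unit_vecs_basis, of N n] S.mat_of_carrier[of "unit_vecs n" N] unfolding mat_op_def
  by (intro bexI[of _ "S.mat_of (unit_vecs n) N"]) simp_all

lemma mat_op_inj_image:
  assumes "S \<subseteq> carrier_mat n n" "T \<subseteq> carrier_mat n n" "mat_op n ` S = mat_op n ` T" shows "S = T"
proof -
  have "inj_on (mat_op n) (carrier_mat n n)" using mat_op_inj by (rule inj_onI)
  from inj_on_image_eq_iff[OF this assms(1,2)] show ?thesis using assms(3) by simp
qed

lemma mat_op_lin:
  assumes "M \<in> carrier_mat n n" "N \<in> carrier_mat n n" "a \<in> F"
  shows "mat_op n (a \<cdot>\<^sub>m M + N) = (\<lambda>v i. mat_op n M v i * a) + mat_op n N"
  using S.op_of_add[of "a \<cdot>\<^sub>m M" "unit_vecs n" N] S.op_of_smult[of M "unit_vecs n" a] assms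
  unfolding mat_op_def by (simp add: fun_eq_iff)

lemma mat_op_add: "M \<in> carrier_mat n n \<Longrightarrow> N \<in> carrier_mat n n \<Longrightarrow> mat_op n (M + N) = mat_op n M + mat_op n N"
  using S.op_of_add[of M "unit_vecs n" N] unfolding mat_op_def by (simp add: fun_eq_iff)

lemma mat_op_smult: "M \<in> carrier_mat n n \<Longrightarrow> a \<in> F \<Longrightarrow> mat_op n (a \<cdot>\<^sub>m M) = (\<lambda>v i. mat_op n M v i * a)"
  using S.op_of_smult[of M "unit_vecs n" a] unfolding mat_op_def by (simp add: fun_eq_iff)

lemma mat_op_0: "mat_op n (0\<^sub>m n n) = 0"
  unfolding mat_op_def by (auto simp: S.op_of_def fun_eq_iff S.comb_def)

lemma mat_op_mult: "M \<in> carrier_mat n n \<Longrightarrow> N \<in> carrier_mat n n \<Longrightarrow> v \<in> coords n \<Longrightarrow>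
    mat_op n (M * N) v = mat_op n M (mat_op n N v)"
  unfolding mat_op_def by (rule S.op_of_mult[OF unit_vecs_basis]) simp_all

lemma mat_op_one: "v \<in> coords n \<Longrightarrow> mat_op n (1\<^sub>m n) v = v"
  using S.op_of_one[OF unit_vecs_basis, of v n] unfolding mat_op_def by simp

lemma mat_op_ext:
  assumes "v \<in> carrier_mat n n" "E \<subseteq> carrier_mat n n"
  shows "mat_op n ` ring.line_extension (mat_ring n) (scalar_mats F n) v E = S.O.ext (mat_op n v) (mat_op n ` E)"
proof (intro equalityI subsetI)
  fix y assume "y \<in> mat_op n ` ring.line_extension (mat_ring n) (scalar_mats F n) v E"
  then obtain a x where ax: "y = mat_op n (a \<cdot>\<^sub>m v + x)" "a \<in> F" "x \<in> E" unfolding mat_line_extension[OF assms(1)] by blast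
  show "y \<in> S.O.ext (mat_op n v) (mat_op n ` E)"
    unfolding ax(1) mat_op_lin[OF assms(1) subsetD[OF assms(2) ax(3)] ax(2)] by (rule S.O.extI[OF ax(2) imageI[OF ax(3)]])
next
  fix y assume "y \<in> S.O.ext (mat_op n v) (mat_op n ` E)"
  then obtain a w where aw: "a \<in> F" "w \<in> mat_op n ` E" "y = (\<lambda>u i. mat_op n v u i * a) + w" by (rule S.O.extE)
  obtain x where x: "w = mat_op n x" "x \<in> E" using aw(2) by (rule imageE)
  have "y = mat_op n (a \<cdot>\<^sub>m v + x)" unfolding aw(3) x(1) mat_op_lin[OF assms(1) subsetD[OF assms(2) x(2)] aw(1)] ..
  then show "y \<in> mat_op n ` ring.line_extension (mat_ring n) (scalar_mats F n) v E"
    unfolding mat_line_extension[OF assms(1)] using aw(1) x(2) by blast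
qed

lemma dimension_fdim:
  assumes "ring.dimension (mat_ring n) k (scalar_mats F n) S"
  shows "S \<subseteq> carrier_mat n n \<and> S.O.fdim k (mat_op n ` S)"
  using assms
proof (induction k "scalar_mats F n" S rule: ring.dimension.induct[OF ring_mat_ring[of n], consumes 1, case_names zero Suc])
  case zero
  show ?case using S.O.fdim_0 by (simp add: mat_ring_simps mat_op_0)
next
  case (Suc v E k)
  then have v: "v \<in> carrier_mat n n" and E: "E \<subseteq> carrier_mat n n" by (auto simp: mat_ring_simps)
  have "mat_op n v \<notin> mat_op n ` E"
  proof
    assume "mat_op n v \<in> mat_op n ` E"
    then obtain x where x: "mat_op n v = mat_op n x" "x \<in> E" by (rule imageE)
    have "v = x" by (rule mat_op_inj[OF v subsetD[OF E x(2)] x(1)])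
    then show False using Suc x(2) by simp
  qed
  then have "S.O.fdim (Suc k) (S.O.ext (mat_op n v) (mat_op n ` E))" using Suc by (intro S.O.fdim_Suc) simp_all
  moreover have "ring.line_extension (mat_ring n) (scalar_mats F n) v E \<subseteq> carrier_mat n n"
    unfolding mat_line_extension[OF v] using v E by auto
  ultimately show ?case unfolding mat_op_ext[OF v E] by blast
qed

lemma fdim_dimension:
  assumes "S.O.fdim k W" "S \<subseteq> carrier_mat n n" "W = mat_op n ` S"
  shows "ring.dimension (mat_ring n) k (scalar_mats F n) S"
  using assms
proof (induction arbitrary: S rule: S.O.fdim.induct)
  case fdim_0
  have "mat_op n ` {0\<^sub>m n n} = mat_op n ` S" using fdim_0(2) by (simp add: mat_op_0)
  from mat_op_inj_image[OF _ fdim_0(1) this] have "S = {0\<^sub>m n n}" by simp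
  then show ?case using ring.dimension.zero_dim[OF ring_mat_ring, of n "scalar_mats F n"] by (simp add: mat_ring_simps)
next
  case (fdim_Suc f W k)
  have WE: "S.O.ext f W \<subseteq> S.End (coords n)" using fdim_Suc.prems(2) mat_op_End by auto
  have "f \<in> S.End (coords n)" using S.O.ext_base[OF S.O.fdim_subsp[OF fdim_Suc.hyps(2)]] WE by blast
  then obtain v where v: "v \<in> carrier_mat n n" "f = mat_op n v" using mat_op_surj by blast
  \<comment> \<open>The smaller space of operators is pulled back to matrices. All its members come
    from matrices, because the extension W of it lies in the image of S.\<close>
  define T where "T = {M \<in> carrier_mat n n. mat_op n M \<in> W}"
  have T: "T \<subseteq> carrier_mat n n" by (auto simp: T_def)
  have WT: "W = mat_op n ` T"
  proof (intro equalityI subsetI)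
    fix w assume w: "w \<in> W"
    have "w \<in> S.End (coords n)" using w S.O.ext_mono[of W f] WE by blast
    then obtain M where "M \<in> carrier_mat n n" "w = mat_op n M" using mat_op_surj by blast
    then show "w \<in> mat_op n ` T" using w unfolding T_def by blast
  qed (auto simp: T_def)
  have "v \<notin> T" using fdim_Suc.hyps(1) v by (simp add: T_def)
  have 1: "ring.dimension (mat_ring n) (Suc k) (scalar_mats F n) (ring.line_extension (mat_ring n) (scalar_mats F n) v T)"
    by (rule ring.dimension.Suc_dim[OF ring_mat_ring _ \<open>v \<notin> T\<close> fdim_Suc.IH[OF T WT]])
      (use v in \<open>simp add: mat_ring_simps\<close>)
  have "ring.line_extension (mat_ring n) (scalar_mats F n) v T \<subseteq> carrier_mat n n"
    unfolding mat_line_extension[OF v(1)] using v(1) T by auto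
  from mat_op_inj_image[OF this fdim_Suc.prems(1)]
  have "ring.line_extension (mat_ring n) (scalar_mats F n) v T = S"
    unfolding mat_op_ext[OF v(1) T] WT[symmetric] v(2)[symmetric] using fdim_Suc.prems(2) by simp
  then show ?case using 1 by simp
qed

lemma mat_dim_eq:
  assumes "S \<subseteq> carrier_mat n n" "S.O.fdim k (mat_op n ` S)" shows "mat_dim F n S = k"
  unfolding mat_dim_def ring.dim_def[OF ring_mat_ring]
proof (rule the_equality)
  show "ring.dimension (mat_ring n) k (scalar_mats F n) S" by (rule fdim_dimension[OF assms(2,1) refl])
  show "l = k" if "ring.dimension (mat_ring n) l (scalar_mats F n) S" for l
    using S.O.fdim_unique[OF assms(2)] dimension_fdim[OF that] by blast
qed

lemma mat_op_fix:
  assumes "M \<in> carrier_mat n n"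
  shows "1\<^sub>m n - M \<in> GL n \<longleftrightarrow> (\<forall>v\<in>coords n. mat_op n M v = v \<longrightarrow> v = 0)"
proof -
  have "1\<^sub>m n - M \<in> GL n \<longleftrightarrow> (\<forall>v\<in>coords n. mat_op n (1\<^sub>m n - M) v = 0 \<longrightarrow> v = 0)"
    using S.GL_iff_inj[OF unit_vecs_basis, of "1\<^sub>m n - M" n] minus_carrier_mat[OF assms] unfolding mat_op_def by simp
  moreover have "mat_op n (1\<^sub>m n - M) v = v - mat_op n M v" if "v \<in> coords n" for v
    using S.op_of_diff[of "1\<^sub>m n" "unit_vecs n" M "coords n" v] mat_op_one[OF that] assms unfolding mat_op_def by simp
  ultimately show ?thesis by (metis eq_iff_diff_eq_0)
qed

lemma mat_uminus: "M \<in> carrier_mat n n \<Longrightarrow> - M = (- 1) \<cdot>\<^sub>m (M :: 'd mat)"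
  by (intro eq_matI) auto

lemma subalgebra_iff:
  "subalgebra (scalar_mats F n) J (mat_ring n) \<longleftrightarrow> J \<subseteq> carrier_mat n n \<and> 0\<^sub>m n n \<in> J \<and>
    (\<forall>M\<in>J. \<forall>N\<in>J. M + N \<in> J) \<and> (\<forall>a\<in>F. \<forall>M\<in>J. a \<cdot>\<^sub>m M \<in> J)"
proof
  assume "subalgebra (scalar_mats F n) J (mat_ring n)"
  then interpret A: subalgebra "scalar_mats F n" J "mat_ring n" .
  have J: "J \<subseteq> carrier_mat n n" using A.subset by (simp add: mat_ring_simps)
  have "a \<cdot>\<^sub>m M \<in> J" if "a \<in> F" "M \<in> J" for a M
  proof -
    have "(a \<cdot>\<^sub>m 1\<^sub>m n) * M \<in> J" using A.smult_closed[of "a \<cdot>\<^sub>m 1\<^sub>m n" M] that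
      by (simp add: mat_ring_simps scalar_mats_def)
    then show ?thesis unfolding scalar_mat_mult[OF subsetD[OF J that(2)]] .
  qed
  then show "J \<subseteq> carrier_mat n n \<and> 0\<^sub>m n n \<in> J \<and> (\<forall>M\<in>J. \<forall>N\<in>J. M + N \<in> J) \<and> (\<forall>a\<in>F. \<forall>M\<in>J. a \<cdot>\<^sub>m M \<in> J)"
    using J A.m_closed A.one_closed by (simp add: mat_ring_simps)
next
  assume a: "J \<subseteq> carrier_mat n n \<and> 0\<^sub>m n n \<in> J \<and> (\<forall>M\<in>J. \<forall>N\<in>J. M + N \<in> J) \<and> (\<forall>a\<in>F. \<forall>M\<in>J. a \<cdot>\<^sub>m M \<in> J)"
  then have J: "J \<subseteq> carrier_mat n n" by blast
  show "subalgebra (scalar_mats F n) J (mat_ring n)"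
  proof (intro subalgebra.intro subgroup.intro subalgebra_axioms.intro)
    show "J \<subseteq> carrier (add_monoid (mat_ring n))" using J by (simp add: mat_ring_simps)
    show "M \<otimes>\<^bsub>add_monoid (mat_ring n)\<^esub> N \<in> J" if "M \<in> J" "N \<in> J" for M N using a that by (simp add: mat_ring_simps)
    show "\<one>\<^bsub>add_monoid (mat_ring n)\<^esub> \<in> J" using a by (simp add: mat_ring_simps)
    show "inv\<^bsub>add_monoid (mat_ring n)\<^esub> M \<in> J" if M: "M \<in> J" for M
    proof -
      have MC: "M \<in> carrier_mat n n" using M J by blast
      have "\<ominus>\<^bsub>mat_ring n\<^esub> M = - M"
        by (rule abelian_group.minus_equality[OF ring.is_abelian_group[OF ring_mat_ring]])
          (use MC in \<open>simp_all add: mat_ring_simps\<close>)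
      moreover have "- M \<in> J" unfolding mat_uminus[OF MC] using a M F_neg[OF F_1] by blast
      ultimately show ?thesis by (simp add: a_inv_def)
    qed
    show "k \<otimes>\<^bsub>mat_ring n\<^esub> M \<in> J" if k: "k \<in> scalar_mats F n" and M: "M \<in> J" for k M
    proof -
      obtain c where c: "k = c \<cdot>\<^sub>m 1\<^sub>m n" "c \<in> F" using k unfolding scalar_mats_def by (rule imageE)
      have "(c \<cdot>\<^sub>m 1\<^sub>m n) * M = c \<cdot>\<^sub>m M" by (rule scalar_mat_mult) (use M J in blast)
      then show ?thesis using a M c by (simp add: mat_ring_simps)
    qed
  qed
qed

lemma subsp_mat_op:
  assumes J: "J \<subseteq> carrier_mat n n"
  shows "S.O.subsp (mat_op n ` J) \<longleftrightarrow> 0\<^sub>m n n \<in> J \<and> (\<forall>M\<in>J. \<forall>N\<in>J. M + N \<in> J) \<and> (\<forall>a\<in>F. \<forall>M\<in>J. a \<cdot>\<^sub>m M \<in> J)"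
proof -
  have mem: "mat_op n M \<in> mat_op n ` J \<longleftrightarrow> M \<in> J" if "M \<in> carrier_mat n n" for M
    using mat_op_inj[OF that] J by blast
  have z: "0 \<in> mat_op n ` J \<longleftrightarrow> 0\<^sub>m n n \<in> J" using mem[of "0\<^sub>m n n"] by (simp add: mat_op_0)
  have p: "mat_op n M + mat_op n N \<in> mat_op n ` J \<longleftrightarrow> M + N \<in> J" if "M \<in> J" "N \<in> J" for M N
    using mem[of "M + N"] mat_op_add[of M n N] J that by (simp add: subset_iff)
  have s: "(\<lambda>v i. mat_op n M v i * a) \<in> mat_op n ` J \<longleftrightarrow> a \<cdot>\<^sub>m M \<in> J" if "M \<in> J" "a \<in> F" for M a
    using mem[of "a \<cdot>\<^sub>m M"] mat_op_smult[of M n a] J that by (simp add: subset_iff)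
  show ?thesis unfolding S.O.subsp_def z ball_simps using p s by simp
qed

lemma trivial_spectrum_iff:
  "trivial_spectrum_subspace F n J \<longleftrightarrow> J \<subseteq> carrier_mat n n \<and> S.tspec (coords n) (mat_op n ` J)"
proof (cases "J \<subseteq> carrier_mat n n")
  case True
  have "mat_op n ` J \<subseteq> S.End (coords n)" using mat_op_End by (rule image_subsetI)
  moreover have "(\<forall>M\<in>J. 1\<^sub>m n - M \<in> GL n) \<longleftrightarrow> (\<forall>N\<in>mat_op n ` J. \<forall>v\<in>coords n. N v = v \<longrightarrow> v = 0)"
    using mat_op_fix True by (simp add: subset_iff)
  ultimately show ?thesis
    unfolding trivial_spectrum_subspace_def S.tspec_def subalgebra_iff subsp_mat_op[OF True] using True by simp
next
  case False
  then show ?thesis unfolding trivial_spectrum_subspace_def subalgebra_iff by simp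
qed

lemma nonisotropic_list_exists: "\<exists>Ps. nonisotropic_list \<sigma> e (replicate n 1) Ps"
proof -
  obtain p where p: "e p \<noteq> 0" using e_nonzero by blast
  define P where "P = mat 1 1 (\<lambda>_. p)"
  have PC: "P \<in> carrier_mat 1 1" by (simp add: P_def)
  have "nonisotropic \<sigma> e 1 P" unfolding nonisotropic_iff[OF PC]
  proof (intro allI impI)
    fix y :: "nat \<Rightarrow> 'd" assume "\<exists>i<1. y i \<noteq> 0"
    then have y: "y 0 \<noteq> 0" by simp
    have "qform 1 P y = \<sigma> (y 0) * p * y 0" by (simp add: qform_def P_def)
    then show "e (qform 1 P y) \<noteq> 0" using p y norm_eq_0[of "y 0"] by (simp add: e_norm conj_eq_0)
  qed
  then have "nonisotropic_list \<sigma> e (replicate n 1) (replicate n P)"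
    unfolding nonisotropic_list_def using nonisotropic_GL by simp
  then show ?thesis by blast
qed

text \<open>The bound is attained, by joints of n blocks of size one. Optimality, a comparison with
  all other spaces, thus becomes a statement about the dimension of J alone.\<close>

lemma optimal_iff:
  assumes "infinite F \<or> n * d \<le> card F"
  shows "optimal_trivial_spectrum F n J \<longleftrightarrow> J \<subseteq> carrier_mat n n \<and>
    S.tspec (coords n) (mat_op n ` J) \<and> S.O.fdim (S.bd n) (mat_op n ` J)"
proof -
  have E: "S.Dsub (coords n)" by (rule S.basis_Dsub[OF unit_vecs_basis])
  have Ed: "S.V.fdim (n * d) (coords n)" using S.basis_dim[OF unit_vecs_basis, of n] by simp
  have bound: "\<exists>k\<le>S.bd n. S.O.fdim k (mat_op n ` T) \<and> mat_dim F n T = k"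
    if "trivial_spectrum_subspace F n T" for T
    using S.dim_bound[OF E Ed _ assms, of "mat_op n ` T"] that mat_dim_eq[of T n] unfolding trivial_spectrum_iff by blast
  obtain Ps where Ps: "nonisotropic_list \<sigma> e (replicate n 1) Ps" using nonisotropic_list_exists by blast
  define T where "T = SH_joint \<sigma> e (replicate n 1) Ps"
  have TC: "T \<subseteq> carrier_mat n n" unfolding T_def using SH_joint_carrier[of "replicate n 1" Ps] by (simp add: sum_list_replicate)
  have T: "S.tspec (coords n) (mat_op n ` T)" "S.O.fdim (S.bd n) (mat_op n ` T)"
    using S.ops_tspec_dim[OF unit_vecs_basis _ _ Ps, of n] unfolding mat_op_image T_def by (simp_all add: sum_list_replicate)
  have Td: "mat_dim F n T = S.bd n" by (rule mat_dim_eq[OF TC T(2)])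
  have Tt: "trivial_spectrum_subspace F n T" unfolding trivial_spectrum_iff using TC T(1) by blast
  show ?thesis
  proof
    assume o: "optimal_trivial_spectrum F n J"
    then have t: "trivial_spectrum_subspace F n J" and "mat_dim F n T \<le> mat_dim F n J"
      using Tt unfolding optimal_trivial_spectrum_def by auto
    moreover obtain k where k: "k \<le> S.bd n" "S.O.fdim k (mat_op n ` J)" "mat_dim F n J = k" using bound[OF t] by blast
    ultimately have "k = S.bd n" using Td by simp
    then show "J \<subseteq> carrier_mat n n \<and> S.tspec (coords n) (mat_op n ` J) \<and> S.O.fdim (S.bd n) (mat_op n ` J)"
      using t k(2) unfolding trivial_spectrum_iff by simp
  next
    assume a: "J \<subseteq> carrier_mat n n \<and> S.tspec (coords n) (mat_op n ` J) \<and> S.O.fdim (S.bd n) (mat_op n ` J)"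
    then have "mat_dim F n J = S.bd n" using mat_dim_eq by blast
    then show "optimal_trivial_spectrum F n J"
      unfolding optimal_trivial_spectrum_def using a bound trivial_spectrum_iff by auto
  qed
qed

section \<open>Similarity as change of basis\<close>

definition columns :: "nat \<Rightarrow> 'd mat \<Rightarrow> (nat \<Rightarrow> 'd) list" where
  "columns n Q = map (\<lambda>j. mat_op n Q (unit_vecs n ! j)) [0..<n]"

lemma columns_comb: "S.comb (columns n Q) f = mat_op n Q (S.comb (unit_vecs n) f)"
proof -
  have s: "set (unit_vecs n) \<subseteq> coords n" using unit_vecs_basis unfolding S.basis_def by blast
  have "mat_op n Q (S.comb (unit_vecs n) f) = (\<Sum>j<length (unit_vecs n :: (nat \<Rightarrow> 'd) list). (\<lambda>i. mat_op n Q (unit_vecs n ! j) i * f j))"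
    by (rule S.End_comb[OF mat_op_End S.basis_Dsub[OF unit_vecs_basis] s])
  then show ?thesis unfolding S.comb_def[of "columns n Q"] by (simp add: columns_def)
qed

lemma columns_basis:
  assumes Q: "Q \<in> GL n" shows "S.basis (coords n) (columns n Q)"
proof -
  have QC: "Q \<in> carrier_mat n n" by (rule GL_carrier[OF Q])
  note b = unit_vecs_basis[of n]
  have inj: "v = 0" if "v \<in> coords n" "mat_op n Q v = 0" for v
    using S.GL_iff_inj[OF b, of Q] Q QC that unfolding mat_op_def by simp
  show ?thesis unfolding S.basis_def
  proof (intro conjI ballI allI impI)
    show "S.Dsub (coords n)" by (rule S.basis_Dsub[OF b])
    show "set (columns n Q) \<subseteq> coords n"
    proof
      fix w assume "w \<in> set (columns n Q)"
      then obtain j where j: "j < n" "w = mat_op n Q (unit_vecs n ! j)" by (auto simp: columns_def)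
      have "unit_vecs n ! j \<in> coords n" by (rule S.basis_mem[OF b]) (simp add: j(1))
      then show "w \<in> coords n" unfolding j(2) by (rule S.End_mem[OF mat_op_End])
    qed
    show "\<exists>f. v = S.comb (columns n Q) f" if v: "v \<in> coords n" for v
    proof -
      define w where "w = mat_op n (inv\<^bsub>mat_ring n\<^esub> Q) v"
      have w: "w \<in> coords n" unfolding w_def by (rule S.End_mem[OF mat_op_End v])
      have "mat_op n Q w = v" unfolding w_def mat_op_mult[OF QC GL_inv(1)[OF Q] v, symmetric] GL_inv(3)[OF Q] by (rule mat_op_one[OF v])
      then have "v = S.comb (columns n Q) (S.crd (unit_vecs n) w)" unfolding columns_comb S.comb_crd[OF b w] by simp
      then show ?thesis by blast
    qed
    show "f i = 0" if "S.comb (columns n Q) f = 0" "i < length (columns n Q)" for f i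
    proof -
      have "S.comb (unit_vecs n) f = 0" by (rule inj[OF S.basis_comb[OF b] that(1)[unfolded columns_comb]])
      then show ?thesis using S.basis_indep[OF b, of f i] that(2) by (simp add: columns_def)
    qed
  qed
qed

text \<open>Conjugation by Q is the change from the standard basis to the columns of Q; both
  operators are compared on these columns.\<close>

lemma columns_op_of:
  assumes Q: "Q \<in> GL n" and A: "A \<in> carrier_mat n n"
  shows "S.op_of (columns n Q) (coords n) A = mat_op n (Q * A * inv\<^bsub>mat_ring n\<^esub> Q)"
proof (rule S.End_basis_eqI[OF columns_basis[OF Q] S.op_of_End[OF columns_basis[OF Q]] mat_op_End])
  fix j assume "j < length (columns n Q)"
  then have j: "j < n" by (simp add: columns_def)
  note b = unit_vecs_basis[of n]
  have QC: "Q \<in> carrier_mat n n" by (rule GL_carrier[OF Q])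
  have u: "unit_vecs n ! j \<in> coords n" using S.basis_mem[OF b] j by simp
  have c: "columns n Q ! j = mat_op n Q (unit_vecs n ! j)" using j by (simp add: columns_def)
  have v: "columns n Q ! j \<in> coords n" unfolding c by (rule S.End_mem[OF mat_op_End u])
  have "S.op_of (columns n Q) (coords n) A (columns n Q ! j) = S.comb (columns n Q) (\<lambda>i. A $$ (i, j))"
    by (rule S.op_of_basis[OF columns_basis[OF Q]]) (use j in \<open>simp add: columns_def\<close>)
  also have "\<dots> = mat_op n Q (mat_op n A (unit_vecs n ! j))"
    unfolding columns_comb using S.op_of_basis[OF b, of j A] j by (simp add: mat_op_def)
  also have "unit_vecs n ! j = mat_op n (inv\<^bsub>mat_ring n\<^esub> Q) (columns n Q ! j)"
    unfolding c mat_op_mult[OF GL_inv(1)[OF Q] QC u, symmetric] GL_inv(2)[OF Q] using mat_op_one[OF u] by simp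
  also have "mat_op n Q (mat_op n A (mat_op n (inv\<^bsub>mat_ring n\<^esub> Q) (columns n Q ! j))) =
    mat_op n (Q * A * inv\<^bsub>mat_ring n\<^esub> Q) (columns n Q ! j)"
    using mat_op_mult[OF _ GL_inv(1)[OF Q] v, of "Q * A"] mat_op_mult[OF QC A S.End_mem[OF mat_op_End v]] QC A by simp
  finally show "S.op_of (columns n Q) (coords n) A (columns n Q ! j) = mat_op n (Q * A * inv\<^bsub>mat_ring n\<^esub> Q) (columns n Q ! j)" .
qed

lemma basis_columns:
  assumes c: "S.basis (coords n) bs" and l: "length bs = n"
  shows "\<exists>Q\<in>GL n. bs = columns n Q"
proof -
  note b = unit_vecs_basis[of n]
  define Q where "Q = mat n n (\<lambda>(i, j). (bs ! j) i)"
  have QC: "Q \<in> carrier_mat n n" by (simp add: Q_def)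
  have col: "mat_op n Q (unit_vecs n ! j) = bs ! j" if j: "j < n" for j
  proof -
    have "mat_op n Q (unit_vecs n ! j) = S.comb (unit_vecs n) (\<lambda>i. Q $$ (i, j))"
      unfolding mat_op_def by (rule S.op_of_basis[OF b]) (use j in simp)
    also have "\<dots> = bs ! j"
    proof
      fix i
      show "S.comb (unit_vecs n) (\<lambda>i. Q $$ (i, j)) i = (bs ! j) i"
        using S.basis_mem[OF c, of j] j l by (simp add: unit_vecs_comb Q_def coord_space_def)
    qed
    finally show ?thesis .
  qed
  then have bs: "bs = columns n Q" by (intro nth_equalityI) (simp_all add: columns_def l)
  have "v = 0" if v: "v \<in> coords n" "mat_op n Q v = 0" for v
  proof -
    have "S.comb bs (S.crd (unit_vecs n) v) = 0" unfolding bs columns_comb S.comb_crd[OF b v(1)] by (rule v(2))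
    then have "S.crd (unit_vecs n) v i = 0" if "i < n" for i using S.basis_indep[OF c] that l by simp
    then have "S.comb (unit_vecs n) (S.crd (unit_vecs n) v) = 0" by (simp add: unit_vecs_comb fun_eq_iff)
    then show "v = 0" unfolding S.comb_crd[OF b v(1)] .
  qed
  then have "Q \<in> GL n" using S.GL_iff_inj[OF b, of Q] QC unfolding mat_op_def by simp
  then show ?thesis using bs by blast
qed

text \<open>Turns the choice of a conjugating matrix into the choice of a basis, the language of
  \<open>optimal_is_joint\<close> and \<open>ops_joint_unique\<close>.\<close>

lemma similar_sets_iff:
  assumes J: "J \<subseteq> carrier_mat n n" and M: "M \<subseteq> carrier_mat n n"
  shows "similar_sets n J M \<longleftrightarrow> (\<exists>bs. S.basis (coords n) bs \<and> length bs = n \<and> mat_op n ` M = S.ops bs (coords n) J)"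
proof -
  have conj: "S.ops (columns n Q) (coords n) J = mat_op n ` (\<lambda>A. Q * A * inv\<^bsub>mat_ring n\<^esub> Q) ` J"
    and sub: "(\<lambda>A. Q * A * inv\<^bsub>mat_ring n\<^esub> Q) ` J \<subseteq> carrier_mat n n" if Q: "Q \<in> GL n" for Q
  proof -
    show "S.ops (columns n Q) (coords n) J = mat_op n ` (\<lambda>A. Q * A * inv\<^bsub>mat_ring n\<^esub> Q) ` J"
      unfolding S.ops_def image_image by (intro image_cong refl columns_op_of[OF Q]) (use J in blast)
    show "(\<lambda>A. Q * A * inv\<^bsub>mat_ring n\<^esub> Q) ` J \<subseteq> carrier_mat n n"
      by (rule image_subsetI) (rule mult_carrier_mat[OF mult_carrier_mat[OF GL_carrier[OF Q] subsetD[OF J]] GL_inv(1)[OF Q]])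
  qed
  show ?thesis
  proof
    assume "similar_sets n J M"
    then obtain Q where Q: "Q \<in> GL n" "M = (\<lambda>A. Q * A * inv\<^bsub>mat_ring n\<^esub> Q) ` J" unfolding similar_sets_def by (rule bexE)
    show "\<exists>bs. S.basis (coords n) bs \<and> length bs = n \<and> mat_op n ` M = S.ops bs (coords n) J"
      unfolding Q(2) conj[OF Q(1), symmetric] using columns_basis[OF Q(1)]
      by (intro exI[of _ "columns n Q"]) (simp add: columns_def)
  next
    assume "\<exists>bs. S.basis (coords n) bs \<and> length bs = n \<and> mat_op n ` M = S.ops bs (coords n) J"
    then obtain bs where bs: "S.basis (coords n) bs" "length bs = n" "mat_op n ` M = S.ops bs (coords n) J" by blast
    obtain Q where Q: "Q \<in> GL n" "bs = columns n Q" using basis_columns[OF bs(1,2)] by (rule bexE)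
    have "M = (\<lambda>A. Q * A * inv\<^bsub>mat_ring n\<^esub> Q) ` J"
      by (rule mat_op_inj_image[OF M sub[OF Q(1)]]) (use bs(3) in \<open>simp only: Q(2) conj[OF Q(1)]\<close>)
    then show "similar_sets n J M" unfolding similar_sets_def by (rule bexI[OF _ Q(1)])
  qed
qed

lemma similar_sets_sym:
  assumes J: "J \<subseteq> carrier_mat n n" and s: "similar_sets n J M"
  shows "similar_sets n M J"
proof -
  obtain Q where Q: "Q \<in> GL n" "M = (\<lambda>A. Q * A * inv\<^bsub>mat_ring n\<^esub> Q) ` J" using s unfolding similar_sets_def by (rule bexE)
  have ii: "inv\<^bsub>mat_ring n\<^esub> (inv\<^bsub>mat_ring n\<^esub> Q) = Q" by (rule monoid.Units_inv_inv[OF monoid_mat_ring Q(1)])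
  have "inv\<^bsub>mat_ring n\<^esub> Q * (Q * A * inv\<^bsub>mat_ring n\<^esub> Q) * Q = A" if "A \<in> J" for A
  proof -
    have A: "A \<in> carrier_mat n n" using that J by blast
    note C = GL_carrier[OF Q(1)] GL_inv(1)[OF Q(1)]
    have "inv\<^bsub>mat_ring n\<^esub> Q * (Q * A * inv\<^bsub>mat_ring n\<^esub> Q) = A * inv\<^bsub>mat_ring n\<^esub> Q"
      unfolding assoc_mult_mat[OF C(1) A C(2)] by (rule GL_cancel[OF Q(1) mult_carrier_mat[OF A C(2)]])
    then show ?thesis using assoc_mult_mat[OF A C(2,1)] GL_inv(2)[OF Q(1)] A by simp
  qed
  then have "(\<lambda>A. inv\<^bsub>mat_ring n\<^esub> Q * A * inv\<^bsub>mat_ring n\<^esub> (inv\<^bsub>mat_ring n\<^esub> Q)) ` M = J"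
    unfolding ii Q(2) image_image by simp
  then show ?thesis unfolding similar_sets_def by (intro bexI[OF _ GL_inv_GL[OF Q(1)]]) (rule sym)
qed

lemma similar_sets_carrier:
  assumes J: "J \<subseteq> carrier_mat n n" and s: "similar_sets n J M"
  shows "M \<subseteq> carrier_mat n n"
proof -
  obtain Q where Q: "Q \<in> GL n" "M = (\<lambda>A. Q * A * inv\<^bsub>mat_ring n\<^esub> Q) ` J" using s unfolding similar_sets_def by (rule bexE)
  show ?thesis unfolding Q(2)
    by (rule image_subsetI) (rule mult_carrier_mat[OF mult_carrier_mat[OF GL_carrier[OF Q(1)] subsetD[OF J]] GL_inv(1)[OF Q(1)]])
qed

lemma optimal_similar_to_joint:
  assumes card: "infinite F \<or> n * d \<le> card F" and o: "optimal_trivial_spectrum F n M"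
  shows "\<exists>ns Ps. ordered_partition n ns \<and> nonisotropic_list \<sigma> e ns Ps \<and> similar_sets n M (SH_joint \<sigma> e ns Ps)"
proof -
  have Ed: "S.V.fdim (n * d) (coords n)" using S.basis_dim[OF unit_vecs_basis, of n] by simp
  have M: "M \<subseteq> carrier_mat n n" "S.tspec (coords n) (mat_op n ` M)" "S.O.fdim (S.bd n) (mat_op n ` M)"
    using o unfolding optimal_iff[OF card] by auto
  obtain bs ns Ps where j: "S.basis (coords n) bs \<and> length bs = n \<and> sum_list ns = n \<and> (\<forall>k\<in>set ns. 0 < k) \<and>
    nonisotropic_list \<sigma> e ns Ps \<and> mat_op n ` M = S.ops bs (coords n) (SH_joint \<sigma> e ns Ps)"
    using S.optimal_is_joint[OF S.basis_Dsub[OF unit_vecs_basis] Ed M(2,3) card] by (elim exE) (rule that)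
  note r = j[THEN conjunct1] j[THEN conjunct2, THEN conjunct1] j[THEN conjunct2, THEN conjunct2, THEN conjunct1]
    j[THEN conjunct2, THEN conjunct2, THEN conjunct2, THEN conjunct1]
    j[THEN conjunct2, THEN conjunct2, THEN conjunct2, THEN conjunct2, THEN conjunct1]
    j[THEN conjunct2, THEN conjunct2, THEN conjunct2, THEN conjunct2, THEN conjunct2]
  have C: "SH_joint \<sigma> e ns Ps \<subseteq> carrier_mat n n" using SH_joint_carrier[of ns Ps] r(3) by simp
  have "similar_sets n (SH_joint \<sigma> e ns Ps) M" unfolding similar_sets_iff[OF C M(1)]
    by (rule exI[of _ bs]) (intro conjI r)
  then have "similar_sets n M (SH_joint \<sigma> e ns Ps)" by (rule similar_sets_sym[OF C])
  moreover have "ordered_partition n ns" unfolding ordered_partition_def by (rule conjI[OF r(4) r(3)])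
  ultimately show ?thesis using r(5) by blast
qed

lemma joint_data_unique:
  assumes M: "M \<subseteq> carrier_mat n n"
    and 1: "ordered_partition n ns" "nonisotropic_list \<sigma> e ns Ps" "similar_sets n M (SH_joint \<sigma> e ns Ps)"
    and 2: "ordered_partition n ns'" "nonisotropic_list \<sigma> e ns' Ps'" "similar_sets n M (SH_joint \<sigma> e ns' Ps')"
  shows "ns = ns' \<and> (\<forall>i<length ns. homo_star_congruent F \<sigma> (ns ! i) (Ps ! i) (Ps' ! i))"
proof -
  have s: "\<exists>bs. S.basis (coords n) bs \<and> length bs = n \<and> mat_op n ` M = S.ops bs (coords n) (SH_joint \<sigma> e ms Qs)"
    if "ordered_partition n ms" "similar_sets n M (SH_joint \<sigma> e ms Qs)" for ms Qs
  proof -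
    have C: "SH_joint \<sigma> e ms Qs \<subseteq> carrier_mat n n"
      using SH_joint_carrier[of ms Qs] that(1) unfolding ordered_partition_def by simp
    show ?thesis by (rule iffD1[OF similar_sets_iff[OF C M] similar_sets_sym[OF M that(2)]])
  qed
  obtain bs where bs: "S.basis (coords n) bs \<and> length bs = n \<and> mat_op n ` M = S.ops bs (coords n) (SH_joint \<sigma> e ns Ps)"
    by (rule exE[OF s[OF 1(1,3)]])
  obtain bs' where bs': "S.basis (coords n) bs' \<and> length bs' = n \<and> mat_op n ` M = S.ops bs' (coords n) (SH_joint \<sigma> e ns' Ps')"
    by (rule exE[OF s[OF 2(1,3)]])
  have l: "length bs = sum_list ns" unfolding ordered_partition_sum[OF 1(1)] by (rule conjunct1[OF conjunct2[OF bs]])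
  have l': "length bs' = sum_list ns'" unfolding ordered_partition_sum[OF 2(1)] by (rule conjunct1[OF conjunct2[OF bs']])
  have eq: "S.ops bs (coords n) (SH_joint \<sigma> e ns Ps) = S.ops bs' (coords n) (SH_joint \<sigma> e ns' Ps')"
    by (rule trans[OF sym[OF conjunct2[OF conjunct2[OF bs]]] conjunct2[OF conjunct2[OF bs']]])
  show ?thesis
    by (rule S.ops_joint_unique[OF conjunct1[OF bs] conjunct1[OF bs'] l l' ordered_partition_pos[OF 1(1)]
      ordered_partition_pos[OF 2(1)] 1(2) 2(2) eq])
qed

lemma similar_to_joint_optimal:
  assumes card: "infinite F \<or> n * d \<le> card F"
    and 1: "ordered_partition n ns" "nonisotropic_list \<sigma> e ns Ps" "similar_sets n (SH_joint \<sigma> e ns Ps) M"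
  shows "optimal_trivial_spectrum F n M"
proof -
  note ns = ordered_partition_sum[OF 1(1)] ordered_partition_pos[OF 1(1)]
  have C: "SH_joint \<sigma> e ns Ps \<subseteq> carrier_mat n n" using SH_joint_carrier[of ns Ps] ns by simp
  have M: "M \<subseteq> carrier_mat n n" by (rule similar_sets_carrier[OF C 1(3)])
  obtain bs where bs: "S.basis (coords n) bs \<and> length bs = n \<and> mat_op n ` M = S.ops bs (coords n) (SH_joint \<sigma> e ns Ps)"
    by (rule exE[OF 1(3)[unfolded similar_sets_iff[OF C M]]])
  have l: "length bs = sum_list ns" unfolding ns(1) by (rule conjunct1[OF conjunct2[OF bs]])
  note t = S.ops_tspec_dim[OF conjunct1[OF bs] l ns(2) 1(2), unfolded ns(1)]
  show ?thesis unfolding optimal_iff[OF card] conjunct2[OF conjunct2[OF bs]]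
    by (rule conjI[OF M t])
qed

lemma similar_sets_refl: assumes "J \<subseteq> (carrier_mat n n :: 'd mat set)" shows "similar_sets n J J"
proof (rule iffD2[OF similar_sets_iff[OF assms assms]])
  show "\<exists>bs. S.basis (coords n) bs \<and> length bs = n \<and> mat_op n ` J = S.ops bs (coords n) J"
    by (rule exI[of _ "unit_vecs n"]) (intro conjI unit_vecs_basis length_unit_vecs mat_op_image[symmetric])
qed

end

section \<open>Associated pairs\<close>

lemma ring_dring: "ring (\<D> :: 'd :: division_ring ring)"
proof -
  have "\<exists>y. x + y = 0" for x :: 'd
    using add.right_inverse by blast
  then show ?thesis
    unfolding ring_of_type_algebra_def using add.right_inverse
    by unfold_locales (auto simp: algebra_simps Units_def)
qed

lemma dring_simps:
  "carrier \<D> = UNIV" "mult \<D> = (*)" "one \<D> = 1" "zero \<D> = 0" "add \<D> = (+)"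
  by (simp_all add: ring_of_type_algebra_def)

lemma central_field_if:
  fixes F :: "'d :: division_ring set"
  assumes "central_subfield F" shows "central_field F"
proof -
  have sf: "subfield F \<D>" and c: "\<forall>a\<in>F. \<forall>x. a * x = x * a" using assms unfolding central_subfield_def by auto
  interpret R: ring "\<D> :: 'd ring" by (rule ring_dring)
  note sr = subringE[OF subfieldE(1)[OF sf], unfolded dring_simps]
  have neg: "\<ominus>\<^bsub>\<D>\<^esub> a = - a" for a :: 'd
    using R.minus_equality[of "- a" a] by (simp add: dring_simps)
  have inv: "inverse k \<in> F" if "k \<in> F" for k
  proof (cases "k = 0")
    case False
    then have k: "k \<in> F - {\<zero>\<^bsub>\<D>\<^esub>}" using that by (simp add: dring_simps)
    have "k * inv\<^bsub>\<D>\<^esub> k = 1" using R.subfield_m_inv(2)[OF sf k] by (simp add: dring_simps)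
    then have "inv\<^bsub>\<D>\<^esub> k = inverse k" using False by (metis inverse_unique)
    then show ?thesis using R.subfield_m_inv(1)[OF sf k] by simp
  qed (use that in simp)
  show ?thesis
  proof
    show "0 \<in> F" "1 \<in> F" using sr by auto
    show "a + b \<in> F" if "a \<in> F" "b \<in> F" for a b using sr that by auto
    show "a * b \<in> F" if "a \<in> F" "b \<in> F" for a b using sr that by auto
    show "- a \<in> F" if "a \<in> F" for a using sr(5)[OF that] neg by simp
    show "inverse a \<in> F" if "a \<in> F" for a by (rule inv[OF that])
    show "a * x = x * a" if "a \<in> F" for a x using c that by blast
  qed
qed

lemma dring_line_extension:
  "ring.line_extension \<D> F v E = {a * v + x | a x. a \<in> F \<and> x \<in> E}" for v :: "'d :: division_ring"
  unfolding ring.line_extension_def[OF ring_dring] set_add_def set_mult_def r_coset_def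
  by (auto simp: dring_simps)

context central_field
begin

lemma Fc: "a \<in> F \<Longrightarrow> z * a = a * z"
  using F_comm[of a z] by (rule sym)

lemma Fcc: "a \<in> F \<Longrightarrow> z * (a * w) = a * (z * w)"
  by (simp only: mult.assoc[symmetric] Fc)

lemma fspace_mult: "fspace F (*)"
  by unfold_locales (auto simp: algebra_simps)

lemma dring_dimension_fdim:
  assumes "ring.dimension \<D> k F E" shows "fspace.fdim F (*) k E"
proof -
  interpret D: fspace F "(*)" by (rule fspace_mult)
  have "D.fdim k E" if "ring.dimension \<D> k G E" "G = F" for k G E
    using that
  proof (induction k G E rule: ring.dimension.induct[OF ring_dring, consumes 1, case_names zero Suc])
    case (zero K)
    show ?case using D.fdim_0 by (simp add: dring_simps)
  next
    case (Suc v E k K)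
    have "ring.line_extension \<D> F v E = D.ext v E" unfolding dring_line_extension D.ext_def ..
    then show ?case using D.fdim_Suc[of v E k] Suc by simp
  qed
  then show ?thesis using assms by blast
qed

end

text \<open>Serves the types in which the division ring is a field: there a multiplicative \<sigma>
  is anti-multiplicative, and cyclicity of e is immediate.\<close>

lemma (in central_field) quad_commutative:
  assumes dim: "fspace.fdim F (*) d UNIV" and comm: "\<And>x y :: 'd. x * y = y * x"
    and s: "\<And>x y. \<sigma> (x + y) = \<sigma> x + \<sigma> y" "\<And>x y. \<sigma> (x * y) = \<sigma> x * \<sigma> y" "\<And>x. \<sigma> (\<sigma> x) = x" "\<And>a. a \<in> F \<Longrightarrow> \<sigma> a = a"
    and e: "linear_form F e" "\<And>x. e (\<sigma> x) = e x" "\<exists>x. e x \<noteq> 0" "\<And>x. e x = 0 \<Longrightarrow> \<sigma> x = - x"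
    and norm: "\<And>x. x * \<sigma> x \<in> F"
  shows "quad F d \<sigma> e"
proof
  note l = e(1)[unfolded linear_form_def]
  show "fspace.fdim F (*) d UNIV" by (rule dim)
  fix x y a
  show "\<sigma> (x + y) = \<sigma> x + \<sigma> y" "\<sigma> (\<sigma> x) = x" by (rule s)+
  show "\<sigma> (x * y) = \<sigma> y * \<sigma> x" unfolding s(2) by (rule comm)
  show "a \<in> F \<Longrightarrow> \<sigma> a = a" by (rule s(4))
  show "e x \<in> F" "e (x + y) = e x + e y" "a \<in> F \<Longrightarrow> e (a * x) = a * e x" using l by blast+
  show "e (x * y) = e (y * x)" by (rule arg_cong[OF comm])
  show "e (\<sigma> x) = e x" "\<exists>x. e x \<noteq> 0" by (rule e)+
  show "e x = 0 \<Longrightarrow> \<sigma> x = - x" by (rule e(4))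
  show "x * \<sigma> x \<in> F" by (rule norm)
qed

text \<open>For \<open>\<sigma> x = e x - x\<close>, the condition \<open>x * \<sigma> x \<in> F\<close> alone forces \<open>\<sigma>\<close> to be anti-multiplicative:
  comparing the quadratic equations of \<open>x\<close>, \<open>y\<close> and \<open>x * y\<close> puts \<open>c * (x * y)\<close> in \<open>F\<close>, where \<open>c\<close> is the
  defect of \<open>e (x * y)\<close>.\<close>

locale trace_form = central_field F for F :: "'d :: division_ring set" +
  fixes e :: "'d \<Rightarrow> 'd"
  assumes lin: "linear_form F e" and e_1: "e 1 = 1 + 1" and nrm: "x * (e x - x) \<in> F"
begin

lemma e_F: "e x \<in> F" and e_add: "e (x + y) = e x + e y" and e_sc: "a \<in> F \<Longrightarrow> e (a * x) = a * e x"
  using lin unfolding linear_form_def by auto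

lemma e_diff: "e (x - y) = e x - e y"
  using e_add[of "x - y" y] by simp

lemma e_of_F: "a \<in> F \<Longrightarrow> e a = a + a"
  using e_sc[of a 1] by (simp add: e_1 mult_2_right)

lemma comm_e: "x * e y = e y * x"
  by (rule Fc[OF e_F])

definition B :: "'d \<Rightarrow> 'd \<Rightarrow> 'd" where
  "B x y = e y * x + e x * y - x * y - y * x"

lemma B_F: "B x y \<in> F"
proof -
  have "(x + y) * (e (x + y) - (x + y)) - x * (e x - x) - y * (e y - y) = x * e y + y * e x - x * y - y * x"
    by (simp add: e_add algebra_simps)
  also have "\<dots> = B x y" by (simp add: B_def comm_e)
  finally show ?thesis using F_diff[OF F_diff[OF nrm nrm] nrm, of "x + y" x y] by simp
qed

lemma square: "x * x = e x * x - x * (e x - x)"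
  by (simp add: right_diff_distrib comm_e)

lemma product_equation: "(e (x * y) - e x * e y + B x y) * (x * y) \<in> F"
proof -
  define N M where "N = x * (e x - x)" and "M = y * (e y - y)"
  have NF: "N \<in> F" "M \<in> F" using nrm by (simp_all add: N_def M_def)
  have x2: "x * x = e x * x - N" and y2: "y * y = e y * y - M" by (simp_all add: N_def M_def square)
  have yx: "y * x = e y * x + e x * y - x * y - B x y" by (simp add: B_def)
  have m: "x * N = N * x" "x * M = M * x" "y * N = N * y" "y * M = M * y" "x * e y = e y * x" "x * e x = e x * x"
    "y * e x = e x * y" "y * e y = e y * y" "x * B x y = B x y * x" "M * N = N * M" "e y * e x = e x * e y"
    "N * e x = e x * N" "N * e y = e y * N" "M * e x = e x * M" "M * e y = e y * M"
    by (rule Fc, rule NF e_F B_F)+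
  have mm: "x * (N * z) = N * (x * z)" "x * (M * z) = M * (x * z)" "y * (N * z) = N * (y * z)" "y * (M * z) = M * (y * z)"
    "x * (e y * z) = e y * (x * z)" "x * (e x * z) = e x * (x * z)" "y * (e x * z) = e x * (y * z)"
    "y * (e y * z) = e y * (y * z)" "x * (B x y * z) = B x y * (x * z)" "M * (N * z) = N * (M * z)" "e y * (e x * z) = e x * (e y * z)"
    "N * (e x * z) = e x * (N * z)" "N * (e y * z) = e y * (N * z)" "M * (e x * z) = e x * (M * z)" "M * (e y * z) = e y * (M * z)" for z
    by (rule Fcc, rule NF e_F B_F)+
  have x2': "x * (x * z) = e x * (x * z) - N * z" for z
    using arg_cong[OF x2, of "\<lambda>w. w * z"] by (simp only: mult.assoc left_diff_distrib)
  \<comment> \<open>The inner product y * x is reversed by means of \<open>B\<close>, and both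
    squares are reduced. Comparison with the quadratic equation of x * y itself leaves the defect
    times x * y in F.\<close>
  have "(x * y) * (x * y) = x * (y * x) * y" by (simp only: mult.assoc)
  also have "\<dots> = x * (e y * x + e x * y - x * y - B x y) * y" by (simp only: yx)
  also have "\<dots> = e y * (x * (x * y)) + e x * (x * (y * y)) - x * (x * (y * y)) - B x y * (x * y)"
    by (simp only: distrib_left distrib_right left_diff_distrib right_diff_distrib mult.assoc mm)
  also have "\<dots> = (e x * e y - B x y) * (x * y) - N * M"
    by (simp only: x2' y2 distrib_left distrib_right left_diff_distrib right_diff_distrib mult.assoc mm m) (simp add: mm m x2 right_diff_distrib)
  finally have 1: "(x * y) * (x * y) = (e x * e y - B x y) * (x * y) - N * M" .
  have "(x * y) * (x * y) = e (x * y) * (x * y) - x * y * (e (x * y) - x * y)" by (rule square)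
  then have "(e (x * y) - e x * e y + B x y) * (x * y) = x * y * (e (x * y) - x * y) - N * M"
    using 1 by (simp add: algebra_simps)
  then show ?thesis using nrm[of "x * y"] NF by (simp add: F_diff F_mul)
qed

text \<open>If x * y is not in F, a nonzero defect could be divided out of
  \<open>product_equation\<close> and would put x * y into F. If x * y is in F and x \<noteq> 0,
  then y is an F-multiple of the conjugate e x - x, and both sides can be computed.\<close>

lemma trace_mult: "e (x * y) = e x * e y - B x y"
proof (cases "x * y \<in> F")
  case False
  define c where "c = e (x * y) - e x * e y + B x y"
  have cF: "c \<in> F" unfolding c_def by (intro F_add F_diff F_mul e_F B_F)
  have "c = 0"
  proof (rule ccontr)
    assume "c \<noteq> 0"
    then have "inverse c * (c * (x * y)) = x * y" by (simp flip: mult.assoc)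
    moreover have "inverse c * (c * (x * y)) \<in> F"
      using product_equation[of x y] F_inv[OF cF] by (simp add: c_def[symmetric] F_mul)
    ultimately show False using False by simp
  qed
  then show ?thesis by (simp add: c_def algebra_simps)
next
  case True
  have e0: "e 0 = 0" using e_add[of 0 0] by simp
  show ?thesis
  proof (cases "x = 0")
    case True
    then show ?thesis by (simp add: B_def e0)
  next
    case x: False
    define N c where "N = x * (e x - x)" and "c = x * y"
    have NF: "N \<in> F" "c \<in> F" using nrm True by (simp_all add: N_def c_def)
    define s where "s = c * inverse N"
    show ?thesis
    \<comment> \<open>A vanishing norm would give e x = x, hence x in F and x + x = x.\<close>
    proof (cases "N = 0")
      case True
      then have ex: "e x = x" using x by (simp add: N_def)
      then have xF: "x \<in> F" using e_F[of x] by simp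
      have "x + x = x" using e_of_F[OF xF] ex by simp
      then show ?thesis using x by simp
    next
      case False
      have sF: "s \<in> F" unfolding s_def by (intro F_mul F_inv NF)
      have sN: "s * N = c" using False by (simp add: s_def mult.assoc)
      have xs: "x * (s * (e x - x)) = s * N" unfolding N_def by (rule Fcc[OF sF])
      have "x * y = x * (s * (e x - x))" by (simp only: xs sN c_def[symmetric])
      then have y: "y = s * (e x - x)" using mult_left_cancel[OF x] by blast
      have "e (e x - x) = e x" by (simp add: e_diff e_of_F e_F)
      then have ey: "e y = s * e x" using y by (simp add: e_sc sF)
      have xy: "x * y = s * N" using sN by (simp add: c_def)
      have yx: "y * x = s * N" unfolding y N_def
        by (simp only: mult.assoc left_diff_distrib right_diff_distrib comm_e[of x x] Fcc[OF sF, of "e x"])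
      have "e (x * y) = s * N + s * N" unfolding xy by (rule e_of_F) (intro F_mul sF NF)
      moreover have "e y * x + e x * y = s * e x * e x"
      proof -
        have "e x * y = s * e x * (e x - x)" unfolding y mult.assoc by (rule Fcc[OF sF])
        then show ?thesis unfolding ey by (simp add: right_diff_distrib)
      qed
      moreover have "e x * e y = s * e x * e x" unfolding ey mult.assoc by (rule Fcc[OF sF])
      ultimately show ?thesis unfolding B_def xy yx by simp
    qed
  qed
qed

lemma quad_trace:
  assumes "fspace.fdim F (*) d UNIV" "\<exists>x. e x \<noteq> 0"
  shows "quad F d (\<lambda>x. e x - x) e"
proof
  show "fspace.fdim F (*) d UNIV" "\<exists>x. e x \<noteq> 0" by fact+
  fix x y :: 'd
  have tm: "e (x * y) = e x * e y - (e y * x + e x * y - x * y - y * x)" for x y using trace_mult unfolding B_def .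
  show "e (x + y) - (x + y) = e x - x + (e y - y)" by (simp add: e_add)
  show "e (x * y) - x * y = (e y - y) * (e x - x)"
    unfolding tm left_diff_distrib right_diff_distrib comm_e[of y x] Fc[OF e_F, of "e y" x] by simp
  have ee: "e (e x) = e x + e x" for x by (rule e_of_F[OF e_F])
  show "e (e x - x) - (e x - x) = x" by (simp add: e_diff ee)
  show "e a - a = a" if "a \<in> F" for a using that by (simp add: e_of_F)
  show "e x \<in> F" "e (x + y) = e x + e y" by (rule e_F e_add)+
  show "e (a * x) = a * e x" if "a \<in> F" for a using that by (rule e_sc)
  show "e (x * y) = e (y * x)" unfolding tm Fc[OF e_F, of "e y" x] by (simp add: algebra_simps)
  show "e (e x - x) = e x" by (simp add: e_diff ee)
  show "e x - x = - x" if "e x = 0" using that by simp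
  show "x * (e x - x) \<in> F" by (rule nrm)
qed

end

section \<open>The four quadratic types\<close>

lemma field_dring_comm:
  fixes x y :: "'d :: division_ring"
  assumes "field (\<D> :: 'd ring)" shows "x * y = y * x"
proof -
  interpret K: field "\<D> :: 'd ring" by (rule assms)
  show ?thesis using K.m_comm[of x y] by (simp add: dring_simps)
qed

lemma char_two: "CHAR('d :: division_ring) = 2 \<Longrightarrow> x + x = (0 :: 'd)"
proof -
  assume "CHAR('d) = 2"
  then have "of_nat 2 = (0 :: 'd)" using of_nat_CHAR[where 'a = 'd] by simp
  then have "(1 + 1 :: 'd) = 0" by simp
  then have "x * (1 + 1) = 0" by simp
  then show ?thesis by (simp only: distrib_left mult_1_right)
qed

lemma automorphism_simps:
  assumes "g \<in> automorphisms_over F"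
  shows "g (x + y) = g x + g y" "g (x * y) = g x * g y" "a \<in> F \<Longrightarrow> g a = a"
  using assms unfolding automorphisms_over_def ring_iso_def ring_hom_def by (auto simp: dring_simps)

lemma id_automorphism: "id \<in> automorphisms_over (F :: 'd :: division_ring set)"
  unfolding automorphisms_over_def ring_iso_def ring_hom_def by (auto simp: dring_simps)

text \<open>Squares lie in F and are fixed, and squaring is injective in characteristic two.\<close>

lemma automorphism_radicial:
  fixes F :: "'d :: division_ring set"
  assumes r: "quad_radicial F d" and g: "g \<in> automorphisms_over F" shows "g = id"
proof
  fix x
  have f: "field (\<D> :: 'd ring)" and c: "CHAR('d) = 2" and sq: "x\<^sup>2 \<in> F" using r unfolding quad_radicial_def by auto
  have "g x * g x = x * x" using automorphism_simps(2)[OF g, of x x] automorphism_simps(3)[OF g sq] by (simp add: power2_eq_square)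
  moreover have "(g x + x) * (g x + x) = (g x * g x + x * x) + (g x * x + g x * x)"
    using field_dring_comm[OF f, of x "g x"] by (simp add: algebra_simps)
  ultimately have "(g x + x) * (g x + x) = 0" by (simp add: char_two[OF c])
  then have "g x + x = x + x" by (simp add: char_two[OF c])
  then show "g x = id x" by simp
qed

text \<open>In a field of characteristic two the relation j i = (i + 1) j would give j = 0.\<close>

lemma quaternion_not_radicial:
  assumes "quaternion_basis F i j" shows "\<not> quad_radicial F d"
proof
  assume r: "quad_radicial (F :: 'a set) d"
  then have f: "field (\<D> :: 'a ring)" and c: "CHAR('a) = 2" unfolding quad_radicial_def by auto
  have "j * i = (i + 1) * j" "j \<noteq> 0" using assms c unfolding quaternion_basis_def by auto
  then show False using field_dring_comm[OF f, of j i] by (simp add: distrib_right)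
qed

context central_field
begin

lemma fdim_F: "fspace.fdim F (*) 1 F"
proof -
  interpret D: fspace F "(*)" by (rule fspace_mult)
  have "F = D.ext 1 {0}" unfolding D.ext_def by auto
  then show ?thesis using D.fdim_Suc[OF _ D.fdim_0, of 1] by simp
qed

lemma fdim_one_iff: "fspace.fdim F (*) d UNIV \<Longrightarrow> d = 1 \<longleftrightarrow> F = UNIV"
proof -
  interpret D: fspace F "(*)" by (rule fspace_mult)
  assume "D.fdim d UNIV"
  then show ?thesis using fdim_F D.fdim_unique[of 1 UNIV d] D.fdim_eq[of 1 UNIV F] by auto
qed

text \<open>An element y moved by \<sigma> generates the extension, and automorphisms permute the
  two roots y and p - y of its quadratic equation. So the group consists of id and \<sigma>, and the
  trace is x + \<sigma> x.\<close>

lemma quad_separable: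
  assumes dim: "fspace.fdim F (*) 2 UNIV" and comm: "\<And>x y :: 'd. x * y = y * x"
    and \<sigma>: "\<sigma> \<in> automorphisms_over F" "\<sigma> \<noteq> id" and e: "e = galois_trace F" and lin: "linear_form F e"
  shows "quad F 2 \<sigma> e"
proof -
  interpret D: fspace F "(*)" by (rule fspace_mult)
  note a = automorphism_simps[OF \<sigma>(1)]
  obtain y where y: "\<sigma> y \<noteq> y" using \<sigma>(2) by (auto simp: fun_eq_iff)
  have yF: "y \<notin> F" using a(3) y by blast
  have "D.fdim 2 (D.ext y F)" using D.fdim_Suc[OF yF fdim_F] by (simp add: numeral_2_eq_2)
  then have U: "D.ext y F = UNIV" using D.fdim_eq[OF dim] by simp
  have rep: "\<exists>s\<in>F. \<exists>t\<in>F. x = s * y + t" for x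
  proof -
    have "x \<in> D.ext y F" by (simp add: U)
    then show ?thesis by (rule D.extE) blast
  qed
  obtain p q where pq: "p \<in> F" "q \<in> F" "y * y = p * y + q" using rep[of "y * y"] by blast
  have conj: "g y = y \<or> g y = p - y" if g: "g \<in> automorphisms_over F" for g
  proof -
    note b = automorphism_simps[OF g]
    have "g y * g y = p * g y + q" using b(2)[of y y] b(1)[of "p * y" q] b(2)[of p y] b(3) pq by simp
    then have "(g y - y) * (g y + y - p) = 0" using pq(3)
      by (simp add: distrib_left distrib_right right_diff_distrib left_diff_distrib comm)
    then have "g y - y = 0 \<or> g y + y - p = 0" by (simp only: mult_eq_0_iff)
    then show ?thesis by (auto simp: algebra_simps)
  qed
  have sy: "\<sigma> y = p - y" using conj[OF \<sigma>(1)] y by blast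
  have eqI: "g = h" if "g \<in> automorphisms_over F" "h \<in> automorphisms_over F" "g y = h y" for g h
  proof
    fix x
    obtain s t where "s \<in> F" "t \<in> F" "x = s * y + t" using rep[of x] by blast
    then show "g x = h x" using that automorphism_simps[OF that(1)] automorphism_simps[OF that(2)] by simp
  qed
  have "automorphisms_over F = {id, \<sigma>}"
  proof (intro equalityI subsetI)
    fix g assume g: "g \<in> automorphisms_over F"
    show "g \<in> {id, \<sigma>}" using conj[OF g]
    proof
      assume "g y = y"
      then have "g = id" by (intro eqI[OF g id_automorphism]) simp
      then show ?thesis by simp
    next
      assume "g y = p - y"
      then have "g = \<sigma>" by (intro eqI[OF g \<sigma>(1)]) (simp add: sy)
      then show ?thesis by simp
    qed
  qed (use \<sigma> id_automorphism in auto)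
  then have e_eq: "e x = x + \<sigma> x" for x unfolding e galois_trace_def using \<sigma>(2) by simp
  have ss: "\<sigma> (\<sigma> x) = x" for x
  proof -
    obtain s t where x: "s \<in> F" "t \<in> F" "x = s * y + t" using rep[of x] by blast
    have "\<sigma> (p - y) = y" using a(1)[of "p - y" y] a(3)[OF pq(1)] sy by (simp add: algebra_simps)
    then show ?thesis using x a sy by simp
  qed
  have norm: "x * \<sigma> x \<in> F" for x
  proof -
    obtain s t where x: "s \<in> F" "t \<in> F" "x = s * y + t" using rep[of x] by blast
    have sx: "\<sigma> x = s * (p - y) + t" using x a sy by simp
    have lc: "w * (w' * z) = w' * (w * z)" for w w' z :: 'd
      unfolding mult.assoc[symmetric] comm[of w w'] ..
    have yy: "y * (p - y) = - q" using pq(3) comm[of y p] by (simp add: algebra_simps)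
    have "x * \<sigma> x = (s * s) * (y * (p - y)) + (s * t) * (y + (p - y)) + t * t"
      unfolding sx unfolding x(3) by (simp add: distrib_left distrib_right right_diff_distrib left_diff_distrib mult.assoc lc comm)
    also have "\<dots> \<in> F" unfolding yy using x pq by (simp add: F_add F_mul F_neg F_diff)
    finally show ?thesis .
  qed
  show ?thesis
  proof (rule quad_commutative[OF dim comm])
    \<comment> \<open>A zero trace would make \<sigma> the negation. As \<sigma> fixes 1, the
      characteristic would be two and \<sigma> the identity.\<close>
    show "\<exists>x. e x \<noteq> 0"
    proof (rule ccontr)
      assume "\<not> ?thesis"
      then have z: "\<sigma> x = - x" for x using e_eq[of x] by (simp add: eq_neg_iff_add_eq_0 add.commute)
      have "(1 :: 'd) = - 1" using z[of 1] a(3)[OF F_1] by simp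
      from arg_cong[OF this, of "\<lambda>w. y * w"] have "y = - y" by simp
      then have "\<sigma> y = y" using z[of y] by simp
      then show False using y by simp
    qed
    show "\<sigma> x = - x" if "e x = 0" for x using that e_eq[of x] by (simp add: eq_neg_iff_add_eq_0 add.commute)
    show "e (\<sigma> x) = e x" for x by (simp add: e_eq ss add.commute)
  qed (use a ss norm lin in auto)
qed

lemma quad_quaternion:
  assumes dim: "fspace.fdim F (*) d UNIV" and \<sigma>: "quaternion_conjugation F \<sigma>"
    and e: "\<And>x. e x = x + \<sigma> x" and lin: "linear_form F e"
  shows "quad F d \<sigma> e"
proof -
  obtain i j where ij: "quaternion_basis F i j" and
    s: "\<forall>s\<in>F. \<forall>t\<in>F. \<forall>u\<in>F. \<forall>v\<in>F. \<sigma> (s + t * i + u * j + v * (i * j)) =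
        (if CHAR('d) = 2 then s + t else s) - t * i - u * j - v * (i * j)"
    using \<sigma> unfolding quaternion_conjugation_def by blast
  txt \<open>With this \<open>c\<close>, both presentations read \<open>j * i = (c - i) * j\<close> with \<open>i * (c - i)\<close> in \<open>F\<close>.\<close>
  define c :: 'd where "c = (if CHAR('d) = 2 then 1 else 0)"
  have cF: "c \<in> F" using F_0 F_1 by (simp add: c_def)
  have jj: "j * j \<in> F" using ij unfolding quaternion_basis_def by blast
  have ji: "j * i = (c - i) * j"
  proof (cases "CHAR('d) = 2")
    case True
    then have "1 - i = i + 1" using char_two[OF True, of i] by (simp add: algebra_simps)
    then show ?thesis using ij True unfolding quaternion_basis_def c_def by simp
  qed (use ij in \<open>simp add: quaternion_basis_def c_def\<close>)
  define m where "m = i * (c - i)"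
  have mF: "m \<in> F"
  proof (cases "CHAR('d) = 2")
    case True
    have "m = (i * i + i) - (i * i + i * i)" using True by (simp add: m_def c_def right_diff_distrib)
    then show ?thesis using ij True char_two[OF True, of "i * i"] unfolding quaternion_basis_def by simp
  next
    case False
    then have "m = - (i * i)" by (simp add: m_def c_def)
    then show ?thesis using ij False F_neg unfolding quaternion_basis_def by auto
  qed
  have rep: "\<exists>s\<in>F. \<exists>t\<in>F. \<exists>u\<in>F. \<exists>v\<in>F. x = s + t * i + u * j + v * (i * j)" for x
  proof -
    have "x \<in> ring.Span \<D> F [1, i, j, i * j]" using ij unfolding quaternion_basis_def by blast
    then obtain s t u v where "s \<in> F" "t \<in> F" "u \<in> F" "v \<in> F" "x = s * 1 + (t * i + (u * j + (v * (i * j) + 0)))"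
      unfolding ring.Span.simps[OF ring_dring] by (auto simp: dring_line_extension dring_simps)
    then show ?thesis by (intro bexI[of _ s] bexI[of _ t] bexI[of _ u] bexI[of _ v]) (simp_all add: add.assoc)
  qed
  have conj: "\<sigma> (s + t * i + u * j + v * (i * j)) = s + t * (c - i) - (u + v * i) * j"
    if "s \<in> F" "t \<in> F" "u \<in> F" "v \<in> F" for s t u v
  proof -
    have "\<sigma> (s + t * i + u * j + v * (i * j)) = (if CHAR('d) = 2 then s + t else s) - t * i - u * j - v * (i * j)"
      using s that by blast
    also have "\<dots> = s + t * (c - i) - (u + v * i) * j" by (simp add: c_def algebra_simps)
    finally show ?thesis .
  qed
  have norm: "x * \<sigma> x \<in> F" for x
  proof -
    obtain s t u v where x: "s \<in> F" "t \<in> F" "u \<in> F" "v \<in> F" "x = s + t * i + u * j + v * (i * j)" using rep[of x] by blast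
    \<comment> \<open>Write x = p + q j with p and q in the commuting set F + F i, where p' and q'
      are their conjugates. Moving j across conjugates, so the norm becomes p p' - q q' (j j), and
      all three products lie in F.\<close>
    define p p' q q' where "p = s + t * i" and "p' = s + t * (c - i)" and "q = u + v * i" and "q' = u + v * (c - i)"
    have x': "x = p + q * j" "\<sigma> x = p' - q * j"
      using x(5) conj[OF x(1-4)] by (simp_all add: p_def q_def p'_def distrib_right mult.assoc add.assoc)
    have cm: "a * z = z * a" if "a \<in> {s, t, u, v, c}" for a z using that F_comm x cF by auto
    have ic: "i * (c - i) = (c - i) * i" using cm[of c i] by (simp add: right_diff_distrib left_diff_distrib)
    have com: "(a + b * w) * (a' + b' * w') = a * a' + a * b' * w' + a' * b * w + b * b' * (w * w')"
      if "a \<in> F" "b \<in> F" "a' \<in> F" "b' \<in> F" for a b a' b' w w' :: 'd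
      by (simp add: distrib_left distrib_right mult.assoc Fc[OF that(3), of w] Fcc[OF that(3), of b w] Fcc[OF that(4), of w w'])
    have pp: "p * p' = s * s + s * t * c + t * t * m"
    proof -
      have "p * p' = s * s + s * t * (c - i) + s * t * i + t * t * (i * (c - i))"
        unfolding p_def p'_def by (rule com) (use x in auto)
      then show ?thesis by (simp add: m_def right_diff_distrib)
    qed
    have qq: "q * q' = u * u + u * v * c + v * v * m"
    proof -
      have "q * q' = u * u + u * v * (c - i) + u * v * i + v * v * (i * (c - i))"
        unfolding q_def q'_def by (rule com) (use x in auto)
      then show ?thesis by (simp add: m_def right_diff_distrib)
    qed
    have pq: "p * q = q * p"
    proof -
      have "p * q = s * u + s * v * i + u * t * i + t * v * (i * i)" unfolding p_def q_def by (rule com) (use x in auto)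
      moreover have "q * p = u * s + u * t * i + s * v * i + v * t * (i * i)" unfolding p_def q_def by (rule com) (use x in auto)
      ultimately show ?thesis using F_comm[OF x(1), of u] F_comm[OF x(2), of v] by simp
    qed
    have ji': "j * (c - i) = i * j" using ji cm[of c j] by (simp add: right_diff_distrib left_diff_distrib)
    have jp: "j * p' = p * j" unfolding p_def p'_def
      by (simp only: distrib_left distrib_right mult.assoc Fcc[OF x(2), of j] ji' Fc[OF x(1), of j])
    have jq: "j * q = q' * j" unfolding q_def q'_def
      by (simp only: distrib_left distrib_right mult.assoc Fcc[OF x(4), of j] ji Fc[OF x(3), of j])
    have "x * \<sigma> x = p * p' - p * q * j + q * (j * p') - q * (j * q) * j"
      unfolding x'(2) unfolding x'(1) by (simp add: distrib_left distrib_right right_diff_distrib left_diff_distrib mult.assoc algebra_simps)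
    also have "\<dots> = p * p' - (q * q') * (j * j)" unfolding jp jq pq by (simp add: mult.assoc)
    also have "\<dots> \<in> F" unfolding pp qq by (intro F_diff F_mul F_add x(1-4) cF mF jj)
    finally show ?thesis .
  qed
  have s1: "\<sigma> 1 = 1" using conj[OF F_1 F_0 F_0 F_0] by simp
  have si: "\<sigma> i = c - i" using conj[OF F_0 F_1 F_0 F_0] by simp
  have \<sigma>e: "\<sigma> = (\<lambda>x. e x - x)" by (simp add: e fun_eq_iff)
  have "trace_form F e"
  proof
    show "linear_form F e" by (rule lin)
    show "e 1 = 1 + 1" by (simp add: e s1)
    show "x * (e x - x) \<in> F" for x using norm[of x] unfolding \<sigma>e .
  qed
  moreover have "\<exists>x. e x \<noteq> 0"
  proof (cases "CHAR('d) = 2")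
    case True
    have "e i = 1" using True by (simp add: e si c_def)
    then show ?thesis by (intro exI[of _ i]) simp
  next
    case False
    have "(1 + 1 :: 'd) \<noteq> 0"
    proof
      assume "(1 + 1 :: 'd) = 0"
      then have "of_nat 2 = (0 :: 'd)" by simp
      then have "CHAR('d) dvd 2" by (simp only: of_nat_eq_0_iff_char_dvd)
      then have "CHAR('d) \<le> 2" "0 < CHAR('d)" using dvd_imp_le[of "CHAR('d)" 2] dvd_pos_nat[of 2 "CHAR('d)"] by simp_all
      then have "CHAR('d) = 1" using False by linarith
      then show False using of_nat_CHAR[where 'a = 'd] by simp
    qed
    then show ?thesis by (intro exI[of _ 1]) (simp add: e s1)
  qed
  ultimately show ?thesis using trace_form.quad_trace[OF _ dim] unfolding \<sigma>e by blast
qed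

end

text \<open>The disjunctions for \<sigma> and for e are separate, so a pair could take \<sigma> from
  one type and e from another. Such mixtures are excluded, or, for radicial extensions, still shown
  to have e \<noteq> 0.\<close>

lemma quad_if_associated_pair:
  fixes F :: "'d :: division_ring set"
  assumes F: "central_subfield F" and dim: "ring.dimension \<D> d F UNIV" and ap: "associated_pair F d \<sigma> e"
  shows "quad F d \<sigma> e"
proof -
  interpret central_field F by (rule central_field_if[OF F])
  have D: "fspace.fdim F (*) d UNIV" by (rule dring_dimension_fdim[OF dim])
  have lin: "linear_form F e" using ap unfolding associated_pair_def by blast
  have s: "standard_involution F d \<sigma>" using ap unfolding associated_pair_def by blast
  have E: "(quad_trivial F d \<or> quad_separable F d) \<and> e = galois_trace F \<or>
      quad_quaternion F d \<and> (\<forall>x. e x = x + \<sigma> x) \<or> quad_radicial F d \<and> (\<exists>x. e x \<noteq> 0)"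
    using ap unfolding associated_pair_def by blast
  have rd: "d \<noteq> 1" if "quad_radicial F d"
    using that unfolding quad_radicial_def by auto
  have id_trace: "e = id" if "automorphisms_over F = {id}" "e = galois_trace F"
    using that by (simp add: galois_trace_def fun_eq_iff)
  from s consider (trivial) "quad_trivial F d" "\<sigma> = id" | (radicial) "quad_radicial F d" "\<sigma> = id"
    | (separable) "quad_separable F d" "\<sigma> \<in> automorphisms_over F" "\<sigma> \<noteq> id"
    | (quaternion) "quad_quaternion F d" "quaternion_conjugation F \<sigma>"
    unfolding standard_involution_def by blast
  then show ?thesis
  proof cases
    case trivial
    have d: "d = 1" using trivial(1) unfolding quad_trivial_def .
    have U: "F = UNIV" using fdim_one_iff[OF D] d by blast
    have "automorphisms_over F = {id}"
      using id_automorphism automorphism_simps(3)[where F = F] unfolding U by (auto simp: fun_eq_iff)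
    moreover have "e = galois_trace F" using E rd d unfolding quad_quaternion_def by auto
    ultimately have e: "e = id" by (rule id_trace)
    show ?thesis
    proof (rule quad_commutative[OF D])
      show "x * y = y * x" for x y :: 'd using F_comm[of x y] U by simp
      show "\<exists>x. e x \<noteq> 0" by (rule exI[of _ 1]) (simp add: e)
    qed (use lin trivial(2) e U in auto)
  next
    case radicial
    have f: "field (\<D> :: 'd ring)" and c: "CHAR('d) = 2" and sq: "\<And>x :: 'd. x\<^sup>2 \<in> F"
      using radicial(1) unfolding quad_radicial_def by auto
    have e0: "\<exists>x. e x \<noteq> 0"
    proof (rule ccontr)
      assume n: "\<not> ?thesis"
      from E n consider "e = galois_trace F" | "quad_quaternion F d" by blast
      then show False
      proof cases
        case 1
        have "automorphisms_over F = {id}" using id_automorphism automorphism_radicial[OF radicial(1)] by blast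
        then have "e 1 = 1" using id_trace 1 by simp
        then show False using n by simp
      next
        case 2
        then show False using quaternion_not_radicial radicial(1) unfolding quad_quaternion_def quaternion_algebra_def by blast
      qed
    qed
    show ?thesis
    proof (rule quad_commutative[OF D field_dring_comm[OF f]])
      show "\<sigma> x = - x" if "e x = 0" for x
        using char_two[OF c, of x] radicial(2) by (simp add: eq_neg_iff_add_eq_0)
      show "x * \<sigma> x \<in> F" for x using sq[of x] radicial(2) by (simp add: power2_eq_square)
    qed (use lin radicial(2) e0 in auto)
  next
    case separable
    have d: "d = 2" and f: "field (\<D> :: 'd ring)"
      using separable(1) unfolding quad_separable_def separable_field_extension_def by auto
    have "\<not> quad_radicial F d" using automorphism_radicial[OF _ separable(2)] separable(3) by blast
    then have "e = galois_trace F" using E d unfolding quad_quaternion_def by auto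
    then show ?thesis using quad_separable[OF D[unfolded d] field_dring_comm[OF f] separable(2,3) _ lin] d by simp
  next
    case quaternion
    have d: "d = 4" and "quaternion_algebra F" using quaternion(1) unfolding quad_quaternion_def by auto
    then have "\<not> quad_radicial F d" using quaternion_not_radicial unfolding quaternion_algebra_def by blast
    then have "\<forall>x. e x = x + \<sigma> x" using E d unfolding quad_trivial_def quad_separable_def by auto
    then show ?thesis using quad_quaternion[OF D quaternion(2) _ lin] by blast
  qed
qed

theorem theorem1p19:
  fixes F :: "'d :: division_ring set" and d n :: nat and \<sigma> e :: "'d \<Rightarrow> 'd"
  assumes "central_subfield F"
    and "ring.dimension \<D> d F UNIV"
    and "quadratic_type F d"
    and "associated_pair F d \<sigma> e"
    and "n \<ge> 1"
    and "infinite F \<or> card F \<ge> n * d"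
  shows
    "(\<forall>M. optimal_trivial_spectrum F n M \<longrightarrow>
        (\<exists>ns Ps. ordered_partition n ns \<and> nonisotropic_list \<sigma> e ns Ps \<and>
           similar_sets n M (SH_joint \<sigma> e ns Ps)) \<and>
        (\<forall>ns Ps ns' Ps'.
           ordered_partition n ns \<and> nonisotropic_list \<sigma> e ns Ps \<and>
           similar_sets n M (SH_joint \<sigma> e ns Ps) \<and>
           ordered_partition n ns' \<and> nonisotropic_list \<sigma> e ns' Ps' \<and>
           similar_sets n M (SH_joint \<sigma> e ns' Ps') \<longrightarrow>
           ns = ns' \<and>
           (\<forall>i<length ns. homo_star_congruent F \<sigma> (ns ! i) (Ps ! i) (Ps' ! i)))) \<and>
     (\<forall>ns Ps. ordered_partition n ns \<and> nonisotropic_list \<sigma> e ns Ps \<longrightarrow>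
        optimal_trivial_spectrum F n (SH_joint \<sigma> e ns Ps) \<and>
        (\<forall>M. similar_sets n (SH_joint \<sigma> e ns Ps) M \<longrightarrow> optimal_trivial_spectrum F n M))"
proof -
  interpret Q: quad F d \<sigma> e by (rule quad_if_associated_pair[OF assms(1,2,4)])
  note card = assms(6)
  have A: "(\<exists>ns Ps. ordered_partition n ns \<and> nonisotropic_list \<sigma> e ns Ps \<and> similar_sets n M (SH_joint \<sigma> e ns Ps)) \<and>
      (\<forall>ns Ps ns' Ps'.
         ordered_partition n ns \<and> nonisotropic_list \<sigma> e ns Ps \<and> similar_sets n M (SH_joint \<sigma> e ns Ps) \<and>
         ordered_partition n ns' \<and> nonisotropic_list \<sigma> e ns' Ps' \<and> similar_sets n M (SH_joint \<sigma> e ns' Ps') \<longrightarrow>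
         ns = ns' \<and> (\<forall>i<length ns. homo_star_congruent F \<sigma> (ns ! i) (Ps ! i) (Ps' ! i)))"
    if o: "optimal_trivial_spectrum F n M" for M
  proof (rule conjI[OF Q.optimal_similar_to_joint[OF card o]], intro allI impI)
    have M: "M \<subseteq> carrier_mat n n" by (rule conjunct1[OF iffD1[OF Q.optimal_iff[OF card] o]])
    fix ns Ps ns' Ps'
    assume a: "ordered_partition n ns \<and> nonisotropic_list \<sigma> e ns Ps \<and> similar_sets n M (SH_joint \<sigma> e ns Ps) \<and>
       ordered_partition n ns' \<and> nonisotropic_list \<sigma> e ns' Ps' \<and> similar_sets n M (SH_joint \<sigma> e ns' Ps')"
    show "ns = ns' \<and> (\<forall>i<length ns. homo_star_congruent F \<sigma> (ns ! i) (Ps ! i) (Ps' ! i))"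
      by (rule Q.joint_data_unique[OF M]) (simp_all only: a)
  qed
  have B: "optimal_trivial_spectrum F n (SH_joint \<sigma> e ns Ps) \<and>
      (\<forall>M. similar_sets n (SH_joint \<sigma> e ns Ps) M \<longrightarrow> optimal_trivial_spectrum F n M)"
    if a: "ordered_partition n ns \<and> nonisotropic_list \<sigma> e ns Ps" for ns Ps
  proof -
    note o = Q.similar_to_joint_optimal[OF card conjunct1[OF a] conjunct2[OF a]]
    have "SH_joint \<sigma> e ns Ps \<subseteq> carrier_mat n n"
      using Q.SH_joint_carrier[of ns Ps] unfolding ordered_partition_sum[OF conjunct1[OF a]] .
    note r = Q.similar_sets_refl[OF this]
    show ?thesis
    proof (rule conjI[OF o[OF r]], intro allI impI)
      show "optimal_trivial_spectrum F n M" if "similar_sets n (SH_joint \<sigma> e ns Ps) M" for M by (rule o[OF that])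
    qed
  qed
  show ?thesis
    by (rule conjI; intro allI impI; rule A B; assumption)
qed

end
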